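(* Let $M$ be a PL surface with compact boundary, and let $\eta$ be an end of $M$. If $r$ and $r'$ are rays in $M$ pointing to $\eta$, then there is a PL automorphism $\psi:M\to M$ which sends $r$ to $r'$ (that is, $\psi$ maps the image of $r$ onto the image of $r'$).
   Context: Manifolds are PL, Hausdorff and paracompact, possibly with boundary and possibly disconnected; a surface is a 2-manifold; an automorphism is a PL isomorphism of $M$ with itself. Compact boundary means that the manifold boundary $\partial M$ is compact (possibly empty). For a connected, locally connected, locally compact, $\sigma$-compact Hausdorff space $X$, an end of $X$ is a function $\epsilon$ assigning to each compact $K\subset X$ a (nonempty) connected component $\epsilon(K)$ of $X\setminus K$, such that $K_1\subset K_2$ implies $\epsilon(K_2)\subset\epsilon(K_1)$. An end of a disconnected space is an end of one of its connected components. A ray in $M$ is a proper, locally flat (PL) embedding $r:[0,\infty)\to M$ with image in the manifold interior of $M$; a ray is often conflated with its image. The ray $r$ points to the end $\epsilon$ if for each compact $K$ the component $\epsilon(K)$ contains $r((a,\infty))$ for some $a$. *)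

theory Defs
  imports "HOL-Analysis.Analysis"
begin

section \<open>Piecewise linear maps between subsets of Euclidean spaces\<close>

text \<open>
  The sets \<open>S\<close> to which this is applied are open in a plane, a closed half-plane or a closed
  half-line, hence polyhedra in the sense of PL topology (every point has a neighbourhood that is
  a finite union of polytopes). Continuity of \<open>f\<close> on \<open>S\<close> follows, because the finitely many
  polytopes covering a neighbourhood of \<open>x\<close> are closed and \<open>f\<close> is single-valued.
\<close>

definition pl_on :: "'a::euclidean_space set \<Rightarrow> ('a \<Rightarrow> 'b::euclidean_space) \<Rightarrow> bool" where
  "pl_on S f \<longleftrightarrow>
     (\<forall>x\<in>S. \<exists>\<P>. finite \<P> \<and>
        (\<forall>P\<in>\<P>. polytope P \<and> P \<subseteq> S \<and> (\<exists>L c. linear L \<and> (\<forall>y\<in>P. f y = L y + c))) \<and>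
        (\<exists>T. openin (top_of_set S) T \<and> x \<in> T \<and> T \<subseteq> \<Union>\<P>))"


section \<open>PL surfaces and PL maps\<close>

text \<open>
  A PL structure is given by an atlas, a set of pairs \<open>(U, \<phi>)\<close> in which only the values of \<open>\<phi>\<close> on
  \<open>U\<close> matter. The atlas need not be maximal: all notions below depend only on the PL structure it
  generates.
\<close>

type_synonym ('a, 'b) atlas = "('a set \<times> ('a \<Rightarrow> 'b)) set"

definition half_plane :: "(real^2) set" where
  "half_plane = {v. 0 \<le> v $ 2}"

definition paracompact_space :: "'a topology \<Rightarrow> bool" where
  "paracompact_space X \<longleftrightarrow>
     (\<forall>\<U>. (\<forall>U\<in>\<U>. openin X U) \<and> \<Union>\<U> = topspace X \<longrightarrow>
        (\<exists>\<V>. (\<forall>V\<in>\<V>. openin X V \<and> (\<exists>U\<in>\<U>. V \<subseteq> U)) \<and> \<Union>\<V> = topspace X \<and>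
              locally_finite_in X \<V>))"

definition pl_surface_atlas :: "'a topology \<Rightarrow> ('a, real^2) atlas \<Rightarrow> bool" where
  "pl_surface_atlas X \<A> \<longleftrightarrow>
     (\<forall>(U, \<phi>)\<in>\<A>. openin X U \<and>
        (\<exists>V. openin (top_of_set half_plane) V \<and>
             homeomorphic_map (subtopology X U) (top_of_set V) \<phi>)) \<and>
     (\<Union>(U, \<phi>)\<in>\<A>. U) = topspace X \<and>
     (\<forall>(U, \<phi>)\<in>\<A>. \<forall>(V, \<psi>)\<in>\<A>. pl_on (\<phi> ` (U \<inter> V)) (\<psi> \<circ> inv_into U \<phi>))"

definition pl_surface :: "'a topology \<Rightarrow> ('a, real^2) atlas \<Rightarrow> bool" where
  "pl_surface X \<A> \<longleftrightarrow> Hausdorff_space X \<and> paracompact_space X \<and> pl_surface_atlas X \<A>"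

definition surface_boundary :: "('a, real^2) atlas \<Rightarrow> 'a set" where
  "surface_boundary \<A> = {x. \<exists>(U, \<phi>)\<in>\<A>. x \<in> U \<and> \<phi> x $ 2 = 0}"

definition surface_interior :: "'a topology \<Rightarrow> ('a, real^2) atlas \<Rightarrow> 'a set" where
  "surface_interior X \<A> = topspace X - surface_boundary \<A>"

definition pl_map ::
  "'a topology \<Rightarrow> ('a, 'c::euclidean_space) atlas \<Rightarrow>
   'b topology \<Rightarrow> ('b, 'd::euclidean_space) atlas \<Rightarrow> ('a \<Rightarrow> 'b) \<Rightarrow> bool" where
  "pl_map X \<A> Y \<B> f \<longleftrightarrow> continuous_map X Y f \<and>
     (\<forall>(U, \<phi>)\<in>\<A>. \<forall>(V, \<psi>)\<in>\<B>. pl_on (\<phi> ` {x\<in>U. f x \<in> V}) (\<psi> \<circ> f \<circ> inv_into U \<phi>))"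

definition pl_isomorphism ::
  "'a topology \<Rightarrow> ('a, 'c::euclidean_space) atlas \<Rightarrow>
   'b topology \<Rightarrow> ('b, 'd::euclidean_space) atlas \<Rightarrow> ('a \<Rightarrow> 'b) \<Rightarrow> bool" where
  "pl_isomorphism X \<A> Y \<B> f \<longleftrightarrow>
     (\<exists>g. homeomorphic_maps X Y f g \<and> pl_map X \<A> Y \<B> f \<and> pl_map Y \<B> X \<A> g)"

definition pl_automorphism :: "'a topology \<Rightarrow> ('a, real^2) atlas \<Rightarrow> ('a \<Rightarrow> 'a) \<Rightarrow> bool" where
  "pl_automorphism X \<A> f \<longleftrightarrow> pl_isomorphism X \<A> X \<A> f"

definition restrict_atlas :: "'a set \<Rightarrow> ('a, 'b) atlas \<Rightarrow> ('a, 'b) atlas" where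
  "restrict_atlas W \<A> = (\<lambda>(U, \<phi>). (U \<inter> W, \<phi>)) ` \<A>"

definition standard_atlas :: "'a set \<Rightarrow> ('a, 'a) atlas" where
  "standard_atlas S = {(S, \<lambda>x. x)}"


section \<open>Ends\<close>

text \<open>
  An end is a function on the compact subsets only, hence the extensionality requirement. The
  standing hypotheses on the space (connected, locally connected, locally compact, sigma-compact,
  Hausdorff) are not repeated here: they hold for every connected component of a paracompact
  Hausdorff surface.
\<close>

definition end_of_connected :: "'a topology \<Rightarrow> ('a set \<Rightarrow> 'a set) \<Rightarrow> bool" where
  "end_of_connected X \<epsilon> \<longleftrightarrow>
     \<epsilon> \<in> extensional {K. compactin X K} \<and>
     (\<forall>K. compactin X K \<longrightarrow>
        \<epsilon> K \<in> connected_components_of (subtopology X (topspace X - K))) \<and>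
     (\<forall>K\<^sub>1 K\<^sub>2. compactin X K\<^sub>1 \<and> compactin X K\<^sub>2 \<and> K\<^sub>1 \<subseteq> K\<^sub>2 \<longrightarrow> \<epsilon> K\<^sub>2 \<subseteq> \<epsilon> K\<^sub>1)"

definition end_of :: "'a topology \<Rightarrow> ('a set \<Rightarrow> 'a set) \<Rightarrow> bool" where
  "end_of X \<epsilon> \<longleftrightarrow> (\<exists>C\<in>connected_components_of X. end_of_connected (subtopology X C) \<epsilon>)"


section \<open>Rays\<close>

text \<open>
  Local flatness: near each of its points, the image of the ray is PL equivalent to a straight
  line in the plane, or to a closed half-line near its initial point.
\<close>

definition locally_flat_ray :: "'a topology \<Rightarrow> ('a, real^2) atlas \<Rightarrow> (real \<Rightarrow> 'a) \<Rightarrow> bool" where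
  "locally_flat_ray X \<A> r \<longleftrightarrow>
     (\<forall>t\<ge>0. \<exists>U \<psi>. openin X U \<and> r t \<in> U \<and>
        pl_isomorphism (subtopology X U) (restrict_atlas U \<A>)
          (euclidean :: (real^2) topology) (standard_atlas UNIV) \<psi> \<and>
        (if t = 0 then \<psi> (r t) = 0 \<and> \<psi> ` (U \<inter> r ` {0..}) = {v. v $ 2 = 0 \<and> 0 \<le> v $ 1}
         else \<psi> ` (U \<inter> r ` {0..}) = {v. v $ 2 = 0}))"

definition ray :: "'a topology \<Rightarrow> ('a, real^2) atlas \<Rightarrow> (real \<Rightarrow> 'a) \<Rightarrow> bool" where
  "ray X \<A> r \<longleftrightarrow>
     embedding_map (top_of_set {0..}) X r \<and>
     proper_map (top_of_set {0..}) X r \<and>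
     pl_map (top_of_set {0..}) (standard_atlas {0..}) X \<A> r \<and>
     locally_flat_ray X \<A> r \<and>
     r ` {0..} \<subseteq> surface_interior X \<A>"

text \<open>
  The component \<open>C\<close> of which \<open>\<epsilon>\<close> is an end is determined by \<open>\<epsilon>\<close>, namely \<open>C = \<epsilon> {}\<close>.
\<close>

definition points_to :: "'a topology \<Rightarrow> (real \<Rightarrow> 'a) \<Rightarrow> ('a set \<Rightarrow> 'a set) \<Rightarrow> bool" where
  "points_to X r \<epsilon> \<longleftrightarrow>
     (\<exists>C\<in>connected_components_of X. end_of_connected (subtopology X C) \<epsilon> \<and>
        (\<forall>K. compactin (subtopology X C) K \<longrightarrow> (\<exists>a\<ge>0. r ` {a<..} \<subseteq> \<epsilon> K)))"

end

theory Submission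
 imports Defs
begin

text \<open>
 An automorphism supported in a compact set cannot be expected to carry one ray to another, so \<open>psi\<close> is built as
 a back-and-forth limit of compactly supported automorphisms. A single step compares two rays that have the same
 tail. Given a compact set \<open>P\<close>, a regular level of a PL function bounding \<open>P\<close> away from the end is modified to a closed
 curve that crosses each of the two rays once, together with an annulus around it. Dragging along the first ray, a
 small disc that is fixed by the slides between the rays is traded for everything inside the annulus; this turns a
 slide of one ray onto the other into an automorphism that fixes \<open>P\<close>. The slide can be made to fix the small disc only
 if it respects the two sides of the rays. As the surface need not be orientable, this is arranged with signs: going
 from the first ray to the second, back, and again to the second changes a sign by a square.
\<close>

subsection \<open>Locally affine maps\<close>

text \<open>Two rays related by a compactly supported automorphism have a common tail, and
  \<open>r\<close> and \<open>r'\<close> need not have one. So auxiliary rays are inserted: each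
  follows its predecessor through an annulus far out and then switches to the tail of the other
  given ray. Every second one has the same tail, and these are related by the single step. The maps
  of even index converge to a map carrying \<open>r\<close> to a limit set, those of odd index to a
  map carrying \<open>r'\<close> to the same set.

  The sign of a switch cannot be prescribed, because the automorphism that pulls one ray over to the
  other is merely known to exist. It is only known that some sign occurs arbitrarily far out; the
  two directions are then made to use the same sign, and a double switch has sign 1.

  The closed curve comes without a classification of 1-manifolds. Sliding along a compact regular
  level from one side of the ray must end up on the other side, for otherwise the points reached,
  with one end point added, would form a compact set covered by nested open arcs, none of which
  contains them all.\<close>

definition affine_on :: "'a::euclidean_space set => ('a => 'b::euclidean_space) => bool" where
 "affine_on P f \<longleftrightarrow> (EX L c. linear L & (ALL y:P. f y = L y + c))"

text \<open>The pointwise form of \<open>pl_on\<close>, with pieces that cover a full neighbourhood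
  in the ambient space; PL maps can then be handled like maps continuous at a point.\<close>

definition plat :: "('a::euclidean_space => 'b::euclidean_space) => 'a => bool" where
 "plat f x \<longleftrightarrow>
  (EX \<P>. finite \<P> & (ALL P:\<P>. polytope P & affine_on P f) & x : interior (\<Union>\<P>))"

lemma affine_on_subset: "affine_on P f ==> Q \<subseteq> P ==> affine_on Q f"
 unfolding affine_on_def by blast

lemma affine_on_continuous: "affine_on P f ==> continuous_on P f"
proof -
 assume "affine_on P f"
 then obtain L c where L: "linear L" "ALL y:P. f y = L y + c" unfolding affine_on_def by blast
 have "continuous_on P (%y. L y + c)"
  by (intro continuous_intros linear_continuous_on) (simp add: L(1) linear_conv_bounded_linear[symmetric])
 then show ?thesis using L(2) by auto
qed

lemma small_polytope:
 assumes "open S" "x : S"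
 shows "EX C. polytope C & (x::'a::euclidean_space) : interior C & C \<subseteq> S"
proof -
 obtain a b where "x : box a b" "cbox a b \<subseteq> S"
  using assms open_contains_cbox[of S] by metis
 then show ?thesis by (intro exI[of _ "cbox a b"]) (auto simp: polytope_interval)
qed

text \<open>The pieces that miss \<open>x\<close> have a closed union, so they can be discarded near
  \<open>x\<close>; intersecting the others with a small box \<open>C\<close> puts them into
  \<open>S\<close>.\<close>

lemma plat_pieces:
 assumes "plat f x" "open S" "x : S"
 shows "EX \<P>. finite \<P> & (ALL P:\<P>. polytope P & affine_on P f & x : P & P \<subseteq> S) & x : interior (\<Union>\<P>)"
proof -
 obtain \<P> where P: "finite \<P>" "ALL P:\<P>. polytope P & affine_on P f" "x : interior (\<Union>\<P>)"
  using assms(1) unfolding plat_def by blast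
 let ?R = "{P:\<P>. x ~: P}"
 let ?S = "S Int interior (\<Union>\<P>) - \<Union>?R"
 have "closed (\<Union>?R)" using P by (intro closed_Union) (auto intro: polytope_imp_closed)
 then have "open ?S" using assms(2) by auto
 moreover have "x : ?S" using assms P by auto
 ultimately obtain C where C: "polytope C" "x : interior C" "C \<subseteq> ?S"
  using small_polytope by blast
 let ?Q = "(%P. P Int C) ` {P:\<P>. x : P}"
 have "C \<subseteq> \<Union>?Q"
 proof
  fix y assume y: "y : C"
  then have "y : ?S" using C(3) by blast
  then show "y : \<Union>?Q" using interior_subset y by blast
 qed
 then have "x : interior (\<Union>?Q)" using C(2) interior_mono by blast
 moreover have "ALL P:?Q. polytope P & affine_on P f & x : P & P \<subseteq> S" using C interior_subset P(2) C(1) by (auto intro!: polytope_Int elim!: affine_on_subset)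
 moreover have "finite ?Q" using P(1) by simp
 ultimately show ?thesis by blast
qed

lemma pl_on_interior_plat:
 assumes "pl_on S f" "x : interior S"
 shows "plat f x"
proof -
 have "x : S" using assms(2) interior_subset by blast
 then obtain \<P> T where P: "finite \<P>" "ALL P:\<P>. polytope P & affine_on P f"
   "openin (top_of_set S) T" "x : T" "T \<subseteq> \<Union>\<P>"
  using assms(1) unfolding pl_on_def affine_on_def by meson
 then obtain U where U: "open U" "T = S Int U" by (auto simp: openin_open)
 have "U Int interior S \<subseteq> \<Union>\<P>" using U P interior_subset by blast
 then have "x : interior (\<Union>\<P>)"
  using U P(4) assms(2) by (intro interiorI[of "U Int interior S"]) auto
 then show ?thesis using P unfolding plat_def by blast
qed

lemma pl_on_iff_plat:
 assumes "open S"
 shows "pl_on S f \<longleftrightarrow> (ALL x:S. plat f x)"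
proof
 assume "pl_on S f"
 then show "ALL x:S. plat f x" using pl_on_interior_plat interior_open assms by blast
next
 assume R: "ALL x:S. plat f x"
 show "pl_on S f" unfolding pl_on_def
 proof
  fix x assume x: "x : S"
  then obtain \<P> where P: "finite \<P>" "ALL P:\<P>. polytope P & affine_on P f & x : P & P \<subseteq> S" "x : interior (\<Union>\<P>)"
   using plat_pieces R assms by metis
  have "interior (\<Union>\<P>) \<subseteq> S" using interior_subset P(2) by blast
  then have "openin (top_of_set S) (interior (\<Union>\<P>))"
   using assms by (simp add: open_openin_trans)
  then show "EX \<P>. finite \<P> &
    (ALL P:\<P>. polytope P & P \<subseteq> S & (EX L c. linear L & (ALL y:P. f y = L y + c))) &
    (EX T. openin (top_of_set S) T & x : T & T \<subseteq> \<Union>\<P>)"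
   using P interior_subset unfolding affine_on_def by metis
 qed
qed

lemma plat_affine: "linear L ==> (!!y. f y = L y + c) ==> plat f x"
proof -
 assume L: "linear L" "!!y. f y = L y + c"
 obtain C where C: "polytope C" "x : interior C" using small_polytope[of UNIV x] by auto
 have "affine_on C f" using L unfolding affine_on_def by blast
 then show ?thesis using C unfolding plat_def by (intro exI[of _ "{C}"]) auto
qed

lemma plat_cong:
 assumes "plat f x" "open S" "x : S" "!!y. y : S ==> f y = g y"
 shows "plat g x"
proof -
 obtain \<P> where P: "finite \<P>" "ALL P:\<P>. polytope P & affine_on P f & x : P & P \<subseteq> S" "x : interior (\<Union>\<P>)"
  using plat_pieces assms by metis
 show ?thesis using P(2) assms(4) P unfolding affine_on_def plat_def by (metis subsetD)
qed

lemma plat_isCont: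
 assumes "plat f x" shows "isCont f x"
proof -
 obtain \<P> where P: "finite \<P>" "ALL P:\<P>. polytope P & affine_on P f" "x : interior (\<Union>\<P>)"
  using assms unfolding plat_def by blast
 have "continuous_on (\<Union>P\<in>\<P>. P) f"
  using P by (intro continuous_on_closed_Union) (auto intro: polytope_imp_closed affine_on_continuous)
 then show ?thesis using P(3) by (simp add: continuous_on_interior)
qed

lemma affine_on_Pair:
 assumes "affine_on P f" "affine_on P g" shows "affine_on P (%y. (f y, g y))"
proof -
 obtain L c L' c' where "linear L" "ALL y:P. f y = L y + c" "linear L'" "ALL y:P. g y = L' y + c'"
  using assms unfolding affine_on_def by blast
 moreover have "linear (%y. (L y, L' y))" using calculation(1,3) by (simp add: linear_iff)
 ultimately show ?thesis unfolding affine_on_def by auto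
qed

lemma affine_on_comp:
 assumes "affine_on P f" "affine_on Q g" "f ` P \<subseteq> Q" shows "affine_on P (%y. g (f y))"
proof -
 obtain L c L' c' where L: "linear L" "ALL y:P. f y = L y + c" "linear L'" "ALL y:Q. g y = L' y + c'"
  using assms unfolding affine_on_def by blast
 have "linear (%y. L' (L y))" using L(1,3) by (simp add: linear_compose[unfolded o_def])
 moreover have "ALL y:P. g (f y) = L' (L y) + (L' c + c')"
  using L assms(3) by (auto simp: linear_add)
 ultimately show ?thesis unfolding affine_on_def by auto
qed

text \<open>The preimage is the projection of a part of the graph of \<open>f\<close>, and the graph
  of an affine map is a polyhedron.\<close>

lemma polytope_affine_preimage:
 fixes f :: "'a::euclidean_space => 'b::euclidean_space"
 assumes "polytope P" "affine_on P f" "polytope Q"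
 shows "polytope {y:P. f y : Q}"
proof -
 obtain L c where L: "linear L" "ALL y:P. f y = L y + c" using assms unfolding affine_on_def by blast
 let ?G = "{z :: 'a \<times> 'b. snd z = L (fst z) + c}"
 have "affine ?G" unfolding affine_def
  by (auto simp: L(1) linear_add linear_scale algebra_simps simp flip: scaleR_add_left)
 then have "polytope ((P \<times> Q) Int ?G)"
  by (intro polytope_Int_polyhedron polytope_Times affine_imp_polyhedron assms)
 then have "polytope (fst ` ((P \<times> Q) Int ?G))"
  by (intro polytope_linear_image) (simp_all add: linear_fst)
 moreover have "fst ` ((P \<times> Q) Int ?G) = {y:P. f y : Q}" using L by force
 ultimately show ?thesis by simp
qed

lemma plat_comp:
 assumes "plat f x" "plat g (f x)"
 shows "plat (%y. g (f y)) x"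
proof -
 obtain \<P> where P: "finite \<P>" "ALL P:\<P>. polytope P & affine_on P f" "x : interior (\<Union>\<P>)"
  using assms unfolding plat_def by blast
 obtain \<Q> where Q: "finite \<Q>" "ALL P:\<Q>. polytope P & affine_on P g" "f x : interior (\<Union>\<Q>)"
  using assms unfolding plat_def by blast
 let ?R = "(%(P,Q). {y:P. f y : Q}) ` (\<P> \<times> \<Q>)"
 obtain U where U: "open U" "x : U" "ALL y:U. f y : interior (\<Union>\<Q>)" using assms plat_isCont Q(3) open_interior continuous_at_open by metis
 have "U Int interior (\<Union>\<P>) \<subseteq> \<Union>?R"
 proof
  fix y assume y: "y : U Int interior (\<Union>\<P>)"
  obtain P Q where "P : \<P>" "y : P" "Q : \<Q>" "f y : Q" using y interior_subset[of "\<Union>\<P>"] U(3) interior_subset[of "\<Union>\<Q>"] by blast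
  then show "y : \<Union>?R" by force
 qed
 then have "x : interior (\<Union>?R)" using U P(3) by (intro interiorI[of "U Int interior (\<Union>\<P>)"]) auto
 moreover have "polytope R & affine_on R (%y. g (f y))" if R: "R : ?R" for R
 proof -
  obtain P Q' where PQ: "P : \<P>" "Q' : \<Q>" "R = {y:P. f y : Q'}" using R by blast
  have "affine_on R f" using P(2) PQ affine_on_subset[of P f R] by blast
  then have "affine_on R (%y. g (f y))" using Q(2) PQ by (intro affine_on_comp[of R f Q' g]) auto
  then show ?thesis using PQ P(2) Q(2) polytope_affine_preimage by blast
 qed
 moreover have "finite ?R" using P(1) Q(1) by simp
 ultimately show ?thesis unfolding plat_def by blast
qed

lemma plat_Pair:
 assumes "plat f x" "plat g x" shows "plat (%y. (f y, g y)) x"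
proof -
 obtain \<P> where P: "finite \<P>" "ALL P:\<P>. polytope P & affine_on P f" "x : interior (\<Union>\<P>)"
  using assms unfolding plat_def by blast
 obtain \<Q> where Q: "finite \<Q>" "ALL P:\<Q>. polytope P & affine_on P g" "x : interior (\<Union>\<Q>)"
  using assms unfolding plat_def by blast
 let ?R = "(%(P,Q). P Int Q) ` (\<P> \<times> \<Q>)"
 have "interior (\<Union>\<P>) Int interior (\<Union>\<Q>) \<subseteq> \<Union>?R"
  using interior_subset[of "\<Union>\<P>"] interior_subset[of "\<Union>\<Q>"] by fastforce
 then have "x : interior (\<Union>?R)" using Q P(3) by (intro interiorI[of "interior (\<Union>\<P>) Int interior (\<Union>\<Q>)"]) auto
 moreover have "polytope R & affine_on R (%y. (f y, g y))" if R: "R : ?R" for R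
 proof -
  obtain P Q' where PQ: "P : \<P>" "Q' : \<Q>" "R = P Int Q'" using R by blast
  show ?thesis using P(2) Q(2) PQ affine_on_subset[of P f R] affine_on_subset[of Q' g R] polytope_Int affine_on_Pair by blast
 qed
 moreover have "finite ?R" using P(1) Q(1) by simp
 ultimately show ?thesis unfolding plat_def by blast
qed

lemma plat_linear: "linear f ==> plat f x" by (rule plat_affine[of f f 0]) auto
lemma plat_const: "plat (%y. c) x" by (rule plat_affine[of "%y. 0" _ c]) (auto simp: linear_iff)
lemma plat_id: "plat (%y. y) x" by (rule plat_linear) (auto simp: linear_iff)

lemma plat_add: assumes "plat f x" "plat g x" shows "plat (%y. f y + g y) x"
 using plat_comp[OF plat_Pair[OF assms], of "%z. fst z + snd z"]
 by (simp add: plat_linear linear_iff algebra_simps)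

lemma plat_scaleR: assumes "plat f x" shows "plat (%y. k *\<^sub>R f y) x"
 using plat_comp[OF assms, of "%z. k *\<^sub>R z"] by (simp add: plat_linear linear_iff algebra_simps)

lemma plat_cmult: "plat f x ==> plat (%y. (k::real) * f y) x" using plat_scaleR[of f x k] by simp
lemma plat_multc: "plat f x ==> plat (%y. f y * (k::real)) x" using plat_scaleR[of f x k] by (simp add: mult.commute)
lemma plat_divc: "plat f x ==> plat (%y. f y / (k::real)) x" using plat_multc[of f x "inverse k"] by (simp add: field_simps)
lemma plat_minus: "plat f x ==> plat (%y. - f y) x" using plat_scaleR[of f x "-1"] by simp
lemma plat_diff: "plat f x ==> plat g x ==> plat (%y. f y - g y) x" using plat_add[of f x "%y. - g y"] plat_minus[of g x] by simp

lemma plat_abs_real: "plat (%y::real. \<bar>y\<bar>) x"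
proof -
 have a: "affine_on {0..a} (%y::real. \<bar>y\<bar>)" for a unfolding affine_on_def by (intro exI[of _ "%y. y"] exI[of _ 0]) (auto simp: linear_iff)
 have b: "affine_on {-a..0} (%y::real. \<bar>y\<bar>)" for a unfolding affine_on_def by (intro exI[of _ "%y. -y"] exI[of _ 0]) (auto simp: linear_iff)
 define a where "a = \<bar>x\<bar> + 1"
 have "{-a<..<a} \<subseteq> \<Union>{{0..a},{-a..0}}" by auto
 then have "x : interior (\<Union>{{0..a},{-a..0}})" by (intro interiorI[of "{-a<..<a}"]) (auto simp: a_def)
 moreover have "polytope {u..v::real}" for u v by (metis cbox_interval polytope_interval)
 ultimately show ?thesis unfolding plat_def using a b by (intro exI[of _ "{{0..a},{-a..0}}"]) simp
qed

lemma plat_abs: "plat f x ==> plat (%y. \<bar>f y::real\<bar>) x"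
 using plat_comp plat_abs_real by blast

lemma plat_max: assumes "plat f x" "plat g x" shows "plat (%y. max (f y) (g y :: real)) x"
proof -
 have "plat (%y. (f y + g y + \<bar>f y - g y\<bar>) / 2) x"
  using assms by (intro plat_divc plat_add plat_abs plat_diff)
 moreover have "(%y. (f y + g y + \<bar>f y - g y\<bar>) / 2) = (%y. max (f y) (g y))" by auto
 ultimately show ?thesis by simp
qed

lemma plat_min: assumes "plat f x" "plat g x" shows "plat (%y. min (f y) (g y :: real)) x"
proof -
 have "plat (%y. (f y + g y - \<bar>f y - g y\<bar>) / 2) x"
  using assms by (intro plat_divc plat_add plat_abs plat_diff)
 moreover have "(%y. (f y + g y - \<bar>f y - g y\<bar>) / 2) = (%y. min (f y) (g y))" by auto
 ultimately show ?thesis by simp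
qed

text \<open>If \<open>L\<close> killed a direction of the affine hull of \<open>P\<close>, a short
  segment in this direction at a relatively interior point \<open>p\<close> would lie in
  \<open>P\<close> and be collapsed by \<open>f\<close>. So \<open>L\<close> has a linear left
  inverse on these directions.\<close>

lemma affine_on_inverse:
 fixes f :: "'a::euclidean_space => 'b::euclidean_space"
 assumes "convex P" "affine_on P f" "inj_on f P" "!!y. y : P ==> g (f y) = y"
 shows "affine_on (f ` P) g"
proof (cases "P = {}")
 case True
 then show ?thesis unfolding affine_on_def by (intro exI[of _ "%x. 0"]) (auto simp: linear_iff)
next
 case False
 obtain L c where L: "linear L" "ALL y:P. f y = L y + c" using assms unfolding affine_on_def by blast
 obtain p where "p : rel_interior P" using False assms(1) rel_interior_eq_empty by blast
 then obtain e where e: "p : P" "e > 0" "ball p e Int affine hull P \<subseteq> P" using mem_rel_interior_ball by blast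
 let ?V = "span ((%x. -p+x) ` P)"
 have hull: "affine hull P = (%x. p+x) ` ?V" using e(1) by (intro affine_hull_span_gen) (simp add: hull_inc)
 have "inj_on L ?V"
 proof (rule linear_inj_on_iff_eq_0[OF L(1) subspace_span, THEN iffD2], safe)
  fix v assume v: "v : ?V" "L v = 0"
  show "v = 0"
  proof (rule ccontr)
   assume "v ~= 0"
   define k where "k = e / (2 * norm v)"
   have k: "k > 0" "k * norm v < e" using \<open>v ~= 0\<close> e by (auto simp: k_def)
   have "k *\<^sub>R v : ?V" using v by (simp add: span_scale)
   then have "p + k *\<^sub>R v : P" using hull k e by (auto simp: dist_norm)
   moreover have "f (p + k *\<^sub>R v) = f p" using L e(1) v \<open>p + k *\<^sub>R v : P\<close> by (simp add: linear_add linear_scale)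
   ultimately show False using assms(3) e(1) inj_onD k \<open>v ~= 0\<close> by fastforce
  qed
 qed
 then obtain L' where L': "linear L'" "ALL x:?V. L' (L x) = x" using linear_inj_on_left_inverse[OF L(1)] by blast
 have "g z = L' z + (p - L' (f p))" if z: "z : f ` P" for z
 proof -
  obtain y where y: "y : P" "z = f y" using z by blast
  have "y - p : ?V" using y by (intro span_base) (auto simp: image_iff)
  then have "L' (L (y - p)) = y - p" using L' by blast
  moreover have "L (y - p) = z - f p" using L y e(1) by (simp add: linear_diff)
  ultimately show ?thesis using L'(1) assms(4) y by (auto simp: algebra_simps linear_diff)
 qed
 then show ?thesis unfolding affine_on_def using L'(1) by blast
qed

lemma polytope_affine_image:
 assumes "polytope P" "affine_on P f" shows "polytope (f ` P)"
proof -
 obtain L c where L: "linear L" "ALL y:P. f y = L y + c" using assms unfolding affine_on_def by blast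
 have "f ` P = (+) c ` (L ` P)" using L(2) by auto
 then show ?thesis using polytope_linear_image[OF L(1) assms(1)] by (simp add: polytope_translation_eq)
qed

lemma plat_continuous_on: "ALL x:S. plat f x ==> continuous_on S f"
 by (simp add: plat_isCont continuous_at_imp_continuous_on)

text \<open>Invariance of domain makes the images of the pieces cover a neighbourhood of
  \<open>f x\<close>; on each of them the inverse is affine.\<close>

lemma plat_inverse:
 fixes f :: "'a::euclidean_space => 'a"
 assumes "open S" "inj_on f S" "ALL x:S. plat f x" "!!y. y : S ==> g (f y) = y" "x : S"
 shows "plat g (f x)"
proof -
 obtain \<P> where P: "finite \<P>" "ALL P:\<P>. polytope P & affine_on P f & x : P & P \<subseteq> S" "x : interior (\<Union>\<P>)"
  using plat_pieces assms by meson
 let ?Q = "(`) f ` \<P>"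
 let ?U = "interior (\<Union>\<P>)"
 have US: "?U \<subseteq> S" using P(2) interior_subset[of "\<Union>\<P>"] by blast
 have "open (f ` ?U)"
  using assms US by (intro invariance_of_domain plat_continuous_on) (auto intro: inj_on_subset)
 moreover have "f ` ?U \<subseteq> \<Union>?Q" using interior_subset[of "\<Union>\<P>"] by blast
 ultimately have "f x : interior (\<Union>?Q)" using P(3) by (intro interiorI[of "f ` ?U"]) auto
 moreover have "polytope R & affine_on R g" if R: "R : ?Q" for R
 proof -
  obtain P where PP: "P : \<P>" "R = f ` P" using R by blast
  then show ?thesis using P(2) assms(2,4) affine_on_inverse[of P f g] polytope_imp_convex inj_on_subset[of f S P] PP polytope_affine_image by (metis subsetD)
 qed
 moreover have "finite ?Q" using P(1) by simp
 ultimately show ?thesis unfolding plat_def by blast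
qed

text \<open>Cutting the pieces by the sign of \<open>l\<close> must give polytopes again. The pieces
  are compact, so \<open>l\<close> is bounded on them by some \<open>b\<close>, and the intervals
  \<open>{0..b}\<close> and \<open>{-b..0}\<close> can replace the half-lines.\<close>

lemma plat_If:
 assumes "plat f x" "plat g x" "plat l x" "open S" "x : S" "!!y. y : S ==> l y = 0 ==> f y = g y"
 shows "plat (%y. if (l y::real) >= 0 then f y else g y) x"
proof -
 have "plat (%y. (l y, f y, g y)) x" using assms by (intro plat_Pair)
 then obtain \<P> where P: "finite \<P>" "ALL P:\<P>. polytope P & affine_on P (%y. (l y, f y, g y)) & x : P & P \<subseteq> S" "x : interior (\<Union>\<P>)"
  using plat_pieces assms(4,5) by meson
 obtain b where b: "b > 0" "ALL P:\<P>. ALL y:P. \<bar>l y\<bar> <= b"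
 proof -
  have "EX b>0. ALL y:P. \<bar>l y\<bar> <= b" if "P : \<P>" for P
  proof -
   have "continuous_on P (%y. fst (l y, f y, g y))" using that P(2) by (intro continuous_on_fst affine_on_continuous) auto
   then have "compact (l ` P)" using P(2) that by (intro compact_continuous_image) (auto simp: polytope_imp_compact)
   then show ?thesis using compact_imp_bounded bounded_pos[of "l ` P"] by auto
  qed
  then obtain bb where bb: "!!P. P : \<P> ==> bb P > 0 & (ALL y:P. \<bar>l y\<bar> <= bb P)" by metis
  have "ALL P:\<P>. ALL y:P. \<bar>l y\<bar> <= 1 + sum bb \<P>"
  proof (intro ballI)
   fix P y assume Py: "P : \<P>" "y : P"
   have "bb P <= sum bb \<P>" using P(1) Py bb by (intro member_le_sum) (auto intro: less_imp_le)
   then show "\<bar>l y\<bar> <= 1 + sum bb \<P>" using bb Py by force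
  qed
  moreover have "1 + sum bb \<P> > 0" using bb by (smt (verit) sum_nonneg)
  ultimately show thesis using that by blast
 qed
 let ?h = "%y. if l y >= 0 then f y else g y"
 have comp: "affine_on R l & affine_on R f & affine_on R g" if "affine_on R (%y. (l y, f y, g y))" for R
 proof -
  have 1: "affine_on UNIV (fst :: real \<times> 'b \<times> 'b => real)" "affine_on UNIV (fst :: 'b \<times> 'b => 'b)"
    "affine_on UNIV (snd :: real \<times> 'b \<times> 'b => 'b \<times> 'b)" "affine_on UNIV (snd :: 'b \<times> 'b => 'b)" using linear_fst linear_snd unfolding affine_on_def by auto
  show ?thesis using affine_on_comp[OF that 1(1)] affine_on_comp[OF affine_on_comp[OF that 1(3)] 1(2)]
    affine_on_comp[OF affine_on_comp[OF that 1(3)] 1(4)] by auto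
 qed
 let ?R = "(%P. {y:P. l y : {0..b}}) ` \<P> Un (%P. {y:P. l y : {-b..0}}) ` \<P>"
 have "\<Union>\<P> \<subseteq> \<Union>?R" using b by force
 then have "x : interior (\<Union>?R)" using P(3) interior_mono by blast
 moreover have "polytope R & affine_on R ?h" if R: "R : ?R" for R
 proof -
  have iv: "polytope {u..v::real}" for u v by (metis cbox_interval polytope_interval)
  have "polytope {y:P. l y : {0..b}} & polytope {y:P. l y : {-b..0}}" if "P : \<P>" for P
   using P(2) that comp polytope_affine_preimage iv by blast
  moreover have "affine_on {y:P. l y : {0..b}} ?h" if "P : \<P>" for P
  proof -
   have "affine_on P f" using P(2) that comp by blast
   then show ?thesis unfolding affine_on_def by auto
  qed
  moreover have "affine_on {y:P. l y : {-b..0}} ?h" if "P : \<P>" for P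
  proof -
   have "affine_on P g" using P(2) that comp by blast
   then have "affine_on {y:P. l y : {-b..0}} g" by (rule affine_on_subset) auto
   \<comment> \<open>This closed piece contains points with \<open>l y = 0\<close>, where
     \<open>?h\<close> takes its first branch; there both branches agree.\<close>
   moreover have "?h y = g y" if "y : {y:P. l y : {-b..0}}" for y
    using that assms(6)[of y] P(2) \<open>P : \<P>\<close> by (auto simp: subset_iff)
   ultimately show ?thesis unfolding affine_on_def by metis
  qed
  ultimately show ?thesis using R by blast
 qed
 moreover have "finite ?R" using P(1) by simp
 ultimately show ?thesis unfolding plat_def by blast
qed

subsection \<open>The plane\<close>

definition v2 :: "real => real => real^2" where "v2 a b = vector [a, b]"

lemma v2_nth [simp]: "v2 a b $ 1 = a" "v2 a b $ 2 = b" by (simp_all add: v2_def)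
lemma vec2_eq_iff: "(p::real^2) = q \<longleftrightarrow> p$1 = q$1 & p$2 = q$2" by (auto simp: vec_eq_iff forall_2)
lemma v2_eta [simp]: "v2 (p$1) (p$2) = p" by (simp add: vec2_eq_iff)
lemma v2_eq [simp]: "v2 a b = v2 c d \<longleftrightarrow> a = c & b = d" by (simp add: vec2_eq_iff)

lemma plat_v2: assumes "plat f x" "plat g x" shows "plat (%y. v2 (f y) (g y)) x"
 using plat_comp[OF plat_Pair[OF assms], of "%z. v2 (fst z) (snd z)"]
 by (simp add: plat_linear linear_iff vec2_eq_iff)

lemma plat_nth: "plat f x ==> plat (%y. (f y :: real^2) $ i) x"
 using plat_comp[of f x "%z. z $ i"] by (simp add: plat_linear linear_iff)

text \<open>The l1 norm. It is PL, unlike the Euclidean norm, so cut-off functions built from it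
  stay PL; its balls are squares standing on a corner.\<close>

definition n1 :: "real^2 => real" where "n1 p = \<bar>p$1\<bar> + \<bar>p$2\<bar>"

lemma plat_n1: "plat f x ==> plat (%y. n1 (f y)) x"
 unfolding n1_def by (intro plat_add plat_abs plat_nth)

lemmas plat_intros = plat_v2 plat_nth plat_n1 plat_const plat_id plat_add plat_diff plat_minus plat_cmult plat_multc
 plat_divc plat_scaleR plat_max plat_min plat_abs

lemma n1_0 [simp]: "n1 0 = 0" and n1_ge0 [simp]: "n1 p >= 0" and n1_eq0 [simp]: "n1 p = 0 \<longleftrightarrow> p = 0"
 by (auto simp: n1_def vec2_eq_iff)
lemma n1_v2 [simp]: "n1 (v2 a b) = \<bar>a\<bar> + \<bar>b\<bar>" by (simp add: n1_def)
lemma n1_triangle: "n1 (p + q) <= n1 p + n1 q" by (simp add: n1_def)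
lemma n1_scale [simp]: "n1 (c *\<^sub>R p) = \<bar>c\<bar> * n1 p" by (simp add: n1_def abs_mult algebra_simps)
lemma n1_commute: "n1 (p - q) = n1 (q - p)" by (simp add: n1_def abs_minus_commute)
lemma n1_minus [simp]: "n1 (- p) = n1 p" by (simp add: n1_def)

lemma norm_le_n1: "norm p <= n1 p"
 using norm_le_l1_cart[of p] by (simp add: n1_def sum_2)
lemma continuous_on_n1 [continuous_intros]: "continuous_on S f ==> continuous_on S (%x. n1 (f x))"
 unfolding n1_def by (intro continuous_intros)

abbreviation D :: "real => (real^2) set" where "D r \<equiv> {p. n1 p < r}"
abbreviation cD :: "real => (real^2) set" where "cD r \<equiv> {p. n1 p <= r}"

lemma open_D [simp, intro]: "open {p. n1 (p - x) < r}" "open (D r)"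
 by (intro open_Collect_less continuous_intros)+

lemma open_n1_ball:
 assumes "open S" "x : S"
 shows "EX r>0. ALL p. n1 (p - x) < r --> p : S"
proof -
 obtain e where "e > 0" "ball x e \<subseteq> S" using assms open_contains_ball by blast
 then show ?thesis using norm_le_n1 by (intro exI[of _ e]) (force simp: dist_norm norm_minus_commute intro: le_less_trans)
qed

lemma compact_cD [simp]: "compact (cD r)"
proof -
 have "closed (cD r)" by (intro closed_Collect_le continuous_intros)
 moreover have "bounded (cD r)" unfolding bounded_iff using norm_le_n1 order_trans by blast
 ultimately show ?thesis by (simp add: compact_eq_bounded_closed)
qed

lemma convex_D: "convex (D r)"
proof (rule convexI)
 fix x y u v assume *: "x : D r" "y : D r" "0 <= u" "0 <= v" "u + v = (1::real)"
 have "n1 (u *\<^sub>R x + v *\<^sub>R y) <= u * n1 x + v * n1 y"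
  using n1_triangle[of "u *\<^sub>R x" "v *\<^sub>R y"] * by simp
 also have "... < r"
  using * by (simp add: convex_bound_lt)
 finally show "u *\<^sub>R x + v *\<^sub>R y : D r" by simp
qed

section \<open>Germs of PL maps along a line; generic and regular points\<close>

definition det2 :: "real^2 => real^2 => real" where "det2 d n = d$1 * n$2 - d$2 * n$1"

lemma convex_triangle:
 fixes p x y :: "'a::real_vector"
 assumes P: "convex P" "p : P" "p + x : P" "p + y : P" and st: "0 <= s" "0 <= t" "s + t <= 1"
 shows "p + s *\<^sub>R x + t *\<^sub>R y : P"
proof (cases "s + t = 0")
 case True then show ?thesis using st P by (simp add: add_nonneg_eq_0_iff)
next
 case False
 then have pos: "s + t > 0" using st by simp
 define q where "q = (s/(s+t)) *\<^sub>R (p + x) + (t/(s+t)) *\<^sub>R (p + y)"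
 have "q : P" unfolding q_def using P st pos by (intro convexD) (auto simp: add_divide_distrib[symmetric])
 then have "(1 - (s+t)) *\<^sub>R p + (s+t) *\<^sub>R q : P" using P st by (intro convexD) auto
 moreover have "(1 - (s+t)) *\<^sub>R p + (s+t) *\<^sub>R q = p + s *\<^sub>R x + t *\<^sub>R y"
 proof -
  have "(s+t) *\<^sub>R q = s *\<^sub>R (p + x) + t *\<^sub>R (p + y)" using pos by (simp add: q_def scaleR_add_right del: scaleR_left.add)
  then show ?thesis by (simp add: algebra_simps)
 qed
 ultimately show ?thesis by simp
qed

lemma open_along:
 fixes x :: "'a::real_normed_vector"
 assumes "open S" "x : S"
 shows "EX b>0. ALL t. \<bar>t\<bar> <= b --> x + t *\<^sub>R d : S"
proof -
 obtain e where e: "e > 0" "ball x e \<subseteq> S" using assms open_contains_ball by blast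
 have pos: "0 < 2 * (norm d + 1)" by (smt (verit) norm_ge_zero)
 have "x + t *\<^sub>R d : S" if t: "\<bar>t\<bar> <= e / (2 * (norm d + 1))" for t using t pos e(1) e by (auto simp: pos_le_divide_eq algebra_simps dist_norm)
 moreover have "e / (2 * (norm d + 1)) > 0" using e pos by simp
 ultimately show ?thesis by blast
qed

text \<open>The map may be bent at \<open>x\<close> only along the line in direction
  \<open>d\<close>. A PL map has this form at generic points of a line, and this is the only kind of
  bend that is later put into normal form.\<close>

definition semi :: "(real^2 => 'b::real_vector) => real^2 => real^2 => real^2 => bool" where
 "semi f x d n \<longleftrightarrow> (EX rho>0. EX A Bp Bm. ALL alpha beta. \<bar>alpha\<bar> < rho & \<bar>beta\<bar> < rho -->
   f (x + alpha *\<^sub>R d + beta *\<^sub>R n) = f x + alpha *\<^sub>R A + max beta 0 *\<^sub>R Bp + min beta 0 *\<^sub>R Bm)"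

text \<open>Some piece contains \<open>x + b *\<^sub>R n\<close> for a small \<open>b\<close>. Being
  convex and containing a segment through \<open>x\<close> in direction \<open>d\<close>, it
  contains the triangle over that segment, which covers a half-disc on the side of
  \<open>n\<close>.\<close>

lemma halfdisc:
 fixes x d n :: "'a::real_normed_vector"
 assumes P: "!!P. P : \<P> ==> convex P & x : P & (EX e>0. x + e *\<^sub>R d : P & x - e *\<^sub>R d : P)"
   and x: "x : interior (\<Union>\<P>)"
 shows "EX P:\<P>. EX rho>0. ALL alpha beta. \<bar>alpha\<bar> < rho & 0 <= beta & beta < rho --> x + alpha *\<^sub>R d + beta *\<^sub>R n : P"
proof -
 obtain b where "b > 0" "!!t. \<bar>t\<bar> <= b ==> x + t *\<^sub>R n : interior (\<Union>\<P>)"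
  using open_along[OF open_interior x] by metis
 then have b: "b > 0" "x + b *\<^sub>R n : interior (\<Union>\<P>)" by auto
 then obtain P where PP: "P : \<P>" "x + b *\<^sub>R n : P" using interior_subset[of "\<Union>\<P>"] by blast
 then obtain e where e: "e > 0" "x + e *\<^sub>R d : P" "x - e *\<^sub>R d : P" and cP: "convex P" "x : P" using P by blast
 have "x + alpha *\<^sub>R d + beta *\<^sub>R n : P" if *: "\<bar>alpha\<bar> < min e b / 2" "0 <= beta" "beta < min e b / 2" for alpha beta
 proof -
  have "\<bar>alpha\<bar> / e <= 1/2" "beta / b <= 1/2" using * e b by auto
  then have le1: "\<bar>alpha\<bar> / e + beta / b <= 1" by linarith
  have "x + (sgn alpha * e) *\<^sub>R d : P" using e cP by (auto simp: sgn_if)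
  then have "x + (\<bar>alpha\<bar>/e) *\<^sub>R ((sgn alpha * e) *\<^sub>R d) + (beta/b) *\<^sub>R (b *\<^sub>R n) : P"
   using cP PP b e * le1 by (intro convex_triangle) auto
  moreover have "\<bar>alpha\<bar>/e * (sgn alpha * e) = alpha" using e by (simp add: sgn_if)
  ultimately show ?thesis using b by simp
 qed
 moreover have "min e b / 2 > 0" using e b by simp
 ultimately show ?thesis using PP(1) by blast
qed

lemma semi_pieces:
 assumes P: "!!P. P : \<P> ==> convex P & affine_on P f & x : P & (EX e>0. x + e *\<^sub>R d : P & x - e *\<^sub>R d : P)"
   and x: "x : interior (\<Union>\<P>)"
 shows "semi f x d n"
proof -
 have H: "EX P:\<P>. EX rho>0. ALL alpha beta. \<bar>alpha\<bar> < rho & 0 <= beta & beta < rho --> x + alpha *\<^sub>R d + beta *\<^sub>R n : P" for n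
  using P x by (intro halfdisc) auto
 have "EX rho>0. EX A B. ALL alpha beta. \<bar>alpha\<bar> < rho & 0 <= beta & beta < rho --> f (x + alpha *\<^sub>R d + beta *\<^sub>R n) = f x + alpha *\<^sub>R A + beta *\<^sub>R B" for n
 proof -
  obtain P rho where PP: "P : \<P>" "rho > 0" "ALL alpha beta. \<bar>alpha\<bar> < rho & 0 <= beta & beta < rho --> x + alpha *\<^sub>R d + beta *\<^sub>R n : P"
   using H by blast
  obtain L c where L: "linear L" "ALL y:P. f y = L y + c" using P PP(1) unfolding affine_on_def by blast
  have "f (x + alpha *\<^sub>R d + beta *\<^sub>R n) = f x + alpha *\<^sub>R L d + beta *\<^sub>R L n" if "\<bar>alpha\<bar> < rho & 0 <= beta & beta < rho" for alpha beta
   using that PP L P by (simp add: linear_add linear_scale)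
  then show ?thesis using PP(2) by blast
 qed
 note K = this
 obtain r1 A1 B1 where 1: "r1 > 0" "!!alpha beta. \<bar>alpha\<bar> < r1 & 0 <= beta & beta < r1 ==> f (x + alpha *\<^sub>R d + beta *\<^sub>R n) = f x + alpha *\<^sub>R A1 + beta *\<^sub>R B1"
  using K[of n] by blast
 obtain r2 A2 B2 where 2: "r2 > 0" "!!alpha beta. \<bar>alpha\<bar> < r2 & 0 <= beta & beta < r2 ==> f (x + alpha *\<^sub>R d + beta *\<^sub>R (-n)) = f x + alpha *\<^sub>R A2 + beta *\<^sub>R B2"
  using K[of "-n"] by blast
 define r where "r = min r1 r2"
 have r: "r > 0" "r <= r1" "r <= r2" using 1 2 by (auto simp: r_def)
 \<comment> \<open>Both half-discs contain a piece of the line itself, so the two derivatives along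
   \<open>d\<close> coincide.\<close>
 have A: "A1 = A2" using 1(2)[of "r/2" 0] 2(2)[of "r/2" 0] r by simp
 have "f (x + alpha *\<^sub>R d + beta *\<^sub>R n) = f x + alpha *\<^sub>R A1 + max beta 0 *\<^sub>R B1 + min beta 0 *\<^sub>R (- B2)"
  if "\<bar>alpha\<bar> < r & \<bar>beta\<bar> < r" for alpha beta
  using 1(2)[of alpha beta] 2(2)[of alpha "-beta"] that r A by (cases "beta >= 0") (auto simp: max_def min_def)
 then show ?thesis unfolding semi_def using r(1) by blast
qed

lemma plat_germ_direction:
 fixes f :: "'a::euclidean_space => 'b::euclidean_space"
 assumes "plat f x"
 shows "EX rho>0. EX A. ALL t. 0 <= t & t < rho --> f (x + t *\<^sub>R d) = f x + t *\<^sub>R A"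
proof -
 obtain \<P> where P: "finite \<P>" "ALL P:\<P>. polytope P & affine_on P f & x : P & P \<subseteq> UNIV" "x : interior (\<Union>\<P>)"
  using plat_pieces[OF assms open_UNIV] by auto
 obtain b where "b > 0" "!!t. \<bar>t\<bar> <= b ==> x + t *\<^sub>R d : interior (\<Union>\<P>)"
  using open_along[OF open_interior P(3)] by metis
 then have b: "b > 0" "x + b *\<^sub>R d : interior (\<Union>\<P>)" by auto
 then obtain P' where PP: "P' : \<P>" "x + b *\<^sub>R d : P'" using interior_subset[of "\<Union>\<P>"] by blast
 then have cP: "convex P'" "x : P'" using P(2) polytope_imp_convex by auto
 obtain L c where L: "linear L" "ALL y:P'. f y = L y + c" using P PP(1) unfolding affine_on_def by blast
 have "f (x + t *\<^sub>R d) = f x + t *\<^sub>R L d" if t: "0 <= t" "t < b" for t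
 proof -
  have "x + (t/b) *\<^sub>R (b *\<^sub>R d) + 0 *\<^sub>R (b *\<^sub>R d) : P'" using cP PP t b by (intro convex_triangle) auto
  then show ?thesis using b L cP by (simp add: linear_add linear_scale)
 qed
 then show ?thesis using b(1) by blast
qed

text \<open>All pieces contain \<open>x\<close>. A piece that meets the open half-line contains, by
  convexity, everything up to some \<open>s P\<close>; once \<open>2 * u\<close> is below all these
  numbers, a piece through \<open>x + u *\<^sub>R d\<close> contains a segment around that point, as
  \<open>semi_pieces\<close> requires.\<close>

lemma plat_generic_axis:
 fixes f :: "real^2 => 'b::euclidean_space"
 assumes "plat f x" "e > 0"
 shows "EX u. 0 < u & u < e & semi f (x + u *\<^sub>R d) d n"
proof -
 obtain \<P> where P: "finite \<P>" "ALL P:\<P>. polytope P & affine_on P f & x : P & P \<subseteq> UNIV" "x : interior (\<Union>\<P>)"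
  using plat_pieces[OF assms(1) open_UNIV] by auto
 have "EX s>0. (EX t>0. x + t *\<^sub>R d : P) --> x + s *\<^sub>R d : P" for P by (metis zero_less_one)
 then obtain s where s: "!!P. s P > 0 & ((EX t>0. x + t *\<^sub>R d : P) --> x + s P *\<^sub>R d : P)" by metis
 define m where "m = Min (insert e (s ` \<P>))"
 have m: "m > 0" "m <= e" "!!P. P : \<P> ==> m <= s P" using P(1) s assms(2) by (auto simp: m_def)
 obtain b where b: "b > 0" "!!t. \<bar>t\<bar> <= b ==> x + t *\<^sub>R d : interior (\<Union>\<P>)"
  using open_along[OF open_interior P(3)] by metis
 define u where "u = min b (m/3)"
 have u: "0 < u" "u < m/2" "x + u *\<^sub>R d : interior (\<Union>\<P>)" using b m by (auto simp: u_def)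
 let ?x = "x + u *\<^sub>R d"
 let ?P = "{P:\<P>. ?x : P}"
 let ?S = "interior (\<Union>\<P>) - \<Union>{P:\<P>. ?x ~: P}"
 have "closed (\<Union>{P:\<P>. ?x ~: P})" using P by (intro closed_Union) (auto intro: polytope_imp_closed)
 then have "open ?S" by auto
 moreover have "?S \<subseteq> \<Union>?P" using interior_subset[of "\<Union>\<P>"] by blast
 ultimately have B: "?x : interior (\<Union>?P)" using u by (intro interiorI[of ?S]) auto
 have A: "convex P & affine_on P f & ?x : P & (EX e>0. ?x + e *\<^sub>R d : P & ?x - e *\<^sub>R d : P)" if PP: "P : ?P" for P
 proof -
  have c: "convex P" "affine_on P f" "x : P" "?x : P" using PP P(2) polytope_imp_convex by auto
  have "x + s P *\<^sub>R d : P" using s c(4) u(1) by blast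
  then have "x + (2*u/s P) *\<^sub>R (s P *\<^sub>R d) + 0 *\<^sub>R (s P *\<^sub>R d) : P"
   using c u m(3)[of P] s[of P] PP by (intro convex_triangle) (auto simp: field_simps)
  then have "x + (2*u) *\<^sub>R d : P" using s[of P, THEN conjunct1] by simp
  moreover have "x + (2*u) *\<^sub>R d = ?x + u *\<^sub>R d" by (simp add: vec2_eq_iff)
  ultimately have "?x + u *\<^sub>R d : P" by metis
  moreover have "?x - u *\<^sub>R d : P" using c by simp
  ultimately show ?thesis using c u(1) by blast
 qed
 have "semi f ?x d n" by (rule semi_pieces[OF A B])
 then show ?thesis using u m by auto
qed

text \<open>PL regularity: the function has the nonzero slope \<open>s\<close> along
  \<open>d\<close> and may be bent only along the line in this direction. This suffices to solve for
  the coordinate along \<open>d\<close>.\<close>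

definition regular :: "(real^2 => real) => real^2 => bool" where
 "regular f p \<longleftrightarrow> (EX d n. det2 d n ~= 0 & (EX rho>0. EX s mp mm. s ~= 0 &
   (ALL alpha beta. \<bar>alpha\<bar> < rho & \<bar>beta\<bar> < rho -->
    f (p + alpha *\<^sub>R d + beta *\<^sub>R n) = f p + s * alpha + mp * max beta 0 + mm * min beta 0)))"

lemma regular_from_semi:
 fixes f :: "real^2 => real"
 assumes "semi f p d n" "det2 d n ~= 0" "!!e. e > 0 ==> EX t. \<bar>t\<bar> < e & f (p + t *\<^sub>R d) ~= f p"
 shows "regular f p"
proof -
 obtain rho A Bp Bm where r: "rho > 0" and f: "!!alpha beta. \<bar>alpha\<bar> < rho & \<bar>beta\<bar> < rho ==>
   f (p + alpha *\<^sub>R d + beta *\<^sub>R n) = f p + alpha *\<^sub>R A + max beta 0 *\<^sub>R Bp + min beta 0 *\<^sub>R Bm"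
  using assms(1) unfolding semi_def by blast
 obtain t where t: "\<bar>t\<bar> < rho" "f (p + t *\<^sub>R d) ~= f p" using assms(3) r by blast
 have "A ~= 0" using f[of t 0] t r by auto
 moreover have "ALL alpha beta. \<bar>alpha\<bar> < rho & \<bar>beta\<bar> < rho -->
    f (p + alpha *\<^sub>R d + beta *\<^sub>R n) = f p + A * alpha + Bp * max beta 0 + Bm * min beta 0" using f by auto
 ultimately show ?thesis unfolding regular_def using assms(2) r by blast
qed

text \<open>
 The finitely many critical values are those at the extreme points of the intersections of the linear pieces.
 At any other level, \<open>f\<close> is not constant on the segment \<open>b v\<close> below.
\<close>
lemma sard_local:
 fixes f :: "real^2 => real"
 assumes "plat f x"
 shows "EX B. finite B & (EX rho>0. ALL p. n1 (p - x) < rho & f p ~: B --> regular f p)"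
proof -
 obtain \<P> where P: "finite \<P>" "ALL P:\<P>. polytope P & affine_on P f" "x : interior (\<Union>\<P>)"
  using assms unfolding plat_def by auto
 define B where "B = (\<Union>\<Q>\<in>Pow \<P> - {{}}. f ` {v. v extreme_point_of \<Inter>\<Q>})"
 have fin: "finite {v. v extreme_point_of \<Inter>\<Q>}" if "\<Q> : Pow \<P> - {{}}" for \<Q>
  using that P(1,2) by (intro finite_polyhedron_extreme_points polyhedron_Inter) (auto intro: finite_subset polytope_imp_polyhedron)
 then have "finite B" using P(1) unfolding B_def by auto
 obtain r where r: "r > 0" "ALL p. n1 (p - x) < r --> p : interior (\<Union>\<P>)" using open_n1_ball[OF open_interior P(3)] by blast
 have "regular f p" if p: "n1 (p - x) < r" "f p ~: B" for p
 proof -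
  let ?P = "{P:\<P>. p : P}"
  let ?S = "interior (\<Union>\<P>) - \<Union>{P:\<P>. p ~: P}"
  have "closed (\<Union>{P:\<P>. p ~: P})" using P by (intro closed_Union) (auto intro: polytope_imp_closed)
  then have "open ?S" by auto
  moreover have "?S \<subseteq> \<Union>?P" using interior_subset[of "\<Union>\<P>"] by blast
  ultimately have pin: "p : interior (\<Union>?P)" using r p by (intro interiorI[of ?S]) auto
  then obtain P0 where P0: "P0 : \<P>" "p : P0" using interior_subset[of "\<Union>?P"] by blast
  define R where "R = \<Inter>?P"
  have R: "convex R" "p : R" unfolding R_def by (rule convex_Inter, use P(2) polytope_imp_convex in blast) simp
  have "compact R" unfolding R_def by (rule compact_Inter) (use P(2) P0 polytope_imp_compact in auto)
  have "?P : Pow \<P> - {{}}" using P0 by blast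
  then have "f v : B" if "v extreme_point_of R" for v using that unfolding B_def R_def by (intro UN_I[of ?P]) auto
  then have ext: "f v ~= f p" if "v extreme_point_of R" for v using p(2) that by metis
  let ?A = "{v. v extreme_point_of R}"
  have "finite ?A" using fin[of ?P] P0 unfolding R_def by auto
  moreover have "p : convex hull ?A" using Krein_Milman_Minkowski[OF \<open>compact R\<close> R(1)] R(2) by simp
  \<comment> \<open>A minimal \<open>V\<close> makes \<open>p\<close> an inner point of the segment
    from any \<open>v : V\<close> to a point \<open>b\<close> in the hull of the others:
    \<open>a ~= 0\<close> by minimality, \<open>c ~= 0\<close> because \<open>f v ~= f p\<close>.
    The segment lies in all pieces through \<open>p\<close>.\<close>
  ultimately obtain V where V: "V \<subseteq> ?A" "p : convex hull V" and min: "!!V'. V' \<subseteq> ?A ==> p : convex hull V' ==> card V <= card V'"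
   using ex_has_least_nat[of "%V. V \<subseteq> ?A & p : convex hull V" ?A card] by blast
  obtain v where v: "v : V" using V(2) by fastforce
  have "finite V" using V(1) \<open>finite ?A\<close> finite_subset by blast
  then have "card (V - {v}) < card V" using v by (intro psubset_card_mono) auto
  then have no: "p ~: convex hull (V - {v})" using min[of "V - {v}"] V(1) by auto
  have fv: "f v ~= f p" "v : R" using ext V(1) v by (auto simp: extreme_point_of_def)
  have "V - {v} ~= {}"
  proof
   assume "V - {v} = {}"
   then have "V = {v}" using v by blast
   then show False using V(2) fv(1) by simp
  qed
  moreover have "V = insert v (V - {v})" using v by blast
  ultimately obtain a c b where ac: "0 <= a" "0 <= c" "a + c = 1" "b : convex hull (V - {v})" "p = a *\<^sub>R v + c *\<^sub>R b"
   using V(2) convex_hull_insert[of "V - {v}" v] by auto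
  have "a ~= 0" using no ac by auto
  have "c ~= 0" using fv(1) ac by auto
  have "b : R" using ac(4) hull_minimal[of "V - {v}" R convex] V(1) R(1) by (auto simp: extreme_point_of_def)
  define d where "d = v - b"
  have seg: "p + t *\<^sub>R d : R" if "- a <= t" "t <= c" for t
  proof -
   have "p + t *\<^sub>R d = (a + t) *\<^sub>R v + (c - t) *\<^sub>R b" unfolding ac(5) d_def by (simp add: algebra_simps)
   then show ?thesis using convexD[OF R(1) fv(2) \<open>b : R\<close>, of "a + t" "c - t"] that ac(3) by simp
  qed
  obtain L k where L: "linear L" "ALL y:P0. f y = L y + k" using P(2) P0(1) unfolding affine_on_def by blast
  have fL: "f (p + t *\<^sub>R d) = f p + t * L d" if "- a <= t" "t <= c" for t
   using L(2) seg[OF that] P0 by (simp add: R_def linear_add[OF L(1)] linear_scale[OF L(1)])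
  have "v = p + c *\<^sub>R d" unfolding ac(5) d_def using ac(3) by (simp add: algebra_simps flip: scaleR_add_left)
  then have Ld: "L d ~= 0" using fL[of c] fv(1) ac(1,2) by auto
  then have "d ~= 0" using linear_0[OF L(1)] by auto
  define n where "n = v2 (- d$2) (d$1)"
  have det: "det2 d n ~= 0" using \<open>d ~= 0\<close> by (auto simp: det2_def n_def vec2_eq_iff sum_power2_eq_zero_iff power2_eq_square[symmetric])
  define e0 where "e0 = min a c"
  have e0: "0 < e0" "e0 <= a" "e0 <= c" using ac(1,2) \<open>a ~= 0\<close> \<open>c ~= 0\<close> by (auto simp: e0_def)
  have "semi f p d n"
  proof (rule semi_pieces[OF _ pin])
   fix P assume PP: "P : ?P"
   have "p + e0 *\<^sub>R d : P" "p + (- e0) *\<^sub>R d : P" using seg[of e0] seg[of "- e0"] e0 ac(1,2) PP by (auto simp: R_def)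
   then show "convex P & affine_on P f & p : P & (EX e>0. p + e *\<^sub>R d : P & p - e *\<^sub>R d : P)"
    using PP P(2) e0(1) polytope_imp_convex by auto
  qed
  then show ?thesis
  proof (rule regular_from_semi[OF _ det])
   fix e :: real assume e: "e > 0"
   define t where "t = min e0 e / 2"
   have t: "0 < t" "t < e" "- a <= t" "t <= c" using e e0 ac(1) by (auto simp: t_def)
   then show "EX t. \<bar>t\<bar> < e & f (p + t *\<^sub>R d) ~= f p" using fL[of t] Ld by (intro exI[of _ t]) auto
  qed
 qed
 then show ?thesis using \<open>finite B\<close> r(1) by blast
qed

section \<open>PL homeomorphisms of the plane with bounded support\<close>

definition plane_aut :: "real => (real^2 => real^2) => bool" where
 "plane_aut r nu \<longleftrightarrow> bij nu & (ALL x. plat nu x) & (ALL x. plat (inv nu) x) & (ALL p. r <= n1 p --> nu p = p)"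

text \<open>Surjectivity follows from injectivity: the range is open by invariance of domain, and
  closed as the union of the compact image of \<open>cD r\<close> and a closed set on which
  \<open>nu\<close> is the identity.\<close>

lemma plane_autI:
 assumes pl: "!!x. plat nu x" and inj: "inj nu" and fixd: "!!p. r <= n1 p ==> nu p = p"
 shows "plane_aut r nu"
proof -
 have cont: "continuous_on S nu" for S using pl by (intro plat_continuous_on) auto
 have op: "open (range nu)" using cont inj by (intro invariance_of_domain) auto
 have "range nu = nu ` cD r Un {p. r <= n1 p}"
 proof (intro set_eqI iffI)
  fix y assume "y : range nu"
  then obtain x where "y = nu x" by blast
  then show "y : nu ` cD r Un {p. r <= n1 p}" using fixd[of x] by force
 next
  fix y assume "y : nu ` cD r Un {p. r <= n1 p}"
  then show "y : range nu" using fixd[of y] by (metis (no_types, lifting) UnE image_iff mem_Collect_eq rangeI)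
 qed
 moreover have "closed (nu ` cD r)" using cont by (intro compact_imp_closed compact_continuous_image) auto
 moreover have "closed {p. r <= n1 p}" by (intro closed_Collect_le continuous_intros)
 ultimately have "closed (range nu)" by (simp add: closed_Un)
 then have "range nu = UNIV" using op clopen[of "range nu"] by auto
 then have bij: "bij nu" using inj by (simp add: bij_def)
 have "plat (inv nu) y" for y
 proof -
  obtain x where "y = nu x" using bij by (metis bij_pointE)
  then show ?thesis using plat_inverse[of UNIV nu "inv nu" x] pl inj by simp
 qed
 then show ?thesis unfolding plane_aut_def using bij pl fixd by blast
qed

lemma plane_aut_mono: "plane_aut r nu ==> r <= r' ==> plane_aut r' nu"
 unfolding plane_aut_def by auto

lemma plane_aut_comp:
 assumes "plane_aut r nu" "plane_aut r mu" shows "plane_aut r (%p. nu (mu p))"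
proof (rule plane_autI)
 have inj: "inj nu" "inj mu" using assms by (simp_all add: plane_aut_def bij_def)
 then show "inj (%p. nu (mu p))" by (simp add: inj_compose[unfolded o_def])
 show "plat (%p. nu (mu p)) x" for x
  using assms by (intro plat_comp[of mu x nu]) (simp_all add: plane_aut_def)
qed (use assms in \<open>simp add: plane_aut_def\<close>)

lemma plane_aut_inv:
 assumes "plane_aut r nu" shows "plane_aut r (inv nu)"
proof -
 have "bij nu" using assms by (simp add: plane_aut_def)
 then show ?thesis using assms unfolding plane_aut_def
  by (simp add: bij_imp_bij_inv inv_inv_eq) (metis bij_inv_eq_iff)
qed

lemma plane_aut_less:
 assumes "plane_aut r nu" shows "n1 (nu p) < r \<longleftrightarrow> n1 p < r"
proof -
 have "inj nu" using assms by (simp add: plane_aut_def bij_def)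
 then show ?thesis using assms unfolding plane_aut_def by (metis injD linorder_not_less)
qed

lemma plane_aut_isCont: "plane_aut r nu ==> isCont nu x"
 unfolding plane_aut_def using plat_isCont by blast

lemma plane_aut_near:
 assumes "plane_aut r nu" "e > 0"
 shows "EX delta>0. ALL p. n1 (p - x) < delta --> n1 (nu p - nu x) < e"
proof -
 have "continuous_on UNIV nu" using plane_aut_isCont[OF assms(1)] by (simp add: continuous_at_imp_continuous_on)
 then have "open (nu -` {q. n1 (q - nu x) < e})" by (intro open_vimage) auto
 moreover have "x : nu -` {q. n1 (q - nu x) < e}" using assms(2) by simp
 ultimately show ?thesis using open_n1_ball[of _ x] by fastforce
qed

text \<open>The condition on \<open>omega\<close> keeps the order of the points on each horizontal
  line, and these lines are preserved.\<close>

lemma hshift: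
 assumes pl: "!!x. plat omega x" and fixd: "!!p. r <= n1 p ==> omega p = 0"
  and mono: "!!a a' b. a < a' ==> omega (v2 a' b) - omega (v2 a b) > - (a' - a)"
 shows "plane_aut r (%p. v2 (p$1 + omega p) (p$2))"
proof (rule plane_autI)
 show "inj (%p. v2 (p$1 + omega p) (p$2))"
 proof (rule injI)
  fix p q assume "v2 (p$1 + omega p) (p$2) = v2 (q$1 + omega q) (q$2)"
  then have *: "p$1 + omega p = q$1 + omega q" "p$2 = q$2" by auto
  have e: "v2 (q$1) (p$2) = q" "v2 (p$1) (p$2) = p" using * by (simp_all add: vec2_eq_iff)
  have "~ p$1 < q$1" using mono[of "p$1" "q$1" "p$2"] * unfolding e by linarith
  moreover have "~ q$1 < p$1" using mono[of "q$1" "p$1" "p$2"] * unfolding e by linarith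
  ultimately show "p = q" using * by (simp add: vec2_eq_iff)
 qed
qed (auto intro!: plat_intros pl simp: fixd)

definition clamp :: "real => real => real" where "clamp k w = max (- k) (min k w)"

lemma clamp_eq: "\<bar>w\<bar> <= k ==> clamp k w = w" by (auto simp: clamp_def)
lemma clamp_lipschitz:
 "w <= w' ==> k - d <= k' ==> k' - d <= k ==> 0 <= k ==> 0 <= k' ==> clamp k w - d <= clamp k' w'"
 by (simp add: clamp_def max_def min_def)
lemma clamp_0 [simp]: "clamp 0 w = 0" "k >= 0 ==> clamp k 0 = 0" by (auto simp: clamp_def)

text \<open>A cone that vanishes outside \<open>D (2 * rho)\<close>. Its slope 1/2 is below 1, so
  that a shift cut off at this height satisfies the condition of \<open>hshift\<close>.\<close>

definition bump :: "real => real^2 => real" where "bump rho p = max 0 (rho - n1 p / 2)"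

lemma bump_ge0 [simp]: "bump rho p >= 0" by (simp add: bump_def)

lemma bump_lipschitz: "bump rho p - n1 (p - q) / 2 <= bump rho q"
proof -
 have "n1 q <= n1 p + n1 (p - q)" using n1_triangle[of p "q - p"] n1_commute[of p q] by simp
 moreover have "0 <= n1 (p - q)" by simp
 ultimately show ?thesis unfolding bump_def by linarith
qed

definition hmove :: "real => (real^2 => real) => real^2 => real^2" where
 "hmove rho w p = v2 (p$1 + clamp (bump rho p) (w p)) (p$2)"

lemma plat_clamp_bump: "plat w x ==> plat (%p. clamp (bump rho p) (w p)) x"
 unfolding clamp_def bump_def by (intro plat_intros)

text \<open>Along a horizontal line \<open>w\<close> increases weakly, so the shift can decrease
  only where it is cut off, and there at rate at most 1/2.\<close>

lemma hmove_aut: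
 assumes "!!x. plat w x" "!!a a' b. a <= a' ==> w (v2 a b) <= w (v2 a' b)"
 shows "plane_aut (2*rho) (hmove rho w)"
 unfolding hmove_def[abs_def]
proof (rule hshift)
 fix x show "plat (%p. clamp (bump rho p) (w p)) x" using assms by (intro plat_clamp_bump)
next
 fix p assume "2 * rho <= n1 p"
 then show "clamp (bump rho p) (w p) = 0" by (simp add: bump_def)
next
 fix a a' b :: real assume "a < a'"
 have k: "bump rho (v2 a b) - (a' - a)/2 <= bump rho (v2 a' b)" "bump rho (v2 a' b) - (a' - a)/2 <= bump rho (v2 a b)"
  using bump_lipschitz[of rho "v2 a b" "v2 a' b"] bump_lipschitz[of rho "v2 a' b" "v2 a b"] \<open>a < a'\<close> by (simp_all add: n1_def)
 have "w (v2 a b) <= w (v2 a' b)" using assms(2) \<open>a < a'\<close> by simp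
 then have "clamp (bump rho (v2 a b)) (w (v2 a b)) - (a' - a)/2 <= clamp (bump rho (v2 a' b)) (w (v2 a' b))"
  using k by (intro clamp_lipschitz) auto
 then show "clamp (bump rho (v2 a' b)) (w (v2 a' b)) - clamp (bump rho (v2 a b)) (w (v2 a b)) > - (a' - a)"
  using \<open>a < a'\<close> by argo
qed

lemma hmove_eq: "\<bar>w p\<bar> <= rho - n1 p / 2 ==> hmove rho w p = v2 (p$1 + w p) (p$2)"
 unfolding hmove_def bump_def by (subst clamp_eq) auto

lemma hmove_snd [simp]: "hmove rho w p $ 2 = p$2" by (simp add: hmove_def)

definition swp :: "real^2 => real^2" where "swp p = v2 (p$2) (p$1)"

lemma swp [simp]: "swp p $ 1 = p$2" "swp p $ 2 = p$1" "swp (swp p) = p" "n1 (swp p) = n1 p" "swp (v2 a b) = v2 b a"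
 by (auto simp: swp_def vec2_eq_iff n1_def)

lemma plat_swp: "plat swp x" unfolding swp_def[abs_def] by (intro plat_intros)

lemma plane_aut_swp:
 assumes "plane_aut r nu" shows "plane_aut r (%p. swp (nu (swp p)))"
proof (rule plane_autI)
 show "plat (%p. swp (nu (swp p))) x" for x
  using assms by (intro plat_comp[of "%p. nu (swp p)" x swp] plat_comp[of swp x nu] plat_swp) (auto simp: plane_aut_def)
 show "inj (%p. swp (nu (swp p)))"
  by (metis (no_types, lifting) assms bij_def inj_def plane_aut_def swp(3))
qed (use assms in \<open>auto simp: plane_aut_def\<close>)

definition vmove :: "real => (real^2 => real) => real^2 => real^2" where
 "vmove rho w p = swp (hmove rho (%q. w (swp q)) (swp p))"

lemma vmove_aut:
 assumes "!!x. plat w x" "!!a b b'. b <= b' ==> w (v2 a b) <= w (v2 a b')"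
 shows "plane_aut (2*rho) (vmove rho w)"
 unfolding vmove_def[abs_def]
 using assms by (intro plane_aut_swp hmove_aut plat_comp[of swp _ w] plat_swp) auto

lemma vmove_alt: "vmove rho w p = v2 (p$1) (p$2 + clamp (bump rho p) (w p))"
 by (simp add: vmove_def hmove_def bump_def vec2_eq_iff)

lemma vmove_eq: "\<bar>w p\<bar> <= rho - n1 p / 2 ==> vmove rho w p = v2 (p$1) (p$2 + w p)"
 unfolding vmove_alt bump_def by (subst clamp_eq) auto

section \<open>Germs at the origin that extend with arbitrarily small support\<close>

definition axial :: "(real^2 => real^2) => bool" where
 "axial nu \<longleftrightarrow> (ALL p. (nu p $ 2 <= 0 \<longleftrightarrow> p$2 <= 0) & (0 <= nu p $ 2 \<longleftrightarrow> 0 <= p$2))"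

lemma axial_hmove: "axial (hmove rho w)" by (simp add: axial_def)
lemma axial_comp: "axial nu ==> axial mu ==> axial (%p. nu (mu p))" by (simp add: axial_def)
lemma axial_inv: "axial nu ==> bij nu ==> axial (inv nu)"
 unfolding axial_def by (metis bij_inv_eq_iff)

lemma axial_vmove:
 assumes "!!x. plat w x" "!!a b b'. b <= b' ==> w (v2 a b) <= w (v2 a b')" "!!a. w (v2 a 0) = 0"
 shows "axial (vmove rho w)"
proof -
 have "(0 <= w p | p$2 < 0) & (w p <= 0 | p$2 > 0)" for p
  using assms(2)[of 0 "p$2" "p$1"] assms(2)[of "p$2" 0 "p$1"] assms(3)[of "p$1"] by (auto simp: not_less)
 moreover have "inj (vmove rho w)" using vmove_aut[OF assms(1,2)] by (simp add: plane_aut_def bij_def)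
 moreover have z: "vmove rho w (v2 a 0) = v2 a 0" for a by (simp add: vmove_alt assms(3))
 have m: "b < b' ==> vmove rho w (v2 a b) $ 2 < vmove rho w (v2 a b') $ 2" for a b b'
 proof -
  assume "b < b'"
  have k: "bump rho (v2 a b) - (b' - b)/2 <= bump rho (v2 a b')" "bump rho (v2 a b') - (b' - b)/2 <= bump rho (v2 a b)"
   using bump_lipschitz[of rho "v2 a b" "v2 a b'"] bump_lipschitz[of rho "v2 a b'" "v2 a b"] \<open>b < b'\<close> by (simp_all add: n1_def)
  have "w (v2 a b) <= w (v2 a b')" using assms(2) \<open>b < b'\<close> by simp
  then have "clamp (bump rho (v2 a b)) (w (v2 a b)) - (b' - b)/2 <= clamp (bump rho (v2 a b')) (w (v2 a b'))"
   using k by (intro clamp_lipschitz) auto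
  then show ?thesis unfolding vmove_alt v2_nth using \<open>b < b'\<close> by argo
 qed
 show ?thesis unfolding axial_def
 proof
  fix p
  have "p$2 > 0 ==> vmove rho w p $ 2 > 0" "p$2 < 0 ==> vmove rho w p $ 2 < 0" "p$2 = 0 ==> vmove rho w p $ 2 = 0"
   using m[of 0 "p$2" "p$1"] m[of "p$2" 0 "p$1"] z[of "p$1"] by (auto, metis v2_eta v2_nth(2))
  then show "(vmove rho w p $ 2 <= 0 \<longleftrightarrow> p $ 2 <= 0) & (0 <= vmove rho w p $ 2 \<longleftrightarrow> 0 <= p $ 2)"
   by (cases "p$2" "0::real" rule: linorder_cases) auto
 qed
qed

text \<open>The extensions respect the axis and both half-planes, so they can be used in a chart
  whose axis is a piece of a ray or of a level curve.\<close>

definition germ_ext :: "(real^2 => real^2) => bool" where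
 "germ_ext N \<longleftrightarrow> N 0 = 0 & (ALL r>0. EX nu. plane_aut r nu & axial nu & (EX delta>0. ALL p. n1 p < delta --> nu p = N p))"

lemma germ_ext_comp:
 assumes "germ_ext N" "germ_ext N'" shows "germ_ext (%p. N (N' p))"
 unfolding germ_ext_def
proof (intro conjI allI impI)
 show "N (N' 0) = 0" using assms by (simp add: germ_ext_def)
 fix r :: real assume "r > 0"
 obtain nu d where 1: "plane_aut r nu" "axial nu" "d > 0" "!!p. n1 p < d ==> nu p = N p"
  using assms(1) \<open>r > 0\<close> unfolding germ_ext_def by blast
 obtain mu d' where 2: "plane_aut r mu" "axial mu" "d' > 0" "!!p. n1 p < d' ==> mu p = N' p"
  using assms(2) \<open>r > 0\<close> unfolding germ_ext_def by blast
 have "mu 0 = 0" using 2 assms(2) by (simp add: germ_ext_def)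
 then obtain d'' where 3: "d'' > 0" "!!p. n1 p < d'' ==> n1 (mu p) < d"
  using plane_aut_near[OF 2(1) 1(3), of 0] by auto
 show "EX nu. plane_aut r nu & axial nu & (EX delta>0. ALL p. n1 p < delta --> nu p = N (N' p))"
 proof (intro exI[of _ "%p. nu (mu p)"] conjI exI[of _ "min d' d''"] allI impI)
  show "nu (mu p) = N (N' p)" if "n1 p < min d' d''" for p
   using that 1(4)[of "mu p"] 2(4)[of p] 3(2)[of p] by auto
 qed (use 1 2 3 plane_aut_comp axial_comp in auto)
qed

lemma germ_ext_inv:
 assumes "germ_ext N" "!!p. N' (N p) = p" "!!p. N (N' p) = p" "isCont N' 0"
 shows "germ_ext N'"
 unfolding germ_ext_def
proof (intro conjI allI impI)
 show N0: "N' 0 = 0" using assms by (metis germ_ext_def)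
 fix r :: real assume "r > 0"
 obtain nu d where 1: "plane_aut r nu" "axial nu" "d > 0" "!!p. n1 p < d ==> nu p = N p"
  using assms(1) \<open>r > 0\<close> unfolding germ_ext_def by blast
 have bij: "bij nu" using 1 by (simp add: plane_aut_def)
 obtain U where U: "open U" "0 : U" "ALL p:U. N' p : D d"
  using assms(4) N0 1(3) continuous_at_open[of 0 N'] by (metis (no_types, lifting) mem_Collect_eq n1_0 open_D(2))
 then obtain d' where d': "d' > 0" "!!p. n1 p < d' ==> n1 (N' p) < d" using open_n1_ball[of U 0] by auto
 have "inv nu p = N' p" if "n1 p < d'" for p
  using 1(4)[of "N' p"] d'(2)[OF that] assms(3) bij by (simp add: bij_def inv_f_eq)
 then show "EX nu. plane_aut r nu & axial nu & (EX delta>0. ALL p. n1 p < delta --> nu p = N' p)"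
  using plane_aut_inv[OF 1(1)] axial_inv[OF 1(2) bij] d'(1) by blast
qed

text \<open>Near the origin \<open>w\<close> is smaller than the height of the cut-off. Hence the
  moves \<open>hmove\<close> and \<open>vmove\<close> realise the germ of the full shift.\<close>

lemma near_bound:
 assumes "!!p. n1 p < d0 ==> \<bar>w p\<bar> <= C * n1 p" "r > 0" "d0 > 0"
 shows "EX delta>0. ALL p. n1 p < delta --> \<bar>w p\<bar> <= r/2 - n1 p / 2"
proof -
 define delta where "delta = min d0 (r / (2 * (\<bar>C\<bar> + 1)))"
 have "\<bar>w p\<bar> <= r/2 - n1 p / 2" if "n1 p < delta" for p
 proof -
  have "n1 p * (2 * (\<bar>C\<bar> + 1)) < r" using that by (simp add: delta_def field_simps pos_less_divide_eq)
  then have "2 * n1 p + 2 * (\<bar>C\<bar> * n1 p) < r" by (simp add: algebra_simps)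
  moreover have "\<bar>w p\<bar> <= \<bar>C\<bar> * n1 p" using assms(1)[of p] that by (smt (verit) delta_def mult_right_mono n1_ge0)
  ultimately show ?thesis using n1_ge0[of p] by argo
 qed
 moreover have "delta > 0" using assms by (auto simp: delta_def)
 ultimately show ?thesis by blast
qed

lemma germ_ext_h:
 assumes "!!x. plat w x" "!!a a' b. a <= a' ==> w (v2 a b) <= w (v2 a' b)" "!!p. \<bar>w p\<bar> <= C * n1 p"
 shows "germ_ext (%p. v2 (p$1 + w p) (p$2))"
 unfolding germ_ext_def
proof (intro conjI allI impI)
 show "v2 ((0::real^2)$1 + w 0) (0$2) = 0" using assms(3)[of 0] by (simp add: vec2_eq_iff)
 fix r :: real assume r: "r > 0"
 obtain delta where "delta > 0" "ALL p. n1 p < delta --> \<bar>w p\<bar> <= r/2 - n1 p / 2"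
  using near_bound[of 1 w C r] assms(3) r by auto
 then show "EX nu. plane_aut r nu & axial nu & (EX delta>0. ALL p. n1 p < delta --> nu p = v2 (p$1 + w p) (p$2))"
  using hmove_aut[OF assms(1,2), of "r/2"] axial_hmove[of "r/2" w]
  by (intro exI[of _ "hmove (r/2) w"] conjI exI[of _ delta]) (auto simp: hmove_eq)
qed

lemma germ_ext_v:
 assumes "!!x. plat w x" "!!a b b'. b <= b' ==> w (v2 a b) <= w (v2 a b')" "!!p. \<bar>w p\<bar> <= C * n1 p"
  "!!a. w (v2 a 0) = 0"
 shows "germ_ext (%p. v2 (p$1) (p$2 + w p))"
 unfolding germ_ext_def
proof (intro conjI allI impI)
 show "v2 ((0::real^2)$1) (0$2 + w 0) = 0" using assms(3)[of 0] by (simp add: vec2_eq_iff)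
 fix r :: real assume r: "r > 0"
 obtain delta where "delta > 0" "ALL p. n1 p < delta --> \<bar>w p\<bar> <= r/2 - n1 p / 2"
  using near_bound[of 1 w C r] assms(3) r by auto
 then show "EX nu. plane_aut r nu & axial nu & (EX delta>0. ALL p. n1 p < delta --> nu p = v2 (p$1) (p$2 + w p))"
  using vmove_aut[OF assms(1,2), of "r/2"] axial_vmove[OF assms(1,2,4), of "r/2"]
  by (intro exI[of _ "vmove (r/2) w"] conjI exI[of _ delta]) (auto simp: vmove_eq)
qed

text \<open>Stretching is a shift by the increasing function \<open>(alpha - 1) * p$1\<close>; a
  contraction is obtained as the inverse of a stretching.\<close>

lemma germ_ext_hscale: assumes "alpha > 0" shows "germ_ext (%p. v2 (alpha * p$1) (p$2))"
proof -
 have A: "germ_ext (%p. v2 (a * p$1) (p$2))" if "a >= 1" for a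
 proof -
  have "germ_ext (%p. v2 (p$1 + (a - 1) * p$1) (p$2))"
  proof (rule germ_ext_h[where C = "a - 1"])
   fix p show "\<bar>(a - 1) * p $ 1\<bar> <= (a - 1) * n1 p" using that by (simp add: abs_mult n1_def mult_left_mono)
  qed (use that in \<open>auto intro!: plat_intros mult_left_mono\<close>)
  then show ?thesis by (simp add: algebra_simps)
 qed
 show ?thesis
 proof (cases "alpha >= 1")
  case False
  then have "1/alpha >= 1" using assms by simp
  from A[OF this] show ?thesis
   by (rule germ_ext_inv) (use assms in \<open>auto intro!: plat_isCont plat_intros simp: vec2_eq_iff\<close>)
 qed (rule A)
qed

lemma abs_mult_le: "\<bar>m\<bar> <= n ==> \<bar>k * m\<bar> <= \<bar>k\<bar> * (n::real)" by (simp add: abs_mult mult_left_mono)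

lemma min_max_n1: "\<bar>max (p$2) 0\<bar> <= n1 p" "\<bar>min (p$2) 0\<bar> <= n1 p" by (auto simp: n1_def)

text \<open>Each of the two slopes may lie on either side of 1. They are split by
  \<open>gamma = max gamma 1 * min gamma 1\<close>, and likewise for \<open>gamma'\<close>, into a
  stretching and a contraction.\<close>

lemma germ_ext_vscale:
 assumes "gamma > 0" "gamma' > 0" shows "germ_ext (%p. v2 (p$1) (gamma * max (p$2) 0 + gamma' * min (p$2) 0))"
proof -
 have A: "germ_ext (%p. v2 (p$1) (a * max (p$2) 0 + b * min (p$2) 0))" if "a >= 1" "b >= 1" for a b
 proof -
  have "germ_ext (%p. v2 (p$1) (p$2 + ((a - 1) * max (p$2) 0 + (b - 1) * min (p$2) 0)))"
  proof (rule germ_ext_v[where C = "(a - 1) + (b - 1)"])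
   fix p :: "real^2"
   have "\<bar>(a - 1) * max (p$2) 0\<bar> <= (a - 1) * n1 p" "\<bar>(b - 1) * min (p$2) 0\<bar> <= (b - 1) * n1 p"
    using that abs_mult_le[OF min_max_n1(1), of "a - 1" p] abs_mult_le[OF min_max_n1(2), of "b - 1" p] by auto
   then show "\<bar>(a - 1) * max (p $ 2) 0 + (b - 1) * min (p $ 2) 0\<bar> <= ((a - 1) + (b - 1)) * n1 p"
    unfolding distrib_right by linarith
  next
   fix u c d :: real assume "c <= d"
   then show "(a - 1) * max (v2 u c $ 2) 0 + (b - 1) * min (v2 u c $ 2) 0 <= (a - 1) * max (v2 u d $ 2) 0 + (b - 1) * min (v2 u d $ 2) 0"
    using that by (intro add_mono mult_left_mono) auto
  qed (auto intro!: plat_intros)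
  moreover have "p$2 + ((a - 1) * max (p$2) 0 + (b - 1) * min (p$2) 0) = a * max (p$2) 0 + b * min (p$2) 0" for p :: "real^2"
   by (auto simp: max_def min_def algebra_simps)
  ultimately show ?thesis by simp
 qed
 have B: "germ_ext (%p. v2 (p$1) (a * max (p$2) 0 + b * min (p$2) 0))" if "0 < a" "a <= 1" "0 < b" "b <= 1" for a b
 proof -
  have "germ_ext (%p. v2 (p$1) (1/a * max (p$2) 0 + 1/b * min (p$2) 0))" using that by (intro A) auto
  then show ?thesis
  proof (rule germ_ext_inv)
   show "isCont (%p::real^2. v2 (p$1) (a * max (p$2) 0 + b * min (p$2) 0)) (0::real^2)" by (intro plat_isCont plat_intros)
  qed (use that in \<open>auto simp: vec2_eq_iff max_def min_def zero_le_mult_iff mult_le_0_iff zero_le_divide_iff divide_le_0_iff\<close>)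
 qed
 have "germ_ext (%p. v2 (p$1) (min gamma 1 * max (p$2) 0 + min gamma' 1 * min (p$2) 0))" using assms by (intro B) auto
 from germ_ext_comp[OF A[of "max gamma 1" "max gamma' 1"] this]
 have *: "germ_ext (%p. v2 (p$1) (max gamma 1 * max (min gamma 1 * max (p$2) 0 + min gamma' 1 * min (p$2) 0) 0 +
       max gamma' 1 * min (min gamma 1 * max (p$2) 0 + min gamma' 1 * min (p$2) 0) 0))" by simp
 have "max gamma 1 * max (min gamma 1 * max c 0 + min gamma' 1 * min c 0) 0 + max gamma' 1 * min (min gamma 1 * max c 0 + min gamma' 1 * min c 0) 0
   = gamma * max c 0 + gamma' * min c 0" for c
  using assms by (cases "c >= 0"; cases "gamma >= 1"; cases "gamma' >= 1") (auto simp: max_def min_def mult_le_0_iff zero_le_mult_iff)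
 then show ?thesis using * by simp
qed

text \<open>The normal form of a semi-affine germ preserving the axis, its direction and its sides:
  a scaling of the coordinates followed by a bent horizontal shear.\<close>

lemma germ_ext_semi:
 assumes "alpha > 0" "gamma > 0" "gamma' > 0"
 shows "germ_ext (%p. v2 (alpha * p$1 + beta * max (p$2) 0 + beta' * min (p$2) 0) (gamma * max (p$2) 0 + gamma' * min (p$2) 0))"
proof -
 have "germ_ext (%p. v2 (p$1 + ((beta/gamma) * max (p$2) 0 + (beta'/gamma') * min (p$2) 0)) (p$2))"
 proof (rule germ_ext_h[where C = "\<bar>beta/gamma\<bar> + \<bar>beta'/gamma'\<bar>"])
  fix p :: "real^2"
  have "\<bar>(beta/gamma) * max (p$2) 0\<bar> <= \<bar>beta/gamma\<bar> * n1 p" "\<bar>(beta'/gamma') * min (p$2) 0\<bar> <= \<bar>beta'/gamma'\<bar> * n1 p"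
   by (intro abs_mult_le min_max_n1)+
  then show "\<bar>(beta/gamma) * max (p $ 2) 0 + (beta'/gamma') * min (p $ 2) 0\<bar> <= (\<bar>beta/gamma\<bar> + \<bar>beta'/gamma'\<bar>) * n1 p"
   unfolding distrib_right by linarith
 qed (auto intro!: plat_intros)
 from germ_ext_comp[OF this germ_ext_comp[OF germ_ext_vscale[OF assms(2,3)] germ_ext_hscale[OF assms(1)]]]
 have *: "germ_ext (%p. v2 (alpha * p$1 + ((beta/gamma) * max (gamma * max (p$2) 0 + gamma' * min (p$2) 0) 0 + (beta'/gamma') * min (gamma * max (p$2) 0 + gamma' * min (p$2) 0) 0))
   (gamma * max (p$2) 0 + gamma' * min (p$2) 0))" by simp
 have "(beta/gamma) * max (gamma * max c 0 + gamma' * min c 0) 0 + (beta'/gamma') * min (gamma * max c 0 + gamma' * min c 0) 0 = beta * max c 0 + beta' * min c 0" for c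
  using assms by (cases "c >= 0") (auto simp: max_def min_def mult_le_0_iff zero_le_mult_iff)
 then show ?thesis using * by (simp add: add.assoc)
qed

lemma plat_cong_ev:
 assumes "plat f x" "\<forall>\<^sub>F y in nhds x. f y = g y" shows "plat g x"
proof -
 obtain S where "open S" "x : S" "!!y. y : S ==> f y = g y" using assms(2) unfolding eventually_nhds by blast
 then show ?thesis using plat_cong assms(1) by blast
qed

lemma isCont_eventually_open:
 assumes "isCont f x" "open S" "f x : S" shows "\<forall>\<^sub>F y in nhds x. f y : S"
 using assms by (simp add: continuous_at_open eventually_nhds)

lemma eventually_n1:
 "eventually P (nhds x) \<longleftrightarrow> (EX d>0. ALL p. n1 (p - x) < d --> P p)"
proof
 assume "eventually P (nhds x)"
 then obtain S where S: "open S" "x : S" "!!p. p : S ==> P p" unfolding eventually_nhds by blast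
 obtain d where "d > 0" "!!p. n1 (p - x) < d ==> p : S" using open_n1_ball[OF S(1,2)] by metis
 then show "EX d>0. ALL p. n1 (p - x) < d --> P p" using S(3) by auto
next
 assume "EX d>0. ALL p. n1 (p - x) < d --> P p"
 then obtain d where "d > 0" "ALL p. n1 (p - x) < d --> P p" by blast
 then show "eventually P (nhds x)"
  unfolding eventually_nhds by (intro exI[of _ "{p. n1 (p - x) < d}"]) auto
qed

subsection \<open>Surfaces with compact boundary\<close>

locale compact_boundary_surface =
 fixes M :: "'a topology" and A :: "('a, real^2) atlas"
 assumes surface: "pl_surface M A" and boundary: "compactin M (surface_boundary A)"
begin

abbreviation Int_M :: "'a set" where "Int_M \<equiv> surface_interior M A"

lemma Hausdorff: "Hausdorff_space M" using surface by (simp add: pl_surface_def)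

lemma openin_Int_M: "openin M Int_M"
 unfolding surface_interior_def using compactin_imp_closedin[OF Hausdorff boundary] by blast

lemma Int_M_subset: "Int_M \<subseteq> topspace M" by (auto simp: surface_interior_def)

lemma chart_open: "(U, phi) : A ==> openin M U"
 using surface unfolding pl_surface_def pl_surface_atlas_def by blast

lemma chart_homeo:
 assumes "(U, phi) : A"
 shows "openin (top_of_set half_plane) (phi ` U)" "homeomorphic_map (subtopology M U) (top_of_set (phi ` U)) phi"
proof -
 obtain V where V: "openin (top_of_set half_plane) V" "homeomorphic_map (subtopology M U) (top_of_set V) phi"
  using surface assms unfolding pl_surface_def pl_surface_atlas_def by fast
 have "U \<subseteq> topspace M" using chart_open[OF assms] openin_subset by blast
 then have "phi ` U = V" using homeomorphic_imp_surjective_map[OF V(2)] by auto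
 then show "openin (top_of_set half_plane) (phi ` U)" "homeomorphic_map (subtopology M U) (top_of_set (phi ` U)) phi"
  using V by auto
qed

lemma chart_inj: assumes "(U, phi) : A" shows "inj_on phi U"
proof -
 have "topspace (subtopology M U) = U" using chart_open[OF assms] openin_subset by auto
 then show ?thesis using homeomorphic_imp_injective_map[OF chart_homeo(2)[OF assms]] by simp
qed

lemma chart_image_open:
 assumes "(U, phi) : A" "openin M W" "W \<subseteq> U"
 shows "openin (top_of_set half_plane) (phi ` W)"
proof -
 have "openin (top_of_set (phi ` U)) (phi ` W)" using assms(2,3) homeomorphic_imp_open_map[OF chart_homeo(2)[OF assms(1)]] unfolding open_map_def by (meson chart_open[OF assms(1)] openin_open_subtopology)
 then show ?thesis using chart_homeo(1)[OF assms(1)] by (rule openin_trans)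
qed

lemma chart_preimage_open:
 assumes "(U, phi) : A" "openin (top_of_set half_plane) S"
 shows "openin M {x:U. phi x : S}"
proof -
 have t: "topspace (subtopology M U) = U" using chart_open[OF assms(1)] openin_subset by auto
 obtain T where "open T" "S = half_plane Int T" using assms(2) by (auto simp: openin_open)
 then have "openin (top_of_set (phi ` U)) (phi ` U Int S)"
  using openin_imp_subset[OF chart_homeo(1)[OF assms(1)]] by (auto simp: openin_open)
 then have "openin (subtopology M U) {x : topspace (subtopology M U). phi x : phi ` U Int S}"
  using homeomorphic_imp_continuous_map[OF chart_homeo(2)[OF assms(1)]] openin_continuous_map_preimage by blast
 moreover have "{x : topspace (subtopology M U). phi x : phi ` U Int S} = {x:U. phi x : S}" using t by auto
 ultimately show ?thesis using chart_open[OF assms(1)] by (metis openin_trans_full)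
qed

lemma chart_half_plane: "(U, phi) : A ==> x : U ==> 0 <= phi x $ 2"
 using openin_imp_subset[OF chart_homeo(1)] by (auto simp: half_plane_def)

lemma chart_cover: "x : topspace M ==> EX U phi. (U, phi) : A & x : U"
 using surface unfolding pl_surface_def pl_surface_atlas_def by blast

lemma chart_Int_M: "(U, phi) : A ==> x : U ==> x : Int_M ==> 0 < phi x $ 2"
 using chart_half_plane[of U phi x] unfolding surface_interior_def surface_boundary_def by fastforce

lemma chart_interior:
 assumes "(U, phi) : A" "openin M W" "W \<subseteq> U" "x : W" "x : Int_M"
 shows "phi x : interior (phi ` W)"
proof -
 obtain T where T: "open T" "phi ` W = half_plane Int T" using chart_image_open[OF assms(1-3)] by (auto simp: openin_open)
 have "open (T Int {v::real^2. 0 < v $ 2})" using T(1) by (intro open_Int open_Collect_less continuous_intros)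
 moreover have "T Int {v. 0 < v $ 2} \<subseteq> phi ` W" using T(2) by (auto simp: half_plane_def)
 moreover have "phi x : T Int {v. 0 < v $ 2}" using T(2) assms chart_Int_M by blast
 ultimately show ?thesis using interiorI by blast
qed

lemma chart_transition:
 assumes "(U, phi) : A" "(V, psi) : A" "x : U" "x : V" "x : Int_M"
 shows "plat (psi \<circ> inv_into U phi) (phi x)"
proof (rule pl_on_interior_plat)
 show "pl_on (phi ` (U Int V)) (psi \<circ> inv_into U phi)"
  using surface assms(1,2) unfolding pl_surface_def pl_surface_atlas_def by fast
 show "phi x : interior (phi ` (U Int V))"
  using assms chart_open by (intro chart_interior) auto
qed

section \<open>PL maps from the plane into the surface\<close>

definition plm :: "(real^2 => 'a) => real^2 => bool" where
 "plm e p \<longleftrightarrow> e p : topspace M &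
   (ALL U phi. (U, phi) : A & e p : U --> (\<forall>\<^sub>F q in nhds p. e q : U) & plat (%q. phi (e q)) p)"

text \<open>One chart suffices: at an interior point the chart image of the overlap is a
  neighbourhood in the plane, so the transition map is PL at \<open>phi (e p)\<close> in the sense
  of \<open>plat\<close>.\<close>

lemma plmI:
 assumes c: "(U, phi) : A" "e p : U" "e p : Int_M" and ev: "\<forall>\<^sub>F q in nhds p. e q : U" and pl: "plat (%q. phi (e q)) p"
 shows "plm e p"
 unfolding plm_def
proof (intro conjI allI impI)
 show "e p : topspace M" using c(3) Int_M_subset by blast
 fix V psi assume V: "(V, psi) : A & e p : V"
 have "phi (e p) : interior (phi ` (U Int V))"
  using c V chart_open by (intro chart_interior) auto
 then have "\<forall>\<^sub>F q in nhds p. phi (e q) : interior (phi ` (U Int V))"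
  using isCont_eventually_open[OF plat_isCont[OF pl] open_interior] by blast
 then have ev2: "\<forall>\<^sub>F q in nhds p. e q : U & e q : V"
  using ev
 proof eventually_elim
  case (elim q)
  then have "phi (e q) : phi ` (U Int V)" using interior_subset[of "phi ` (U Int V)"] by blast
  then show ?case using elim(2) chart_inj[OF c(1)] by (metis IntD1 IntD2 image_iff inj_onD)
 qed
 then show "\<forall>\<^sub>F q in nhds p. e q : V" by (rule eventually_mono) auto
 have tr: "plat (psi \<circ> inv_into U phi) (phi (e p))"
  using V by (intro chart_transition[OF c(1) _ c(2) _ c(3)]) auto
 have "plat (%q. (psi \<circ> inv_into U phi) (phi (e q))) p" by (rule plat_comp[OF pl tr])
 then show "plat (%q. psi (e q)) p"
 proof (rule plat_cong_ev)
  show "\<forall>\<^sub>F q in nhds p. (psi \<circ> inv_into U phi) (phi (e q)) = psi (e q)"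
   using ev by (rule eventually_mono) (simp add: chart_inj[OF c(1)])
 qed
qed

lemma plm_open:
 assumes "plm e p" "openin M W" "e p : W"
 shows "\<forall>\<^sub>F q in nhds p. e q : W"
proof -
 obtain U phi where c: "(U, phi) : A" "e p : U" using assms chart_cover unfolding plm_def by blast
 then have ev: "\<forall>\<^sub>F q in nhds p. e q : U" and pl: "plat (%q. phi (e q)) p" using assms(1) unfolding plm_def by auto
 have "openin (top_of_set half_plane) (phi ` (U Int W))"
  using c assms chart_open by (intro chart_image_open) auto
 then obtain T where T: "open T" "phi ` (U Int W) = half_plane Int T" by (auto simp: openin_open)
 have "\<forall>\<^sub>F q in nhds p. phi (e q) : T" using T(2) c assms(3) isCont_eventually_open[OF plat_isCont[OF pl] T(1)] by blast
 then show ?thesis using ev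
 proof eventually_elim
  case (elim q)
  then have "phi (e q) : phi ` (U Int W)" using T(2) chart_half_plane[OF c(1)] by (auto simp: half_plane_def)
  then show ?case using elim(2) chart_inj[OF c(1)] by (metis IntD1 IntD2 image_iff inj_onD)
 qed
qed

lemma plm_topspace: "plm e p ==> e p : topspace M" by (simp add: plm_def)

lemma plm_comp:
 assumes "plm e (k p)" "plat k p" shows "plm (%q. e (k q)) p"
 unfolding plm_def
proof (intro conjI allI impI)
 show "e (k p) : topspace M" using assms(1) by (simp add: plm_def)
 fix U phi assume "(U, phi) : A & e (k p) : U"
 then have *: "\<forall>\<^sub>F q in nhds (k p). e q : U" "plat (%q. phi (e q)) (k p)" using assms(1) unfolding plm_def by auto
 have "filterlim k (nhds (k p)) (nhds p)" using plat_isCont[OF assms(2)] by (simp add: isCont_def tendsto_at_iff_tendsto_nhds)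
 then show "\<forall>\<^sub>F q in nhds p. e (k q) : U" by (rule eventually_compose_filterlim[OF *(1)])
 show "plat (%q. phi (e (k q))) p" using plat_comp[OF assms(2) *(2)] .
qed

lemma plm_cong_ev:
 assumes "plm e p" "\<forall>\<^sub>F q in nhds p. e q = e' q" shows "plm e' p"
 unfolding plm_def
proof (intro conjI allI impI)
 have ep: "e p = e' p" using assms(2) eventually_nhds_x_imp_x by blast
 then show "e' p : topspace M" using assms(1) by (simp add: plm_def)
 fix U phi assume "(U, phi) : A & e' p : U"
 then have *: "\<forall>\<^sub>F q in nhds p. e q : U" "plat (%q. phi (e q)) p" using assms(1) ep unfolding plm_def by auto
 show "\<forall>\<^sub>F q in nhds p. e' q : U" using *(1) assms(2) by eventually_elim auto
 show "plat (%q. phi (e' q)) p"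
  by (rule plat_cong_ev[OF *(2)]) (use assms(2) in \<open>auto elim: eventually_mono\<close>)
qed

lemma plm_If:
 assumes "plm e p" "plm e' p" "plat l p" "e p = e' p" "\<forall>\<^sub>F q in nhds p. l q = 0 --> e q = e' q"
 shows "plm (%q. if (l q::real) >= 0 then e q else e' q) p"
 unfolding plm_def
proof (intro conjI allI impI)
 show "(if 0 <= l p then e p else e' p) : topspace M" using assms by (simp add: plm_def)
 fix U phi assume "(U, phi) : A & (if 0 <= l p then e p else e' p) : U"
 then have *: "\<forall>\<^sub>F q in nhds p. e q : U" "plat (%q. phi (e q)) p" "\<forall>\<^sub>F q in nhds p. e' q : U" "plat (%q. phi (e' q)) p"
  using assms unfolding plm_def by (auto split: if_splits)
 show "\<forall>\<^sub>F q in nhds p. (if 0 <= l q then e q else e' q) : U" using *(1,3) by eventually_elim auto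
 obtain S where S: "open S" "p : S" "!!q. q : S ==> l q = 0 --> e q = e' q"
  using assms(5) unfolding eventually_nhds by blast
 have "plat (%q. if 0 <= l q then phi (e q) else phi (e' q)) p"
  using *(2,4) assms(3) S by (intro plat_If[where S = S]) auto
 then show "plat (%q. phi (if 0 <= l q then e q else e' q)) p" by (simp add: if_distrib)
qed

text \<open>Parametrisations of open parts of the interior. Used in place of charts, they have open
  plane domains and keep half-planes out of the arguments.\<close>

definition pe :: "(real^2) set => (real^2 => 'a) => bool" where
 "pe Z e \<longleftrightarrow> open Z & inj_on e Z & e ` Z \<subseteq> Int_M & (ALL p:Z. plm e p)"

lemma pe_subset: "pe Z e ==> open Z' ==> Z' \<subseteq> Z ==> pe Z' e"
 unfolding pe_def by (meson image_mono inj_on_subset order_trans subsetD)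

lemma pe_comp:
 assumes "pe Z e" "open Z'" "inj_on k Z'" "k ` Z' \<subseteq> Z" "!!p. p : Z' ==> plat k p"
 shows "pe Z' (%p. e (k p))"
proof -
 have "inj_on (e \<circ> k) Z'" using assms by (intro comp_inj_on) (auto simp: pe_def intro: inj_on_subset)
 moreover have "plm (%p. e (k p)) p" if p: "p : Z'" for p
 proof (rule plm_comp[of e k p])
  show "plm e (k p)" using p assms(4) assms(1) by (auto simp: pe_def)
 qed (rule assms(5)[OF p])
 moreover have "(%p. e (k p)) ` Z' \<subseteq> Int_M" using assms(1,4) unfolding pe_def by blast
 ultimately show ?thesis using assms(2) unfolding pe_def by (simp add: o_def)
qed

text \<open>Invariance of domain in a chart: the local image is open in the plane, hence in
  \<open>half_plane\<close>.\<close>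

lemma pe_open:
 assumes "pe Z e" shows "openin M (e ` Z)"
proof (subst openin_subopen, intro ballI)
 fix x assume "x : e ` Z"
 then obtain p where p: "p : Z" "x = e p" by blast
 have plm: "plm e p" using assms p by (simp add: pe_def)
 then obtain U phi where c: "(U, phi) : A" "e p : U" using chart_cover unfolding plm_def by blast
 then obtain S where S: "open S" "p : S" "!!q. q : S ==> e q : U" using plm unfolding plm_def eventually_nhds by metis
 let ?Z = "Z Int S"
 have pl: "plat (%q. phi (e q)) q" if "q : ?Z" for q
  using that assms S(3) c(1) unfolding pe_def plm_def by blast
 have inj: "inj_on (%q. phi (e q)) ?Z" using chart_inj[OF c(1)] S(3) assms by (auto simp: pe_def inj_on_def)
 have "open ((%q. phi (e q)) ` ?Z)"
  using assms S(1) pl inj by (intro invariance_of_domain plat_continuous_on) (auto simp: pe_def)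
 moreover have "(%q. phi (e q)) ` ?Z \<subseteq> half_plane" using chart_half_plane[OF c(1)] S(3) by (auto simp: half_plane_def)
 ultimately have "openin (top_of_set half_plane) ((%q. phi (e q)) ` ?Z)" by (metis open_subset)
 then have "openin M {y:U. phi y : (%q. phi (e q)) ` ?Z}" using chart_preimage_open[OF c(1)] by blast
 moreover have "{y:U. phi y : (%q. phi (e q)) ` ?Z} = e ` ?Z"
  using chart_inj[OF c(1)] S(3) by (auto simp: inj_on_def)
 ultimately show "EX T. openin M T & x : T & T \<subseteq> e ` Z" using p S(2) by auto
qed

text \<open>In a common chart \<open>e'\<close> has a PL local inverse by
  \<open>plat_inverse\<close>, so the change of parametrisation is a composition of PL maps.\<close>

lemma pe_inv:
 assumes "plm e p" "pe Z' e'" "p' : Z'" "e p = e' p'"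
 shows "plat (%q. inv_into Z' e' (e q)) p"
proof -
 have plm': "plm e' p'" using assms by (simp add: pe_def)
 obtain U phi where c: "(U, phi) : A" "e p : U" using assms(1) chart_cover unfolding plm_def by blast
 then obtain S where S: "open S" "p' : S" "!!q. q : S ==> e' q : U" using plm' assms(4) unfolding plm_def eventually_nhds by metis
 let ?Z = "Z' Int S"
 have opn: "open ?Z" using assms(2) S(1) by (auto simp: pe_def)
 have pl: "plat (%q. phi (e' q)) q" if "q : ?Z" for q
  using that assms(2) S(3) c(1) unfolding pe_def plm_def by blast
 have inje: "inj_on e' Z'" using assms(2) by (simp add: pe_def)
 have inj: "inj_on (%q. phi (e' q)) ?Z" using chart_inj[OF c(1)] S(3) inje by (auto simp: inj_on_def)
 let ?g = "inv_into ?Z (%q. phi (e' q))"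
 have gi: "?g (phi (e' y)) = y" if "y : ?Z" for y using inv_into_f_f[OF inj that] .
 have "plat ?g (phi (e' p'))"
  by (rule plat_inverse[where f = "%q. phi (e' q)" and S = ?Z, OF opn inj]) (use pl gi assms(3) S(2) in auto)
 then have "plat ?g (phi (e p))" by (simp add: assms(4))
 moreover have "plat (%q. phi (e q)) p" using assms(1) c unfolding plm_def by blast
 ultimately have "plat (%q. ?g (phi (e q))) p" using plat_comp by blast
 then show ?thesis
 proof (rule plat_cong_ev)
  have "openin M (e' ` ?Z)" by (rule pe_open[OF pe_subset[OF assms(2) opn]]) blast
  moreover have "e p : e' ` ?Z" unfolding assms(4) using assms(3) S(2) by blast
  ultimately have "\<forall>\<^sub>F q in nhds p. e q : e' ` ?Z" using plm_open[OF assms(1)] by blast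
  then show "\<forall>\<^sub>F q in nhds p. ?g (phi (e q)) = inv_into Z' e' (e q)"
  proof eventually_elim
   case (elim q)
   then obtain a where a: "a : ?Z" "e q = e' a" by blast
   then have "?g (phi (e q)) = a" using inv_into_f_f[OF inj a(1)] by simp
   moreover have "inv_into Z' e' (e q) = a" using a inje by simp
   ultimately show ?case by simp
  qed
 qed
qed

text \<open>Quantifying over all PL maps from the plane, not only charts, makes composition immediate.\<close>

definition lpl :: "('a => 'a) => 'a => bool" where
 "lpl h x \<longleftrightarrow> (ALL e p. plm e p & e p = x --> plm (%q. h (e q)) p)"

text \<open>A single parametrisation tests \<open>lpl\<close>, because near the point every other PL
  map into \<open>M\<close> factors through it.\<close>

lemma lplI:
 assumes "pe Z c" "p : Z" "c p = x" "plm (%q. h (c q)) p" shows "lpl h x"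
 unfolding lpl_def
proof (intro allI impI)
 fix e p' assume e: "plm e p' & e p' = x"
 have "plat (%q. inv_into Z c (e q)) p'" by (rule pe_inv[OF _ assms(1,2)]) (use e assms(3) in auto)
 moreover have "inv_into Z c (e p') = p" using e assms by (auto simp: pe_def)
 ultimately have "plm (%q. h (c (inv_into Z c (e q)))) p'"
  using plm_comp[of "%q. h (c q)" "%q. inv_into Z c (e q)" p'] assms(4) by simp
 then show "plm (%q. h (e q)) p'"
 proof (rule plm_cong_ev)
  have "\<forall>\<^sub>F q in nhds p'. e q : c ` Z" using e assms(2,3) plm_open[of e p', OF _ pe_open[OF assms(1)]] by (auto intro: image_eqI[of _ c p])
  then show "\<forall>\<^sub>F q in nhds p'. h (c (inv_into Z c (e q))) = h (e q)"
   by (rule eventually_mono) (simp add: f_inv_into_f)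
 qed
qed

lemma lpl_comp: "lpl h x ==> lpl g (h x) ==> lpl (%y. g (h y)) x"
 unfolding lpl_def by blast

lemma lpl_id: "lpl (%y. y) x" unfolding lpl_def by simp

lemma lpl_cong:
 assumes "lpl h x" "openin M W" "x : W" "!!y. y : W ==> h y = h' y" shows "lpl h' x"
 unfolding lpl_def
proof (intro allI impI)
 fix e p assume e: "plm e p & e p = x"
 then have "\<forall>\<^sub>F q in nhds p. e q : W" using assms plm_open by blast
 then have "\<forall>\<^sub>F q in nhds p. h (e q) = h' (e q)" by (rule eventually_mono) (use assms in auto)
 moreover have "plm (%q. h (e q)) p" using assms(1) e unfolding lpl_def by blast
 ultimately show "plm (%q. h' (e q)) p" by (rule plm_cong_ev[rotated])
qed

lemma lpl_id_on: "openin M W ==> x : W ==> (!!y. y : W ==> h y = y) ==> lpl h x"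
 by (rule lpl_cong[OF lpl_id]) (assumption | rule sym)+

lemma pe_vimage_open:
 assumes "pe Z e" "openin M V" shows "open {q:Z. e q : V}"
proof (subst open_subopen, intro ballI)
 fix q assume q: "q : {q:Z. e q : V}"
 then obtain S where S: "open S" "q : S" "!!p. p : S ==> e p : V" using plm_open[of e q V] assms unfolding eventually_nhds by (auto simp: pe_def)
 show "EX T. open T & q : T & T \<subseteq> {q:Z. e q : V}" using assms(1) S q by (auto simp: pe_def)
qed

lemma pe_continuous: assumes "pe Z e" shows "continuous_map (top_of_set Z) M e"
proof (rule continuous_map_openin_preimage_eq[THEN iffD2], intro conjI allI impI)
 show "e : topspace (top_of_set Z) \<rightarrow> topspace M" using assms Int_M_subset unfolding pe_def by auto
 fix V assume "openin M V"
 then have "open (Z Int e -` V)" using pe_vimage_open[OF assms] by (simp add: vimage_def Int_def)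
 then show "openin (top_of_set Z) (topspace (top_of_set Z) Int e -` V)"
  by (metis Int_lower1 open_subset topspace_euclidean_subtopology)
qed

lemma pe_compact: assumes "pe Z e" "compact K" "K \<subseteq> Z" shows "compactin M (e ` K)"
 by (rule image_compactin[OF _ pe_continuous[OF assms(1)]]) (simp add: compactin_subtopology assms)

section \<open>Automorphisms with compact support in the interior\<close>

lemma chart_at:
 assumes "openin M W" "x : W" "x : Int_M"
 shows "EX e. pe (D 1) e & e 0 = x & e ` D 1 \<subseteq> W"
proof -
 obtain U phi where c: "(U, phi) : A" "x : U" using chart_cover assms(3) Int_M_subset by blast
 let ?W = "U Int W Int Int_M"
 have oW: "openin M ?W" using chart_open[OF c(1)] assms openin_Int_M by auto
 have "phi x : interior (phi ` ?W)" using oW c assms by (intro chart_interior) auto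
 then obtain r where r: "r > 0" "!!p. n1 (p - phi x) < r ==> p : interior (phi ` ?W)"
  using open_n1_ball[OF open_interior, of "phi x"] by metis
 define k where "k p = phi x + r *\<^sub>R p" for p
 define e where "e p = inv_into U phi (k p)" for p
 have k: "k p : phi ` ?W" if "p : D 1" for p
  using r(2)[of "k p"] that r(1) interior_subset[of "phi ` ?W"] by (auto simp: k_def)
 have e: "e p : ?W" "phi (e p) = k p" if p: "p : D 1" for p using k[OF p] chart_inj[OF c(1)] by (auto simp: e_def)
 have "inj_on e (D 1)"
 proof (rule inj_onI)
  fix p q assume *: "p : D 1" "q : D 1" "e p = e q"
  then have "k p = k q" using e(2)[of p] e(2)[of q] by simp
  then show "p = q" using r(1) by (simp add: k_def)
 qed
 moreover have "plm e p" if p: "p : D 1" for p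
 proof (rule plmI[OF c(1)])
  show "e p : U" "e p : Int_M" using e(1)[OF p] by auto
  have ev: "\<forall>\<^sub>F q in nhds p. q : D 1" using p open_D(2) eventually_nhds by blast
  then show "\<forall>\<^sub>F q in nhds p. e q : U" by (rule eventually_mono) (use e(1) in blast)
  show "plat (%q. phi (e q)) p"
  proof (rule plat_cong_ev)
   show "plat k p" unfolding k_def[abs_def] by (intro plat_intros)
   show "\<forall>\<^sub>F q in nhds p. k q = phi (e q)" using ev by (rule eventually_mono) (use e(2) in simp)
  qed
 qed
 moreover have "e 0 = x" using c chart_inj[OF c(1)] by (simp add: e_def k_def)
 ultimately show ?thesis using e(1) by (intro exI[of _ e]) (auto simp: pe_def)
qed

text \<open>The support is compact and inside the interior, so \<open>h\<close> is the identity near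
  the boundary and \<open>lpl\<close> at interior points carries the whole PL condition. Bijectivity
  on the entire type makes \<open>inv h\<close> the inverse automorphism.\<close>

definition aut :: "'a set => ('a => 'a) => bool" where
 "aut W h \<longleftrightarrow> bij h & (EX K. compactin M K & K \<subseteq> W & K \<subseteq> Int_M & (ALL x. x ~: K --> h x = x)) &
   (ALL x:Int_M. lpl h x) & (ALL x:Int_M. lpl (inv h) x)"

lemma bij_fixed_outside: "bij h ==> (!!x. x ~: K ==> h x = x) ==> h x : K \<longleftrightarrow> x : K"
 by (metis bij_def inj_eq)

lemma aut_supp:
 assumes "aut W h"
 obtains K where "compactin M K" "K \<subseteq> W" "K \<subseteq> Int_M" "!!x. x ~: K ==> h x = x" "!!x. x ~: K ==> inv h x = x"
proof -
 obtain K where K: "compactin M K" "K \<subseteq> W" "K \<subseteq> Int_M" "!!x. x ~: K ==> h x = x" using assms unfolding aut_def by blast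
 moreover have "inv h x = x" if "x ~: K" for x using K(4)[OF that] assms unfolding aut_def by (metis bij_inv_eq_iff)
 ultimately show thesis using that by blast
qed

lemma aut_bij: "aut W h ==> bij h" by (simp add: aut_def)

lemma aut_outside: "aut W h ==> x ~: W ==> h x = x" unfolding aut_def by blast

lemma aut_mem: "aut W h ==> W \<subseteq> S ==> h x : S \<longleftrightarrow> x : S"
 by (rule bij_fixed_outside[OF aut_bij]) (auto intro: aut_outside)

lemma aut_Int_M: assumes "aut W h" shows "h x : Int_M \<longleftrightarrow> x : Int_M"
proof -
 obtain K where "K \<subseteq> Int_M" "!!x. x ~: K ==> h x = x" using aut_supp[OF assms] by metis
 then show ?thesis by (metis bij_fixed_outside[OF aut_bij[OF assms]] subsetD)
qed

lemma aut_topspace: assumes "aut W h" shows "h x : topspace M \<longleftrightarrow> x : topspace M"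
proof -
 obtain K where "K \<subseteq> Int_M" "!!x. x ~: K ==> h x = x" using aut_supp[OF assms] by metis
 then show ?thesis using Int_M_subset by (metis bij_fixed_outside[OF aut_bij[OF assms]] subsetD)
qed

lemma aut_lpl: "aut W h ==> x : Int_M ==> lpl h x" by (simp add: aut_def)

lemma aut_mono: "aut W h ==> W \<subseteq> W' ==> aut W' h" unfolding aut_def by blast

lemma aut_id: "aut W (%x. x)"
proof -
 show ?thesis using lpl_id unfolding aut_def by (auto intro!: exI[of _ "{}"] bij_id[unfolded id_def])
qed

lemma aut_inv: assumes "aut W h" shows "aut W (inv h)"
proof -
 obtain K where "compactin M K" "K \<subseteq> W" "K \<subseteq> Int_M" "!!x. x ~: K ==> inv h x = x" using aut_supp[OF assms] by metis
 moreover have "bij h" using assms by (rule aut_bij)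
 ultimately show ?thesis using assms unfolding aut_def by (auto simp: bij_imp_bij_inv inv_inv_eq)
qed

lemma aut_comp: assumes g: "aut W g" and h: "aut W h" shows "aut W (%x. g (h x))"
proof -
 obtain K where K: "compactin M K" "K \<subseteq> W" "K \<subseteq> Int_M" "!!x. x ~: K ==> g x = x" using aut_supp[OF g] by metis
 obtain L where L: "compactin M L" "L \<subseteq> W" "L \<subseteq> Int_M" "!!x. x ~: L ==> h x = x" using aut_supp[OF h] by metis
 have b: "bij g" "bij h" using g h by (auto simp: aut_bij)
 then have bij: "bij (%x. g (h x))" using bij_comp[of h g] by (simp add: o_def)
 have i: "inv (%x. g (h x)) = (%x. inv h (inv g x))" using o_inv_distrib[OF b] by (simp add: o_def fun_eq_iff)
 have "compactin M (K Un L)" using K(1) L(1) by (rule compactin_Un)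
 then have 1: "EX K. compactin M K & K \<subseteq> W & K \<subseteq> Int_M & (ALL x. x ~: K --> g (h x) = x)"
  using K L by (intro exI[of _ "K Un L"]) auto
 have 2: "lpl (%x. g (h x)) x" if "x : Int_M" for x
  using lpl_comp[OF aut_lpl[OF h that] aut_lpl[OF g]] aut_Int_M[OF h] that by blast
 have 3: "lpl (%x. inv h (inv g x)) x" if "x : Int_M" for x
  using lpl_comp[OF aut_lpl[OF aut_inv[OF g] that] aut_lpl[OF aut_inv[OF h]]] aut_Int_M[OF aut_inv[OF g]] that by blast
 show ?thesis unfolding aut_def i using bij 1 2 3 by blast
qed

lemma aut_pe: assumes "aut W h" "pe Z e" shows "pe Z (%p. h (e p))"
proof -
 have "inj h" using aut_bij[OF assms(1)] by (simp add: bij_def)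
 then have "inj_on (%p. h (e p)) Z" using assms(2) unfolding pe_def inj_on_def by blast
 moreover have "plm (%p. h (e p)) p" if "p : Z" for p
  using aut_lpl[OF assms(1), of "e p"] assms(2) that unfolding pe_def lpl_def by blast
 ultimately show ?thesis using assms(2) aut_Int_M[OF assms(1)] unfolding pe_def by auto
qed

text \<open>At interior points openness is tested in a parametrisation; at all others
  \<open>h\<close> is the identity nearby.\<close>

lemma aut_vimage_open:
 assumes h: "aut W h" and V: "openin M V" shows "openin M {x. h x : V}"
proof (subst openin_subopen, intro ballI)
 obtain K where K: "compactin M K" "K \<subseteq> Int_M" "!!x. x ~: K ==> h x = x" using aut_supp[OF h] by metis
 fix x assume x: "x : {x. h x : V}"
 then have xt: "x : topspace M" using V openin_subset aut_topspace[OF h] by blast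
 show "EX T. openin M T & x : T & T \<subseteq> {x. h x : V}"
 proof (cases "x : Int_M")
  case True
  then obtain e where e: "pe (D 1) e" "e 0 = x" using chart_at[OF openin_Int_M] by blast
  have o: "open {q:D 1. h (e q) : V}" using pe_vimage_open[OF aut_pe[OF h e(1)] V] .
  have "openin M (e ` {q:D 1. h (e q) : V})" by (rule pe_open[OF pe_subset[OF e(1) o]]) auto
  then show ?thesis using e(2) x by auto
 next
  case False
  then have "x ~: K" "h x = x" using K by blast+
  then show ?thesis using x xt K(3) compactin_imp_closedin[OF Hausdorff K(1)] V by auto
 qed
qed

lemma aut_image_open: assumes "aut W h" "openin M V" shows "openin M (h ` V)"
proof -
 have b: "bij h" using assms(1) by (rule aut_bij)
 show ?thesis using bij_vimage_eq_inv_image[OF bij_imp_bij_inv[OF b], of V] inv_inv_eq[OF b] aut_vimage_open[OF aut_inv[OF assms(1)] assms(2)] by (simp add: vimage_def)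
qed

lemma aut_homeomorphic: assumes "aut W h" shows "homeomorphic_map M M h"
proof -
 have c: "continuous_map M M h" if h: "aut W h" for h
 proof (rule continuous_map_openin_preimage_eq[THEN iffD2], intro conjI allI impI)
  show "h : topspace M \<rightarrow> topspace M" using aut_topspace[OF h] by blast
  fix V assume V: "openin M V"
  have "topspace M Int h -` V = topspace M Int {x. h x : V}" by blast
  then show "openin M (topspace M Int h -` V)" using openin_Int[OF openin_topspace aut_vimage_open[OF h V]] by simp
 qed
 show ?thesis using c[OF assms] c[OF aut_inv[OF assms]] aut_bij[OF assms] homeomorphic_map_maps unfolding homeomorphic_maps_def by (force simp: bij_def surj_f_inv_f)
qed

lemma aut_compactin: "aut W h ==> compactin M K ==> compactin M (h ` K)"
 using image_compactin homeomorphic_imp_continuous_map[OF aut_homeomorphic] by blast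

definition cext :: "(real^2 => 'a) => (real^2 => real^2) => 'a => 'a" where
 "cext e nu x = (if x : e ` D 1 then e (nu (inv_into (D 1) e x)) else x)"

lemma cext_eq: "pe (D 1) e ==> p : D 1 ==> cext e nu (e p) = e (nu p)"
 unfolding cext_def pe_def by simp

text \<open>As \<open>r < 1\<close>, the support lies in the compact image of \<open>cD r\<close>,
  so the transplanted map is the identity near the edge of the chart.\<close>

lemma cext_lpl:
 assumes e: "pe (D 1) e" and nu: "plane_aut r nu" and r: "r < 1"
 shows "lpl (cext e nu) x"
proof (cases "x : e ` D 1")
 case True
 then obtain p where p: "p : D 1" "x = e p" by blast
 show ?thesis
 proof (rule lplI[OF e p(1) p(2)[symmetric]])
  have "nu p : D 1" using plane_aut_less[OF plane_aut_mono[OF nu, of 1]] r p(1) by simp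
  then have "plm (%q. e (nu q)) p" using e nu by (intro plm_comp[of e nu p]) (auto simp: pe_def plane_aut_def)
  then show "plm (%q. cext e nu (e q)) p"
  proof (rule plm_cong_ev)
   have "\<forall>\<^sub>F q in nhds p. q : D 1" using p open_D(2) eventually_nhds by blast
   then show "\<forall>\<^sub>F q in nhds p. e (nu q) = cext e nu (e q)" by (rule eventually_mono) (simp add: cext_eq[OF e])
  qed
 qed
next
 case False
 show ?thesis
 proof (cases "x : topspace M")
  case True
  have "cD r \<subseteq> D 1" using r by auto
  then have o: "openin M (topspace M - e ` cD r)" using compactin_imp_closedin[OF Hausdorff pe_compact[OF e]] by auto
  show ?thesis
  proof (rule lpl_id_on[OF o])
   show "x : topspace M - e ` cD r" using False True \<open>cD r \<subseteq> D 1\<close> by blast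
   fix y assume y: "y : topspace M - e ` cD r"
   show "cext e nu y = y"
   proof (cases "y : e ` D 1")
    case True
    then obtain q where "q : D 1" "y = e q" by blast
    moreover have "r <= n1 q" using y calculation by force
    ultimately show ?thesis using cext_eq[OF e] nu by (simp add: plane_aut_def)
   qed (simp add: cext_def)
  qed
 next
  case False
  then show ?thesis unfolding lpl_def using plm_topspace by blast
 qed
qed

lemma cext_aut:
 assumes e: "pe (D 1) e" and nu: "plane_aut r nu" and r: "r < 1"
 shows "aut (e ` D 1) (cext e nu)" "inv (cext e nu) = cext e (inv nu)"
proof -
 have b: "bij nu" using nu by (simp add: plane_aut_def)
 have nu1: "plane_aut 1 nu" using plane_aut_mono[OF nu] r by simp
 have D: "n1 (nu p) < 1 \<longleftrightarrow> n1 p < 1" "n1 (inv nu p) < 1 \<longleftrightarrow> n1 p < 1" for p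
  using plane_aut_less[OF nu1] plane_aut_less[OF plane_aut_inv[OF nu1]] by auto
 have 1: "cext e nu (cext e (inv nu) x) = x" for x
 proof (cases "x : e ` D 1")
  case True
  then obtain p where "p : D 1" "x = e p" by blast
  then show ?thesis using D b by (simp add: cext_eq[OF e] bij_def surj_f_inv_f)
 qed (simp add: cext_def)
 have 2: "cext e (inv nu) (cext e nu x) = x" for x
 proof (cases "x : e ` D 1")
  case True
  then obtain p where "p : D 1" "x = e p" by blast
  then show ?thesis using D b by (simp add: cext_eq[OF e] bij_def)
 qed (simp add: cext_def)
 show i: "inv (cext e nu) = cext e (inv nu)" using 1 2 by (intro inv_unique_comp) (auto simp: fun_eq_iff)
 have bij: "bij (cext e nu)" using 1 2 by (intro o_bij[of "cext e (inv nu)"]) (auto simp: fun_eq_iff)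
 have "cD r \<subseteq> D 1" using r by auto
 have "compactin M (e ` cD r)" using pe_compact[OF e _ \<open>cD r \<subseteq> D 1\<close>] by simp
 moreover have "e ` cD r \<subseteq> e ` D 1" using \<open>cD r \<subseteq> D 1\<close> by blast
 moreover have "e ` cD r \<subseteq> Int_M" using calculation(2) e by (auto simp: pe_def)
 moreover have "cext e nu y = y" if y: "y ~: e ` cD r" for y
 proof (cases "y : e ` D 1")
  case True
  then obtain q where "q : D 1" "y = e q" by blast
  moreover have "r <= n1 q" using y calculation by force
  ultimately show ?thesis using cext_eq[OF e] nu by (simp add: plane_aut_def)
 qed (simp add: cext_def)
 ultimately have K: "EX K. compactin M K & K \<subseteq> e ` D 1 & K \<subseteq> Int_M & (ALL x. x ~: K --> cext e nu x = x)" by blast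
 show "aut (e ` D 1) (cext e nu)" unfolding aut_def i
  using bij K cext_lpl[OF e nu r] cext_lpl[OF e plane_aut_inv[OF nu] r] by blast
qed

end

subsection \<open>Adapted charts\<close>

definition axis :: "(real^2) set" where "axis = {p. p$2 = 0}"
definition lower :: "(real^2) set" where "lower = {p. p$2 <= 0}"

definition flip :: "real => real => real^2 => real^2" where "flip s t p = v2 (s * p$1) (t * p$2)"

definition is_sign :: "real => bool" where "is_sign s \<longleftrightarrow> s = 1 | s = -1"

lemma is_sign_mult: "is_sign s ==> is_sign t ==> is_sign (s * t)" by (auto simp: is_sign_def)
lemma is_sign_square: "is_sign s ==> s * s = 1" by (auto simp: is_sign_def)
lemma is_sign_sgn: "x ~= 0 ==> is_sign (sgn x)" by (auto simp: is_sign_def sgn_if)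
lemma n1_flip [simp]: "is_sign s ==> is_sign t ==> n1 (flip s t p) = n1 p"
 by (auto simp: n1_def flip_def is_sign_def)
lemma flip_flip: "flip s t (flip s' t' p) = flip (s * s') (t * t') p" by (simp add: flip_def)
lemma flip_1 [simp]: "flip 1 1 p = p" by (simp add: flip_def)
lemma flip_nth [simp]: "flip s t p $ 1 = s * p$1" "flip s t p $ 2 = t * p$2" by (simp_all add: flip_def)

lemma locally_constant_connectedin:
 assumes "connectedin X S" "!!x. x : S ==> EX U. openin X U & x : U & (ALL y:S Int U. P x \<longleftrightarrow> P y)"
  "x : S" "y : S" "P x"
 shows "P y"
proof (rule ccontr)
 assume "~ P y"
 let ?E = "%b. \<Union>{U. openin X U & (ALL z:S Int U. P z \<longleftrightarrow> b)}"
 have o: "openin X (?E b)" for b by auto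
 have cov: "S \<subseteq> ?E True Un ?E False"
 proof
  fix z assume "z : S"
  then obtain U where "openin X U" "z : U" "ALL y:S Int U. P z \<longleftrightarrow> P y" using assms(2) by blast
  then show "z : ?E True Un ?E False" by (cases "P z") auto
 qed
 have dis: "?E True Int ?E False Int S = {}" by blast
 have ne: "?E True Int S ~= {}" "?E False Int S ~= {}" using cov assms(3,4,5) \<open>~ P y\<close> by blast+
 show False using assms(1) o[of True] o[of False] cov dis ne unfolding connectedin by meson
qed

context compact_boundary_surface
begin

text \<open>With \<open>m = axis\<close> the set \<open>Z\<close> is a curve. With
  \<open>m = lower\<close> it is a region whose frontier is the axis; preserving such a
  \<open>Z\<close> preserves the curve and also its sides.\<close>

definition adapted :: "(real^2) set => 'a set => (real^2 => 'a) => bool" where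
 "adapted m Z e \<longleftrightarrow> pe (D 1) e & (ALL p:D 1. e p : Z \<longleftrightarrow> p : m)"

definition preserves :: "'a set => ('a => 'a) => bool" where
 "preserves Z g \<longleftrightarrow> (ALL x. g x : Z \<longleftrightarrow> x : Z)"

lemma axial_mem: "axial nu ==> m = axis | m = lower ==> nu p : m \<longleftrightarrow> p : m"
 unfolding axial_def axis_def lower_def by (auto; smt (verit))

lemma cext_preserves:
 assumes "adapted m Z e" "m = axis | m = lower" "axial nu" "plane_aut r nu" "r < 1"
 shows "preserves Z (cext e nu)"
 unfolding preserves_def
proof
 fix x
 have e: "pe (D 1) e" using assms(1) by (simp add: adapted_def)
 show "cext e nu x : Z \<longleftrightarrow> x : Z"
 proof (cases "x : e ` D 1")
  case True
  then obtain p where p: "p : D 1" "x = e p" by blast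
  show ?thesis using plane_aut_less[OF plane_aut_mono[OF assms(4), of 1]] assms(5) p(1) p assms(1) axial_mem[OF assms(3,2)] by (simp add: cext_eq[OF e] adapted_def)
 qed (simp add: cext_def)
qed

text \<open>Charts are compared as germs at points of their axes, up to reflections in both
  coordinates. The values of the two signs are settled later, by arguments specific to each
  use.\<close>

definition germ_equiv :: "'a set => 'a set => (real^2 => 'a) => real => (real^2 => 'a) => real => bool" where
 "germ_equiv W Z e a e' a' \<longleftrightarrow> (EX g s t rho. aut W g & preserves Z g & is_sign s & is_sign t & rho > 0 &
   (ALL p. n1 p < rho --> g (e (v2 a 0 + p)) = e' (v2 a' 0 + flip s t p)))"

lemma germ_equiv_sym:
 assumes "germ_equiv W Z e a e' a'" shows "germ_equiv W Z e' a' e a"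
proof -
 obtain g s t rho where g: "aut W g" "preserves Z g" "is_sign s" "is_sign t" "rho > 0"
  "!!p. n1 p < rho ==> g (e (v2 a 0 + p)) = e' (v2 a' 0 + flip s t p)"
  using assms unfolding germ_equiv_def by blast
 have b: "bij g" using g(1) by (rule aut_bij)
 have "inv g (e' (v2 a' 0 + p)) = e (v2 a 0 + flip s t p)" if "n1 p < rho" for p
 proof -
  have "g (e (v2 a 0 + flip s t p)) = e' (v2 a' 0 + p)" using g(3,4) g(6)[of "flip s t p"] that by (simp add: flip_flip is_sign_square)
  then show ?thesis using b by (metis bij_inv_eq_iff)
 qed
 moreover have "preserves Z (inv g)" using g(2) b unfolding preserves_def by (metis bij_inv_eq_iff)
 ultimately show ?thesis unfolding germ_equiv_def using aut_inv[OF g(1)] g(3-5) by blast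
qed

lemma germ_equiv_trans:
 assumes "germ_equiv W Z e a e' a'" "germ_equiv W Z e' a' e'' a''" shows "germ_equiv W Z e a e'' a''"
proof -
 obtain g s t rho where g: "aut W g" "preserves Z g" "is_sign s" "is_sign t" "rho > 0"
  "!!p. n1 p < rho ==> g (e (v2 a 0 + p)) = e' (v2 a' 0 + flip s t p)"
  using assms(1) unfolding germ_equiv_def by blast
 obtain g' s' t' rho' where g': "aut W g'" "preserves Z g'" "is_sign s'" "is_sign t'" "rho' > 0"
  "!!p. n1 p < rho' ==> g' (e' (v2 a' 0 + p)) = e'' (v2 a'' 0 + flip s' t' p)"
  using assms(2) unfolding germ_equiv_def by blast
 have "g' (g (e (v2 a 0 + p))) = e'' (v2 a'' 0 + flip (s' * s) (t' * t) p)" if "n1 p < min rho rho'" for p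
  using that g(6)[of p] g'(6)[of "flip s t p"] g(3,4) by (simp add: flip_flip)
 moreover have "preserves Z (%x. g' (g x))" using g(2) g'(2) unfolding preserves_def by blast
 moreover have "min rho rho' > 0" using g(5) g'(5) by simp
 ultimately show ?thesis unfolding germ_equiv_def
  using aut_comp[OF g'(1) g(1)] is_sign_mult[OF g'(3) g(3)] is_sign_mult[OF g'(4) g(4)] by blast
qed

lemma germ_equiv_translate:
 assumes e: "adapted m Z e" "m = axis | m = lower" "e ` D 1 \<subseteq> W" and a: "\<bar>a\<bar> < 1/4"
 shows "germ_equiv W Z e 0 e a"
proof -
 let ?nu = "hmove (2/5) (%p. a)"
 have nu: "plane_aut (4/5) ?nu" using hmove_aut[of "%p. a" "2/5"] by (simp add: plat_const)
 have pe: "pe (D 1) e" using e(1) by (simp add: adapted_def)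
 have "cext e ?nu (e (v2 0 0 + p)) = e (v2 a 0 + flip 1 1 p)" if "n1 p < 1/4" for p
 proof -
  have "?nu p = v2 (p$1 + a) (p$2)" using a that by (intro hmove_eq) auto
  then have "?nu p = v2 a 0 + p" by (simp add: vec2_eq_iff)
  moreover have "v2 0 0 + p = p" by (simp add: vec2_eq_iff)
  ultimately show ?thesis using that cext_eq[OF pe, of p] by simp
 qed
 moreover have "aut W (cext e ?nu)" using aut_mono[OF cext_aut(1)[OF pe nu] e(3)] by simp
 moreover have "preserves Z (cext e ?nu)" using cext_preserves[OF e(1,2) axial_hmove nu] by simp
 moreover have "is_sign 1" by (simp add: is_sign_def)
 ultimately show ?thesis unfolding germ_equiv_def by (metis zero_less_divide_1_iff zero_less_numeral)
qed

lemma plane_aut_translate: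
 assumes "plane_aut r nu"
 shows "plane_aut (r + n1 x) (%q. x + nu (q - x))"
proof (rule plane_autI)
 have inj: "inj nu" using assms by (simp add: plane_aut_def bij_def)
 show "inj (%q. x + nu (q - x))" by (rule injI) (use inj_eq[OF inj] in simp)
 show "plat (%q. x + nu (q - x)) y" for y
  using assms by (intro plat_intros plat_comp[of "%q. q - x" y nu]) (auto simp: plane_aut_def)
 fix p assume "r + n1 x <= n1 p"
 then show "x + nu (p - x) = p" using n1_triangle[of "p - x" x] assms by (simp add: plane_aut_def)
qed

text \<open>Up to two signs the transition map is a map \<open>N\<close> in the normal form of
  \<open>germ_ext_semi\<close>; undoing \<open>N\<close> inside the chart \<open>e\<close>, with
  small support, makes the germs equal.\<close>

lemma germ_equiv_semi:
 assumes e: "adapted m Z e" "m = axis | m = lower" "e ` D 1 \<subseteq> W" and e': "adapted m Z e'"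
  and a: "\<bar>a\<bar> < 1" "\<bar>a'\<bar> < 1" "e (v2 a 0) = e' (v2 a' 0)"
  and semi: "semi (%q. inv_into (D 1) e' (e q)) (v2 a 0) (v2 1 0) (v2 0 1)"
 shows "germ_equiv W Z e a e' a'"
proof -
 define T where "T q = inv_into (D 1) e' (e q)" for q
 have pe: "pe (D 1) e" and pe': "pe (D 1) e'" using e(1) e' by (auto simp: adapted_def)
 have inj: "inj_on e (D 1)" "inj_on e' (D 1)" using pe pe' by (auto simp: pe_def)
 have T0: "T (v2 a 0) = v2 a' 0" unfolding T_def a(3) using inj(2) a(2) by simp
 obtain r0 Av Bpv Bmv where r0: "r0 > 0" and Tv: "!!alpha beta. \<bar>alpha\<bar> < r0 & \<bar>beta\<bar> < r0 ==>
   T (v2 a 0 + alpha *\<^sub>R v2 1 0 + beta *\<^sub>R v2 0 1) = T (v2 a 0) + alpha *\<^sub>R Av + max beta 0 *\<^sub>R Bpv + min beta 0 *\<^sub>R Bmv"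
  using semi unfolding semi_def T_def by blast
 define A where "A = Av$1"
 define Bp where "Bp = Bpv$1"
 define Bm where "Bm = Bmv$1"
 define C where "C = Bpv$2"
 define C' where "C' = Bmv$2"
 have "\<forall>\<^sub>F q in nhds (v2 a 0). e q : e' ` D 1"
  using pe pe_open[OF pe'] a by (intro plm_open) (auto simp: pe_def)
 then obtain r1 where r1: "r1 > 0" "!!q. n1 (q - v2 a 0) < r1 ==> e q : e' ` D 1" unfolding eventually_n1 by blast
 define r where "r = min (min (r0/2) r1) (1 - \<bar>a\<bar>)"
 have r: "r > 0" "r <= r0/2" "r <= r1" "r <= 1 - \<bar>a\<bar>" using r0 r1(1) a(1) unfolding r_def by linarith+
 have qD: "v2 a 0 + p : D 1" if "n1 p < r" for p
  using n1_triangle[of "v2 a 0" p] that r(4) by simp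
 have eT: "e (v2 a 0 + p) = e' (T (v2 a 0 + p))" "T (v2 a 0 + p) : D 1" if "n1 p < r" for p
 proof -
  have "e (v2 a 0 + p) : e' ` D 1" using r1(2)[of "v2 a 0 + p"] that r(3) by simp
  then show "e (v2 a 0 + p) = e' (T (v2 a 0 + p))" "T (v2 a 0 + p) : D 1"
   unfolding T_def using inv_into_into[of "e (v2 a 0 + p)" e' "D 1"] by (simp_all only: f_inv_into_f)
 qed
 have Tinj: "p = q" if "n1 p < r" "n1 q < r" "T (v2 a 0 + p) = T (v2 a 0 + q)" for p q
 proof -
  show ?thesis using eT[OF that(1)] eT[OF that(2)] that(3) inj(1) qD[OF that(1)] qD[OF that(2)] by (metis add_left_cancel inj_onD)
 qed
 have Tm: "T (v2 a 0 + p) : m \<longleftrightarrow> v2 a 0 + p : m" if "n1 p < r" for p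
  using e(1) e' qD[OF that] eT[OF that] unfolding adapted_def by metis
 have Tf: "T (v2 a 0 + p) = v2 (a' + p$1 * A + max (p$2) 0 * Bp + min (p$2) 0 * Bm)
    (p$1 * Av$2 + max (p$2) 0 * C + min (p$2) 0 * C')" if "n1 p < r" for p
 proof -
  have "\<bar>p$1\<bar> < r0 & \<bar>p$2\<bar> < r0" using that r(2) r0 by (auto simp: n1_def)
  moreover have "T (v2 a 0 + p) = T (v2 a 0 + (p$1) *\<^sub>R v2 1 0 + (p$2) *\<^sub>R v2 0 1)" by (rule arg_cong[of _ _ T]) (simp add: vec2_eq_iff)
  ultimately show ?thesis using Tv[of "p$1" "p$2"] unfolding T0 by (simp add: vec2_eq_iff A_def Bp_def Bm_def C_def C'_def)
 qed
 have m_cases: "p : m \<longleftrightarrow> p$2 = 0 | (m = lower & p$2 <= 0)" for p using e(2) by (auto simp: axis_def lower_def)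
 \<comment> \<open>Points of the axis on either side of the base point go to \<open>m\<close>; a
   nonzero \<open>Av$2\<close> would put at least one of the two images outside
   \<open>m\<close>.\<close>
 have A2: "Av$2 = 0" using Tm[of "v2 (r/2) 0"] Tm[of "v2 (-r/2) 0"] r(1) Tf[of "v2 (r/2) 0"] Tf[of "v2 (-r/2) 0"] by (auto simp: m_cases mult_le_0_iff zero_le_mult_iff)
 have A1: "A ~= 0"
  using Tinj[of "v2 (r/2) 0" 0] Tf[of "v2 (r/2) 0"] Tf[of 0] r(1) A2 by (auto simp: vec2_eq_iff)
 have C0: "C ~= 0"
 proof
  assume "C = 0"
  then show False using Tf[of "v2 0 (r/2)"] r(1) Tm[of "v2 0 (r/2)"] by (simp add: m_cases)
 qed
 \<comment> \<open>Otherwise nothing near the base point would be sent strictly to the side opposite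
   to \<open>sgn C\<close>, although the image of \<open>e\<close> is open. The point
   \<open>?q\<close> lies on that side.\<close>
 have C'C: "C * C' > 0"
 proof (rule ccontr)
  assume neg: "~ 0 < C * C'"
  let ?B = "{q. n1 (q - v2 a 0) < r}"
  have "?B \<subseteq> D 1" using qD[of "q - v2 a 0" for q] by auto
  define Y where "Y = {q:D 1. e' q : e ` ?B}"
  have "open Y" unfolding Y_def using \<open>?B \<subseteq> D 1\<close> by (intro pe_vimage_open[OF pe'] pe_open pe_subset[OF pe]) auto
  moreover have "v2 a' 0 : Y" unfolding Y_def using a r(1) by (auto simp flip: a(3))
  ultimately obtain delta where delta: "delta > 0" "!!q. n1 (q - v2 a' 0) < delta ==> q : Y" using open_n1_ball[of Y "v2 a' 0"] by blast
  let ?q = "v2 a' (- sgn C * delta / 2)"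
  have "?q : Y" using delta(1) C0 by (intro delta(2)) (auto simp: n1_def sgn_if)
  then obtain q where q: "?q : D 1" "n1 (q - v2 a 0) < r" "e' ?q = e q" by (auto simp: Y_def)
  have "T q = ?q" unfolding T_def q(3)[symmetric] using inj(2) q(1) by simp
  define c where "c = (q - v2 a 0)$2"
  have "max c 0 * C + min c 0 * C' = - sgn C * delta / 2" using Tf[OF q(2)] A2 \<open>T q = ?q\<close> by (simp add: vec2_eq_iff c_def)
  then have "max c 0 * \<bar>C\<bar> + min c 0 * (sgn C * C') = - delta / 2" using C0 by (auto simp: sgn_if split: if_splits)
  moreover have "sgn C * C' <= 0" using neg C0 by (auto simp: sgn_if mult_less_0_iff zero_less_mult_iff not_less)
  then have "0 <= min c 0 * (sgn C * C')" by (intro mult_nonpos_nonpos) auto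
  moreover have "0 <= max c 0 * \<bar>C\<bar>" by simp
  ultimately show False using delta(1) by linarith
 qed
 then have C'0: "C' ~= 0" by auto
 define N where "N p = v2 (\<bar>A\<bar> * p$1 + sgn A * Bp * max (p$2) 0 + sgn A * Bm * min (p$2) 0) (\<bar>C\<bar> * max (p$2) 0 + \<bar>C'\<bar> * min (p$2) 0)" for p :: "real^2"
 let ?s = "sgn A" and ?t = "sgn C"
 have sg: "is_sign ?s" "is_sign ?t" using A1 C0 by (auto intro: is_sign_sgn)
 have ss: "?s * ?s = 1" "?s * \<bar>A\<bar> = A" "?t * \<bar>C\<bar> = C" "?t * \<bar>C'\<bar> = C'"
 proof -
  show "?t * \<bar>C'\<bar> = C'" using C'C by (auto simp: sgn_if zero_less_mult_iff)
  show "?s * ?s = 1" using sg(1) by (rule is_sign_square)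
  show "?s * \<bar>A\<bar> = A" "?t * \<bar>C\<bar> = C" by (metis mult.commute abs_mult_sgn)+
 qed
 have TN: "T (v2 a 0 + p) = v2 a' 0 + flip ?s ?t (N p)" if "n1 p < r" for p
 proof -
  have "?s * (N p$1) = A * p$1 + Bp * max (p$2) 0 + Bm * min (p$2) 0"
   unfolding N_def v2_nth distrib_left mult.assoc[symmetric] ss by simp
  moreover have "?t * (N p$2) = C * max (p$2) 0 + C' * min (p$2) 0"
   unfolding N_def v2_nth distrib_left mult.assoc[symmetric] ss by simp
  ultimately show ?thesis using Tf[OF that] A2 by (simp add: vec2_eq_iff algebra_simps)
 qed
 have "germ_ext N" unfolding N_def[abs_def] using A1 C0 C'0 by (intro germ_ext_semi) auto
 moreover define r2 where "r2 = (1 - \<bar>a\<bar>)/2"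
 have r2: "r2 > 0" "r2 + \<bar>a\<bar> < 1" using a(1) unfolding r2_def by argo+
 ultimately obtain nu delta where nu: "plane_aut r2 nu" "axial nu" "delta > 0" "!!p. n1 p < delta ==> nu p = N p"
  unfolding germ_ext_def by blast
 have N0: "N 0 = 0" by (simp add: N_def vec2_eq_iff)
 have b: "bij nu" using nu(1) by (simp add: plane_aut_def)
 have mp: "min delta r > 0" using nu(3) r(1) by simp
 obtain delta' where delta': "delta' > 0" "!!p. n1 p < delta' ==> n1 (inv nu p) < min delta r" using plane_aut_near[OF plane_aut_inv[OF nu(1)] mp, where x = 0] nu(3) nu(4)[of 0] N0 b by (auto simp: bij_def inv_f_eq)
 let ?mu = "%q. v2 a 0 + inv nu (q - v2 a 0)"
 have mu: "plane_aut (r2 + \<bar>a\<bar>) ?mu" using plane_aut_translate[OF plane_aut_inv[OF nu(1)], of "v2 a 0"] by simp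
 have ax: "axial ?mu" using axial_inv[OF nu(2) b] by (simp add: axial_def)
 have "cext e ?mu (e (v2 a 0 + p)) = e' (v2 a' 0 + flip ?s ?t p)" if p: "n1 p < min delta' r" for p
 proof -
  let ?q = "inv nu p"
  have q: "n1 ?q < delta" "n1 ?q < r" using delta'(2)[of p] p by auto
  have "N ?q = p" using b nu(4)[OF q(1)] by (simp add: bij_def surj_f_inv_f)
  then show ?thesis using eT(1)[OF q(2)] TN[OF q(2)] cext_eq[OF pe, of "v2 a 0 + p"] qD[of p] p by simp
 qed
 moreover have "aut W (cext e ?mu)" using aut_mono[OF cext_aut(1)[OF pe mu r2(2)] e(3)] .
 moreover have "preserves Z (cext e ?mu)" using cext_preserves[OF e(1,2) ax mu r2(2)] .
 moreover have "min delta' r > 0" using delta' r by simp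
 ultimately show ?thesis unfolding germ_equiv_def using sg by blast
qed

text \<open>The case of interest is \<open>m = lower\<close>. If \<open>q'\<close> were strictly
  below the axis, then all points near \<open>e q\<close> would belong to \<open>Z\<close>; but
  those just above the axis of \<open>e\<close> do not.\<close>

lemma adapted_axis_transition:
 assumes e: "adapted m Z e" "m = axis | m = lower" and e': "adapted m Z e'"
  and q: "q : D 1" "q' : D 1" "e q = e' q'" "q$2 = 0"
 shows "q'$2 = 0"
proof -
 have mem: "q' : m" using e e' q unfolding adapted_def by (auto simp: axis_def lower_def)
 show ?thesis
 proof (cases "m = axis")
  case False
  then have low: "m = lower" using e(2) by blast
  show ?thesis
  proof (rule ccontr)
   assume "q'$2 ~= 0"
   then have "q'$2 < 0" using mem low by (auto simp: lower_def)
   let ?N = "{p:D 1. p$2 < 0}"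
   have pe: "pe (D 1) e" "pe (D 1) e'" using e(1) e' by (auto simp: adapted_def)
   have "open ({p. n1 p < 1} Int {p::real^2. p$2 < 0})" by (intro open_Int open_Collect_less continuous_intros open_D)
   moreover have "D 1 Int {p. p$2 < 0} = ?N" by blast
   ultimately have "open ?N" by metis
   then have "openin M (e' ` ?N)" by (rule pe_open[OF pe_subset[OF pe(2)]]) blast
   moreover have "e q : e' ` ?N" unfolding q(3) using q(2) \<open>q'$2 < 0\<close> by blast
   ultimately have "\<forall>\<^sub>F p in nhds q. e p : e' ` ?N" using pe(1) q(1) by (intro plm_open) (auto simp: pe_def)
   moreover have "\<forall>\<^sub>F p in nhds q. p : D 1" using q(1) open_D(2) eventually_nhds by blast
   ultimately have "\<forall>\<^sub>F p in nhds q. e p : e' ` ?N & p : D 1" by eventually_elim blast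
   then obtain d where d: "d > 0" "!!p. n1 (p - q) < d ==> e p : e' ` ?N & p : D 1" unfolding eventually_n1 by blast
   let ?p = "q + v2 0 (d/2)"
   have p: "e ?p : e' ` ?N" "?p : D 1" using d(2)[of ?p] d(1) by auto
   show False using p(1) e' low q(4) d(1) e(1) p(2) unfolding adapted_def by (auto simp: lower_def)
  qed
 qed (use mem in \<open>simp add: axis_def\<close>)
qed

lemma adapted_recentre:
 assumes "adapted m Z e" "m = axis | m = lower" "0 < c" "\<bar>a\<bar> + c <= 1"
 shows "adapted m Z (%p. e (v2 a 0 + c *\<^sub>R p))"
proof -
 have D: "v2 a 0 + c *\<^sub>R p : D 1" if "p : D 1" for p
 proof -
  have "n1 (v2 a 0 + c *\<^sub>R p) <= \<bar>a\<bar> + c * n1 p" using n1_triangle[of "v2 a 0" "c *\<^sub>R p"] assms(3) by simp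
  moreover have "c * n1 p < c" using that assms(3) by simp
  ultimately show ?thesis using assms(4) by simp
 qed
 have "pe (D 1) (%p. e (v2 a 0 + c *\<^sub>R p))"
 proof (rule pe_comp[where Z = "D 1"])
  show "pe (D 1) e" using assms(1) by (simp add: adapted_def)
  show "inj_on (%p. v2 a 0 + c *\<^sub>R p) (D 1)" using assms(3) by (simp add: inj_on_def)
  show "(%p. v2 a 0 + c *\<^sub>R p) ` D 1 \<subseteq> D 1" using D by blast
  show "plat (%p. v2 a 0 + c *\<^sub>R p) p" for p by (intro plat_intros)
 qed (rule open_D)
 moreover have "v2 a 0 + c *\<^sub>R p : m \<longleftrightarrow> p : m" for p
  using assms(2,3) by (auto simp: axis_def lower_def mult_le_0_iff)
 ultimately show ?thesis using assms(1) D unfolding adapted_def by blast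
qed

lemma adapted_shrink:
 assumes e: "adapted m Z e" "m = axis | m = lower" and a: "\<bar>a\<bar> < 1" and W: "openin M W" "e (v2 a 0) : W"
 shows "EX c>0. \<bar>a\<bar> + c <= 1 & adapted m Z (%p. e (v2 a 0 + c *\<^sub>R p)) & (%p. e (v2 a 0 + c *\<^sub>R p)) ` D 1 \<subseteq> W"
proof -
 have pe: "pe (D 1) e" using e by (simp add: adapted_def)
 then have "\<forall>\<^sub>F p in nhds (v2 a 0). e p : W" using a W by (intro plm_open) (auto simp: pe_def)
 then obtain d where d: "d > 0" "!!p. n1 (p - v2 a 0) < d ==> e p : W" unfolding eventually_n1 by blast
 define c where "c = min d (1 - \<bar>a\<bar>)"
 have "c > 0" using d(1) a by (simp add: c_def)
 moreover have c: "c <= d" "\<bar>a\<bar> + c <= 1" unfolding c_def by linarith+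
 moreover have "e (v2 a 0 + c *\<^sub>R p) : W" if "p : D 1" for p
 proof (rule d(2))
  have "c * n1 p < c" using that \<open>c > 0\<close> by simp
  moreover have "n1 (v2 a 0 + c *\<^sub>R p - v2 a 0) = c * n1 p" using \<open>c > 0\<close> by simp
  ultimately show "n1 (v2 a 0 + c *\<^sub>R p - v2 a 0) < d" using c(1) by linarith
 qed
 ultimately show ?thesis using adapted_recentre[OF e, of c a] by auto
qed

text \<open>At the common point the transition map may be bent in many directions. A little further
  along the axis it is semi-affine, and translations along the two axes bring the germs back to the
  centres.\<close>

lemma germ_equiv_common:
 assumes m: "m = axis | m = lower" and e: "adapted m Z e" "e ` D 1 \<subseteq> W" and e': "adapted m Z e'" "e' ` D 1 \<subseteq> W"
  and a: "\<bar>a\<bar> < 1/4" "\<bar>a'\<bar> < 1/4" "e (v2 a 0) = e' (v2 a' 0)"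
 shows "germ_equiv W Z e 0 e' 0"
proof -
 have pe: "pe (D 1) e" "pe (D 1) e'" using e(1) e'(1) by (auto simp: adapted_def)
 let ?T = "%q. inv_into (D 1) e' (e q)"
 have plm: "plm e (v2 a 0)" using pe(1) a(1) by (simp add: pe_def)
 have pl: "plat ?T (v2 a 0)" by (rule pe_inv[OF plm pe(2) _ a(3)]) (use a(2) in simp)
 have "openin M (e' ` D (1/4))" by (rule pe_open[OF pe_subset[OF pe(2) open_D(2)]]) auto
 moreover have "e (v2 a 0) : e' ` D (1/4)" using a(2) unfolding a(3) by auto
 ultimately obtain d where d: "d > 0" "!!p. n1 (p - v2 a 0) < d ==> e p : e' ` D (1/4)" using plm_open[OF plm] unfolding eventually_n1 by blast
 have "min d (1/4 - \<bar>a\<bar>) > 0" using d(1) a(1) by simp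
 then obtain u where u: "0 < u" "u < min d (1/4 - \<bar>a\<bar>)" "semi ?T (v2 a 0 + u *\<^sub>R v2 1 0) (v2 1 0) (v2 0 1)"
  using plat_generic_axis[OF pl] by blast
 have x: "v2 a 0 + u *\<^sub>R v2 1 0 = v2 (a + u) 0" by (simp add: vec2_eq_iff)
 have au: "\<bar>a + u\<bar> < 1/4" using u(1,2) by linarith
 obtain q where q: "q : D (1/4)" "e (v2 (a+u) 0) = e' q" using d(2)[of "v2 (a+u) 0"] u(1,2) by (auto simp: n1_def)
 have "q$2 = 0" by (rule adapted_axis_transition[OF e(1) m e'(1) _ _ q(2)]) (use au q in auto)
 then obtain a2 where a2: "q = v2 a2 0" "\<bar>a2\<bar> < 1/4" using q(1) by (metis mem_Collect_eq n1_v2 v2_eta abs_zero add_0_right)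
 have "germ_equiv W Z e (a + u) e' a2"
  by (rule germ_equiv_semi[OF e(1) m e(2) e'(1)]) (use au a2 q(2) u(3) x in auto)
 from germ_equiv_trans[OF germ_equiv_trans[OF germ_equiv_translate[OF e(1) m e(2) au] this]
   germ_equiv_sym[OF germ_equiv_translate[OF e'(1) m e'(2) a2(2)]]]
 show ?thesis .
qed

text \<open>Being reachable from \<open>e\<close> is locally constant along \<open>S\<close>: the
  centre of a chart near \<open>x\<close> lies on the axis of any chart at \<open>x\<close>, so
  \<open>germ_equiv_common\<close> applies to the two.\<close>

lemma framed_transport:
 assumes m: "m = axis | m = lower" and S: "connectedin M S"
  "!!x. x : S ==> EX e. adapted m Z e & e ` D 1 \<subseteq> W & e 0 = x"
  and e: "adapted m Z e" "e ` D 1 \<subseteq> W" "e 0 : S" and e': "adapted m Z e'" "e' ` D 1 \<subseteq> W" "e' 0 : S"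
 shows "germ_equiv W Z e 0 e' 0"
proof -
 have v00: "v2 0 0 = 0" by (simp add: vec2_eq_iff)
 have same: "germ_equiv W Z e1 0 e2 0"
  if "adapted m Z e1" "e1 ` D 1 \<subseteq> W" "adapted m Z e2" "e2 ` D 1 \<subseteq> W" "e1 0 = e2 0" for e1 e2
  by (rule germ_equiv_common[OF m that(1-4), of 0 0]) (use that(5) v00 in auto)
 define P where "P x \<longleftrightarrow> (EX e1. adapted m Z e1 & e1 ` D 1 \<subseteq> W & e1 0 = x & germ_equiv W Z e 0 e1 0)" for x
 have "P (e' 0)"
 proof (rule locally_constant_connectedin[OF S(1) _ e(3) e'(3)])
  show "P (e 0)" unfolding P_def using e same[OF e(1,2) e(1,2)] by blast
  fix x assume x: "x : S"
  then obtain e1 where e1: "adapted m Z e1" "e1 ` D 1 \<subseteq> W" "e1 0 = x" using S(2) by blast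
  have pe1: "pe (D 1) e1" using e1(1) by (simp add: adapted_def)
  let ?U = "e1 ` D (1/4)"
  have "openin M ?U" by (rule pe_open[OF pe_subset[OF pe1 open_D(2)]]) auto
  moreover have "x : ?U" unfolding e1(3)[symmetric] by auto
  moreover have "P x \<longleftrightarrow> P y" if y: "y : S Int ?U" for y
  proof -
   obtain e2 where e2: "adapted m Z e2" "e2 ` D 1 \<subseteq> W" "e2 0 = y" using S(2) y by blast
   obtain q where q: "q : D (1/4)" "y = e1 q" using y by blast
   have "q$2 = 0" by (rule adapted_axis_transition[OF e2(1) m e1(1), of 0]) (use e2 q in auto)
   then obtain a where a: "q = v2 a 0" "\<bar>a\<bar> < 1/4" using q(1) by (metis mem_Collect_eq n1_v2 v2_eta abs_zero add_0_right)
   have 12: "germ_equiv W Z e1 0 e2 0"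
    by (rule germ_equiv_common[OF m e1(1,2) e2(1,2), of a 0]) (use a q e2 v00 in auto)
   show ?thesis
   proof
    assume "P x"
    then obtain e3 where e3: "adapted m Z e3" "e3 ` D 1 \<subseteq> W" "e3 0 = x" "germ_equiv W Z e 0 e3 0" unfolding P_def by blast
    have "germ_equiv W Z e3 0 e1 0" by (rule same[OF e3(1,2) e1(1,2)]) (simp add: e3 e1)
    from germ_equiv_trans[OF germ_equiv_trans[OF e3(4) this] 12]
    show "P y" unfolding P_def using e2 by blast
   next
    assume "P y"
    then obtain e3 where e3: "adapted m Z e3" "e3 ` D 1 \<subseteq> W" "e3 0 = y" "germ_equiv W Z e 0 e3 0" unfolding P_def by blast
    have "germ_equiv W Z e3 0 e2 0" by (rule same[OF e3(1,2) e2(1,2)]) (simp add: e3 e2)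
    from germ_equiv_trans[OF germ_equiv_trans[OF e3(4) this] germ_equiv_sym[OF 12]]
    show "P x" unfolding P_def using e1 by blast
   qed
  qed
  ultimately show "EX U. openin M U & x : U & (ALL y:S Int U. P x \<longleftrightarrow> P y)" by blast
 qed
 then obtain e1 where e1: "adapted m Z e1" "e1 ` D 1 \<subseteq> W" "e1 0 = e' 0" "germ_equiv W Z e 0 e1 0" unfolding P_def by blast
 have "germ_equiv W Z e1 0 e' 0" by (rule same[OF e1(1,2) e'(1,2) e1(3)])
 then show ?thesis by (rule germ_equiv_trans[OF e1(4)])
qed

text \<open>Being an image of \<open>x\<close> is locally constant along \<open>S\<close>, since in
  a chart a horizontal move followed by a vertical one takes the centre to any nearby point.\<close>

lemma point_transport:
 assumes W: "openin M W" and S: "connectedin M S" "S \<subseteq> W" "S \<subseteq> Int_M" and xy: "x : S" "y : S"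
 shows "EX g. aut W g & g x = y"
proof -
 define P where "P z \<longleftrightarrow> (EX g. aut W g & g x = z)" for z
 have "P y"
 proof (rule locally_constant_connectedin[OF S(1) _ xy])
  show "P x" unfolding P_def using aut_id by blast
  fix z assume z: "z : S"
  then obtain e where e: "pe (D 1) e" "e 0 = z" "e ` D 1 \<subseteq> W" using chart_at[OF W] S by blast
  let ?U = "e ` D (1/8)"
  have "openin M ?U" by (rule pe_open[OF pe_subset[OF e(1) open_D(2)]]) auto
  moreover have "z : ?U" unfolding e(2)[symmetric] by auto
  moreover have loc: "EX h. aut W h & h z = y" if yU: "y : ?U" for y
  proof -
   obtain q where q: "n1 q < 1/8" "y = e q" using yU by blast
   have q': "\<bar>q$1\<bar> < 1/8" "\<bar>q$2\<bar> < 1/8" using q(1) unfolding n1_def by linarith+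
   let ?h = "hmove (2/5) (%p. q$1)" and ?v = "vmove (2/5) (%p. q$2)"
   have h: "plane_aut (4/5) ?h" using hmove_aut[of "%p. q$1" "2/5"] by (simp add: plat_const)
   have v: "plane_aut (4/5) ?v" using vmove_aut[of "%p. q$2" "2/5"] by (simp add: plat_const)
   have vh: "plane_aut (4/5) (%p. ?v (?h p))" by (rule plane_aut_comp[OF v h])
   have "?h 0 = v2 (q$1) 0" using q' by (subst hmove_eq) auto
   moreover have "?v (v2 (q$1) 0) = q"
    using q' by (subst vmove_eq) (auto simp: vec2_eq_iff)
   ultimately have "cext e (%p. ?v (?h p)) z = y" using cext_eq[OF e(1), of 0] e(2) q(2) by simp
   moreover have "aut W (cext e (%p. ?v (?h p)))" using aut_mono[OF cext_aut(1)[OF e(1) vh] e(3)] by simp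
   ultimately show ?thesis by blast
  qed
  moreover have "P z \<longleftrightarrow> P y" if y: "y : S Int ?U" for y
  proof -
   obtain h where h: "aut W h" "h z = y" using loc y by blast
   show ?thesis using h aut_bij aut_comp[OF h(1)] aut_comp[OF aut_inv[OF h(1)]] h(2) unfolding P_def by (metis bij_inv_eq_iff)
  qed
  ultimately show "EX U. openin M U & z : U & (ALL y:S Int U. P z \<longleftrightarrow> P y)" by blast
 qed
 then show ?thesis unfolding P_def .
qed

end

subsection \<open>Rays\<close>

text \<open>If the order of \<open>x < y\<close> were reversed, the value \<open>gamma x\<close>
  would be taken again beyond \<open>y\<close>, because \<open>gamma\<close> is unbounded to the
  right.\<close>

lemma strict_mono_eventually_id:
 fixes gamma :: "real => real"
 assumes cont: "continuous_on {0..} gamma" and inj: "inj_on gamma {0..}" and id: "!!t. T <= t ==> gamma t = t"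
 shows "strict_mono_on {0..} gamma" "0 <= t ==> gamma ` {t..} = {gamma t..}"
proof -
 have cs: "continuous_on {a..b} gamma" if "a >= 0" for a b using cont that by (auto intro: continuous_on_subset)
 show mono: "strict_mono_on {0..} gamma"
 proof (rule strict_mono_onI)
  fix x y :: real assume xy: "x : {0..}" "y : {0..}" "x < y"
  show "gamma x < gamma y"
  proof (rule ccontr)
   assume "~ gamma x < gamma y"
   define z where "z = max (max y T) (gamma x)"
   have z: "y <= z" "gamma x <= gamma z" using id[of z] by (auto simp: z_def)
   then obtain w where w: "y <= w" "w <= z" "gamma w = gamma x"
    using IVT'[of gamma y "gamma x" z] xy cs[of y z] \<open>~ gamma x < gamma y\<close> by auto
   then show False using inj_onD[OF inj, of w x] xy by auto
  qed
 qed
 assume t: "0 <= t"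
 show "gamma ` {t..} = {gamma t..}"
 proof (intro set_eqI iffI)
  fix y assume y: "y : {gamma t..}"
  define z where "z = max (max y T) t"
  have z: "t <= z" "y <= gamma z" using id[of z] by (auto simp: z_def)
  then obtain w where "t <= w" "w <= z" "gamma w = y" using IVT'[of gamma t y z] cs[OF t] y by auto
  then show "y : gamma ` {t..}" by auto
 next
  fix y assume "y : gamma ` {t..}"
  then obtain w where "t <= w" "y = gamma w" by auto
  then show "y : {gamma t..}" using strict_mono_onD[OF mono, of t w] t by force
 qed
qed

context compact_boundary_surface
begin

text \<open>The consequences of \<open>ray\<close> that survive compactly supported automorphisms
  and splicing. The parametrisation is only continuous and injective; flatness concerns the image
  alone.\<close>

definition fray :: "(real => 'a) => bool" where
 "fray s \<longleftrightarrow> continuous_map (top_of_set {0..}) M s & inj_on s {0..} & s ` {0..} \<subseteq> Int_M &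
   (ALL a>=0. closedin M (s ` {a..})) &
   (ALL K. compactin M K --> (EX T>=0. ALL t>=T. s t ~: K)) &
   (ALL t>0. EX e. adapted axis (s ` {0..}) e & e 0 = s t) &
   (EX e. pe (D 1) e & e 0 = s 0 & (ALL p:D 1. e p : s ` {0..} \<longleftrightarrow> p$2 = 0 & 0 <= p$1))"

lemma fray_compact:
 assumes "fray s" "0 <= a" shows "compactin M (s ` {a..b})"
proof (rule image_compactin)
 show "continuous_map (top_of_set {0..}) M s" using assms(1) by (simp add: fray_def)
 show "compactin (top_of_set {0..}) {a..b}" using assms(2) by (auto simp: compactin_subtopology)
qed

lemma fray_closed: "fray s ==> 0 <= a ==> closedin M (s ` {a..})" by (simp add: fray_def)

lemma fray_closed_segment: "fray s ==> 0 <= a ==> closedin M (s ` {a..b})"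
 using fray_compact compactin_imp_closedin[OF Hausdorff] by blast

lemma fray_Int: "fray s ==> 0 <= t ==> s t : Int_M" unfolding fray_def by auto

lemma fray_inj: "fray s ==> 0 <= t ==> 0 <= t' ==> s t = s t' \<longleftrightarrow> t = t'"
 unfolding fray_def by (meson atLeast_iff inj_on_eq_iff)

lemma fray_mem: "fray s ==> I \<subseteq> {0..} ==> 0 <= t ==> s t : s ` I \<longleftrightarrow> t : I"
 by (auto simp: fray_inj subset_iff image_iff)

lemma fray_connected:
 assumes "fray s" "0 <= a" shows "connectedin M (s ` {a..b})"
proof (rule connectedin_continuous_map_image)
 show "continuous_map (top_of_set {0..}) M s" using assms(1) by (simp add: fray_def)
 show "connectedin (top_of_set {0..}) {a..b}" using assms(2) by (auto simp: connectedin_subtopology)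
qed

text \<open>Tails and initial segments of the ray are closed in \<open>M\<close>, so the sets where
  the parameter is below or above a bound are open.\<close>

lemma fray_param_continuous:
 fixes f :: "'c::topological_space => 'a"
 assumes s: "fray s" and f: "continuous_map (top_of_set I) M f" and gamma: "!!u. u : I ==> 0 <= gamma u & f u = s (gamma u)"
 shows "continuous_on I (gamma :: 'c => real)"
proof -
 have mem: "f u : s ` J \<longleftrightarrow> gamma u : J" if "u : I" "J \<subseteq> {0..}" for u J
  using gamma[OF that(1)] fray_mem[OF s that(2), of "gamma u"] by auto
 have op: "openin (top_of_set I) {u:I. gamma u : - J}" if "closedin M (s ` J)" "J \<subseteq> {0..}" for J
 proof -
  have eq: "{u:I. gamma u : - J} = I - {u:I. f u : s ` J}" using mem[OF _ that(2)] by auto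
  show ?thesis using closedin_continuous_map_preimage[OF f that(1)] unfolding eq by auto
 qed
 have nn: "0 <= gamma u" if "u : I" for u using gamma[OF that] by blast
 have "openin (top_of_set I) {u:I. gamma u < a}" for a
 proof (cases "a >= 0")
  case True
  show ?thesis using op[OF fray_closed[OF s True]] True by simp
 next
  case False
  then have eq: "{u:I. gamma u < a} = {}" using nn by force
  show ?thesis unfolding eq by simp
 qed
 moreover have "openin (top_of_set I) {u:I. gamma u > a}" for a
 proof -
  have eq: "{u:I. gamma u > a} = {u:I. gamma u : - {0..a}}"
   by (intro Collect_cong conj_cong refl) (simp add: nn not_le)
  show ?thesis unfolding eq by (rule op[OF fray_closed_segment[OF s order_refl]]) simp
 qed
 ultimately have "continuous_map (top_of_set I) euclideanreal gamma"
  by (simp add: continuous_map_upper_lower_semicontinuous_lt)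
 then show ?thesis by simp
qed

lemma fray_arc:
 assumes s: "fray s" and I: "is_interval (I :: real set)" and k: "continuous_map (top_of_set I) M k" "inj_on k I" "k ` I \<subseteq> s ` {0..}"
 obtains gamma where "strict_mono_on I gamma | strict_antimono_on I gamma" "!!u. u : I ==> 0 <= gamma u & k u = s (gamma u)"
proof -
 have "EX t. 0 <= t & k u = s t" if "u : I" for u using k(3) that by auto
 then obtain gamma where gamma: "!!u. u : I ==> 0 <= gamma u & k u = s (gamma u)" by metis
 show thesis using k(2) gamma that[OF _ gamma] injective_eq_monotone_map[OF I fray_param_continuous[OF s k(1) gamma]] unfolding inj_on_def by metis
qed

text \<open>The automorphism acts on the parameter by a continuous injective map. Far out on the ray
  it is the identity, which forces this map to be increasing.\<close>

lemma fray_reparam: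
 assumes s: "fray s" and g: "aut W g" "g ` s ` {0..} \<subseteq> s ` {0..}"
 obtains gamma where "strict_mono_on {0..} gamma" "!!t. 0 <= t ==> gamma ` {t..} = {gamma t..}"
  "!!t. 0 <= t ==> 0 <= gamma t & g (s t) = s (gamma t)"
proof -
 let ?S = "s ` {0..}"
 define gamma where "gamma t = inv_into {0..} s (g (s t))" for t
 have gS: "g (s t) : ?S" if "t >= 0" for t using that g(2) by auto
 have gamma: "0 <= gamma t & g (s t) = s (gamma t)" if "0 <= t" for t
  using inv_into_into[OF gS[OF that]] f_inv_into_f[OF gS[OF that]] unfolding gamma_def by simp
 have b: "bij g" using g(1) by (rule aut_bij)
 have "inj_on gamma {0..}"
 proof (rule inj_onI)
  fix x y :: real assume *: "x : {0..}" "y : {0..}" "gamma x = gamma y"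
  then have "g (s x) = g (s y)" using gamma by auto
  then show "x = y" using b fray_inj[OF s] * by (simp add: bij_def inj_eq)
 qed
 moreover have "continuous_on {0..} gamma"
 proof -
  have cs: "continuous_map (top_of_set {0..}) M (%t. g (s t))"
   using continuous_map_compose[OF _ homeomorphic_imp_continuous_map[OF aut_homeomorphic[OF g(1)]], of "top_of_set {0..}" s] s
   by (simp add: fray_def o_def)
  show ?thesis by (rule fray_param_continuous[OF s cs]) (use gamma in simp)
 qed
 moreover obtain T where "!!t. T <= t ==> gamma t = t"
 proof -
  obtain K where K: "compactin M K" "!!x. x ~: K ==> g x = x" using aut_supp[OF g(1)] by metis
  obtain T where T: "T >= 0" "!!t. T <= t ==> s t ~: K" using s K(1) unfolding fray_def by blast
  have "gamma t = t" if "T <= t" for t using s that T(1) unfolding gamma_def K(2)[OF T(2)[OF that]] by (simp add: fray_def)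
  then show thesis using that by blast
 qed
 ultimately show thesis using strict_mono_eventually_id[of gamma T] that gamma by blast
qed

lemma fray_reparam_tail:
 assumes s: "fray s" and g: "aut W g" "g ` s ` {0..} \<subseteq> s ` {0..}" and t: "0 <= t" "0 <= t'" "g (s t) = s t'"
 shows "g ` (s ` {t..}) = s ` {t'..}"
proof -
 obtain gamma where gamma: "!!t. 0 <= t ==> gamma ` {t..} = {gamma t..}" "!!t. 0 <= t ==> 0 <= gamma t & g (s t) = s (gamma t)"
  using fray_reparam[OF s g] by metis
 have "g ` (s ` {t..}) = s ` (gamma ` {t..})" using gamma(2) t(1) by (auto simp: image_image)
 then show ?thesis using gamma(1)[OF t(1)] gamma(2)[OF t(1)] t fray_inj[OF s] by auto
qed

lemma preserves_image: assumes "bij g" "preserves Z g" shows "g ` Z = Z"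
proof (intro set_eqI iffI)
 fix z assume z: "z : Z"
 have "g (inv g z) = z" using assms(1) by (simp add: bij_is_surj surj_f_inv_f)
 then show "z : g ` Z" using assms(2) z \<open>g (inv g z) = z\<close> unfolding preserves_def by (metis image_eqI)
qed (use assms(2) in \<open>auto simp: preserves_def\<close>)

lemma fray_reparam_initial:
 assumes s: "fray s" and g: "aut W g" "preserves (s ` {0..}) g" and t: "0 <= t" "0 <= t'" "g (s t) = s t'"
 shows "g ` (s ` {0..t}) = s ` {0..t'}" "g (s 0) = s 0"
proof -
 have b: "bij g" using g(1) by (rule aut_bij)
 have im: "g ` s ` {0..} = s ` {0..}" by (rule preserves_image[OF b g(2)])
 have d: "s ` {0..a} = s ` {0..} - s ` {a..} Un {s a}" if "a >= 0" for a
 proof (intro set_eqI)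
  fix x
  show "x : s ` {0..a} \<longleftrightarrow> x : s ` {0..} - s ` {a..} Un {s a}"
  proof (cases "x : s ` {0..}")
   case True
   then obtain u where u: "0 <= u" "x = s u" by auto
   have "x : s ` {0..a} \<longleftrightarrow> u : {0..a}" "x : s ` {a..} \<longleftrightarrow> u : {a..}" "x : s ` {0..} \<longleftrightarrow> u : {0..}"
    unfolding u(2) by (rule fray_mem[OF s _ u(1)]; use that in auto)+
   then show ?thesis using u that fray_inj[OF s u(1) that] by auto
  qed (use that in auto)
 qed
 show "g ` (s ` {0..t}) = s ` {0..t'}"
  using fray_reparam_tail[OF s g(1) _ t] im t(3) b unfolding d[OF t(1)] d[OF t(2)]
  by (simp add: image_Un image_set_diff bij_is_inj)
 obtain gamma where gamma: "!!t. 0 <= t ==> gamma ` {t..} = {gamma t..}" "!!t. 0 <= t ==> 0 <= gamma t & g (s t) = s (gamma t)"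
  using fray_reparam[OF s g(1)] im by (metis order_refl)
 have "s 0 : s ` {gamma 0..}" using fray_reparam_tail[OF s g(1), of 0 "gamma 0"] im gamma(2)[of 0] by auto
 then show "g (s 0) = s 0" using fray_inj[OF s] gamma(2)[of 0] by auto
qed

lemma fray_adapted_in:
 assumes "fray s" "0 < t" "openin M W" "s t : W"
 shows "EX e. adapted axis (s ` {0..}) e & e ` D 1 \<subseteq> W & e 0 = s t"
proof -
 obtain e where e: "adapted axis (s ` {0..}) e" "e 0 = s t" using assms(1,2) unfolding fray_def by blast
 have "v2 0 0 = 0" by (simp add: vec2_eq_iff)
 then obtain c where "adapted axis (s ` {0..}) (%p. e (v2 0 0 + c *\<^sub>R p))" "(%p. e (v2 0 0 + c *\<^sub>R p)) ` D 1 \<subseteq> W"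
  using adapted_shrink[OF e(1), of 0 W] assms(3,4) e(2) by auto
 then show ?thesis using e(2) \<open>v2 0 0 = 0\<close> by auto
qed

lemma fray_slide:
 assumes s: "fray s" and t: "0 < t" "t <= t'" and W: "openin M W" "s ` {t..t'} \<subseteq> W"
  and e: "adapted axis (s ` {0..}) e" "e ` D 1 \<subseteq> W" "e 0 = s t"
  and e': "adapted axis (s ` {0..}) e'" "e' ` D 1 \<subseteq> W" "e' 0 = s t'"
 shows "germ_equiv W (s ` {0..}) e 0 e' 0"
proof (rule framed_transport[OF _ _ _ e(1,2) _ e'(1,2)])
 show "connectedin M (s ` {t..t'})" using fray_connected[OF s] t by simp
 show "EX e. adapted axis (s ` {0..}) e & e ` D 1 \<subseteq> W & e 0 = x" if x: "x : s ` {t..t'}" for x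
 proof -
  obtain u where "t <= u" "x = s u" using x by auto
  then show ?thesis using fray_adapted_in[OF s _ W(1), of u] W(2) t x by auto
 qed
qed (use t e e' in auto)

lemma germ_equiv_center: "germ_equiv W Z e 0 e' 0 ==> EX g. aut W g & preserves Z g & g (e 0) = e' 0"
proof -
 assume "germ_equiv W Z e 0 e' 0"
 then obtain g s t rho where g: "aut W g" "preserves Z g" "rho > 0" "!!p. n1 p < rho ==> g (e (v2 0 0 + p)) = e' (v2 0 0 + flip s t p)"
  unfolding germ_equiv_def by blast
 have "v2 0 0 = 0" "flip s t 0 = 0" by (simp_all add: vec2_eq_iff)
 then show ?thesis using g(1,2) g(4)[of 0] g(3) by auto
qed

lemma fray_move:
 assumes s: "fray s" and t: "0 < t" "t <= t'" and W: "openin M W" "s ` {t..t'} \<subseteq> W"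
 shows "EX g. aut W g & preserves (s ` {0..}) g & g (s t) = s t'"
proof -
 have "s t : W" "s t' : W" using W(2) t by auto
 have "0 < t'" using t by simp
 obtain e where e: "adapted axis (s ` {0..}) e" "e ` D 1 \<subseteq> W" "e 0 = s t"
  using fray_adapted_in[OF s t(1) W(1) \<open>s t : W\<close>] by blast
 obtain e' where e': "adapted axis (s ` {0..}) e'" "e' ` D 1 \<subseteq> W" "e' 0 = s t'"
  using fray_adapted_in[OF s \<open>0 < t'\<close> W(1) \<open>s t' : W\<close>] by blast
 show ?thesis using germ_equiv_center[OF fray_slide[OF s t W e e']] e(3) e'(3) by simp
qed

definition half_axis :: "(real^2) set" where "half_axis = {p. p$2 = 0 & 0 <= p$1}"

lemma pe_axis:
 assumes "pe (D 1) e" shows "continuous_map (top_of_set {-1<..<1}) M (%u. e (v2 u 0))" "inj_on (%u. e (v2 u 0)) {-1<..<1}"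
proof -
 have D: "v2 u 0 : D 1" if "u : {-1<..<1}" for u using that by auto
 have "continuous_on {-1<..<1} (%u. v2 u 0)" by (intro plat_continuous_on ballI plat_v2 plat_id plat_const)
 then show "continuous_map (top_of_set {-1<..<1}) M (%u. e (v2 u 0))"
  using continuous_map_compose[OF _ pe_continuous[OF assms], of "top_of_set {-1<..<1}" "%u. v2 u 0"] D by (auto simp: o_def)
 show "inj_on (%u. e (v2 u 0)) {-1<..<1}"
  using assms D unfolding pe_def inj_on_def by (metis v2_eq)
qed

text \<open>A chart at \<open>s 0\<close> contains at least a short initial segment. An automorphism
  that preserves the ray and moves \<open>s u\<close> to \<open>s (T + 1)\<close> stretches this
  segment, and the chart with it, over the ray up to \<open>T\<close>.\<close>

lemma fray_start_chart:
 assumes s: "fray s" "0 <= T"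
 obtains E gamma where "pe (D 1) E" "!!p. p : D 1 ==> E p : s ` {0..} \<longleftrightarrow> p$2 = 0 & 0 <= p$1" "s ` {0..T} \<subseteq> E ` D 1"
  "strict_mono_on {0..<1} gamma" "gamma 0 = 0" "!!u. 0 <= u ==> u < 1 ==> 0 <= gamma u & E (v2 u 0) = s (gamma u)"
  "!!p t. p : D 1 ==> 0 <= t ==> E p = s t ==> EX u. 0 <= u & u < 1 & p = v2 u 0 & t = gamma u"
proof -
 obtain e where e: "pe (D 1) e" "e 0 = s 0" "ALL p:D 1. e p : s ` {0..} \<longleftrightarrow> p$2 = 0 & 0 <= p$1"
  using s(1) unfolding fray_def by blast
 have "openin (top_of_set {0..}) {t:{0..}. s t : e ` D 1}" using s(1) openin_continuous_map_preimage[OF _ pe_open[OF e(1)]] by (force simp: fray_def)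
 moreover have "0 : {t:{0..}. s t : e ` D 1}" using e(2) by (auto intro: image_eqI[of _ e 0])
 ultimately obtain d where d: "d > 0" "!!t. t : {0..} ==> dist t 0 < d ==> s t : e ` D 1"
  unfolding openin_euclidean_subtopology_iff by blast
 define u where "u = min (d/2) (T+1)"
 have u: "0 < u" "u < d" "u <= T + 1" using d(1) s(2) by (auto simp: u_def)
 obtain g where g: "aut Int_M g" "preserves (s ` {0..}) g" "g (s u) = s (T+1)" using s(1) u(1) fray_move[OF s(1) u(1,3) openin_Int_M] unfolding fray_def by force
 have im: "g ` (s ` {0..u}) = s ` {0..T+1}" "g (s 0) = s 0" using fray_reparam_initial[OF s(1) g(1,2) _ _ g(3)] u(1) s(2) by simp_all
 define E where "E p = g (e p)" for p
 have pE: "pe (D 1) E" unfolding E_def[abs_def] using aut_pe[OF g(1) e(1)] .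
 have E: "E p : s ` {0..} \<longleftrightarrow> p$2 = 0 & 0 <= p$1" if "p : D 1" for p
  using that e(3) g(2) unfolding preserves_def E_def by blast
 have "g ` (s ` {0..u}) \<subseteq> g ` (e ` D 1)" using d(2) u(2) by (auto simp: dist_real_def simp del: mem_Collect_eq)
 then have cover: "s ` {0..T} \<subseteq> E ` D 1" unfolding im E_def by force
 have "continuous_map (top_of_set {0..<1}) M (%u. E (v2 u 0))"
  by (rule continuous_map_from_subtopology_mono[OF pe_axis(1)[OF pE]]) auto
 moreover have "inj_on (%u. E (v2 u 0)) {0..<1}" by (rule inj_on_subset[OF pe_axis(2)[OF pE]]) auto
 moreover have "(%u. E (v2 u 0)) ` {0..<1} \<subseteq> s ` {0..}" using E by auto
 moreover have "is_interval {0..<1::real}" by auto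
 ultimately obtain gamma where gamma: "strict_mono_on {0..<1} gamma | strict_antimono_on {0..<1} gamma" "!!u. u : {0..<1} ==> 0 <= gamma u & E (v2 u 0) = s (gamma u)"
  using fray_arc[OF s(1), of "{0..<1}" "%u. E (v2 u 0)"] by blast
 have v20: "v2 0 0 = 0" by (simp add: vec2_eq_iff)
 have gamma0: "gamma 0 = 0" using gamma(2)[of 0] im(2) e(2) fray_inj[OF s(1), of "gamma 0" 0] by (simp add: v20 E_def)
 have mono: "strict_mono_on {0..<1} gamma"
  using gamma(1) monotone_onD[of "{0..<1}" "(<)" "(>)" gamma 0 "1/2"] gamma0 gamma(2)[of "1/2"] by auto
 show thesis
 proof (rule that[OF pE E cover mono gamma0])
  fix p t assume p: "p : D 1" "0 <= t" "E p = s t"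
  have "p$2 = 0" "0 <= p$1" using E[OF p(1)] p(2,3) by auto
  moreover have "p = v2 (p$1) 0" "p$1 < 1" using p(1) calculation by (auto simp: vec2_eq_iff n1_def)
  moreover have "t = gamma (p$1)" using gamma(2)[of "p$1"] calculation p(2,3) fray_inj[OF s(1)] by auto
  ultimately show "EX u. 0 <= u & u < 1 & p = v2 u 0 & t = gamma u" by blast
 qed (use gamma(2) in auto)
qed

text \<open>In a chart at \<open>s 0\<close> the ray is a half-axis, which a horizontal move shifts
  into itself. Afterwards the new starting point is moved along the ray to
  \<open>s T\<close>.\<close>

lemma fray_tail_slide:
 assumes s: "fray s" and T: "0 < T"
 shows "EX g. aut Int_M g & g ` (s ` {0..}) = s ` {T..}"
proof -
 have S_Int: "s ` {0..} \<subseteq> Int_M" using s by (simp add: fray_def)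
 obtain e where e: "pe (D 1) e" "e 0 = s 0" "ALL p:D 1. e p : s ` {0..} \<longleftrightarrow> p$2 = 0 & 0 <= p$1" using s by (auto simp: fray_def)
 note e(3)[THEN bspec]
 note e = e(1,2) this
 let ?nu = "hmove (2/5) (%p. 1/8)"
 have nu: "plane_aut (4/5) ?nu" using hmove_aut[of "%p. 1/8" "2/5"] by (simp add: plat_const)
 let ?h = "cext e ?nu"
 have h: "aut Int_M ?h" using e(1) aut_mono[OF cext_aut(1)[OF e(1) nu]] by (simp add: pe_def)
 have hS: "?h ` s ` {0..} \<subseteq> s ` {0..}"
 proof (rule image_subsetI)
  fix x assume x: "x : s ` {0..}"
  show "?h x : s ` {0..}"
  proof (cases "x : e ` D 1")
   case True
   then obtain p where p: "p : D 1" "x = e p" by blast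
   have pa: "p$2 = 0" "0 <= p$1" using e(3)[OF p(1)] x p(2) by auto
   have np: "?nu p : D 1" using plane_aut_less[OF plane_aut_mono[OF nu, of 1]] p(1) by simp
   have "e (?nu p) : s ` {0..}" using pa e(3)[OF np] by (auto simp: hmove_def clamp_def)
   then show ?thesis using cext_eq[OF e(1) p(1)] p(2) by simp
  qed (use x in \<open>simp add: cext_def\<close>)
 qed
 have h0: "?h (s 0) = e (v2 (1/8) 0)"
 proof -
  have "?nu 0 = v2 (1/8) 0" by (subst hmove_eq) auto
  then show ?thesis using cext_eq[OF e(1), of 0] e(2) by simp
 qed
 obtain t1 where t1: "0 <= t1" "?h (s 0) = s t1" using hS by auto
 have "e (v2 (1/8) 0) ~= e 0"
 proof
  assume "e (v2 (1/8) 0) = e 0"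
  moreover have "inj_on e (D 1)" using e(1) by (simp add: pe_def)
  ultimately show False using inj_onD[of e "D 1" "v2 (1/8) 0" 0] by (simp add: vec2_eq_iff)
 qed
 then have "t1 ~= 0" using t1(2) h0 e(2) by metis
 then have t1p: "0 < t1" using t1(1) by simp
 have im1: "?h ` (s ` {0..}) = s ` {t1..}" by (rule fray_reparam_tail[OF s h hS _ t1]) simp
 have "EX g. aut Int_M g & preserves (s ` {0..}) g & g (s t1) = s T"
 proof (cases "t1 <= T")
  case True
  show ?thesis using S_Int t1(1) fray_move[OF s t1p True openin_Int_M] by force
 next
  case False
  then have le: "T <= t1" by simp
  obtain g where g: "aut Int_M g" "preserves (s ` {0..}) g" "g (s T) = s t1" using S_Int T fray_move[OF s T le openin_Int_M] by force
  have b: "bij g" using g(1) by (rule aut_bij)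
  show ?thesis using g(3) b g(2) aut_inv[OF g(1)] unfolding preserves_def by (metis bij_inv_eq_iff)
 qed
 then obtain g where g: "aut Int_M g" "preserves (s ` {0..}) g" "g (s t1) = s T" by blast
 have "g ` (s ` {t1..}) = s ` {T..}" using preserves_image[OF aut_bij[OF g(1)] g(2)] fray_reparam_tail[OF s g(1) _ t1(1) _ g(3)] T by simp
 moreover have "(%x. g (?h x)) ` (s ` {0..}) = g ` (?h ` (s ` {0..}))" by auto
 ultimately show ?thesis using im1 aut_comp[OF g(1) h] by auto
qed

section \<open>PL functions with compact support and their regular levels\<close>

definition plf :: "('a => real) => bool" where
 "plf m \<longleftrightarrow> continuous_map M euclideanreal m & (EX K. compactin M K & (ALL x:topspace M - K. m x = 0)) &
   (ALL x:topspace M. 0 <= m x) &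
   (ALL e p. plm e p --> plat (%q. m (e q)) p)"

text \<open>A cone in a chart, at least 1 within distance \<open>r/2\<close> and 0 beyond
  \<open>r\<close>. The point may lie on the boundary, so charts into the half-plane are used here
  instead of parametrisations.\<close>

lemma bump_exists:
 assumes "x : topspace M"
 shows "EX b U. plf b & openin M U & x : U & (ALL y:U. 1 <= b y)"
proof -
 obtain U phi where c: "(U, phi) : A" "x : U" using chart_cover assms by blast
 have hm: "homeomorphic_map (subtopology M U) (top_of_set (phi ` U)) phi" by (rule chart_homeo(2)[OF c(1)])
 have UM: "U \<subseteq> topspace M" using chart_open[OF c(1)] openin_subset by blast
 obtain T where T: "open T" "phi ` U = half_plane Int T" using chart_homeo(1)[OF c(1)] by (auto simp: openin_open)
 obtain r0 where r0: "r0 > 0" "!!p. n1 (p - phi x) < r0 ==> p : T" using T(2) c(2) open_n1_ball[OF T(1)] by blast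
 define r where "r = r0 / 2"
 have r: "r > 0" "!!p. n1 (p - phi x) <= r ==> p : T" using r0 by (auto simp: r_def)
 define beta where "beta p = max 0 (2 - 2 * n1 (p - phi x) / r)" for p
 define b where "b y = (if y : U then beta (phi y) else 0)" for y
 let ?B = "{p. n1 (p - phi x) <= r}"
 define K where "K = {y:U. n1 (phi y - phi x) <= r}"
 have phiK: "phi ` K = half_plane Int ?B" using T(2) r(2) by (auto simp: K_def)
 have "compact (phi ` K)"
 proof -
  have "?B = (%p. phi x + p) ` cD r" by force
  then have "compact ?B" using compact_translation[OF compact_cD, of "phi x" r] by simp
  moreover have "closed half_plane" unfolding half_plane_def by (intro closed_Collect_le continuous_intros)
  ultimately show ?thesis unfolding phiK by auto
 qed
 then have "compactin (subtopology M U) K" using homeomorphic_map_compactness[OF hm, of K] UM unfolding K_def by (auto simp: compactin_subtopology)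
 then have Kc: "compactin M K" by (simp add: compactin_subtopology)
 then have oK: "openin M (topspace M - K)" using compactin_imp_closedin[OF Hausdorff] by blast
 have b0: "b y = 0" if "y ~: K" for y
  using that r(1) by (auto simp: b_def K_def beta_def field_simps)
 have betapl: "plat beta p" for p unfolding beta_def[abs_def] by (intro plat_intros)
 have "continuous_map M euclideanreal b"
 proof (rule continuous_map_openin_preimage_eq[THEN iffD2], intro conjI allI impI)
  fix V :: "real set" assume V: "openin euclideanreal V"
  show "openin M (topspace M Int b -` V)"
  proof (subst openin_subopen, intro ballI)
   fix y assume y: "y : topspace M Int b -` V"
   show "EX T. openin M T & y : T & T \<subseteq> topspace M Int b -` V"
   proof (cases "y : U")
    case True
    have "open (beta -` V)" using V plat_continuous_on[of UNIV beta] betapl by (intro open_vimage) auto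
    then have "openin M {y:U. phi y : half_plane Int beta -` V}" using chart_preimage_open[OF c(1)] by blast
    moreover have "y : {y:U. phi y : half_plane Int beta -` V}" using y True T(2) by (auto simp: b_def)
    moreover have "{y:U. phi y : half_plane Int beta -` V} \<subseteq> topspace M Int b -` V" using UM by (auto simp: b_def)
    ultimately show ?thesis by blast
   next
    case False
    then show ?thesis using y oK b0 by (auto simp: K_def b_def)
   qed
  qed
 qed auto
 moreover have "plat (%q. b (e q)) p" if "plm e p" for e p
 proof (cases "e p : U")
  case True
  then have ev: "\<forall>\<^sub>F q in nhds p. e q : U" and pl: "plat (%q. phi (e q)) p" using that c(1) unfolding plm_def by auto
  have "plat (%q. beta (phi (e q))) p" by (rule plat_comp[OF pl betapl])
  then show ?thesis by (rule plat_cong_ev) (use ev in \<open>auto elim: eventually_mono simp: b_def\<close>)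
 next
  case False
  then have "e p : topspace M - K" using plm_topspace[OF that] by (auto simp: K_def)
  then have ev: "\<forall>\<^sub>F q in nhds p. e q : topspace M - K" using plm_open[OF that oK] by blast
  have "plat (%q. 0 :: real) p" by (rule plat_const)
  then show ?thesis by (rule plat_cong_ev) (use ev b0 in \<open>auto elim!: eventually_mono\<close>)
 qed
 moreover have "0 <= b y" for y by (simp add: b_def beta_def)
 moreover have "EX K. compactin M K & (ALL y:topspace M - K. b y = 0)" using Kc b0 by blast
 ultimately have "plf b" unfolding plf_def by blast
 moreover have "openin M {y:U. phi y : half_plane Int {p. n1 (p - phi x) < r/2}}"
  by (rule chart_preimage_open[OF c(1) openin_open_Int[OF open_D(1)]])
 moreover have "x : {y:U. phi y : half_plane Int {p. n1 (p - phi x) < r/2}}" using c T(2) r(1) by auto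
 moreover have "ALL y:{y:U. phi y : half_plane Int {p. n1 (p - phi x) < r/2}}. 1 <= b y"
  using r(1) by (auto simp: b_def beta_def field_simps)
 ultimately show ?thesis by blast
qed

lemma plf_add: assumes "plf a" "plf b" shows "plf (%x. a x + b x)"
proof -
 obtain K L where K: "compactin M K" "ALL x:topspace M - K. a x = 0" "compactin M L" "ALL x:topspace M - L. b x = 0"
  using assms unfolding plf_def by blast
 have "compactin M (K Un L)" using K(1,3) by (rule compactin_Un)
 then have 1: "EX K. compactin M K & (ALL x:topspace M - K. a x + b x = 0)" using K(2,4) by (intro exI[of _ "K Un L"]) auto
 have 2: "continuous_map M euclideanreal (%x. a x + b x)" using assms unfolding plf_def by (intro continuous_map_add) auto
 have 3: "plat (%q. a (e q) + b (e q)) p" if "plm e p" for e p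
  using assms that unfolding plf_def by (intro plat_add) auto
 show ?thesis unfolding plf_def using 1 2 3 assms by (auto simp: plf_def)
qed

lemma plf_0: "plf (%x. 0)"
 unfolding plf_def by (auto simp: plat_const intro!: exI[of _ "{}"])

lemma plf_max: assumes "plf a" "plf b" shows "plf (%x. max (a x) (b x))"
proof -
 obtain K L where K: "compactin M K" "ALL x:topspace M - K. a x = 0" "compactin M L" "ALL x:topspace M - L. b x = 0"
  using assms unfolding plf_def by blast
 have "compactin M (K Un L)" using K(1,3) by (rule compactin_Un)
 then have 1: "EX K. compactin M K & (ALL x:topspace M - K. max (a x) (b x) = 0)" using K(2,4) by (intro exI[of _ "K Un L"]) auto
 have 2: "continuous_map M euclideanreal (%x. max (a x) (b x))" using assms unfolding plf_def by (intro continuous_map_real_max) auto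
 have 3: "plat (%q. max (a (e q)) (b (e q))) p" if "plm e p" for e p
  using assms that unfolding plf_def by (intro plat_max) auto
 show ?thesis unfolding plf_def using 1 2 3 assms by (auto simp: plf_def le_max_iff_disj)
qed

lemma plf_nonneg: "plf m ==> x : topspace M ==> 0 <= m x" by (simp add: plf_def)

lemma plf_cover:
 assumes "compactin M L" shows "EX b. plf b & (ALL x:L. 1 <= b x)"
proof -
 have LM: "L \<subseteq> topspace M" using assms by (simp add: compactin_subset_topspace)
 have "ALL x:L. EX b U. plf b & openin M U & x : U & (ALL y:U. 1 <= b y)" using bump_exists LM by blast
 then obtain bb UU where bU: "!!x. x : L ==> plf (bb x) & openin M (UU x) & x : UU x & (ALL y:UU x. 1 <= bb x y)" by metis
 have "ALL U:UU ` L. openin M U" "L \<subseteq> \<Union>(UU ` L)" using bU by blast+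
 then obtain F where F: "finite F" "F \<subseteq> UU ` L" "L \<subseteq> \<Union>F" using assms unfolding compactin_def by meson
 then obtain X where X: "finite X" "X \<subseteq> L" "L \<subseteq> \<Union>(UU ` X)"
  using finite_subset_image[OF F(1,2)] by blast
 define b where "b y = (\<Sum>x\<in>X. bb x y)" for y
 have "plf (%y. \<Sum>x\<in>Y. bb x y)" if "finite Y" "Y \<subseteq> L" for Y using that
 proof (induction Y rule: finite_induct)
  case (insert x Y)
  then have "plf (%y. bb x y + (\<Sum>x\<in>Y. bb x y))" using bU by (intro plf_add) auto
  then show ?case using insert by simp
 qed (simp add: plf_0)
 then have "plf b" unfolding b_def[abs_def] using X by blast
 moreover have "1 <= b y" if y: "y : L" for y
 proof -
  obtain x where x: "x : X" "y : UU x" using X(3) y by blast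
  have "bb x y <= (\<Sum>x\<in>X. bb x y)" using x(1) X bU LM y by (intro member_le_sum) (auto intro!: plf_nonneg)
  then show ?thesis using bU[of x] x X(2) unfolding b_def by (smt (verit, best) subsetD)
 qed
 ultimately show ?thesis by blast
qed

lemma plf_superlevel_compact:
 assumes "plf m" "0 < c" shows "compactin M {x:topspace M. c <= m x}"
proof -
 obtain K where K: "compactin M K" "ALL x:topspace M - K. m x = 0" using assms unfolding plf_def by blast
 have "continuous_map M euclideanreal m" using assms by (simp add: plf_def)
 then have "closedin M {x:topspace M. m x : {c..}}" by (rule closedin_continuous_map_preimage) auto
 then have "closedin M {x:topspace M. c <= m x}" by simp
 moreover have "{x:topspace M. c <= m x} \<subseteq> K" using K(2) assms(2) by force
 ultimately show ?thesis using closed_compactin[OF K(1)] by blast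
qed

lemma plf_level_compact:
 assumes "plf m" "0 < c" shows "compactin M {x:topspace M. c <= m x & m x <= c'}"
proof -
 have "continuous_map M euclideanreal m" using assms by (simp add: plf_def)
 then have "closedin M {x:topspace M. m x : {..c'}}" by (rule closedin_continuous_map_preimage) auto
 then have "closedin M ({x:topspace M. m x : {..c'}} Int {x:topspace M. c <= m x})"
  using compactin_imp_closedin[OF Hausdorff plf_superlevel_compact[OF assms]] by blast
 moreover have eq: "{x:topspace M. m x : {..c'}} Int {x:topspace M. c <= m x} = {x:topspace M. c <= m x & m x <= c'}" by auto
 ultimately show ?thesis by (intro closed_compactin[OF plf_superlevel_compact[OF assms]]) auto
qed

text \<open>Near each point of the compact set \<open>1/4 <= m <= 3/4\<close> only finitely many
  values are critical, by \<open>sard_local\<close>. Finitely many such neighbourhoods suffice, so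
  some \<open>c\<close> avoids all critical values.\<close>

lemma plf_regular_level:
 assumes m: "plf m" and I: "!!x. x : topspace M ==> 1/4 <= m x ==> m x <= 3/4 ==> x : Int_M"
 shows "EX c. 1/4 < c & c < 3/4 &
   (ALL x:topspace M. m x = c --> (EX e p. pe (D 1) e & p : D 1 & e p = x & regular (%q. m (e q)) p))"
proof -
 let ?Q = "{x:topspace M. 1/4 <= m x & m x <= 3/4}"
 have Q: "compactin M ?Q" using plf_level_compact[OF m, of "1/4" "3/4"] by simp
 define R where "R x z \<longleftrightarrow> pe (D 1) (fst z) & fst z 0 = x & finite (fst (snd z)) & 0 < snd (snd z) & snd (snd z) <= (1::real) &
   (ALL p. n1 p < snd (snd z) & m (fst z p) ~: fst (snd z) --> regular (%q. m (fst z q)) p)" for x z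
 have "ALL x:?Q. EX z. R x z"
 proof
  fix x assume "x : ?Q"
  then have "x : Int_M" using I by blast
  then obtain e where e: "pe (D 1) e" "e 0 = x" using chart_at[OF openin_Int_M] by blast
  have "plm e 0" using e(1) by (simp add: pe_def)
  then have "plat (%q. m (e q)) 0" using m unfolding plf_def by blast
  then obtain B r where B: "finite B" "r > 0" "ALL p. n1 (p - 0) < r & m (e p) ~: B --> regular (%q. m (e q)) p"
   using sard_local by blast
  then show "EX z. R x z" unfolding R_def
   using e by (intro exI[of _ "(e, B, min r 1)"]) simp
 qed
 then obtain zz where zz: "ALL x:?Q. R x (zz x)" using bchoice[of ?Q R] by blast
 define ee where "ee x = fst (zz x)" for x
 define BB where "BB x = fst (snd (zz x))" for x
 define rr where "rr x = snd (snd (zz x))" for x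
 have ebr: "pe (D 1) (ee x) & ee x 0 = x & finite (BB x) & 0 < rr x & rr x <= 1 &
   (ALL p. n1 p < rr x & m (ee x p) ~: BB x --> regular (%q. m (ee x q)) p)" if "x : ?Q" for x
  using bspec[OF zz that] unfolding R_def ee_def BB_def rr_def .
 define UU where "UU x = ee x ` D (rr x)" for x
 have U: "openin M (UU x) & x : UU x" if "x : ?Q" for x
 proof -
  have "D (rr x) \<subseteq> D 1" using ebr[OF that] by auto
  then have "openin M (UU x)" unfolding UU_def using pe_open[OF pe_subset[OF _ open_D(2)]] ebr[OF that] by blast
  moreover have "ee x 0 : UU x" unfolding UU_def using ebr[OF that] by (intro imageI) simp
  ultimately show ?thesis using ebr[OF that] by simp
 qed
 then have "ALL U:UU ` ?Q. openin M U" "?Q \<subseteq> \<Union>(UU ` ?Q)" by blast+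
 then obtain F where F: "finite F" "F \<subseteq> UU ` ?Q" "?Q \<subseteq> \<Union>F" using Q unfolding compactin_def by meson
 then obtain X where X: "finite X" "X \<subseteq> ?Q" "?Q \<subseteq> \<Union>(UU ` X)"
  using finite_subset_image[OF F(1,2)] by blast
 define B where "B = (\<Union>x\<in>X. BB x)"
 have "finite B" unfolding B_def using X ebr by (intro finite_UN_I) auto
 moreover have "infinite {1/4<..<3/4::real}" by simp
 ultimately obtain c where c: "c : {1/4<..<3/4}" "c ~: B" by (metis finite_subset subsetI)
 have "EX e p. pe (D 1) e & p : D 1 & e p = x & regular (%q. m (e q)) p" if x: "x : topspace M" "m x = c" for x
 proof -
  have "x : ?Q" using x c(1) by auto
  then obtain z where z: "z : X" "x : UU z" using X(3) by blast
  then obtain p where p: "n1 p < rr z" "x = ee z p" unfolding UU_def by blast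
  have zQ: "z : ?Q" using z(1) X(2) by blast
  have "m (ee z p) ~: BB z" using c(2) z(1) x(2) p(2) unfolding B_def by blast
  then have "regular (%q. m (ee z q)) p" using ebr[OF zQ] p(1) by blast
  moreover have "p : D 1" using ebr[OF zQ] p(1) by simp
  ultimately show ?thesis using ebr[OF zQ] p(2) by blast
 qed
 then show ?thesis using c(1) by (intro exI[of _ c]) auto
qed

text \<open>New coordinates: \<open>q$1\<close> is the coordinate along \<open>n\<close>, and the
  coordinate \<open>al q\<close> along \<open>d\<close> is solved for so that the function drops by
  exactly \<open>q$2\<close>. The superlevel set becomes the lower half-plane.\<close>

lemma regular_adapted:
 assumes e: "pe (D 1) e" "p : D 1" and reg: "regular (%q. m (e q)) p" and W: "openin M W" "e p : W"
 shows "EX e'. adapted lower {x. m (e p) <= m x} e' & e' 0 = e p & e' ` D 1 \<subseteq> W"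
proof -
 let ?f = "%q. m (e q)"
 obtain d n rho s mp mm where det: "det2 d n ~= 0" and r: "rho > 0" "s ~= 0" and
  f: "!!alpha beta. \<bar>alpha\<bar> < rho & \<bar>beta\<bar> < rho ==> ?f (p + alpha *\<^sub>R d + beta *\<^sub>R n) = ?f p + s * alpha + mp * max beta 0 + mm * min beta 0"
  using reg unfolding regular_def by blast
 define al where "al q = - (q$2 + mp * max (q$1) 0 + mm * min (q$1) 0) / s" for q :: "real^2"
 define k where "k q = p + al q *\<^sub>R d + (q$1) *\<^sub>R n" for q
 have pal: "plat al q" for q unfolding al_def[abs_def] by (intro plat_intros)
 have k1: "k q $ i = p$i + al q * d$i + q$1 * n$i" for q i by (simp add: k_def)
 have pk: "plat k q" for q
 proof -
  have "plat (%q. v2 (p$1 + al q * d$1 + q$1 * n$1) (p$2 + al q * d$2 + q$1 * n$2)) q" by (intro plat_intros pal)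
  moreover have "v2 (p$1 + al q * d$1 + q$1 * n$1) (p$2 + al q * d$2 + q$1 * n$2) = k q" for q by (simp add: vec2_eq_iff k1)
  ultimately show ?thesis by simp
 qed
 have injk: "inj k"
 proof (rule injI)
  fix q q' assume "k q = k q'"
  then have 1: "al q * d$1 + q$1 * n$1 = al q' * d$1 + q'$1 * n$1" and 2: "al q * d$2 + q$1 * n$2 = al q' * d$2 + q'$1 * n$2"
   using k1[of q 1] k1[of q' 1] k1[of q 2] k1[of q' 2] by auto
  have "(al q - al q') * det2 d n = (al q * d$1 + q$1 * n$1 - (al q' * d$1 + q'$1 * n$1)) * n$2 - (al q * d$2 + q$1 * n$2 - (al q' * d$2 + q'$1 * n$2)) * n$1"
   by (simp add: det2_def algebra_simps)
  then have a: "al q = al q'" using 1 2 det by simp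
  have "(q$1 - q'$1) * det2 d n = d$1 * (al q * d$2 + q$1 * n$2 - (al q' * d$2 + q'$1 * n$2)) - d$2 * (al q * d$1 + q$1 * n$1 - (al q' * d$1 + q'$1 * n$1))"
   by (simp add: det2_def algebra_simps)
  then have b: "q$1 = q'$1" using 1 2 det by simp
  then have "q$2 = q'$2" using a r(2) by (simp add: al_def)
  then show "q = q'" using b by (simp add: vec2_eq_iff)
 qed
 have k0: "k 0 = p" "al 0 = 0" by (simp_all add: k_def al_def)
 have "plm e p" using e by (simp add: pe_def)
 then have "\<forall>\<^sub>F q in nhds p. e q : W" using plm_open W by blast
 then obtain S where S: "open S" "p : S" "!!q. q : S ==> e q : W" unfolding eventually_nhds by blast
 have "\<forall>\<^sub>F q in nhds 0. k q : S Int D 1" "\<forall>\<^sub>F q in nhds 0. al q : {-rho<..<rho}"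
  using S(1,2) e(2) k0 r(1) by (intro isCont_eventually_open plat_isCont pk pal; auto)+
 then have "\<forall>\<^sub>F q in nhds 0. k q : S Int D 1 & al q : {-rho<..<rho}" by eventually_elim blast
 then obtain delta where delta: "delta > 0" "!!q. n1 q < delta ==> k q : S Int D 1 & al q : {-rho<..<rho}" unfolding eventually_n1 by auto
 define c where "c = min delta rho"
 have c: "0 < c" "c <= delta" "c <= rho" using delta(1) r(1) by (auto simp: c_def)
 define e' where "e' q = e (k (c *\<^sub>R q))" for q
 have small: "n1 (c *\<^sub>R q) < c" if "q : D 1" for q using that c(1) by simp
 have kq: "k (c *\<^sub>R q) : S Int D 1 & al (c *\<^sub>R q) : {-rho<..<rho}" if "q : D 1" for q
  using delta(2)[of "c *\<^sub>R q"] small[OF that] c(2) by linarith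
 have "pe (D 1) (%q. e (k (c *\<^sub>R q)))"
 proof (rule pe_comp[OF e(1), of "D 1" "%q. k (c *\<^sub>R q)"])
  show "inj_on (%q. k (c *\<^sub>R q)) (D 1)" using inj_eq[OF injk] c(1) by (simp add: inj_on_def)
  show "(%q. k (c *\<^sub>R q)) ` D 1 \<subseteq> D 1" using kq by blast
  show "plat (%q. k (c *\<^sub>R q)) q" for q by (rule plat_comp[OF _ pk]) (intro plat_intros)
 qed (rule open_D)
 moreover have "m (e' q) = m (e p) - c * q$2" if "q : D 1" for q
 proof -
  have "\<bar>al (c *\<^sub>R q)\<bar> < rho & \<bar>(c *\<^sub>R q)$1\<bar> < rho"
   using kq[OF that] small[OF that] c(3) by (auto simp: n1_def abs_less_iff)
  then have "m (e' q) = ?f p + s * al (c *\<^sub>R q) + mp * max ((c *\<^sub>R q)$1) 0 + mm * min ((c *\<^sub>R q)$1) 0"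
   unfolding e'_def k_def by (rule f)
  then show ?thesis using r(2) by (simp add: al_def)
 qed
 moreover have "e' q : W" if "q : D 1" for q using kq[OF that] S(3) by (simp add: e'_def)
 moreover have "e' 0 = e p" by (simp add: e'_def k0)
 ultimately show ?thesis using c(1)
  by (intro exI[of _ e']) (auto simp: adapted_def lower_def e'_def[symmetric, abs_def] mult_le_0_iff)
qed

lemma plf_chart:
 assumes E: "pe (D 1) E" and delta: "!!p. plat delta p" "!!p. 0 <= delta p" and K: "compact K" "K \<subseteq> D 1" "!!p. p ~: K ==> delta p = 0"
 shows "plf (%x. if x : E ` D 1 then delta (inv_into (D 1) E x) else 0)"
proof -
 define d where "d x = (if x : E ` D 1 then delta (inv_into (D 1) E x) else 0)" for x
 have dE: "d (E p) = delta p" if "p : D 1" for p using that E by (auto simp: d_def pe_def)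
 have Kc: "compactin M (E ` K)" by (rule pe_compact[OF E K(1,2)])
 have d0: "d x = 0" if "x ~: E ` K" for x
 proof (cases "x : E ` D 1")
  case True
  then obtain p where "p : D 1" "x = E p" by blast
  then show ?thesis using that K(3)[of p] dE by auto
 qed (simp add: d_def)
 have oK: "openin M (topspace M - E ` K)" using compactin_imp_closedin[OF Hausdorff Kc] by blast
 have "continuous_map M euclideanreal d"
 proof (rule continuous_map_openin_preimage_eq[THEN iffD2], intro conjI allI impI)
  fix V :: "real set" assume V: "openin euclideanreal V"
  show "openin M (topspace M Int d -` V)"
  proof (subst openin_subopen, intro ballI)
   fix y assume y: "y : topspace M Int d -` V"
   show "EX T. openin M T & y : T & T \<subseteq> topspace M Int d -` V"
   proof (cases "y : E ` D 1")
    case True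
    have "open (delta -` V)" using V plat_continuous_on[of UNIV delta] delta(1) by (intro open_vimage) auto
    then have "open (D 1 Int delta -` V)" by blast
    then have "openin M (E ` (D 1 Int delta -` V))" using pe_open[OF pe_subset[OF E]] by blast
    moreover have "E ` (D 1 Int delta -` V) \<subseteq> d -` V" using dE by auto
    moreover have "y : E ` (D 1 Int delta -` V)" using True y dE by auto
    moreover have "E ` (D 1 Int delta -` V) \<subseteq> topspace M" using calculation(1) by (rule openin_subset)
    ultimately show ?thesis by blast
   next
    case False
    then have "y ~: E ` K" using K(2) by blast
    moreover have "topspace M - E ` K \<subseteq> topspace M Int d -` V" using d0 y False by (auto simp: d_def)
    ultimately show ?thesis using oK y by blast
   qed
  qed
 qed simp
 moreover have "plat (%q. d (e q)) p" if e: "plm e p" for e p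
 proof (cases "e p : E ` D 1")
  case True
  then obtain p' where p': "p' : D 1" "e p = E p'" by blast
  have 1: "plat (%q. inv_into (D 1) E (e q)) p" by (rule pe_inv[OF e E p'])
  have 2: "plat (%q. delta (inv_into (D 1) E (e q))) p" by (rule plat_comp[OF 1 delta(1)])
  have "\<forall>\<^sub>F q in nhds p. e q : E ` D 1" using plm_open[OF e pe_open[OF E]] True by blast
  then have "\<forall>\<^sub>F q in nhds p. delta (inv_into (D 1) E (e q)) = d (e q)" by eventually_elim (simp add: d_def)
  then show ?thesis by (rule plat_cong_ev[OF 2])
 next
  case False
  then have "e p : topspace M - E ` K" using K(2) plm_topspace[OF e] by blast
  then have "\<forall>\<^sub>F q in nhds p. e q : topspace M - E ` K" by (rule plm_open[OF e oK])
  then have "\<forall>\<^sub>F q in nhds p. 0 = d (e q)" by eventually_elim (simp add: d0)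
  then show ?thesis by (rule plat_cong_ev[OF plat_const])
 qed
 moreover have "0 <= d x" for x using delta(2) by (simp add: d_def)
 ultimately show ?thesis using Kc d0 unfolding plf_def d_def[abs_def] by blast
qed

lemma frontier_adapted:
 assumes e: "adapted lower K e" and p: "p : D 1"
 shows "e p : M frontier_of K \<longleftrightarrow> p$2 = 0"
proof -
 have pe: "pe (D 1) e" using e by (simp add: adapted_def)
 have mem: "e q : K \<longleftrightarrow> q$2 <= 0" if "q : D 1" for q using e that by (simp add: adapted_def lower_def)
 have top: "e ` D 1 \<subseteq> topspace M" using openin_subset[OF pe_open[OF pe]] .
 show ?thesis
 proof
  assume L: "p$2 = 0"
  have near: "EX t:T. t : topspace M & t ~: K" if T: "openin M T" "e p : T" for T
  proof -
   have o: "open {q:D 1. e q : T}" by (rule pe_vimage_open[OF pe T(1)])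
   moreover have "p : {q:D 1. e q : T}" using p T by simp
   ultimately obtain r where r: "r > 0" "!!q. n1 (q - p) < r ==> q : {q:D 1. e q : T}" using open_n1_ball by blast
   let ?q = "p + v2 0 (r/2)"
   show ?thesis using r(2)[of ?q] r(1) mem[of ?q] L top by auto
  qed
  have "e p : K Int topspace M" using mem[OF p] L top p by auto
  then show "e p : M frontier_of K" using near[of "M interior_of K"] interior_of_subset[of M K] by (auto simp: frontier_of_def in_closure_of)
 next
  assume F: "e p : M frontier_of K"
  show "p$2 = 0"
  proof (rule ccontr)
   assume "p$2 ~= 0"
   then consider "p$2 < 0" | "p$2 > 0" by linarith
   then show False
   proof cases
    case 1
    have "open (D 1 Int {q. q$2 < 0})" by (intro open_Int open_D open_Collect_less continuous_intros)
    then have "e p : M interior_of K" using pe_open[OF pe_subset[OF pe]] mem 1 p by (force simp: interior_of_def)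
    then show False using F by (simp add: frontier_of_def)
   next
    case 2
    have "open (D 1 Int {q. q$2 > 0})" by (intro open_Int open_D open_Collect_less continuous_intros)
    then have o: "openin M (e ` (D 1 Int {q. q$2 > 0}))" using pe_open[OF pe_subset[OF pe]] by blast
    have d: "y ~: e ` (D 1 Int {q. q$2 > 0})" if "y : K" for y using mem that by auto
    have "e p : e ` (D 1 Int {q. q$2 > 0})" using 2 p by auto
    then have "e p ~: M closure_of K" using o d in_closure_of[of "e p" M K] by metis
    then show False using F by (simp add: frontier_of_def)
   qed
  qed
 qed
qed

lemma preserves_frontier:
 assumes g: "aut W g" "preserves K g" and K: "K \<subseteq> topspace M" shows "preserves (M frontier_of K) g"
proof -
 have "g ` K = K" by (rule preserves_image[OF aut_bij[OF g(1)] g(2)])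
 then show ?thesis using homeomorphic_map_frontier_of[OF aut_homeomorphic[OF g(1)] K] aut_bij[OF g(1)] unfolding preserves_def bij_def by (metis image_eqI inj_image_mem_iff)
qed

text \<open>\<open>K\<close> is a superlevel set of \<open>max b d\<close>, where
  \<open>b >= 1\<close> on \<open>L\<close> and \<open>d\<close> has a plateau of height 1 along the
  piece of the ray that it takes to leave the support of \<open>b\<close>. On that piece the ray
  stays above the level; afterwards it only runs down the slope of \<open>d\<close>, and so crosses
  the level once.\<close>

lemma gate_crossing:
 assumes s: "fray s" and L: "compactin M L" "surface_boundary A \<subseteq> L"
 obtains K B gamma where "K \<subseteq> topspace M" "compactin M (M frontier_of K)" "M frontier_of K \<subseteq> Int_M" "M frontier_of K Int L = {}"
  "!!x W. x : M frontier_of K ==> openin M W ==> x : W ==> EX e. adapted lower K e & e 0 = x & e ` D 1 \<subseteq> W"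
  "adapted lower K B" "B ` D 1 Int L = {}" "!!p. p : D 1 ==> B p : s ` {0..} \<longleftrightarrow> p$1 = 0"
  "M frontier_of K Int s ` {0..} = {B 0}"
  "strict_mono_on {-1<..<1} gamma" "!!v. \<bar>v\<bar> < 1 ==> 0 <= gamma v & B (v2 0 v) = s (gamma v)"
proof -
 obtain b where b: "plf b" "!!x. x : L ==> 1 <= b x" using plf_cover[OF L(1)] by blast
 obtain Kb where Kb: "compactin M Kb" "!!x. x : topspace M ==> x ~: Kb ==> b x = 0" using b(1) unfolding plf_def by blast
 obtain T where T: "0 <= T" "!!t. T <= t ==> s t ~: Kb" using s Kb(1) unfolding fray_def by blast
 obtain E gamma where E: "pe (D 1) E" "!!p. p : D 1 ==> E p : s ` {0..} \<longleftrightarrow> p$2 = 0 & 0 <= p$1" and ET: "s ` {0..T} \<subseteq> E ` D 1"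
  and gamma: "strict_mono_on {0..<1} gamma" "gamma 0 = 0" "!!u. 0 <= u ==> u < 1 ==> 0 <= gamma u & E (v2 u 0) = s (gamma u)"
  and on_s: "!!p t. p : D 1 ==> 0 <= t ==> E p = s t ==> EX u. 0 <= u & u < 1 & p = v2 u 0 & t = gamma u"
  by (rule fray_start_chart[OF s T(1)]) blast
 have Etop: "E p : topspace M" "E p : Int_M" if "p : D 1" for p using E(1) that Int_M_subset unfolding pe_def by blast+
 obtain a where a: "0 <= a" "a < 1" "gamma a = T"
 proof -
  obtain p where p: "p : D 1" "E p = s T" using ET T(1) by force
  show thesis using on_s[OF p(1) T(1) p(2)] that by blast
 qed
 have gamma_less: "gamma u < gamma u'" if "0 <= u" "u < u'" "u' < 1" for u u'
  using gamma(1) that by (auto simp: strict_mono_on_def)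
 define rho where "rho = (1 - a) / 8"
 have rho: "0 < rho" "a + 8 * rho = 1" using a(2) by (simp_all add: rho_def field_simps)
 \<comment> \<open>The maximum-norm distance to the segment of the axis from \<open>0\<close> to
   \<open>a\<close>, which is the ray up to time \<open>T\<close>. So \<open>delta\<close> is 1 up
   to distance \<open>rho\<close> and 0 from distance \<open>2 * rho\<close> on; the choice of
   \<open>rho\<close> keeps this inside the chart.\<close>
 define mu where "mu p = max (p$1 - a) (max (- p$1) \<bar>p$2\<bar>)" for p :: "real^2"
 define delta where "delta p = min 1 (max 0 (2 - mu p / rho))" for p
 define d where "d x = (if x : E ` D 1 then delta (inv_into (D 1) E x) else 0)" for x
 have delta0: "delta p = 0" if "p ~: cD (a + 4 * rho)" for p using a(1) rho(1) that by (auto simp: mu_def n1_def delta_def field_simps)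
 have "plf d" unfolding d_def[abs_def]
 proof (rule plf_chart[OF E(1) _ _ compact_cD _ delta0])
  show "plat delta p" for p unfolding delta_def[abs_def] mu_def by (intro plat_intros)
  show "cD (a + 4 * rho) \<subseteq> D 1" using rho by auto
 qed (simp add: delta_def)
 have dE: "d (E p) = delta p" if "p : D 1" for p using that E(1) by (auto simp: d_def pe_def)
 define m where "m x = max (b x) (d x)" for x
 have m: "plf m" unfolding m_def[abs_def] by (rule plf_max[OF b(1) \<open>plf d\<close>])
 have mL: "1 <= m x" if "x : L" for x using b(2)[OF that] by (simp add: m_def)
 obtain c where c: "1/4 < c" "c < 3/4"
  and reg: "!!x. x : topspace M ==> m x = c ==> EX e p. pe (D 1) e & p : D 1 & e p = x & regular (%q. m (e q)) p"
 proof -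
  have "x : Int_M" if "x : topspace M" "m x <= 3/4" for x
   using mL[of x] L(2) that by (auto simp: surface_interior_def)
  then show thesis using plf_regular_level[OF m] that by blast
 qed
 define K where "K = {x:topspace M. c <= m x}"
 have mc: "continuous_map M euclideanreal m" using m by (simp add: plf_def)
 have chart: "EX e. adapted lower K e & e 0 = x & e ` D 1 \<subseteq> W" if x: "x : topspace M" "m x = c" and W: "openin M W" "x : W" for x W
 proof -
  obtain e p where e: "pe (D 1) e" "p : D 1" "e p = x" "regular (%q. m (e q)) p" using reg[OF x] by blast
  obtain e' where e': "adapted lower {y. m (e p) <= m y} e'" "e' 0 = e p" "e' ` D 1 \<subseteq> W"
   using regular_adapted[OF e(1,2,4) W(1)] W(2) e(3) by auto
  have "e' q : topspace M" if "q : D 1" for q using e'(3) that openin_subset[OF W(1)] by blast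
  then show ?thesis using e'(1) e(3) x(2) e' by (auto simp: adapted_def K_def)
 qed
 have F: "M frontier_of K = {x:topspace M. m x = c}"
 proof (intro equalityI subsetI)
  fix x assume x: "x : {x:topspace M. m x = c}"
  then obtain e where e: "adapted lower K e" "e 0 = x" using chart[of x "topspace M"] by auto
  then show "x : M frontier_of K" using frontier_adapted[OF e(1), of 0] by simp
 next
  fix x assume x: "x : M frontier_of K"
  have xK: "x : K" using closedin_continuous_map_preimage[OF mc, of "{c..}"] x frontier_of_subset_closedin by (auto simp: K_def)
  have "openin M {x:topspace M. m x : {c<..}}" by (rule openin_continuous_map_preimage[OF mc]) simp
  then have "{x:topspace M. m x : {c<..}} \<subseteq> M interior_of K" by (rule interior_of_maximal[rotated]) (auto simp: K_def)
  then show "x : {x:topspace M. m x = c}" using x xK by (auto simp: frontier_of_def K_def)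
 qed
 \<comment> \<open>Solves \<open>2 - (u0 - a) / rho = c\<close>: here the ray crosses the
   level.\<close>
 define u0 where "u0 = a + rho * (2 - c)"
 have u0: "a + 5/4 * rho < u0" "u0 < a + 2 * rho" using rho(1) c unfolding u0_def by (auto intro!: mult_strict_left_mono simp del: mult_less_cancel_left_pos)
 have "s (gamma u0) ~: Kb" using gamma_less[of a u0] a u0 rho by (intro T(2)) auto
 then have xKb: "E (v2 u0 0) : topspace M - Kb" using gamma(3)[of u0] a u0 rho Etop(1)[of "v2 u0 0"] by auto
 have "openin M (topspace M - Kb)" using compactin_imp_closedin[OF Hausdorff Kb(1)] by blast
 then have o: "open {p:D 1. E p : topspace M - Kb}" by (rule pe_vimage_open[OF E(1)])
 have "v2 u0 0 : {p:D 1. E p : topspace M - Kb}" using xKb a u0 rho by auto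
 then obtain kappa0 where kappa0: "0 < kappa0" "!!p. n1 (p - v2 u0 0) < kappa0 ==> p : {p:D 1. E p : topspace M - Kb}"
  using open_n1_ball[OF o] by blast
 define kappa where "kappa = min kappa0 (rho/4)"
 have kappa: "0 < kappa" "kappa <= kappa0" "kappa <= rho/4" using kappa0(1) rho(1) by (auto simp: kappa_def)
 \<comment> \<open>The coordinates are exchanged: in \<open>B\<close> the ray is the vertical axis,
   the level is the horizontal one, and \<open>m\<close> decreases upwards.\<close>
 define k where "k p = v2 (u0 + kappa * p$2) (kappa * p$1)" for p :: "real^2"
 have kp: "k p : D 1 & E (k p) : topspace M - Kb" if "p : D 1" for p
 proof -
  have "n1 (k p - v2 u0 0) = kappa * n1 p" using kappa(1) by (simp add: k_def n1_def abs_mult algebra_simps)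
  also have "... < kappa * 1" using that kappa(1) by (intro mult_strict_left_mono) auto
  also have "... <= kappa0" using kappa(2) by simp
  finally show ?thesis using kappa0(2)[of "k p"] by blast
 qed
 have kbd: "\<bar>kappa * p$1\<bar> <= rho/4 & \<bar>kappa * p$2\<bar> <= rho/4" if "p : D 1" for p
 proof -
  have *: "\<bar>kappa * p$i\<bar> <= rho/4" if "\<bar>p$i\<bar> <= 1" for i
   using mult_left_mono[OF that, of kappa] kappa unfolding abs_mult by linarith
  show ?thesis using that * by (auto simp: n1_def)
 qed
 have deltak: "delta (k p) = c - kappa * p$2 / rho" if "p : D 1" for p
 proof -
  have kb: "- (rho/4) <= kappa * p$2" "\<bar>kappa * p$2\<bar> <= rho/4" "\<bar>kappa * p$1\<bar> <= rho/4" using kbd[OF that] by auto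
  have "mu (k p) = u0 + kappa * p$2 - a" using kb u0 rho(1) a(1) unfolding mu_def k_def v2_nth by auto
  then have "2 - mu (k p) / rho = c - kappa * p$2 / rho" "\<bar>kappa * p$2 / rho\<bar> <= 1/4" using rho(1) kb(2) by (auto simp: u0_def field_simps abs_divide)
  then show ?thesis using c unfolding delta_def abs_le_iff by linarith
 qed
 define B where "B p = E (k p)" for p
 have mB: "m (B p) = c - kappa * p$2 / rho & b (B p) = 0" if "p : D 1" for p
 proof -
  show ?thesis using kp[OF that] Kb(2) deltak[OF that] dE by (auto simp: m_def B_def delta_def)
 qed
 have peB: "pe (D 1) B" unfolding B_def
 proof (rule pe_comp[OF E(1)])
  show "inj_on k (D 1)" using kappa(1) by (auto simp: inj_on_def k_def vec2_eq_iff)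
  show "plat k p" for p unfolding k_def[abs_def] by (intro plat_intros)
 qed (use kp in auto)
 have Btop: "B p : topspace M" if "p : D 1" for p using kp[OF that] by (simp add: B_def)
 have adB: "adapted lower K B"
  using peB mB Btop kappa(1) rho(1) by (auto simp: adapted_def lower_def K_def zero_le_mult_iff divide_le_0_iff mult_le_0_iff)
 have v20: "v2 0 0 = 0" by (simp add: vec2_eq_iff)
 have B0: "B 0 = E (v2 u0 0)" by (simp add: B_def k_def)
 have Bs: "B p : s ` {0..} \<longleftrightarrow> p$1 = 0" if "p : D 1" for p
 proof -
  have "0 <= k p $ 1" using kbd[OF that] u0 a(1) rho(1) unfolding k_def v2_nth by linarith
  then show ?thesis using E(2)[of "k p"] kp[OF that] kappa(1) by (simp add: B_def k_def)
 qed
 have one: "M frontier_of K Int s ` {0..} = {B 0}"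
 proof (intro equalityI subsetI)
  fix y assume "y : {B 0}"
  then show "y : M frontier_of K Int s ` {0..}" using frontier_adapted[OF adB, of 0] Bs[of 0] by simp
 next
  fix y assume y: "y : M frontier_of K Int s ` {0..}"
  then obtain t where t: "0 <= t" "y = s t" by auto
  have my: "m y = c" and yt: "y : topspace M" using y F by auto
  show "y : {B 0}"
  proof (cases "y : E ` D 1")
   case False
   then have "m y = 0" using subsetD[OF ET, of "s t"] t T(2)[of t] Kb(2) yt False by (force simp: m_def d_def)
   then show ?thesis using my c by simp
  next
   case True
   then obtain p where p: "p : D 1" "E p = s t" using t by auto
   obtain u where u: "0 <= u" "u < 1" "p = v2 u 0" "t = gamma u" using on_s[OF p(1) t(1) p(2)] by blast
   have dy: "d y = min 1 (max 0 (2 - max (u - a) 0 / rho))"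
    using dE[OF p(1)] p(2) t(2) u by (simp add: delta_def mu_def max_def)
   have "~ u <= a" using dy rho(1) my c by (force simp: m_def)
   then have "d y = c" using gamma_less[of a u] a u T(2)[of t] t Kb(2) yt dy my by (simp add: m_def)
   then have "2 - (u - a) / rho = c" using dy \<open>~ u <= a\<close> c by auto
   then show ?thesis using rho(1) t(2) p(2) u(3) B0 by (simp add: u0_def field_simps)
  qed
 qed
 define gamma' where "gamma' v = gamma (u0 + kappa * v)" for v
 have rng: "0 <= u0 + kappa * v & u0 + kappa * v < 1" if "\<bar>v\<bar> < 1" for v using kbd[of "v2 0 v"] u0 a rho that by (auto simp: abs_le_iff)
 show thesis
 proof (rule that)
  show "K \<subseteq> topspace M" by (auto simp: K_def)
  have "{x:topspace M. m x = c} = {x:topspace M. c <= m x & m x <= c}" by auto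
  then show "compactin M (M frontier_of K)" using plf_level_compact[OF m, of c c] c(1) unfolding F by simp
  show "M frontier_of K \<subseteq> Int_M" using mL L(2) c(2) unfolding F by (force simp: surface_interior_def)
  show "M frontier_of K Int L = {}" using mL c(2) unfolding F by force
  show "EX e. adapted lower K e & e 0 = x & e ` D 1 \<subseteq> W" if "x : M frontier_of K" "openin M W" "x : W" for x W
   using chart[of x W] that unfolding F by blast
  show "adapted lower K B" "M frontier_of K Int s ` {0..} = {B 0}" by (fact adB, fact one)
  show "B ` D 1 Int L = {}" using mB b(2) by force
  show "strict_mono_on {-1<..<1} gamma'"
   using gamma_less rng kappa(1) by (auto simp: strict_mono_on_def gamma'_def abs_less_iff)
  show "0 <= gamma' v & B (v2 0 v) = s (gamma' v)" if "\<bar>v\<bar> < 1" for v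
   using gamma(3)[of "u0 + kappa * v"] rng[OF that] by (simp add: gamma'_def B_def k_def)
 qed (fact Bs)
qed

end

subsection \<open>Closed curves crossing a ray once\<close>

text \<open>The frontier of \<open>K\<close> is a compact curve, perhaps with several components.
  The component through \<open>B 0\<close> has to be followed from one side of the ray round to the
  other.\<close>

locale gate = compact_boundary_surface M A for M :: "'a topology" and A +
 fixes s :: "real => 'a" and L K :: "'a set" and B :: "real^2 => 'a"
 assumes s: "fray s" and L: "compactin M L" and KM: "K \<subseteq> topspace M"
  and F_compact: "compactin M (M frontier_of K)" and F_Int: "M frontier_of K \<subseteq> Int_M"
  and F_L: "M frontier_of K Int L = {}"
  and F_chart: "!!x W. x : M frontier_of K ==> openin M W ==> x : W ==> EX e. adapted lower K e & e 0 = x & e ` D 1 \<subseteq> W"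
  and B: "adapted lower K B" and B_L: "B ` D 1 Int L = {}"
  and B_s: "!!p. p : D 1 ==> B p : s ` {0..} \<longleftrightarrow> p$1 = 0"
  and F_s: "M frontier_of K Int s ` {0..} = {B 0}"
begin

abbreviation F :: "'a set" where "F \<equiv> M frontier_of K"
definition pt :: "real => 'a" where "pt u = B (v2 u 0)"
text \<open>A block around the crossing. The automorphisms in \<open>G\<close> fix it, and so see
  the curve \<open>F\<close> cut open between \<open>pt (-1/2)\<close> and \<open>pt (1/4)\<close>;
  they also fix the ray. The arc \<open>J\<close> adjoins the block on the left.\<close>

definition Col :: "'a set" where "Col = B ` {p. \<bar>p$2\<bar> <= 1/8 & -1/2 <= p$1 & p$1 <= 1/4}"
definition W0 :: "'a set" where "W0 = Int_M - (s ` {0..} Un L Un Col)"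
definition G :: "('a => 'a) => bool" where "G g \<longleftrightarrow> aut W0 g & preserves K g"
definition J :: "'a set" where "J = pt ` {-3/4<..<-1/2}"

lemma B_pe: "pe (D 1) B" using B by (simp add: adapted_def)

lemma B_inj: "p : D 1 ==> q : D 1 ==> B p = B q \<longleftrightarrow> p = q"
 using B_pe by (auto simp: pe_def inj_on_def)

lemma B_Int: "p : D 1 ==> B p : Int_M" using B_pe by (auto simp: pe_def)

lemma B_F: "p : D 1 ==> B p : F \<longleftrightarrow> p$2 = 0" by (rule frontier_adapted[OF B])

lemma pt_F: "\<bar>u\<bar> < 1 ==> pt u : F" by (simp add: pt_def B_F)

lemma pt_inj: "\<bar>u\<bar> < 1 ==> \<bar>u'\<bar> < 1 ==> pt u = pt u' \<longleftrightarrow> u = u'" by (simp add: pt_def B_inj)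

lemma F_top: "F \<subseteq> topspace M" using F_compact by (rule compactin_subset_topspace)

lemma Col_compact: "compactin M Col"
 unfolding Col_def
proof (rule pe_compact[OF B_pe])
 let ?C = "{p::real^2. \<bar>p$2\<bar> <= 1/8 & -1/2 <= p$1 & p$1 <= 1/4}"
 show sub: "?C \<subseteq> D 1" by (auto simp: n1_def abs_le_iff abs_less_iff)
 have "?C = {p::real^2. \<bar>p$2\<bar> <= 1/8} Int {p. -1/2 <= p$1} Int {p. p$1 <= 1/4}" by auto
 also have "closed ..." by (intro closed_Int closed_Collect_le continuous_intros)
 finally have "closed ?C" .
 then have "compact (cD 1 Int ?C)" by auto
 moreover have eq: "cD 1 Int ?C = ?C" using sub by auto
 ultimately show "compact ?C" unfolding eq by blast
qed

lemma W0_open: "openin M W0"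
proof -
 have "closedin M (s ` {0..} Un L Un Col)"
  using fray_closed[OF s order_refl] compactin_imp_closedin[OF Hausdorff] L Col_compact by auto
 then show ?thesis unfolding W0_def by (intro openin_diff openin_Int_M)
qed

lemma B_W0: assumes "p : D 1" shows "B p : W0 \<longleftrightarrow> p$1 ~= 0 & ~ (\<bar>p$2\<bar> <= 1/8 & -1/2 <= p$1 & p$1 <= 1/4)"
proof -
 have "B p : Col \<longleftrightarrow> \<bar>p$2\<bar> <= 1/8 & -1/2 <= p$1 & p$1 <= 1/4"
 proof
  assume "B p : Col"
  then obtain q where q: "\<bar>q$2\<bar> <= 1/8" "-1/2 <= q$1" "q$1 <= 1/4" "B p = B q" unfolding Col_def by auto
  then show "\<bar>p$2\<bar> <= 1/8 & -1/2 <= p$1 & p$1 <= 1/4" using B_inj[OF assms] q by (force simp: n1_def abs_le_iff abs_less_iff)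
 qed (auto simp: Col_def)
 then show ?thesis using B_Int[OF assms] B_s[OF assms] B_L assms unfolding W0_def by blast
qed

lemma pt_W0: "\<bar>u\<bar> < 1 ==> pt u : W0 \<longleftrightarrow> u < -1/2 | 1/4 < u"
 using B_W0[of "v2 u 0"] by (auto simp: pt_def)

lemma F_W0: assumes "y : F" "y ~: W0" obtains u where "-1/2 <= u" "u <= 1/4" "y = pt u"
proof -
 have "y : s ` {0..} Un Col" using assms F_Int F_L by (auto simp: W0_def)
 then consider "y = B 0" | "y : Col" using F_s assms(1) by blast
 then show thesis
 proof cases
  case 1
  have "v2 0 0 = 0" by (simp add: vec2_eq_iff)
  then show thesis using that[of 0] 1 by (simp add: pt_def)
 next
  case 2
  then obtain q where q: "\<bar>q$2\<bar> <= 1/8" "-1/2 <= q$1" "q$1 <= 1/4" "y = B q" unfolding Col_def by auto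
  then have "q = v2 (q$1) 0" using B_F assms(1) q(4) by (auto simp: vec2_eq_iff n1_def abs_le_iff abs_less_iff)
  then show thesis using that[of "q$1"] q by (simp add: pt_def)
 qed
qed

lemma pt_open:
 assumes "open I" "I \<subseteq> {-1<..<1}"
 obtains V where "openin M V" "F Int V = pt ` I"
proof -
 have 1: "open {p : D 1. p$1 : I}"
 proof -
  have "open ((%p::real^2. p$1) -` I)" using assms(1) by (intro open_vimage continuous_intros)
  then show ?thesis by (auto simp: Collect_conj_eq vimage_def)
 qed
 have 2: "openin M (B ` {p : D 1. p$1 : I})" using pe_open[OF pe_subset[OF B_pe 1]] by blast
 have "F Int B ` {p : D 1. p$1 : I} = pt ` I"
 proof (intro equalityI subsetI)
  fix y assume "y : F Int B ` {p : D 1. p$1 : I}"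
  then obtain p where p: "p : D 1" "p$1 : I" "y = B p" "B p : F" by auto
  then have "p = v2 (p$1) 0" using B_F by (simp add: vec2_eq_iff)
  then show "y : pt ` I" using p(3) p(2) by (force simp: pt_def)
 next
  fix y assume "y : pt ` I"
  then obtain u where u: "u : I" "y = pt u" by blast
  then have "\<bar>u\<bar> < 1" using assms(2) by force
  then show "y : F Int B ` {p : D 1. p$1 : I}"
   using u pt_F[of u] by (auto simp: pt_def intro!: image_eqI[of _ B "v2 u 0"])
 qed
 then show thesis using that 2 by blast
qed

lemma pt_open_interval:
 assumes "-1 <= a" "b <= 1" shows "EX V. openin M V & F Int V = pt ` {a<..<b}"
 by (rule pt_open[of "{a<..<b}"]) (use assms in auto)

lemma pt_continuous: "continuous_map (top_of_set {-1<..<1}) M pt"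
proof -
 have "continuous_on {-1<..<1} (%u. v2 u 0)" by (intro plat_continuous_on ballI plat_v2 plat_id plat_const)
 then have "continuous_map (top_of_set {-1<..<1}) (top_of_set (D 1)) (%u. v2 u 0)" by auto
 then show ?thesis using continuous_map_compose[OF _ pe_continuous[OF B_pe], of "top_of_set {-1<..<1}" "%u. v2 u 0"]
  by (simp add: o_def pt_def[abs_def])
qed

lemma pt_connected: assumes "is_interval I" "I \<subseteq> {-1<..<1}" shows "connectedin M (pt ` I)"
 using connectedin_continuous_map_image[OF pt_continuous, of I] assms
 by (simp add: connectedin_subtopology is_interval_connected_1)

lemma pt_compact: assumes "compact I" "I \<subseteq> {-1<..<1}" shows "compactin M (pt ` I)"
 using image_compactin[OF _ pt_continuous, of I] assms by (simp add: compactin_subtopology)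

lemma G_id: "G (%x. x)" by (simp add: G_def aut_id preserves_def)

lemma G_comp: "G g ==> G h ==> G (%x. g (h x))"
 using aut_comp by (auto simp: G_def preserves_def)

lemma G_inv: assumes "G g" shows "G (inv g)"
proof -
 have b: "bij g" using assms aut_bij by (auto simp: G_def)
 have "inv g x : K \<longleftrightarrow> x : K" for x
  using assms surj_f_inv_f[OF bij_is_surj[OF b], of x] unfolding G_def preserves_def by metis
 then show ?thesis using assms aut_inv by (auto simp: G_def preserves_def)
qed

lemma G_inj: "G g ==> g x = g y \<longleftrightarrow> x = y"
 using aut_bij by (auto simp: G_def bij_def inj_eq)

lemma G_F: "G g ==> g x : F \<longleftrightarrow> x : F"
 using preserves_frontier[OF _ _ KM] by (auto simp: G_def preserves_def)

lemma G_W0: "G g ==> g x : W0 \<longleftrightarrow> x : W0" using aut_mem[of W0 g W0 x] by (auto simp: G_def)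

lemma G_fix: "G g ==> x ~: W0 ==> g x = x" using aut_outside[of W0 g x] by (auto simp: G_def)

text \<open>The point \<open>B (v2 (-1/2) 0)\<close> belongs to the block, hence is off the compact
  support of \<open>g\<close>.\<close>

lemma G_near:
 assumes g: "G g"
 obtains rho where "0 < rho" "rho <= 1/8" "!!p. n1 p < rho ==> g (B (v2 (-1/2) 0 + p)) = B (v2 (-1/2) 0 + p)"
proof -
 obtain C where C: "compactin M C" "C \<subseteq> W0" "!!x. x ~: C ==> g x = x" using aut_supp[of W0 g] g unfolding G_def by metis
 have "openin M (topspace M - C)" using compactin_imp_closedin[OF Hausdorff C(1)] by blast
 then have o: "open {p:D 1. B p : topspace M - C}" by (rule pe_vimage_open[OF B_pe])
 have "v2 (-1/2) 0 : {p:D 1. B p : topspace M - C}" using B_W0[of "v2 (-1/2) 0"] B_Int[of "v2 (-1/2) 0"] Int_M_subset C(2) by auto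
 then obtain rho where rho: "0 < rho" "!!p. n1 (p - v2 (-1/2) 0) < rho ==> p : {p:D 1. B p : topspace M - C}"
  using open_n1_ball[OF o] by blast
 show thesis
 proof (rule that[of "min rho (1/8)"])
  fix p assume "n1 p < min rho (1/8)"
  then have "v2 (-1/2) 0 + p : {p:D 1. B p : topspace M - C}" by (intro rho(2)) simp
  then show "g (B (v2 (-1/2) 0 + p)) = B (v2 (-1/2) 0 + p)" using C(3) by blast
 qed (use rho(1) in auto)
qed

lemma G_pt_near:
 assumes g: "G g" and v: "v < -1/2"
 obtains u where "v < u" "-3/4 < u" "u < -1/2" "g (pt u) = pt u"
proof -
 obtain rho where rho: "0 < rho" "rho <= 1/8" "!!p. n1 p < rho ==> g (B (v2 (-1/2) 0 + p)) = B (v2 (-1/2) 0 + p)"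
  using G_near[OF g] by metis
 define u where "u = max (-1/2 - rho/2) (v/2 - 1/4)"
 have u: "v < u" "-3/4 < u" "u < -1/2" "-1/2 - rho/2 <= u" using v rho(1,2) by (auto simp: u_def max_def)
 have "v2 (-1/2) 0 + v2 (u + 1/2) 0 = v2 u 0" by (simp add: vec2_eq_iff)
 moreover have "n1 (v2 (u + 1/2) 0) < rho" using u(3,4) rho(1) by auto
 ultimately show thesis using rho(3)[of "v2 (u + 1/2) 0"] that u by (simp add: pt_def)
qed

text \<open>The image arc is open in \<open>F\<close> and becomes compact when its two ends are
  added. As \<open>Q\<close> avoids these ends, the arc is both open and closed within
  \<open>Q\<close>.\<close>

lemma G_J_absorb:
 assumes g: "G g" and Q: "connectedin M Q" "Q \<subseteq> F" "g (pt (-3/4)) ~: Q" "pt (-1/2) ~: Q" and meet: "Q Int g ` J ~= {}"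
 shows "Q \<subseteq> g ` J"
proof -
 have ag: "aut W0 g" using g by (simp add: G_def)
 obtain V where V: "openin M V" "F Int V = J" using pt_open_interval[of "-3/4" "-1/2"] unfolding J_def by auto
 have gV: "Q Int g ` V = Q Int g ` J" using V(2) Q(2) G_F[OF g] by blast
 have o: "openin (subtopology M Q) (Q Int g ` J)"
  using aut_image_open[OF ag V(1)] unfolding gV[symmetric] by (auto simp: openin_subtopology Int_commute)
 have "{-3/4..-1/2::real} = {-3/4<..<-1/2} Un {-3/4, -1/2}" by auto
 then have "g ` pt ` {-3/4..-1/2} = g ` J Un {g (pt (-3/4)), g (pt (-1/2))}" unfolding J_def by simp
 moreover have "g (pt (-1/2)) = pt (-1/2)" by (rule G_fix[OF g]) (simp add: pt_W0)
 ultimately have gC: "Q Int g ` pt ` {-3/4..-1/2} = Q Int g ` J" using Q(3,4) by auto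
 have "closedin M (g ` pt ` {-3/4..-1/2})"
  by (intro compactin_imp_closedin[OF Hausdorff] aut_compactin[OF ag] pt_compact) auto
 then have c: "closedin (subtopology M Q) (Q Int g ` J)" unfolding gC[symmetric] by (auto simp: closedin_subtopology Int_commute)
 have "connected_space (subtopology M Q)" "topspace (subtopology M Q) = Q" using Q(1) by (auto simp: connectedin_def)
 then have "Q Int g ` J = {} | Q Int g ` J = Q" using o c by (metis connected_space_clopen_in)
 then show ?thesis using meet by blast
qed

lemma G_slide:
 assumes Q: "connectedin M Q" "Q \<subseteq> F Int W0" and xy: "x : Q" "y : Q"
 shows "EX g. G g & g x = y"
proof -
 have ch: "EX e. adapted lower K e & e ` D 1 \<subseteq> W0 & e 0 = z" if "z : Q" for z
  using F_chart[of z W0] W0_open Q(2) that by blast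
 obtain e where e: "adapted lower K e" "e ` D 1 \<subseteq> W0" "e 0 = x" using ch[OF xy(1)] by blast
 obtain e' where e': "adapted lower K e'" "e' ` D 1 \<subseteq> W0" "e' 0 = y" using ch[OF xy(2)] by blast
 have "germ_equiv W0 K e 0 e' 0"
  by (rule framed_transport[OF _ Q(1) ch]) (use e e' xy in auto)
 then show ?thesis using germ_equiv_center e(3) e'(3) unfolding G_def by blast
qed

text \<open>Both arcs leave \<open>pt (-1/2)\<close> in the same way. If neither contained the
  other, each would contain the far end of the other; the two would close up to a circle, with no
  room for the points of \<open>F\<close> just beyond the end of \<open>J\<close>. Replacing
  \<open>g\<close> by \<open>k\<close>, which is \<open>g\<close> followed by \<open>inv h\<close>,
  allows one of the arcs to be \<open>J\<close> itself.\<close>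

lemma G_chain:
 assumes g: "G g" and h: "G h" shows "g ` J \<subseteq> h ` J | h ` J \<subseteq> g ` J"
proof -
 have conn: "connectedin M (k ` J) & k ` J \<subseteq> F & pt (-1/2) ~: k ` J" if k: "G k" for k
 proof (intro conjI)
  have "connectedin M J" unfolding J_def by (rule pt_connected) auto
  then show "connectedin M (k ` J)"
   using connectedin_continuous_map_image[OF homeomorphic_imp_continuous_map[OF aut_homeomorphic[of W0 k]]] k by (auto simp: G_def)
  show "k ` J \<subseteq> F" using G_F[OF k] pt_F by (auto simp: J_def)
  have "k ` J \<subseteq> W0" using G_W0[OF k] pt_W0 by (auto simp: J_def)
  then show "pt (-1/2) ~: k ` J" using pt_W0[of "-1/2"] by auto
 qed
 have meet: "g ` J Int h ` J ~= {}"
 proof -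
  obtain rho where rho: "0 < rho" "rho <= 1/8" "!!p. n1 p < rho ==> g (B (v2 (-1/2) 0 + p)) = B (v2 (-1/2) 0 + p)"
   using G_near[OF g] by metis
  obtain u where u: "-1/2 - rho < u" "-3/4 < u" "u < -1/2" "h (pt u) = pt u" using G_pt_near[OF h, of "-1/2 - rho"] rho(1) by auto
  have "v2 (-1/2) 0 + v2 (u + 1/2) 0 = v2 u 0" by (simp add: vec2_eq_iff)
  then show ?thesis using rho(3)[of "v2 (u + 1/2) 0"] u u(4) by (force simp: pt_def J_def)
 qed
 show ?thesis
 proof (rule ccontr)
  assume neg: "~ ?thesis"
  have 1: "h (pt (-3/4)) : g ` J" using G_J_absorb[OF h, of "g ` J"] conn[OF g] meet neg by blast
  have 2: "g (pt (-3/4)) : h ` J" using G_J_absorb[OF g, of "h ` J"] conn[OF h] meet neg by blast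
  define k where "k x = inv h (g x)" for x
  have k: "G k" unfolding k_def[abs_def] by (rule G_comp[OF G_inv[OF h] g])
  have ih: "inv h (h x) = x" for x using G_inj[OF h] by (simp add: inv_f_f inj_def)
  have xL: "pt (-3/4) : k ` J"
  proof -
   obtain x where "x : J" "h (pt (-3/4)) = g x" using 1 by blast
   then show ?thesis using ih[of "pt (-3/4)"] by (auto simp: k_def intro!: image_eqI[of _ _ x])
  qed
  obtain alpha where alpha: "-3/4 < alpha" "alpha < -1/2" "k (pt (-3/4)) = pt alpha" using 2 ih by (auto simp: J_def k_def)
  have sub: "pt ` I \<subseteq> k ` J" if I: "is_interval I" "I \<subseteq> {-3/4<..<-1/2}" "alpha ~: I" "pt ` I Int k ` J ~= {}" for I
  proof (rule G_J_absorb[OF k])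
   show "connectedin M (pt ` I)" using I by (intro pt_connected) auto
   show "pt ` I \<subseteq> F" using I pt_F by force
   show "pt (-1/2) ~: pt ` I"
   proof
    assume "pt (-1/2) : pt ` I"
    then obtain u where "u : I" "pt (-1/2) = pt u" by blast
    then show False using I(2) pt_inj[of "-1/2" u] by force
   qed
   show "k (pt (-3/4)) ~: pt ` I"
   proof
    assume "k (pt (-3/4)) : pt ` I"
    then obtain u where u: "u : I" "pt alpha = pt u" using alpha(3) by auto
    then show False using I(2,3) pt_inj[of alpha u] alpha(1,2) by force
   qed
  qed (use I in simp)
  obtain V where V: "openin M V" "F Int V = J" using pt_open_interval[of "-3/4" "-1/2"] unfolding J_def by auto
  have ak: "aut W0 k" using k by (simp add: G_def)
  have "open {p:D 1. B p : k ` V}" by (rule pe_vimage_open[OF B_pe aut_image_open[OF ak V(1)]])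
  moreover have "v2 (-3/4) 0 : {p:D 1. B p : k ` V}" using xL V(2) by (auto simp: pt_def)
  ultimately obtain r where r: "0 < r" "!!p. n1 (p - v2 (-3/4) 0) < r ==> p : {p:D 1. B p : k ` V}"
   using open_n1_ball by blast
  have left: "pt ` {-3/4<..<alpha} \<subseteq> k ` J"
  proof (rule sub)
   let ?u = "min (-3/4 + r/2) (alpha/2 - 3/8)"
   have u: "-3/4 < ?u" "?u < alpha" "?u < -1/2" using r(1) alpha by auto
   have "pt ?u : k ` V" using r(1) alpha r(2)[of "v2 ?u 0"] by (auto simp: pt_def n1_def min_def)
   then obtain z where z: "z : V" "pt ?u = k z" by blast
   have "pt ?u : F" using u by (intro pt_F) auto
   then have "pt ?u : k ` J" using V(2) G_F[OF k, of z] z z(2) by auto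
   moreover have "pt ?u : pt ` {-3/4<..<alpha}" using u by auto
   ultimately show "pt ` {-3/4<..<alpha} Int k ` J ~= {}" by blast
  qed (use alpha in auto)
  have right: "pt ` {alpha<..<-1/2} \<subseteq> k ` J"
  proof (rule sub)
   obtain u where u: "alpha < u" "-3/4 < u" "u < -1/2" "k (pt u) = pt u" using G_pt_near[OF k, of alpha] alpha by auto
   then have "pt u : k ` J" by (metis J_def greaterThanLessThan_iff image_eqI)
   moreover have "pt u : pt ` {alpha<..<-1/2}" using u by auto
   ultimately show "pt ` {alpha<..<-1/2} Int k ` J ~= {}" by blast
  qed (use alpha in auto)
  have "openin M {x. k x : V}" by (rule aut_vimage_open[OF ak V(1)])
  then have "open {p:D 1. B p : {x. k x : V}}" by (rule pe_vimage_open[OF B_pe])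
  moreover have "v2 (-3/4) 0 : {p:D 1. B p : {x. k x : V}}" using alpha V(2) by (auto simp: pt_def J_def)
  ultimately obtain r' where r': "0 < r'" "!!p. n1 (p - v2 (-3/4) 0) < r' ==> p : {p:D 1. B p : {x. k x : V}}"
   using open_n1_ball by blast
  \<comment> \<open>A point of \<open>F\<close> just beyond the end of \<open>J\<close>. The map
    \<open>k\<close> sends it into \<open>J\<close> next to \<open>pt alpha\<close>, while all of
    \<open>J\<close> except \<open>pt alpha\<close> is already covered by the image of
    \<open>J\<close> under \<open>k\<close>.\<close>
  let ?u = "-3/4 - min (r'/2) (1/8)"
  have u: "?u < -3/4" "-1 < ?u" using r'(1) by auto
  have "k (pt ?u) : J" using r'(1) r'(2)[of "v2 ?u 0"] G_F[OF k] pt_F[of ?u] u V(2) by (auto simp: pt_def n1_def min_def)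
  then obtain w where w: "-3/4 < w" "w < -1/2" "k (pt ?u) = pt w" unfolding J_def by auto
  have "w ~= alpha"
  proof
   assume "w = alpha"
   then show False using w(3) alpha(3) G_inj[OF k] pt_inj[of ?u "-3/4"] u by force
  qed
  then have "pt w : k ` J" using left right w by (metis greaterThanLessThan_iff image_eqI linorder_neqE subsetD)
  then obtain w' where "-3/4 < w'" "w' < -1/2" "pt ?u = pt w'" using w(3) G_inj[OF k] unfolding J_def by auto
  then show False using pt_inj[of ?u w'] u by auto
 qed
qed

text \<open>If the orbit \<open>Omega\<close> of \<open>pt (-3/4)\<close> missed
  \<open>pt (1/2)\<close>, adding \<open>pt (-1/2)\<close> would make it compact. Finitely many
  images of \<open>J\<close> would then cover it, hence by \<open>G_chain\<close> a single one, say
  under \<open>g\<close>; but \<open>g (pt (-3/4))\<close> is in the orbit and not in this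
  image.\<close>

lemma G_right:
 obtains g where "G g" "g (pt (-3/4)) = pt (1/2)"
proof -
 define Omega where "Omega = {y. EX g. G g & g (pt (-3/4)) = y}"
 have Omegasub: "Omega \<subseteq> F Int W0"
 proof
  fix y assume "y : Omega"
  then obtain g where g: "G g" "g (pt (-3/4)) = y" unfolding Omega_def by blast
  then show "y : F Int W0" using G_F[OF g(1), of "pt (-3/4)"] G_W0[OF g(1), of "pt (-3/4)"] pt_F[of "-3/4"] pt_W0[of "-3/4"] by auto
 qed
 have Omegaconn: "z : Omega" if "y : Omega" "connectedin M Q" "Q \<subseteq> F Int W0" "y : Q" "z : Q" for y z Q
  using G_slide[OF that(2-5)] that(1) G_comp unfolding Omega_def by blast
 have "pt (1/2) : Omega"
 proof (rule ccontr)
  assume R: "pt (1/2) ~: Omega"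
  let ?X = "Omega Un {pt (-1/2)}"
  \<comment> \<open>Two reasons why \<open>F\<close> outside \<open>?X\<close> is relatively open:
    off the block, the orbit contains with a point every connected set of \<open>F Int W0\<close>
    through it; at the block, the orbit cannot come in from the right without containing
    \<open>pt (1/2)\<close>.\<close>
  have sep: "EX V. openin M V & y : V & V Int ?X \<subseteq> topspace M - F" if y: "y : F" "y ~: ?X" for y
  proof (cases "y : W0")
   case True
   obtain e where e: "adapted lower K e" "e 0 = y" "e ` D 1 \<subseteq> W0" using F_chart[OF y(1) W0_open True] by blast
   have pe: "pe (D 1) e" using e by (simp add: adapted_def)
   have ax: "F Int e ` D 1 = e ` {p:D 1. p$2 = 0}" using frontier_adapted[OF e(1)] by auto
   have "convex {p:D 1. p$2 = 0}" using convex_Int[OF convex_D] by (force simp: convex_def Collect_conj_eq)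
   then have "connectedin M (e ` {p:D 1. p$2 = 0})"
    by (intro connectedin_continuous_map_image[OF pe_continuous[OF pe]]) (auto simp: connectedin_subtopology convex_connected)
   moreover have "y : e ` {p:D 1. p$2 = 0}" using e(2) by auto
   moreover have "e ` {p:D 1. p$2 = 0} \<subseteq> F Int W0" using ax e(3) by blast
   ultimately have d: "Omega Int (F Int e ` D 1) = {}" using Omegaconn[of _ "e ` {p:D 1. p$2 = 0}" y] y(2) unfolding ax by blast
   have "pt (-1/2) ~: e ` D 1" using e(3) pt_W0[of "-1/2"] by auto
   moreover have "Omega Int e ` D 1 = {}" using d Omegasub by blast
   moreover have "Y Int (X Un {z}) = {}" if "z ~: Y" "X Int Y = {}" for X Y and z :: 'a using that by blast
   ultimately have "e ` D 1 Int ?X = {}" by meson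
   moreover have "y : e ` D 1" using e(2) by auto
   ultimately show ?thesis using pe_open[OF pe] by blast
  next
   case False
   then obtain u where u: "-1/2 <= u" "u <= 1/4" "y = pt u" using F_W0[OF y(1)] by blast
   then have u': "-1/2 < u" using y(2) by force
   obtain V where V: "openin M V" "F Int V = pt ` {-1/2<..<1/2}" using pt_open_interval[of "-1/2" "1/2"] by auto
   have "V Int ?X = {}"
   proof (rule ccontr)
    assume "V Int ?X ~= {}"
    then obtain z where z: "z : V" "z : ?X" by blast
    then obtain w where w: "-1/2 < w" "w < 1/2" "z = pt w" using Omegasub pt_F[of "-1/2"] V(2) z(1) by fastforce
    then have zOmega: "z : Omega" using pt_inj[of w "-1/2"] z(2) by auto
    then have "1/4 < w" using Omegasub pt_W0[of w] w by auto
    moreover have "connectedin M (pt ` {1/4<..1/2})" by (rule pt_connected) auto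
    moreover have "pt ` {1/4<..1/2} \<subseteq> F Int W0" using pt_F pt_W0 by auto
    ultimately show False using Omegaconn[OF zOmega, of "pt ` {1/4<..1/2}" "pt (1/2)"] w R by auto
   qed
   moreover have "y : V" using u u' V(2) by auto
   ultimately show ?thesis using V(1) by blast
  qed
  have XF: "?X \<subseteq> F" using Omegasub pt_F[of "-1/2"] by auto
  have "closedin M ?X"
  proof -
   have "openin M (topspace M - ?X)"
   proof (subst openin_subopen, intro ballI)
    fix y assume y: "y : topspace M - ?X"
    show "EX T. openin M T & y : T & T \<subseteq> topspace M - ?X"
    proof (cases "y : F")
     case True
     then obtain V where V: "openin M V" "y : V" "V Int ?X \<subseteq> topspace M - F" using sep y by blast
     then show ?thesis using XF openin_subset[OF V(1)] V by blast
    next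
     case False
     then show ?thesis using compactin_imp_closedin[OF Hausdorff F_compact] y XF by blast
    qed
   qed
   then show ?thesis using XF F_top by (auto simp: closedin_def)
  qed
  then have X: "compactin M ?X" using closed_compactin[OF F_compact XF] by blast
  have XF': "compactin (subtopology M F) ?X" using X XF by (simp add: compactin_subtopology)
  \<comment> \<open>A neighbourhood of the added point \<open>pt (-1/2)\<close>. As the orbit avoids
    the block, its part in \<open>?N\<close> lies in \<open>J\<close>.\<close>
  let ?N = "pt ` {-3/4<..<-1/4}"
  have oN: "openin (subtopology M F) ?N"
  proof -
   obtain V where "openin M V" "F Int V = ?N" using pt_open_interval[of "-3/4" "-1/4"] by auto
   then show ?thesis by (metis Int_commute openin_subtopology)
  qed
  have oJ: "openin (subtopology M F) (g ` J)" if g: "G g" for g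
  proof -
   obtain V where V: "openin M V" "F Int V = J" using pt_open_interval[of "-3/4" "-1/2"] unfolding J_def by auto
   show ?thesis using V(2) G_F[OF g] aut_image_open[of W0 g V] V(1) g unfolding G_def by (auto simp: openin_subtopology)
  qed
  have in_J: "EX h. G h & y : h ` J" if y: "y : Omega" for y
  proof -
   obtain g where g: "G g" "g (pt (-3/4)) = y" using y unfolding Omega_def by blast
   \<comment> \<open>The end \<open>pt (-3/4)\<close> is not in \<open>J\<close>, so an inner point
     of \<open>J\<close> is first slid to it.\<close>
   have "connectedin M (pt ` {-3/4..-5/8})" by (rule pt_connected) auto
   moreover have "pt ` {-3/4..-5/8} \<subseteq> F Int W0" using pt_F pt_W0 by auto
   ultimately obtain k where k: "G k" "k (pt (-5/8)) = pt (-3/4)" using G_slide[of "pt ` {-3/4..-5/8}" "pt (-5/8)" "pt (-3/4)"] by auto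
   have "y = g (k (pt (-5/8)))" using g k by simp
   moreover have "pt (-5/8) : J" by (auto simp: J_def)
   ultimately show ?thesis using G_comp[OF g(1) k(1)] by blast
  qed
  define \<J> where "\<J> = {g ` J | g. G g}"
  have JJ: "J : \<J>" unfolding \<J>_def by (rule CollectI, rule exI[of _ "%x. x"]) (simp add: G_id)
  have "openin (subtopology M F) U" if "U : insert ?N \<J>" for U using that oN oJ unfolding \<J>_def by blast
  moreover have "?X \<subseteq> \<Union>(insert ?N \<J>)" using in_J by (auto simp: \<J>_def)
  ultimately obtain \<F> where \<F>: "finite \<F>" "\<F> \<subseteq> insert ?N \<J>" "?X \<subseteq> \<Union>\<F>"
   using compactinD[OF XF', of "insert ?N \<J>"] by metis
  define \<C> where "\<C> = insert J (\<F> - {?N})"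
  have C1: "\<C> \<subseteq> \<J>" using \<F>(2) JJ unfolding \<C>_def by blast
  have "U \<subseteq> V | V \<subseteq> U" if "U : \<J>" "V : \<J>" for U V using that G_chain unfolding \<J>_def by blast
  then have "subset.chain \<J> \<C>" using C1 unfolding subset_chain_def by auto
  then have "\<Union>\<C> : \<C>" using \<F>(1) unfolding \<C>_def by (intro Union_in_chain) auto
  then obtain g where g: "G g" "\<Union>\<C> = g ` J" using C1 unfolding \<J>_def by auto
  have "Omega \<subseteq> \<Union>\<C>"
  proof
   fix y assume y: "y : Omega"
   show "y : \<Union>\<C>"
   proof (cases "y : ?N")
    case True
    then obtain u where u: "-3/4 < u" "u < -1/4" "y = pt u" by auto
    then show ?thesis using y Omegasub pt_W0[of u] u unfolding \<C>_def by (auto simp: J_def)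
   next
    case False
    then show ?thesis using y \<F>(3) unfolding \<C>_def by blast
   qed
  qed
  moreover have "g (pt (-3/4)) : Omega" using g(1) unfolding Omega_def by blast
  ultimately obtain w where "-3/4 < w" "w < -1/2" "pt (-3/4) = pt w" using g(2) G_inj[OF g(1)] unfolding J_def by force
  then show False using pt_inj[of "-3/4" w] by auto
 qed
 then show thesis using that unfolding Omega_def by blast
qed

text \<open>If the image arc, which ends at \<open>pt (1/2)\<close>, met the gap between
  \<open>pt (1/4)\<close> and \<open>pt (1/2)\<close>, it would contain the whole gap; its closure
  would then contain \<open>pt (1/4)\<close>, which \<open>g\<close> fixes.\<close>

lemma G_right_disjoint:
 assumes g: "G g" "g (pt (-3/4)) = pt (1/2)" shows "g ` J Int pt ` {-1/2..1/2} = {}"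
proof -
 let ?Y = "pt ` {1/4<..<1/2}"
 have "g ` J Int ?Y = {}"
 proof (rule ccontr)
  assume meet: "g ` J Int ?Y ~= {}"
  have n: "pt u ~: ?Y" if "\<bar>u\<bar> < 1" "~ (1/4 < u & u < 1/2)" for u
  proof
   assume "pt u : ?Y"
   then obtain w where "1/4 < w" "w < 1/2" "pt u = pt w" by auto
   then show False using pt_inj[of u w] that by auto
  qed
  have "?Y \<subseteq> g ` J"
  proof (rule G_J_absorb[OF g(1)])
   show "connectedin M ?Y" by (rule pt_connected) auto
   show "?Y \<subseteq> F" using pt_F by auto
   show "g (pt (-3/4)) ~: ?Y" unfolding g(2) by (rule n) auto
   show "pt (-1/2) ~: ?Y" by (rule n) auto
  qed (use meet in blast)
  moreover have "J \<subseteq> pt ` {-3/4..-1/2}" by (auto simp: J_def)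
  ultimately have Y: "?Y \<subseteq> g ` pt ` {-3/4..-1/2}" by blast
  have "closedin M (g ` pt ` {-3/4..-1/2})"
   by (intro compactin_imp_closedin[OF Hausdorff] aut_compactin[of W0] pt_compact) (use g(1) in \<open>auto simp: G_def\<close>)
  then have "openin M (topspace M - g ` pt ` {-3/4..-1/2})" by blast
  then have "open {p:D 1. B p : topspace M - g ` pt ` {-3/4..-1/2}}" by (rule pe_vimage_open[OF B_pe])
  moreover define Z where "Z = {p:D 1. B p : topspace M - g ` pt ` {-3/4..-1/2}}"
  ultimately have o: "open Z" by simp
  have "pt (1/4) : g ` pt ` {-3/4..-1/2}"
  proof (rule ccontr)
   assume "pt (1/4) ~: g ` pt ` {-3/4..-1/2}"
   then have mem: "v2 (1/4) 0 : Z"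
    using pt_F[of "1/4"] F_top by (auto simp: pt_def Z_def)
   obtain r where r: "0 < r" "!!p. n1 (p - v2 (1/4) 0) < r ==> p : Z"
    using open_n1_ball[OF o mem] by blast
   let ?u = "1/4 + min (r/2) (1/8)"
   have "pt ?u ~: g ` pt ` {-3/4..-1/2}" using r(1) r(2)[of "v2 ?u 0"] by (auto simp: pt_def Z_def n1_def min_def)
   moreover have "pt ?u : ?Y" using r(1) by auto
   ultimately show False using Y by blast
  qed
  then obtain w where w: "-3/4 <= w" "w <= -1/2" "pt (1/4) = g (pt w)" by auto
  have "g (pt (1/4)) = pt (1/4)" by (rule G_fix[OF g(1)]) (simp add: pt_W0)
  then show False using w(3) G_inj[OF g(1)] pt_inj[of "1/4" w] w by auto
 qed
 moreover have "pt u ~: g ` J" if "-1/2 <= u" "u <= 1/4" for u using G_W0[OF g(1)] pt_W0 pt_W0[of u] that by (force simp: J_def)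
 moreover have "pt (1/2) ~: g ` J"
 proof
  assume "pt (1/2) : g ` J"
  then obtain w where "-3/4 < w" "w < -1/2" "pt (-3/4) = pt w" using G_inj[OF g(1)] g(2) unfolding J_def by auto
  then show False using pt_inj[of "-3/4" w] by auto
 qed
 moreover have "u = 1/2 | u <= 1/4 | u : {1/4<..<1/2}" if "u <= 1/2" for u :: real using that by auto
 ultimately show ?thesis by (smt (verit, best) atLeastAtMost_iff disjoint_iff image_iff)
qed

text \<open>The transverse sign is 1 because \<open>g\<close> preserves \<open>K\<close>, the
  longitudinal sign because the image of \<open>J\<close> has to leave \<open>pt (1/2)\<close> away
  from the block. So a strip around the curve closes up to an annulus and not to a Moebius
  band.\<close>

lemma gate_loop:
 obtains g rho where "G g" "0 < rho" "rho <= 1/8" "!!p. n1 p < rho ==> g (B (v2 (-3/4) 0 + p)) = B (v2 (1/2) 0 + p)"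
  "!!p. n1 p < rho ==> g (B (v2 (-1/2) 0 + p)) = B (v2 (-1/2) 0 + p)" "g ` J Int pt ` {-1/2..1/2} = {}"
proof -
 obtain h where h: "G h" "h (pt (-3/4)) = pt (1/2)" using G_right by blast
 have ad: "adapted lower K (%p. B (v2 a 0 + (1/8) *\<^sub>R p))" if "\<bar>a\<bar> + 1/8 <= 1" for a
  using adapted_recentre[OF B _ _ that] by simp
 define e where "e p = B (v2 (-3/4) 0 + (1/8) *\<^sub>R p)" for p
 define e' where "e' p = B (v2 (1/2) 0 + (1/8) *\<^sub>R p)" for p
 have W: "B (v2 a 0 + (1/8) *\<^sub>R p) : W0" if "p : D 1" "a = -3/4 | a = 1/2" for a p
 proof -
  have "\<bar>p$1\<bar> < 1" "n1 p < 1" using that(1) by (auto simp: n1_def)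
  moreover have "n1 (v2 a 0 + (1/8) *\<^sub>R p) <= \<bar>a\<bar> + (1/8) * n1 p" using n1_triangle[of "v2 a 0" "(1/8) *\<^sub>R p"] by simp
  ultimately show ?thesis using that(2) by (subst B_W0) (auto simp: abs_less_iff)
 qed
 have eK: "h (e p) : K \<longleftrightarrow> e p : K" for p using h(1) by (simp add: G_def preserves_def)
 have he: "adapted lower K (%p. h (e p))"
 proof -
  have "adapted lower K e" unfolding e_def[abs_def] by (rule ad) simp
  then show ?thesis using aut_pe[of W0 h "D 1" e] h(1) eK by (simp add: adapted_def G_def)
 qed
 have e': "adapted lower K e'" unfolding e'_def[abs_def] by (rule ad) simp
 have "v2 a 0 + (1/8) *\<^sub>R v2 0 0 = v2 a 0" for a by (simp add: vec2_eq_iff)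
 then have c: "h (e (v2 0 0)) = e' (v2 0 0)" using h(2) by (simp add: e_def e'_def pt_def)
 have v20: "v2 0 0 = 0" by (simp add: vec2_eq_iff)
 have "germ_equiv W0 K (%p. h (e p)) 0 e' 0"
 proof (rule germ_equiv_common[OF _ he _ e'])
  show "(%p. h (e p)) ` D 1 \<subseteq> W0" "e' ` D 1 \<subseteq> W0" using W G_W0[OF h(1)] by (auto simp: e_def e'_def)
 qed (use c in auto)
 then obtain k sig tau rho0 where k: "aut W0 k" "preserves K k" "is_sign sig" "is_sign tau" "0 < rho0"
  "!!p. n1 p < rho0 ==> k (h (e p)) = e' (flip sig tau p)" unfolding germ_equiv_def v20 by (metis add_0)
 define g where "g x = k (h x)" for x
 have g: "G g" unfolding g_def[abs_def] by (rule G_comp[OF _ h(1)]) (simp add: G_def k)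
 define rho1 where "rho1 = min (1/8) (rho0/8)"
 have rho1: "0 < rho1" "rho1 <= 1/8" "rho1 <= rho0/8" using k(5) by (auto simp: rho1_def)
 have gB: "g (B (v2 (-3/4) 0 + p)) = B (v2 (1/2) 0 + flip sig tau p)" if "n1 p < rho1" for p
 proof -
  have "(1/8) *\<^sub>R flip sig tau (8 *\<^sub>R p) = flip sig tau p" by (simp add: vec2_eq_iff)
  then show ?thesis using k(6)[of "8 *\<^sub>R p"] that rho1(3) by (simp add: g_def e_def e'_def)
 qed
 have small: "n1 (v2 a 0 + p) < 1" if "n1 p < rho1" "a = -3/4 | a = 1/2" for a p
  using n1_triangle[of "v2 a 0" p] that rho1(2) by auto
 have "tau = 1"
 proof (rule ccontr)
  assume "tau ~= 1"
  then have t: "tau = -1" using k(4) by (auto simp: is_sign_def)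
  let ?p = "v2 0 (rho1/2)"
  have p: "n1 ?p < rho1" using rho1(1) by simp
  have "B (v2 (-3/4) 0 + ?p) ~: K" using B small[OF p, of "-3/4"] rho1(1) by (simp add: adapted_def lower_def)
  moreover have "B (v2 (1/2) 0 + flip sig tau ?p) : K" using B small[of "flip sig tau ?p" "1/2"] p k(3,4) t by (simp add: adapted_def lower_def)
  ultimately show False using gB[OF p] g by (metis G_def preserves_def)
 qed
 have gL: "g (pt (-3/4)) = pt (1/2)" using gB[of 0] rho1(1) by (simp add: pt_def flip_def v20)
 have disj: "g ` J Int pt ` {-1/2..1/2} = {}" by (rule G_right_disjoint[OF g gL])
 have "sig = 1"
 proof (rule ccontr)
  assume "sig ~= 1"
  then have t: "sig = -1" using k(3) by (auto simp: is_sign_def)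
  let ?p = "v2 (rho1/2) 0"
  have "v2 (-3/4) 0 + ?p = v2 (-3/4 + rho1/2) 0" "v2 (1/2) 0 + flip sig tau ?p = v2 (1/2 - rho1/2) 0"
   using t by (auto simp: vec2_eq_iff)
  then have "g (pt (-3/4 + rho1/2)) = pt (1/2 - rho1/2)" using gB[of ?p] rho1(1) by (simp add: pt_def)
  moreover have "pt (-3/4 + rho1/2) : J" "pt (1/2 - rho1/2) : pt ` {-1/2..1/2}" using rho1 by (auto simp: J_def)
  ultimately show False using disj by auto
 qed
 obtain rho2 where rho2: "0 < rho2" "rho2 <= 1/8" "!!p. n1 p < rho2 ==> g (B (v2 (-1/2) 0 + p)) = B (v2 (-1/2) 0 + p)"
  using G_near[OF g] by metis
 show thesis
  by (rule that[of g "min rho1 rho2"]) (use g rho1 rho2 gB disj \<open>sig = 1\<close> \<open>tau = 1\<close> in auto)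
qed

end

section \<open>An annulus around the closed curve\<close>

lemma axis_tube:
 assumes S: "open S" "!!w. a <= w ==> w <= b ==> v2 w 0 : S"
 shows "EX eta>0. ALL w v. a <= w & w <= b & \<bar>v\<bar> < eta --> v2 w v : S"
proof -
 have "continuous_on {a..b} (%w. v2 w 0)" by (intro plat_continuous_on ballI plat_v2 plat_id plat_const)
 then have c: "compact ((%w. v2 w 0) ` {a..b})" by (intro compact_continuous_image) auto
 have "closed (- S)" "(%w. v2 w 0) ` {a..b} Int - S = {}" using S by auto
 then obtain eta where eta: "0 < eta" "!!x y. x : (%w. v2 w 0) ` {a..b} ==> y : - S ==> eta <= dist x y"
  using separate_compact_closed[OF c] by metis
 have "v2 w v : S" if "a <= w" "w <= b" "\<bar>v\<bar> < eta" for w v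
 proof (rule ccontr)
  assume "v2 w v ~: S"
  then have "eta <= dist (v2 w 0) (v2 w v)" using that by (intro eta(2)) auto
  also have "... <= n1 (v2 w 0 - v2 w v)" unfolding dist_norm by (rule norm_le_n1)
  also have "... = \<bar>v\<bar>" by (simp add: n1_def)
  finally show False using that by simp
 qed
 then show ?thesis using eta(1) by blast
qed

definition wide_ring :: "(real^2) set" where "wide_ring = {p. 1 < n1 p & n1 p < 16}"

text \<open>
 On the square \<open>n1 = t\<close> the function \<open>ring_U\<close> runs monotonically from \<open>-1\<close> to \<open>1\<close> over the upper
 half and over the lower half, with \<open>\<bar>ring_U\<bar> = 1\<close> on the horizontal axis only. The factor
 \<open>1 - \<bar>y\<bar>/32\<close> keeps it strictly monotone where \<open>\<bar>x\<bar> > 1\<close>.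
\<close>
definition ring_U :: "real^2 => real" where "ring_U p = clamp (1 - \<bar>p$2\<bar> / 32) (p$1)"

lemma clamp_strict_mono:
 assumes "x < x'" "\<bar>x\<bar> <= t" "\<bar>x'\<bar> <= t" "t < 16"
 shows "clamp (1 - (t - \<bar>x\<bar>) / 32) x < clamp (1 - (t - \<bar>x'\<bar>) / 32) x'"
proof -
 define a where "a = 1 - (t - \<bar>x\<bar>) / 32"
 define a' where "a' = 1 - (t - \<bar>x'\<bar>) / 32"
 have 1: "0 < a" "0 < a'" "32 * a = 32 - t + \<bar>x\<bar>" "32 * a' = 32 - t + \<bar>x'\<bar>" using assms(4) abs_ge_zero[of x] abs_ge_zero[of x'] unfolding a_def a'_def by argo+
 show ?thesis unfolding a_def[symmetric] a'_def[symmetric] clamp_def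
  using 1 assms by (smt (verit))
qed

lemma ring_U_inj:
 assumes "n1 p = n1 q" "n1 p < 16" "ring_U p = ring_U q" "0 <= p$2 & 0 <= q$2 | p$2 <= 0 & q$2 <= 0"
 shows "p = q"
proof -
 have 1: "\<bar>r$2\<bar> = n1 p - \<bar>r$1\<bar>" "\<bar>r$1\<bar> <= n1 p" if "r = p | r = q" for r using that assms(1) by (auto simp: n1_def)
 have "p$1 = q$1" using assms(3) 1 clamp_strict_mono[of "p$1" "q$1" "n1 p"] clamp_strict_mono[of "q$1" "p$1" "n1 p"] assms(2) unfolding ring_U_def by (smt (verit))
 moreover from this have "p$2 = q$2" using 1[of p] 1[of q] assms(4) by auto
 ultimately show ?thesis by (simp add: vec2_eq_iff)
qed

lemma ring_U_bound: assumes "p : wide_ring" shows "\<bar>ring_U p\<bar> <= 1 - \<bar>p$2\<bar> / 32" "ring_U p = 0 \<longleftrightarrow> p$1 = 0"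
proof -
 have "\<bar>p$2\<bar> < 16" using assms by (auto simp: wide_ring_def n1_def)
 then show "\<bar>ring_U p\<bar> <= 1 - \<bar>p$2\<bar> / 32" "ring_U p = 0 \<longleftrightarrow> p$1 = 0" unfolding ring_U_def clamp_def by auto
qed

lemma plat_ring_U: "plat ring_U p"
 unfolding ring_U_def[abs_def] clamp_def by (intro plat_intros)

context gate
begin

text \<open>Two thin strips, one along \<open>pt\<close> from -1/2 to 1/2 and one moved by
  \<open>g\<close>, should meet only where they are glued. Near the ends of the second strip the
  explicit germs of \<open>g\<close> decide; its middle part and the first arc are disjoint compact
  sets, which have disjoint neighbourhoods.\<close>

lemma loop_separated:
 assumes g: "G g" "0 < rho" "rho <= 1/8" "!!p. n1 p < rho ==> g (B (v2 (-3/4) 0 + p)) = B (v2 (1/2) 0 + p)"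
  "!!p. n1 p < rho ==> g (B (v2 (-1/2) 0 + p)) = B (v2 (-1/2) 0 + p)" "g ` J Int pt ` {-1/2..1/2} = {}"
 shows "EX eta>0. ALL w v b v'. \<bar>w\<bar> <= 1/2 & \<bar>v\<bar> < eta & -3/4 <= b & b <= -1/2 & \<bar>v'\<bar> < eta & B (v2 w v) = g (B (v2 b v')) -->
  v = v' & (w = 1/2 & b = -3/4 | w = -1/2 & b = -1/2)"
proof -
 have ag: "aut W0 g" using g(1) by (simp add: G_def)
 let ?I = "{-3/4 + rho/2..-1/2 - rho/2}"
 have disj: "disjnt (pt ` {-1/2..1/2}) (g ` pt ` ?I)" using g(2) g(6) unfolding disjnt_def by (force simp: J_def)
 have "compactin M (pt ` {-1/2..1/2})" "compactin M (g ` pt ` ?I)"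
  using g(2) by (auto intro!: aut_compactin[OF ag] pt_compact)
 then obtain U V where UV: "openin M U" "openin M V" "pt ` {-1/2..1/2} \<subseteq> U" "g ` pt ` ?I \<subseteq> V" "disjnt U V"
  using Hausdorff_space_compact_sets[of M] Hausdorff disj by metis
 define ZU where "ZU = {p:D 1. B p : U}"
 define ZV where "ZV = {p:D 1. B p : {x. g x : V}}"
 have "open ZU" unfolding ZU_def by (rule pe_vimage_open[OF B_pe UV(1)])
 moreover have "v2 w 0 : ZU" if "-1/2 <= w" "w <= 1/2" for w
  using that UV(3) by (auto simp: pt_def ZU_def)
 ultimately obtain eta1 where eta1: "0 < eta1" "!!w v. -1/2 <= w ==> w <= 1/2 ==> \<bar>v\<bar> < eta1 ==> v2 w v : ZU"
  using axis_tube[of ZU "-1/2" "1/2"] by metis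
 have "open ZV" unfolding ZV_def by (rule pe_vimage_open[OF B_pe aut_vimage_open[OF ag UV(2)]])
 moreover have "v2 w 0 : ZV" if "-3/4 + rho/2 <= w" "w <= -1/2 - rho/2" for w
  using that UV(4) g(2) by (auto simp: pt_def ZV_def)
 ultimately obtain eta2 where eta2: "0 < eta2"
  "!!w v. -3/4 + rho/2 <= w ==> w <= -1/2 - rho/2 ==> \<bar>v\<bar> < eta2 ==> v2 w v : ZV"
  using axis_tube[of ZV "-3/4 + rho/2" "-1/2 - rho/2"] by metis
 define eta where "eta = min (min eta1 eta2) (rho/2)"
 have eta: "0 < eta" "eta <= eta1" "eta <= eta2" "eta <= rho/2" using eta1(1) eta2(1) g(2) by (auto simp: eta_def)
 have "v = v' & (w = 1/2 & b = -3/4 | w = -1/2 & b = -1/2)"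
  if h: "\<bar>w\<bar> <= 1/2" "\<bar>v\<bar> < eta" "-3/4 <= b" "b <= -1/2" "\<bar>v'\<bar> < eta" "B (v2 w v) = g (B (v2 b v'))" for w v b v'
 proof -
  have w: "-1/2 <= w" "w <= 1/2" using h(1) by auto
  have v1: "\<bar>v\<bar> < 1/8" "\<bar>v'\<bar> < 1/8" using h(2,5) eta(4) g(3) by linarith+
  consider "b < -3/4 + rho/2" | "-1/2 - rho/2 < b" | "-3/4 + rho/2 <= b" "b <= -1/2 - rho/2" by linarith
  then show ?thesis
  proof cases
   case 1
   have e: "v2 (-3/4) 0 + v2 (b + 3/4) v' = v2 b v'" "v2 (1/2) 0 + v2 (b + 3/4) v' = v2 (b + 5/4) v'" by (auto simp: vec2_eq_iff)
   have "w = b + 5/4" "v = v'" using 1 h(3,5) eta(4) g(4)[of "v2 (b + 3/4) v'"] h(6) h(1,3) v1 g(3) B_inj unfolding e by auto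
   then show ?thesis using w h(3) by auto
  next
   case 2
   have e: "v2 (-1/2) 0 + v2 (b + 1/2) v' = v2 b v'" by (auto simp: vec2_eq_iff)
   have "w = b" "v = v'" using 2 h(4,5) eta(4) g(5)[of "v2 (b + 1/2) v'"] h(6) h(1,3,4) v1 B_inj unfolding e by auto
   then show ?thesis using w h(4) by auto
  next
   case 3
   show ?thesis using eta1(2)[OF w, of v] h(2) eta(2) eta2(2)[OF 3, of v'] h(5) eta(3) h(6) UV(5) unfolding disjnt_def by (auto simp: ZU_def ZV_def)
  qed
 qed
 then show ?thesis using eta(1) by blast
qed

text \<open>The upper half of the square ring parametrises the strip along \<open>pt\<close> from
  -1/2 to 1/2, the lower half the image under \<open>g\<close> of the strip from -3/4 to -1/2, with
  \<open>n1\<close> as transverse coordinate. On the horizontal axis both definitions agree by the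
  germ conditions of \<open>gate_loop\<close>.\<close>

lemma ring_chart:
 obtains e h where "0 < h" "h <= 1/64" "pe wide_ring e" "e ` wide_ring Int L = {}"
  "!!p. p : wide_ring ==> e p : s ` {0..} \<longleftrightarrow> p$1 = 0 & 0 < p$2"
  "!!t. 1 < t ==> t < 16 ==> e (v2 0 t) = B (v2 0 (h * (t - 8)))"
proof -
 obtain g rho where g: "G g" "0 < rho" "rho <= 1/8" "!!p. n1 p < rho ==> g (B (v2 (-3/4) 0 + p)) = B (v2 (1/2) 0 + p)"
  "!!p. n1 p < rho ==> g (B (v2 (-1/2) 0 + p)) = B (v2 (-1/2) 0 + p)" "g ` J Int pt ` {-1/2..1/2} = {}"
  by (rule gate_loop) blast
 obtain eta where eta: "0 < eta" "!!w v b v'. \<bar>w\<bar> <= 1/2 ==> \<bar>v\<bar> < eta ==> -3/4 <= b ==> b <= -1/2 ==> \<bar>v'\<bar> < eta ==>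
   B (v2 w v) = g (B (v2 b v')) ==> v = v' & (w = 1/2 & b = -3/4 | w = -1/2 & b = -1/2)"
  using loop_separated[OF g] by blast
 have ag: "aut W0 g" using g(1) by (simp add: G_def)
 \<comment> \<open>In \<open>wide_ring\<close> the number \<open>n1 p - 8\<close> is below 8 in
   absolute value, so the transverse coordinate stays below \<open>8 * h\<close>.\<close>
 define h where "h = min eta rho / 8"
 have h: "0 < h" "8 * h <= eta" "8 * h <= rho" "h <= 1/64" using eta(1) g(2,3) by (auto simp: h_def min_def)
 define k where "k p = v2 (ring_U p / 2) (h * (n1 p - 8))" for p
 define k' where "k' p = v2 (-1/2 - (ring_U p + 1) / 8) (h * (n1 p - 8))" for p
 have pk: "plat k p" "plat k' p" for p
  unfolding k_def[abs_def] k'_def[abs_def] by (intro plat_intros plat_ring_U)+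
 have vb: "\<bar>h * (n1 p - 8)\<bar> < 8 * h" if "p : wide_ring" for p using mult_strict_left_mono[of "\<bar>n1 p - 8\<bar>" 8 h] h(1) that by (auto simp: wide_ring_def abs_less_iff abs_mult mult.commute)
 have Ub: "\<bar>ring_U p\<bar> <= 1" if "p : wide_ring" for p using ring_U_bound(1)[OF that] by linarith
 have kD: "k p : D 1" "k' p : D 1" if "p : wide_ring" for p
 proof -
  have "\<bar>-1/2 - (ring_U p + 1) / 8\<bar> <= 3/4" using Ub[OF that] unfolding abs_le_iff by argo
  moreover have "\<bar>ring_U p / 2\<bar> <= 1/2" using Ub[OF that] by simp
  moreover have "\<bar>h * (n1 p - 8)\<bar> < 1/8" using vb[OF that] h(4) by linarith
  ultimately show "k p : D 1" "k' p : D 1" unfolding k_def k'_def mem_Collect_eq n1_v2 by linarith+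
 qed
 have oring: "open wide_ring" unfolding wide_ring_def
  using open_Int[OF open_Collect_less[OF continuous_on_const continuous_on_n1[OF continuous_on_id]]
   open_Collect_less[OF continuous_on_n1[OF continuous_on_id] continuous_on_const], of 1 16] by (simp add: Collect_conj_eq)
 define e1 where "e1 p = B (k p)" for p
 define e2 where "e2 p = g (B (k' p))" for p
 define e where "e p = (if 0 <= p$2 then e1 p else e2 p)" for p
 have pl1: "plm e1 p" and pl2: "plm e2 p" if "p : wide_ring" for p
 proof -
  have "plm B (k p)" using B_pe kD[OF that] by (simp add: pe_def)
  then show "plm e1 p" unfolding e1_def[abs_def] by (rule plm_comp[OF _ pk(1)])
  have "plm (%q. g (B q)) (k' p)" using aut_pe[OF ag B_pe] kD[OF that] by (simp add: pe_def)
  then show "plm e2 p" unfolding e2_def[abs_def] by (rule plm_comp[of "%q. g (B q)", OF _ pk(2)])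
 qed
 have eq: "e1 p = e2 p" if p: "p : wide_ring" "p$2 = 0" for p
 proof -
  have x: "1 < \<bar>p$1\<bar>" using p by (auto simp: wide_ring_def n1_def)
  have v: "n1 (v2 0 (h * (n1 p - 8))) < rho" using vb[OF p(1)] h(3) by simp
  show ?thesis
  proof (cases "0 < p$1")
   case True
   then have U: "ring_U p = 1" using x p(2) by (simp add: ring_U_def clamp_def)
   have "k p = v2 (1/2) 0 + v2 0 (h * (n1 p - 8))" "k' p = v2 (-3/4) 0 + v2 0 (h * (n1 p - 8))"
    unfolding k_def k'_def U by (simp_all add: vec2_eq_iff)
   then show ?thesis using g(4)[OF v] by (simp add: e1_def e2_def)
  next
   case False
   then have U: "ring_U p = -1" using x p(2) by (simp add: ring_U_def clamp_def)
   have "k p = v2 (-1/2) 0 + v2 0 (h * (n1 p - 8))" "k' p = v2 (-1/2) 0 + v2 0 (h * (n1 p - 8))"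
    unfolding k_def k'_def U by (simp_all add: vec2_eq_iff)
   then show ?thesis using g(5)[OF v] by (simp add: e1_def e2_def)
  qed
 qed
 have pl: "plm e p" if p: "p : wide_ring" for p
 proof (cases "p$2 = 0")
  case True
  have "\<forall>\<^sub>F q in nhds p. q : wide_ring" using oring p by (rule eventually_nhds_in_open)
  then have "\<forall>\<^sub>F q in nhds p. q$2 = 0 --> e1 q = e2 q" by eventually_elim (use eq in blast)
  then show ?thesis unfolding e_def[abs_def]
   by (intro plm_If pl1 pl2 p eq True plat_nth plat_id)
 next
  case False
  then consider "0 < p$2" | "p$2 < 0" by linarith
  then show ?thesis
  proof cases
   case 1
   have "\<forall>\<^sub>F q in nhds p. q : {q. 0 < q$2}"
    using 1 by (intro eventually_nhds_in_open open_Collect_less continuous_intros) auto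
   then have "\<forall>\<^sub>F q in nhds p. e1 q = e q" by eventually_elim (simp add: e_def)
   then show ?thesis by (rule plm_cong_ev[OF pl1[OF p]])
  next
   case 2
   have "\<forall>\<^sub>F q in nhds p. q : {q. q$2 < 0}"
    using 2 by (intro eventually_nhds_in_open open_Collect_less continuous_intros) auto
   then have "\<forall>\<^sub>F q in nhds p. e2 q = e q" by eventually_elim (simp add: e_def)
   then show ?thesis by (rule plm_cong_ev[OF pl2[OF p]])
  qed
 qed
 \<comment> \<open>A common point of the two strips lies over their ends, where
   \<open>ring_U\<close> has absolute value 1; strictly below the axis it is smaller.\<close>
 have mixed: False if p: "p : wide_ring" "q : wide_ring" "0 <= p$2" "q$2 < 0" "e1 p = e2 q" for p q
 proof -
  have "\<bar>ring_U q\<bar> = 1" using Ub[OF p(1)] Ub[OF p(2)] eta(2)[of "ring_U p / 2" "h * (n1 p - 8)" "-1/2 - (ring_U q + 1) / 8" "h * (n1 q - 8)"] vb[OF p(1)] vb[OF p(2)] h(2) p(5) unfolding abs_le_iff e1_def e2_def k_def k'_def by argo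
  then show False using ring_U_bound(1)[OF p(2)] p(4) by auto
 qed
 have "inj_on e wide_ring"
 proof (rule inj_onI)
  fix p q assume p: "p : wide_ring" and q: "q : wide_ring" and E: "e p = e q"
  have t: "n1 p < 16" using p by (simp add: wide_ring_def)
  show "p = q"
  proof (cases "0 <= p$2 \<longleftrightarrow> 0 <= q$2")
   case True
   have "ring_U p = ring_U q & h * (n1 p - 8) = h * (n1 q - 8)"
   proof (cases "0 <= p$2")
    case True
    then show ?thesis using E \<open>0 <= p$2 \<longleftrightarrow> 0 <= q$2\<close> B_inj kD p q by (auto simp: k_def e_def e1_def)
   next
    case False
    then show ?thesis using E \<open>0 <= p$2 \<longleftrightarrow> 0 <= q$2\<close> G_inj[OF g(1)] B_inj kD p q by (auto simp: k'_def e_def e2_def)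
   qed
   then show ?thesis using True h(1) by (intro ring_U_inj t) auto
  next
   case False
   then show ?thesis using mixed[of p q] mixed[of q p] p q E by (cases "0 <= p$2") (auto simp: e_def)
  qed
 qed
 moreover have gfix: "g x : Z \<longleftrightarrow> x : Z" if "Z Int W0 = {}" for x Z using G_W0[OF g(1), of x] G_fix[OF g(1), of x] that by auto
 have Lfree: "e p ~: L" if "p : wide_ring" for p
 proof -
  show ?thesis using gfix[of L "B (k' p)"] B_L kD[OF that] unfolding e_def e1_def e2_def by (auto simp: W0_def)
 qed
 have eInt: "e p : Int_M" if "p : wide_ring" for p
  using B_Int[OF kD(1)[OF that]] B_Int[OF kD(2)[OF that]] aut_Int_M[OF ag] by (simp add: e_def e1_def e2_def)
 ultimately have "pe wide_ring e" unfolding pe_def using oring pl by blast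
 moreover have "e p : s ` {0..} \<longleftrightarrow> p$1 = 0 & 0 < p$2" if p: "p : wide_ring" for p
 proof (cases "0 <= p$2")
  case True
  show ?thesis using B_s[OF kD(1)[OF p]] ring_U_bound(2)[OF p] True p by (auto simp: e_def e1_def k_def wide_ring_def n1_def)
 next
  case False
  show ?thesis using gfix[of "s ` {0..}" "B (k' p)"] B_s[OF kD(2)[OF p]] False Ub[OF p] by (auto simp: e_def e2_def k'_def W0_def)
 qed
 moreover have "e (v2 0 t) = B (v2 0 (h * (t - 8)))" if "1 < t" "t < 16" for t
  using that ring_U_bound(2)[of "v2 0 t"] by (simp add: e_def e1_def k_def wide_ring_def)
 ultimately show thesis using that[of h e] h Lfree by blast
qed

end

text \<open>Smaller than \<open>wide_ring\<close>, so that its closure is a compact part of the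
  domain of the embedding.\<close>

definition ring :: "(real^2) set" where "ring = {p. 2 < n1 p & n1 p < 15}"

context compact_boundary_surface
begin

lemma wide_ring_compact:
 assumes e: "pe wide_ring e" and ab: "1 < a" "b < 16" shows "compactin M (e ` {p. a <= n1 p & n1 p <= b})"
proof -
 have "compact (cD b Int {p. a <= n1 p})" by (intro compact_Int_closed compact_cD closed_Collect_le continuous_intros)
 moreover have "cD b Int {p. a <= n1 p} = {p. a <= n1 p & n1 p <= b}" by auto
 moreover have "{p. a <= n1 p & n1 p <= b} \<subseteq> wide_ring" using ab by (auto simp: wide_ring_def)
 ultimately show ?thesis by (intro pe_compact[OF e]) simp_all
qed

lemma wide_ring_pe: assumes "pe wide_ring e" shows "pe ring e"
proof (rule pe_subset[OF assms])
 have "open ({p. 2 < n1 p} Int {p. n1 p < 15})" by (intro open_Int open_Collect_less continuous_intros)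
 then show "open ring" by (simp add: ring_def Collect_conj_eq)
 show "ring \<subseteq> wide_ring" by (auto simp: ring_def wide_ring_def)
qed

lemma ring_exists:
 assumes s: "fray s" and L: "compactin M L" "surface_boundary A \<subseteq> L"
 obtains e tau where "pe wide_ring e" "e ` wide_ring Int L = {}"
  "!!p. p : wide_ring ==> e p : s ` {0..} \<longleftrightarrow> p$1 = 0 & 0 < p$2"
  "strict_mono_on {2..15} tau" "continuous_on {2..15} tau" "!!t. 2 <= t ==> t <= 15 ==> 0 <= tau t & s (tau t) = e (v2 0 t)"
proof -
 obtain K B gamma where K: "K \<subseteq> topspace M" "compactin M (M frontier_of K)" "M frontier_of K \<subseteq> Int_M" "M frontier_of K Int L = {}"
  "!!x W. x : M frontier_of K ==> openin M W ==> x : W ==> EX e. adapted lower K e & e 0 = x & e ` D 1 \<subseteq> W"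
  "adapted lower K B" "B ` D 1 Int L = {}" "!!p. p : D 1 ==> B p : s ` {0..} \<longleftrightarrow> p$1 = 0"
  "M frontier_of K Int s ` {0..} = {B 0}"
  "strict_mono_on {-1<..<1} gamma" "!!v. \<bar>v\<bar> < 1 ==> 0 <= gamma v & B (v2 0 v) = s (gamma v)"
  by (rule gate_crossing[OF s L]) blast
 interpret gate M A s L K B by unfold_locales (fact s L K)+
 obtain e h where e: "0 < h" "h <= 1/64" "pe wide_ring e" "e ` wide_ring Int L = {}"
  "!!p. p : wide_ring ==> e p : s ` {0..} \<longleftrightarrow> p$1 = 0 & 0 < p$2"
  "!!t. 1 < t ==> t < 16 ==> e (v2 0 t) = B (v2 0 (h * (t - 8)))" by (rule ring_chart) blast
 define tau where "tau t = gamma (h * (t - 8))" for t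
 have b: "\<bar>h * (t - 8)\<bar> < 1" if "1 < t" "t < 16" for t
 proof -
  have "\<bar>h * (t - 8)\<bar> <= 1/64 * 8" unfolding abs_mult using e(1,2) that by (intro mult_mono) (auto simp: abs_le_iff)
  then show ?thesis by simp
 qed
 have tau: "0 <= tau t & s (tau t) = e (v2 0 t)" if "1 < t" "t < 16" for t
  using K(11)[OF b[OF that]] e(6)[OF that] by (simp add: tau_def)
 have mono: "strict_mono_on {2..15} tau"
  unfolding strict_mono_on_def
 proof (intro allI impI)
  fix t t' :: real assume t: "t : {2..15} & t' : {2..15} & t < t'"
  then show "tau t < tau t'" using e(1) K(10) b[of t] b[of t'] t by (auto simp: strict_mono_on_def abs_less_iff tau_def)
 qed
 have cont: "continuous_on {2..15} tau"
 proof (rule fray_param_continuous[OF s])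
  have "continuous_on {2..15} (%t. v2 0 t)" by (intro plat_continuous_on ballI plat_v2 plat_id plat_const)
  then show "continuous_map (top_of_set {2..15}) M (%t. e (v2 0 t))" using continuous_map_compose[OF _ pe_continuous[OF e(3)], of "top_of_set {2..15}" "%t. v2 0 t"] by (auto simp: o_def wide_ring_def)
  show "0 <= tau t & e (v2 0 t) = s (tau t)" if "t : {2..15}" for t using tau[of t] that by simp
 qed
 show thesis
  by (rule that[OF e(3,4,5) mono cont]) (use tau in auto)
qed

end

text \<open>The inverse \<open>E\<close> is easier to write: since
  \<open>x + C * x = x / eps\<close>, it consists of two shifts by the increasing functions
  \<open>C * p$1\<close> and \<open>C * p$2\<close>, to which \<open>hmove\<close> and
  \<open>vmove\<close> apply. The half-height 7 gives the support radius 14, below the outer radius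
  15 of \<open>ring\<close>.\<close>

lemma plane_shrink:
 assumes eps: "0 < eps" "eps <= 1"
 shows "EX nu. plane_aut 14 nu & (ALL p. n1 p <= 4 --> nu p = eps *\<^sub>R p) & (ALL p. nu p $ 1 = 0 \<longleftrightarrow> p$1 = 0)"
proof -
 define C where "C = 1/eps - 1"
 have C: "0 <= C" "C * eps = 1 - eps" using eps by (auto simp: C_def field_simps)
 define h where "h = hmove 7 (%p. C * p$1)"
 define v where "v = vmove 7 (%p. C * p$2)"
 have h: "plane_aut 14 h" unfolding h_def using C(1) hmove_aut[of "%p. C * p$1" 7]
  by (simp add: mult_left_mono plat_cmult plat_nth plat_id)
 have v: "plane_aut 14 v" unfolding v_def using C(1) vmove_aut[of "%p. C * p$2" 7]
  by (simp add: mult_left_mono plat_cmult plat_nth plat_id)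
 define E where "E p = v (h p)" for p
 have E: "plane_aut 14 E" unfolding E_def[abs_def] by (rule plane_aut_comp[OF v h])
 then have bE: "bij E" by (simp add: plane_aut_def)
 have Es: "E (eps *\<^sub>R p) = p" if p: "n1 p <= 4" for p
 proof -
  have C4: "C * (eps * \<bar>x\<bar>) <= \<bar>x\<bar>" for x
  proof -
   have "C * eps * \<bar>x\<bar> <= 1 * \<bar>x\<bar>" using C(2) eps by (intro mult_right_mono) auto
   then show ?thesis by auto
  qed
  have e1: "eps * \<bar>x\<bar> <= \<bar>x\<bar>" for x using mult_right_mono[OF eps(2), of "\<bar>x\<bar>"] by simp
  have p12: "\<bar>p$1\<bar> + \<bar>p$2\<bar> <= 4" using p by (simp add: n1_def)
  have ex: "x * eps + C * (x * eps) = x" for x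
  proof -
   have "x * eps + C * (x * eps) = x * (eps + C * eps)" by (simp add: algebra_simps)
   then show ?thesis using C(2) by simp
  qed
  have "h (eps *\<^sub>R p) = v2 (eps * p$1 + C * (eps * p$1)) (eps * p$2)"
  proof -
   have "\<bar>C * (eps *\<^sub>R p)$1\<bar> <= 7 - n1 (eps *\<^sub>R p) / 2"
   proof -
    have "\<bar>C * (eps *\<^sub>R p)$1\<bar> = C * (eps * \<bar>p$1\<bar>)" "n1 (eps *\<^sub>R p) = eps * \<bar>p$1\<bar> + eps * \<bar>p$2\<bar>"
     using C(1) eps(1) by (simp_all add: n1_def abs_mult algebra_simps)
    then show ?thesis using C4[of "p$1"] e1[of "p$1"] e1[of "p$2"] p12 abs_ge_zero[of "p$2"] by argo
   qed
   then show ?thesis unfolding h_def by (subst hmove_eq) auto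
  qed
  also have "... = v2 (p$1) (eps * p$2)" using ex[of "p$1"] by (simp add: mult.commute)
  finally have hp: "h (eps *\<^sub>R p) = v2 (p$1) (eps * p$2)" .
  have "v (v2 (p$1) (eps * p$2)) = v2 (p$1) (eps * p$2 + C * (eps * p$2))"
  proof -
   have "\<bar>C * v2 (p$1) (eps * p$2) $ 2\<bar> <= 7 - n1 (v2 (p$1) (eps * p$2)) / 2"
   proof -
    have "\<bar>C * v2 (p$1) (eps * p$2) $ 2\<bar> = C * (eps * \<bar>p$2\<bar>)" "n1 (v2 (p$1) (eps * p$2)) = \<bar>p$1\<bar> + eps * \<bar>p$2\<bar>"
     using C(1) eps(1) by (simp_all add: abs_mult)
    then show ?thesis using C4[of "p$2"] e1[of "p$2"] p12 abs_ge_zero[of "p$2"] by argo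
   qed
   then show ?thesis unfolding v_def by (subst vmove_eq) auto
  qed
  then show ?thesis unfolding E_def hp using ex[of "p$2"] by (simp add: mult.commute)
 qed
 have E0: "E p $ 1 = 0 \<longleftrightarrow> p$1 = 0" for p
 proof -
  have "p$1 + clamp (bump 7 p) (C * p$1) = 0 \<longleftrightarrow> p$1 = 0"
  proof (cases "p$1 = 0")
   case False
   then consider "0 < p$1" | "p$1 < 0" by linarith
   then show ?thesis
   proof cases
    case 1
    then have "0 <= C * p$1" using C(1) by simp
    then have "0 <= clamp (bump 7 p) (C * p$1)" by (simp add: clamp_def max_def min_def)
    then show ?thesis using 1 by auto
   next
    case 2
    then have "C * p$1 <= 0" using C(1) by (simp add: mult_le_0_iff)
    then have "clamp (bump 7 p) (C * p$1) <= 0" by (simp add: clamp_def max_def min_def)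
    then show ?thesis using 2 by auto
   qed
  qed simp
  then show ?thesis by (simp add: E_def v_def vmove_alt h_def hmove_def)
 qed
 have iE: "inv E p = eps *\<^sub>R p" if "n1 p <= 4" for p
  using Es[OF that] inv_f_f[OF bij_is_inj[OF bE], of "eps *\<^sub>R p"] by simp
 have "inv E p $ 1 = 0 \<longleftrightarrow> p$1 = 0" for p
  using E0[of "inv E p"] surj_f_inv_f[OF bij_is_surj[OF bE], of p] by simp
 then show ?thesis using iE plane_aut_inv[OF E] by blast
qed

text \<open>After the shrinking everything is lifted by 5. The cut-off height
  \<open>7 - n1 p / 2\<close> is at least 5 on \<open>cD 4\<close>, so the shrunken disc is lifted
  rigidly.\<close>

lemma plane_drag:
 assumes eps: "0 < eps" "eps <= 1"
 shows "EX nu. plane_aut 14 nu & (ALL p. n1 p <= 4 --> nu p = v2 0 5 + eps *\<^sub>R p) & (ALL p. nu p $ 1 = 0 \<longleftrightarrow> p$1 = 0)"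
proof -
 obtain nu where nu: "plane_aut 14 nu" "!!p. n1 p <= 4 ==> nu p = eps *\<^sub>R p" "!!p. nu p $ 1 = 0 \<longleftrightarrow> p$1 = 0"
  using plane_shrink[OF eps] by blast
 have v: "plane_aut 14 (vmove 7 (%p. 5))" using vmove_aut[of "%p. 5" 7] by (simp add: plat_const)
 have vs: "vmove 7 (%p. 5) (nu p) = v2 0 5 + eps *\<^sub>R p" if p: "n1 p <= 4" for p
 proof -
  have "eps * n1 p <= 1 * 4" using eps p by (intro mult_mono) auto
  then have "\<bar>5\<bar> <= 7 - n1 (nu p) / 2" using nu(2)[OF p] eps(1) by simp
  then have "vmove 7 (%p. 5) (nu p) = v2 (nu p $ 1) (nu p $ 2 + 5)" by (rule vmove_eq)
  moreover have "nu p $ 1 = eps * p$1" "nu p $ 2 = eps * p$2" using nu(2)[OF p] by simp_all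
  ultimately show ?thesis by (simp add: vec2_eq_iff)
 qed
 have "vmove 7 (%p. 5) (nu p) $ 1 = 0 \<longleftrightarrow> p$1 = 0" for p using nu(3)[of p] by (simp add: vmove_alt)
 then show ?thesis using plane_aut_comp[OF v nu(1)] vs by auto
qed

lemma plane_aut_axis_mono:
 assumes nu: "plane_aut 14 nu" "!!p. nu p $ 1 = 0 \<longleftrightarrow> p$1 = 0"
 obtains gamma where "strict_mono_on {0..} gamma" "!!t. nu (v2 0 t) = v2 0 (gamma t)"
proof -
 define gamma where "gamma t = nu (v2 0 t) $ 2" for t
 have gamma: "nu (v2 0 t) = v2 0 (gamma t)" for t using nu(2)[of "v2 0 t"] by (simp add: gamma_def vec2_eq_iff)
 have "plat gamma t" for t
  unfolding gamma_def[abs_def] using nu(1)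
  by (intro plat_nth plat_comp[of "%t. v2 0 t" t nu] plat_v2 plat_const plat_id) (simp add: plane_aut_def)
 then have "continuous_on {0..} gamma" by (intro plat_continuous_on) blast
 moreover have "inj_on gamma {0..}"
 proof (rule inj_onI)
  fix t t' :: real assume "gamma t = gamma t'"
  then have "nu (v2 0 t) = nu (v2 0 t')" using gamma by simp
  then show "t = t'" using nu(1) by (simp add: plane_aut_def bij_def inj_eq)
 qed
 moreover have "gamma t = t" if "14 <= t" for t using nu(1) that by (simp add: plane_aut_def gamma_def)
 ultimately have "strict_mono_on {0..} gamma" by (rule strict_mono_eventually_id(1))
 then show thesis using that gamma by blast
qed

subsection \<open>Dragging along an annulus\<close>

text \<open>
 The automorphism \<open>drag theta\<close> below is \<open>theta\<close> conjugated by the partial map \<open>move nu\<close>, which lives in the annulus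
 \<open>e ` ring\<close> and carries the inner boundary of the annulus to a small circle about \<open>e (0, 5)\<close>. In
 effect the small disc about \<open>e (0, 5)\<close> fixed by \<open>theta\<close> is traded for the part of the surface
 inside the annulus.
\<close>
locale drag = compact_boundary_surface M A for M :: "'a topology" and A +
 fixes e :: "real^2 => 'a" and eps :: real and nu :: "real^2 => real^2"
 assumes e: "pe ring e" and eps: "0 < eps" "eps <= 1/8" and nu: "plane_aut 14 nu"
  and nu_small: "!!p. n1 p <= 4 ==> nu p = v2 0 5 + eps *\<^sub>R p" and nu_axis: "!!p. nu p $ 1 = 0 \<longleftrightarrow> p$1 = 0"
begin

text \<open>Only the part of the ring with \<open>3 < n1 p\<close> is moved, so there is a jump
  along \<open>n1 p = 3\<close>. It disappears after conjugation of maps that are the identity near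
  both images of this cut.\<close>

definition move :: "(real^2 => real^2) => 'a => 'a" where
 "move k x = (if x : e ` {p:ring. 3 < n1 p} then e (k (inv_into ring e x)) else x)"
definition Z where "Z = e ` {p:ring. n1 (nu p) <= 3}"
definition Z' where "Z' = e ` {p:ring. n1 (inv nu p) <= 3}"
definition drag :: "('a => 'a) => 'a => 'a" where
 "drag theta x = (if x : Z then x else move (inv nu) (theta (move nu x)))"
text \<open>The two conditions concern the two sides of the cut: the inner edge of the ring, and the
  small disc to which \<open>nu\<close> carries it. The radius 4 in place of 3 leaves a collar on
  which \<open>drag theta\<close> is the identity.\<close>

definition rigid :: "'a set => ('a => 'a) => bool" where
 "rigid W theta \<longleftrightarrow> aut W theta & (ALL p:ring. n1 p <= 4 --> theta (e p) = e p) & (ALL p. n1 p <= 4 --> theta (e (v2 0 5 + eps *\<^sub>R p)) = e (v2 0 5 + eps *\<^sub>R p))"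

lemma nu_inv: "inv nu (nu p) = p" "nu (inv nu p) = p"
 using nu by (auto simp: plane_aut_def bij_def inv_f_f surj_f_inv_f)

lemma nu_fix: "14 <= n1 p ==> nu p = p" "14 <= n1 p ==> inv nu p = p"
 using nu plane_aut_inv[OF nu] by (auto simp: plane_aut_def)

lemma nu_less: "n1 (nu p) < 15 \<longleftrightarrow> n1 p < 15" "n1 (inv nu p) < 15 \<longleftrightarrow> n1 p < 15"
 using plane_aut_less[OF plane_aut_mono[OF nu], of 15] plane_aut_less[OF plane_aut_mono[OF plane_aut_inv[OF nu]], of 15] by auto

lemma nu_plat: "plat nu p" "plat (inv nu) p" using nu by (auto simp: plane_aut_def)

lemma small_disc: assumes "n1 p <= 4" shows "4 < n1 (v2 0 5 + eps *\<^sub>R p)" "v2 0 5 + eps *\<^sub>R p : ring"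
proof -
 have "eps * n1 p <= 1/8 * 4" using eps assms by (intro mult_mono) auto
 moreover have "\<bar>n1 (v2 0 5 + eps *\<^sub>R p) - 5\<bar> <= eps * n1 p" using n1_triangle[of "v2 0 5" "eps *\<^sub>R p"] n1_triangle[of "v2 0 5 + eps *\<^sub>R p" "- (eps *\<^sub>R p)"] eps(1) by auto
 ultimately show "4 < n1 (v2 0 5 + eps *\<^sub>R p)" "v2 0 5 + eps *\<^sub>R p : ring" by (auto simp: ring_def abs_le_iff)
qed

lemma nu_far: "n1 p <= 4 ==> 4 < n1 (nu p)" using small_disc nu_small by simp

lemma inj_e: "p : ring ==> q : ring ==> e p = e q \<longleftrightarrow> p = q"
 using e by (auto simp: pe_def inj_on_def)

lemma e_mem: "p : ring ==> S \<subseteq> ring ==> e p : e ` S \<longleftrightarrow> p : S" using inj_e by blast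

lemma Z_iff: "p : ring ==> e p : Z \<longleftrightarrow> n1 (nu p) <= 3" unfolding Z_def by (subst e_mem) auto
lemma Z'_iff: "p : ring ==> e p : Z' \<longleftrightarrow> n1 (inv nu p) <= 3" unfolding Z'_def by (subst e_mem) auto

lemma move_e: "p : ring ==> move k (e p) = (if 3 < n1 p then e (k p) else e p)"
 unfolding move_def using e by (subst e_mem) (auto simp: pe_def)

lemma move_off: "x ~: e ` ring ==> move k x = x" unfolding move_def by auto

lemma move_outside: "k = nu | k = inv nu ==> x ~: e ` {p. 3 <= n1 p & n1 p <= 14} ==> move k x = x"
proof (cases "x : e ` ring")
 case True
 assume k: "k = nu | k = inv nu" and x: "x ~: e ` {p. 3 <= n1 p & n1 p <= 14}"
 obtain p where p: "p : ring" "x = e p" using True by blast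
 then show ?thesis using x p k nu_fix[of p] by (force simp: move_e)
qed (auto simp: move_off)

lemma ring_nu: assumes "p : ring" "3 < n1 (nu p)" shows "nu p : ring" using assms nu_less(1)[of p] by (auto simp: ring_def)
lemma ring_invnu: assumes "p : ring" "3 < n1 (inv nu p)" shows "inv nu p : ring" using assms nu_less(2)[of p] by (auto simp: ring_def)

text \<open>Together with \<open>inv_move\<close>: a bijection between the complements of
  \<open>Z\<close> and \<open>Z'\<close>. The set \<open>Z\<close> is what \<open>nu\<close> would
  push into the part left in place, and \<open>Z'\<close> is the small disc left uncovered.\<close>

lemma move_inv: assumes "x ~: Z" shows "move nu x ~: Z'" "move (inv nu) (move nu x) = x"
proof -
 have "move nu x ~: Z' & move (inv nu) (move nu x) = x"
 proof (cases "x : e ` ring")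
  case True
  then obtain p where p: "p : ring" "x = e p" by blast
  then have n: "3 < n1 (nu p)" using assms Z_iff by auto
  show ?thesis using p n ring_nu[OF p(1) n] nu_far[of "inv nu p"] by (auto simp: move_e Z'_iff nu_inv)
 next
  case False
  then show ?thesis by (auto simp: move_off Z'_def)
 qed
 then show "move nu x ~: Z'" "move (inv nu) (move nu x) = x" by auto
qed

lemma inv_move: assumes "x ~: Z'" shows "move (inv nu) x ~: Z" "move nu (move (inv nu) x) = x"
proof -
 have "move (inv nu) x ~: Z & move nu (move (inv nu) x) = x"
 proof (cases "x : e ` ring")
  case True
  then obtain p where p: "p : ring" "x = e p" by blast
  then have n: "3 < n1 (inv nu p)" using assms Z'_iff by auto
  show ?thesis using p n ring_invnu[OF p(1) n] nu_far[of p] by (auto simp: move_e Z_iff nu_inv)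
 next
  case False
  then show ?thesis by (auto simp: move_off Z_def)
 qed
 then show "move (inv nu) x ~: Z" "move nu (move (inv nu) x) = x" by auto
qed

lemma rigid_inv: assumes "rigid W theta" shows "rigid W (inv theta)"
proof -
 have a: "aut W theta" using assms by (simp add: rigid_def)
 have "inv theta x = x" if "theta x = x" for x using that inv_f_f[OF bij_is_inj[OF aut_bij[OF a]], of x] by simp
 then show ?thesis using assms aut_inv[OF a] by (auto simp: rigid_def)
qed

lemma Z'_eq: "x : Z' \<longleftrightarrow> (EX p. n1 p <= 3 & x = e (v2 0 5 + eps *\<^sub>R p))"
proof
 assume "x : Z'"
 then obtain q where q: "q : ring" "n1 (inv nu q) <= 3" "x = e q" by (auto simp: Z'_def)
 then show "EX p. n1 p <= 3 & x = e (v2 0 5 + eps *\<^sub>R p)"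
  using nu_small[of "inv nu q"] by (intro exI[of _ "inv nu q"]) (simp add: nu_inv)
next
 assume "EX p. n1 p <= 3 & x = e (v2 0 5 + eps *\<^sub>R p)"
 then obtain p where p: "n1 p <= 3" "x = e (v2 0 5 + eps *\<^sub>R p)" by blast
 then have "x = e (nu p)" "nu p : ring" using nu_small[of p] small_disc[of p] by auto
 then show "x : Z'" using p(1) by (simp add: Z'_iff nu_inv)
qed

lemma rigid_fixed: assumes "rigid W theta" "theta x = x" shows "theta y = x \<longleftrightarrow> y = x"
 using assms aut_bij[of W theta] by (auto simp: rigid_def bij_def inj_def)

lemma rigid_Z': assumes "rigid W theta" shows "theta x : Z' \<longleftrightarrow> x : Z'"
proof -
 have f: "theta z = z" if "z : Z'" for z using that assms by (auto simp: Z'_eq rigid_def)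
 show ?thesis using f rigid_fixed[OF assms f] by metis
qed

lemma drag_inverse:
 assumes theta: "rigid W theta" shows "drag (inv theta) (drag theta x) = x"
proof (cases "x : Z")
 case False
 have "move (inv nu) (theta (move nu x)) ~: Z" "move nu (move (inv nu) (theta (move nu x))) = theta (move nu x)" using move_inv(1)[OF False] rigid_Z'[OF theta] inv_move by auto
 moreover have "inv theta (theta y) = y" for y using theta aut_bij by (auto simp: rigid_def bij_def inv_f_f)
 ultimately show ?thesis using False move_inv(2)[OF False] by (simp add: drag_def)
qed (simp add: drag_def)

lemma rigid_inv_inv: "rigid W theta ==> inv (inv theta) = theta"
 using aut_bij by (auto simp: rigid_def inv_inv_eq)

lemma drag_bij: assumes theta: "rigid W theta" shows "bij (drag theta)" "inv (drag theta) = drag (inv theta)"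
proof -
 have 1: "drag (inv theta) (drag theta x) = x" "drag theta (drag (inv theta) x) = x" for x
  using drag_inverse[OF theta, of x] drag_inverse[OF rigid_inv[OF theta], of x] rigid_inv_inv[OF theta] by auto
 show "bij (drag theta)" by (rule bijI') (metis 1)+
 show "inv (drag theta) = drag (inv theta)" by (rule inv_equality) (use 1 in auto)
qed

lemma e_compact: assumes "closed S" "S \<subseteq> {p. 3 <= n1 p & n1 p <= 14}" shows "closedin M (e ` S)" "compactin M (e ` S)"
proof -
 have "compact (cD 15 Int S)" by (intro compact_Int_closed compact_cD assms)
 moreover have eq: "cD 15 Int S = S" using assms(2) by auto
 ultimately have "compact S" unfolding eq by blast
 moreover have "S \<subseteq> ring" using assms(2) by (force simp: ring_def)
 ultimately show "compactin M (e ` S)" by (rule pe_compact[OF e])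
 then show "closedin M (e ` S)" by (rule compactin_imp_closedin[OF Hausdorff])
qed

lemma closed_annulus: "closed {p. a <= n1 p & n1 p <= b}"
proof -
 have "closed ({p. a <= n1 p} Int {p. n1 p <= b})" by (intro closed_Int closed_Collect_le continuous_intros)
 then show ?thesis by (simp add: Collect_conj_eq)
qed

lemma move_lpl:
 assumes k: "k = nu | k = inv nu" and x: "x : topspace M" and
  good: "!!p. p : ring ==> x = e p ==> 3 < n1 p & 3 < n1 (k p)"
 shows "lpl (move k) x"
proof (cases "x : e ` ring")
 case True
 then obtain p where p: "p : ring" "x = e p" by blast
 have pk: "plat k q" for q using k nu_plat by auto
 have "plm e (k p)" using e k good[OF p] ring_nu[OF p(1)] ring_invnu[OF p(1)] by (auto simp: pe_def)
 then have 1: "plm (%q. e (k q)) p" by (rule plm_comp[OF _ pk])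
 have "open {q. 3 < n1 q}" by (intro open_Collect_less continuous_intros)
 moreover have "open ring" using e by (simp add: pe_def)
 ultimately have "open (ring Int {q. 3 < n1 q})" by blast
 then have "\<forall>\<^sub>F q in nhds p. q : ring Int {q. 3 < n1 q}" using p(1) good[OF p] by (intro eventually_nhds_in_open) auto
 then have "\<forall>\<^sub>F q in nhds p. e (k q) = move k (e q)" by eventually_elim (simp add: move_e)
 then have "plm (%q. move k (e q)) p" by (rule plm_cong_ev[OF 1])
 then show ?thesis by (rule lplI[OF e p(1) p(2)[symmetric]])
next
 case False
 let ?C = "e ` {p. 3 <= n1 p & n1 p <= 14}"
 have sub: "{p. 3 <= n1 p & n1 p <= 14} \<subseteq> ring" by (auto simp: ring_def)
 have "closedin M ?C" by (rule e_compact(1)[OF closed_annulus]) auto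
 then have "openin M (topspace M - ?C)" by blast
 then show ?thesis
 proof (rule lpl_id_on)
  show "x : topspace M - ?C" using False x sub by blast
  show "move k y = y" if "y : topspace M - ?C" for y using move_outside[OF k, of y] that by blast
 qed
qed

text \<open>Near the cut and near \<open>Z\<close> rigidity makes the map the identity. Elsewhere it
  is a composition of PL maps, as neither use of \<open>move\<close> comes near its jump.\<close>

lemma drag_lpl:
 assumes theta: "rigid W theta" and x: "x : Int_M" shows "lpl (drag theta) x"
proof -
 have a: "aut W theta" using theta by (simp add: rigid_def)
 have f1: "theta (e p) = e p" if "p : ring" "n1 p <= 4" for p using theta that by (simp add: rigid_def)
 have f2: "theta (e (nu p)) = e (nu p)" if "n1 p <= 4" for p using theta that by (simp add: rigid_def nu_small)
 have n1c: "open {p:ring. n1 (k p) < 4}" if "!!q. plat k q" for k :: "real^2 => real^2"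
 proof -
  have "continuous_on UNIV k" using that by (intro plat_continuous_on) blast
  then have "open {p. n1 (k p) < 4}" by (intro open_Collect_less continuous_intros)
  moreover have "open ring" using e by (simp add: pe_def)
  ultimately show ?thesis by (auto simp: Collect_conj_eq)
 qed
 have id: "drag theta (e p) = e p" if p: "p : ring" and n: "n1 p < 4 | n1 (nu p) < 4" for p
 proof (cases "e p : Z")
  case False
  have n3: "3 < n1 (nu p)" using False p Z_iff by auto
  show ?thesis using n f1[OF p] f2[of p] f1[OF ring_nu[OF p n3]] p False move_inv(2)[OF False] by (auto simp: drag_def move_e)
 qed (simp add: drag_def)
 show ?thesis
 proof (cases "EX p:ring. x = e p & (n1 p < 4 | n1 (nu p) < 4)")
  case True
  have o: "openin M (e ` {p:ring. n1 p < 4})" "openin M (e ` {p:ring. n1 (nu p) < 4})"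
   using pe_open[OF pe_subset[OF e]] n1c[OF plat_id] n1c[OF nu_plat(1)] by auto
  have "drag theta y = y" if "y : e ` {p:ring. n1 p < 4} Un e ` {p:ring. n1 (nu p) < 4}" for y using that id by auto
  moreover have "x : e ` {p:ring. n1 p < 4} Un e ` {p:ring. n1 (nu p) < 4}" using True by blast
  ultimately show ?thesis using lpl_id_on[OF openin_Un[OF o]] by blast
 next
  case False
  have ng: "4 <= n1 p & 4 <= n1 (nu p)" if "p : ring" "x = e p" for p using False that by force
  have xt: "x : topspace M" using x Int_M_subset by blast
  have 1: "lpl (move nu) x" by (rule move_lpl) (use xt ng in force)+
  define y where "y = move nu x"
  have y: "4 <= n1 q & 4 <= n1 (inv nu q)" if q: "q : ring" "y = e q" for q
  proof (cases "x : e ` ring")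
   case True
   then obtain p where p: "p : ring" "x = e p" by blast
   then show ?thesis using ng[OF p] ring_nu[OF p(1)] q inj_e by (auto simp: nu_inv y_def move_e)
  next
   case False
   then show ?thesis using q by (auto simp: y_def move_off)
  qed
  have yI: "y : Int_M"
  proof (cases "x : e ` ring")
   case True
   then obtain p where p: "p : ring" "x = e p" by blast
   then show ?thesis using ng[OF p] ring_nu[OF p(1)] e by (auto simp: pe_def y_def move_e)
  qed (use x in \<open>auto simp: y_def move_off\<close>)
  have 2: "lpl theta y" by (rule aut_lpl[OF a yI])
  have z: "4 <= n1 q & 4 <= n1 (inv nu q)" if q: "q : ring" "theta y = e q" for q using f1[OF q(1)] f2[of "inv nu q"] rigid_fixed[OF theta] q(2) y[OF q(1)] by (force simp: nu_inv)
  have "theta y : topspace M" using aut_Int_M[OF a] yI Int_M_subset by blast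
  then have 3: "lpl (move (inv nu)) (theta y)" by (intro move_lpl) (use z in force)+
  have 4: "lpl (%u. move (inv nu) (theta (move nu u))) x"
   using lpl_comp[OF lpl_comp[OF 1 2[unfolded y_def]] 3[unfolded y_def]] .
  have Zc: "closedin M Z" unfolding Z_def
  proof -
   have "continuous_on UNIV nu" using nu_plat by (intro plat_continuous_on) blast
   then have "closed ({p. n1 (nu p) <= 3} Int {p. 4 <= n1 p & n1 p <= 14})"
    by (intro closed_Int closed_annulus closed_Collect_le continuous_intros)
   moreover have "{p:ring. n1 (nu p) <= 3} = {p. n1 (nu p) <= 3} Int {p. 4 <= n1 p & n1 p <= 14}"
   proof (rule set_eqI)
    fix p
    show "p : {p:ring. n1 (nu p) <= 3} \<longleftrightarrow> p : {p. n1 (nu p) <= 3} Int {p. 4 <= n1 p & n1 p <= 14}" using nu_far[of p] nu_fix(1)[of p] by (force simp: ring_def)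
   qed
   ultimately show "closedin M (e ` {p:ring. n1 (nu p) <= 3})" by (intro e_compact(1)) auto
  qed
  show ?thesis
  proof (rule lpl_cong[OF 4])
   show "openin M (topspace M - Z)" using Zc by blast
   show "x : topspace M - Z" using xt ng by (force simp: Z_def)
  qed (simp add: drag_def)
 qed
qed

lemma drag_aut: assumes theta: "rigid W theta" shows "aut (W Un e ` ring) (drag theta)"
proof -
 have a: "aut W theta" using theta by (simp add: rigid_def)
 obtain K where K: "compactin M K" "K \<subseteq> W" "K \<subseteq> Int_M" "!!x. x ~: K ==> theta x = x" using aut_supp[OF a] by metis
 let ?C = "e ` {p. 3 <= n1 p & n1 p <= 14}"
 have C: "compactin M ?C" by (rule e_compact(2)[OF closed_annulus]) auto
 have "drag theta x = x" if x: "x ~: K Un ?C" for x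
  using x K(4)[of x] move_outside[of nu x] move_outside[of "inv nu" x] by (auto simp: drag_def)
 moreover have "compactin M (K Un ?C)" using K(1) C by (rule compactin_Un)
 moreover have "K Un ?C \<subseteq> W Un e ` ring" "K Un ?C \<subseteq> Int_M" using K(2,3) e unfolding pe_def by (auto simp: ring_def)
 ultimately have "EX K. compactin M K & K \<subseteq> W Un e ` ring & K \<subseteq> Int_M & (ALL x. x ~: K --> drag theta x = x)" by blast
 then show ?thesis unfolding aut_def
  using drag_bij[OF theta] drag_lpl[OF theta] drag_lpl[OF rigid_inv[OF theta]] by simp
qed

text \<open>Here \<open>I\<close> is the initial piece common to both rays, up to
  \<open>(0, 5)\<close> in the ring. Its points off the moved part stay fixed, and those of
  \<open>S\<close> in the moved part are first pushed past \<open>(0, 5 + 3 * eps)\<close>. So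
  \<open>theta\<close> acts on the ray only beyond \<open>I\<close>, where the assumption
  \<open>tail\<close> controls it; what it does to the ray just before \<open>(0, 5)\<close> is
  never seen.\<close>

lemma drag_maps:
 assumes theta: "rigid W theta"
  and S: "!!p. p : ring ==> 3 < n1 p ==> n1 p <= 14 ==> e p : S \<longleftrightarrow> p$1 = 0 & 0 < p$2"
  and S': "!!p. p : ring ==> 3 < n1 p ==> n1 p <= 14 ==> e p : S' \<longleftrightarrow> p$1 = 0 & 0 < p$2"
  and I: "I \<subseteq> S'" "!!t. 2 < t ==> t < 15 ==> e (v2 0 t) : I \<longleftrightarrow> t < 5"
   "!!x. x : I ==> x ~: e ` {p:ring. 3 < n1 p & n1 p <= 14} ==> theta x = x"
  and tail: "!!x. x : S ==> x ~: I ==> theta x : S' - I"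
  and x: "x : S"
 shows "drag theta x : S'"
proof -
 obtain gamma where gamma: "strict_mono_on {0..} gamma" "!!t. nu (v2 0 t) = v2 0 (gamma t)"
  using plane_aut_axis_mono[OF nu nu_axis] by blast
 have gammaless: "gamma t < gamma t'" if "0 <= t" "t < t'" for t t' using gamma(1) that by (auto simp: strict_mono_on_def)
 have gamma3: "gamma 3 = 5 + 3 * eps" using gamma(2)[of 3] nu_small[of "v2 0 3"] by (simp add: vec2_eq_iff)
 have gamma14: "gamma 14 = 14" using gamma(2)[of 14] nu_fix(1)[of "v2 0 14"] by auto
 let ?N = "{p:ring. 3 < n1 p & n1 p <= 14}"
 have on: "EX t. z = e (v2 0 t) & 3 < t & t <= 14" if zN: "z : e ` ?N" and SS: "z : S | z : S'" for z
 proof -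
  obtain p where p: "p : ring" "3 < n1 p" "n1 p <= 14" "z = e p" using zN by auto
  then have ax: "p$1 = 0" "0 < p$2" using S[OF p(1,2,3)] S'[OF p(1,2,3)] SS by auto
  then have "p = v2 0 (p$2)" by (simp add: vec2_eq_iff)
  moreover have "n1 p = p$2" using ax by (simp add: n1_def)
  ultimately show ?thesis using p by metis
 qed
 have ax_ring: "v2 0 t : ring" if "2 < t" "t < 15" for t using that by (simp add: ring_def)
 have off: "move k z = z" if "k = nu | k = inv nu" "z ~: e ` ?N" for k z
 proof (cases "z : e ` ring")
  case True
  then obtain p where p: "p : ring" "z = e p" by blast
  then show ?thesis using that(2) p that(1) nu_fix[of p] by (force simp: move_e)
 qed (auto simp: move_off)
 have fin: "move (inv nu) z : S'" if z: "z : S'" and far: "!!t. z = e (v2 0 t) ==> 3 < t ==> t <= 14 ==> 5 + 3 * eps < t" for z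
 proof (cases "z : e ` ?N")
  case True
  then obtain t where t: "z = e (v2 0 t)" "3 < t" "t <= 14" using on z by blast
  define p where "p = inv nu (v2 0 t)"
  have p: "nu p = v2 0 t" by (simp add: p_def nu_inv)
  have "p$1 = 0" using nu_axis[of p] p by simp
  then have pv: "p = v2 0 (p$2)" by (simp add: vec2_eq_iff)
  then have gammap: "gamma (p$2) = t" using gamma(2)[of "p$2"] p by simp
  have "5 + 3 * eps < t" using far t by blast
  \<comment> \<open>Three ranges are excluded: by monotonicity of \<open>gamma\<close>, by the
    explicit form of \<open>nu\<close> on \<open>cD 4\<close>, and far below by injectivity, since
    \<open>gamma\<close> already takes the value \<open>t\<close> between 3 and 14.\<close>
  have p2: "3 < p$2"
  proof (rule ccontr)
   assume neg: "~ ?thesis"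
   consider "0 <= p$2" | "-4 <= p$2" "p$2 < 0" | "p$2 < -4" by linarith
   then show False
   proof cases
    case 1
    then show False using gammaless[of "p$2" 3] neg gammap gamma3 \<open>5 + 3 * eps < t\<close> by force
   next
    case 2
    then have "nu p = v2 0 5 + eps *\<^sub>R p" by (intro nu_small) (subst pv, simp)
    then show False using p \<open>5 + 3 * eps < t\<close> 2 eps by (simp add: vec2_eq_iff)
   next
    case 3
    have 6: "nu (v2 0 (p$2)) ~= nu (v2 0 u)" if "0 <= u" for u using that 3 nu by (auto simp: plane_aut_def bij_def inj_eq)
    have "continuous_on {3..14} gamma"
    proof -
     have "plat (%t. nu (v2 0 t) $ 2) u" for u
      by (intro plat_nth plat_comp[of "%t. v2 0 t" u nu] plat_v2 plat_const plat_id nu_plat)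
     then show ?thesis using plat_continuous_on[of "{3..14}" "%t. nu (v2 0 t) $ 2"] by (simp add: gamma(2))
    qed
    then obtain u where "3 <= u" "u <= 14" "gamma u = t"
     using IVT'[of gamma 3 t 14] gamma3 gamma14 t \<open>5 + 3 * eps < t\<close> by auto
    then show False using 6[of u] gamma(2) gammap by simp
   qed
  qed
  have "p$2 <= 14" using gammaless[of 14 "p$2"] gammap gamma14 t(3) by force
  then show ?thesis using p2 \<open>p$1 = 0\<close> S'[of p] t by (auto simp: move_e p_def ring_def n1_def)
 qed (use off z in auto)
 have fixd: "theta (e (v2 0 t)) = e (v2 0 t)" if "5 <= t" "t <= 5 + 3 * eps" for t
 proof -
  have "n1 (v2 0 ((t - 5) / eps)) <= 4" using that eps(1) by (simp add: field_simps)
  then have "theta (e (v2 0 5 + eps *\<^sub>R v2 0 ((t - 5) / eps))) = e (v2 0 5 + eps *\<^sub>R v2 0 ((t - 5) / eps))"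
   using theta by (simp add: rigid_def)
  moreover have "v2 0 5 + eps *\<^sub>R v2 0 ((t - 5) / eps) = v2 0 t" using eps(1) by (simp add: vec2_eq_iff)
  ultimately show ?thesis by simp
 qed
 have main: "move (inv nu) (theta y) : S'" if y: "y : S" "y ~: I" and far: "!!t. y = e (v2 0 t) ==> 3 < t ==> t <= 14 ==> 5 + 3 * eps < t" for y
 proof (rule fin)
  show "theta y : S'" using tail y by blast
  show "5 + 3 * eps < t" if t: "theta y = e (v2 0 t)" "3 < t" "t <= 14" for t using tail[OF y] t I(2)[of t] fixd[of t] rigid_fixed[OF theta] t(1) far by force
 qed
 show ?thesis
 proof (cases "x : e ` ?N")
  case True
  then obtain t where t: "x = e (v2 0 t)" "3 < t" "t <= 14" using on x by blast
  have g: "5 + 3 * eps < gamma t" using gammaless[of 3 t] t gamma3 by simp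
  have g14: "gamma t <= 14" using gammaless[of t 14] t gamma14 by force
  have r: "v2 0 t : ring" "v2 0 (gamma t) : ring" using t g g14 eps by (auto simp: ring_def)
  have xZ: "x ~: Z" using r(1) t(1) g eps by (simp add: Z_iff gamma(2))
  have m: "move nu x = e (v2 0 (gamma t))" using t r(1) by (simp add: move_e gamma(2))
  have "move (inv nu) (theta (e (v2 0 (gamma t)))) : S'"
  proof (rule main)
   show "e (v2 0 (gamma t)) : S" using S[OF r(2)] g g14 eps by simp
   show "e (v2 0 (gamma t)) ~: I" using I(2)[of "gamma t"] g g14 eps by simp
   show "5 + 3 * eps < u" if "e (v2 0 (gamma t)) = e (v2 0 u)" "3 < u" "u <= 14" for u
    using that inj_e[OF r(2) ax_ring[of u]] g by simp
  qed
  then show ?thesis using xZ m by (simp add: drag_def)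
 next
  case False
  have "Z \<subseteq> e ` ?N"
  proof
   fix z assume "z : Z"
   then obtain p where p: "p : ring" "n1 (nu p) <= 3" "z = e p" by (auto simp: Z_def)
   show "z : e ` ?N" using nu_far[of p] nu_fix(1)[of p] p(2) p by force+
  qed
  then have xZ: "x ~: Z" using False by blast
  have m: "move nu x = x" using off False by blast
  show ?thesis
  proof (cases "x : I")
   case True
   then show ?thesis using I(3) False True I(1) xZ m off by (auto simp: drag_def)
  next
   case ni: False
   have "x ~= e (v2 0 t)" if "3 < t" "t <= 14" for t using False that ax_ring[of t] by auto
   then have "move (inv nu) (theta x) : S'" by (intro main x ni) blast
   then show ?thesis using xZ m by (simp add: drag_def)
  qed
 qed
qed

end

context compact_boundary_surface
begin

lemma drag_exists:
 assumes e: "pe ring e" and theta: "aut W theta" "!!p. p : ring ==> n1 p <= 4 ==> theta (e p) = e p"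
  and germ: "0 < rho" "!!p. n1 p < rho ==> theta (e (v2 0 5 + p)) = e (v2 0 5 + p)"
  and S: "!!p. p : ring ==> 3 < n1 p ==> n1 p <= 14 ==> e p : S \<longleftrightarrow> p$1 = 0 & 0 < p$2"
  and S': "!!p. p : ring ==> 3 < n1 p ==> n1 p <= 14 ==> e p : S' \<longleftrightarrow> p$1 = 0 & 0 < p$2"
  and I: "I \<subseteq> S" "I \<subseteq> S'" "!!t. 2 < t ==> t < 15 ==> e (v2 0 t) : I \<longleftrightarrow> t < 5"
   "!!x. x : I ==> x ~: e ` {p:ring. 3 < n1 p & n1 p <= 14} ==> theta x = x"
  and tail: "theta ` (S - I) = S' - I"
 shows "EX phi. aut (W Un e ` ring) phi & phi ` S = S'"
proof -
 \<comment> \<open>The disc of radius \<open>4 * eps\<close> about \<open>(0, 5)\<close> has to lie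
   where \<open>theta\<close> is known to be the identity, and away from
   \<open>cD 4\<close>.\<close>
 define eps where "eps = min (1/8) (rho/8)"
 have eps: "0 < eps" "eps <= 1/8" "eps <= rho/8" using germ(1) by (auto simp: eps_def)
 obtain nu where nu: "plane_aut 14 nu" "!!p. n1 p <= 4 ==> nu p = v2 0 5 + eps *\<^sub>R p" "!!p. nu p $ 1 = 0 \<longleftrightarrow> p$1 = 0"
  using plane_drag[of eps] eps by auto
 have "n1 (eps *\<^sub>R p) < rho" if "n1 p <= 4" for p
 proof -
  have "eps * n1 p <= rho/8 * n1 p" by (rule mult_right_mono[OF eps(3)]) simp
  also have "... <= rho/8 * 4" using germ(1) that by (intro mult_left_mono) auto
  finally have "eps * n1 p <= rho/8 * 4" .
  then show ?thesis using germ(1) eps(1) by simp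
 qed
 note near = this
 interpret drag M A e eps nu by unfold_locales (fact e eps nu)+
 have r: "rigid W theta" unfolding rigid_def using theta germ(2) near by blast
 have b: "bij theta" by (rule aut_bij[OF theta(1)])
 have "drag theta ` S \<subseteq> S'"
 proof
  fix y assume "y : drag theta ` S"
  then obtain x where x: "x : S" "y = drag theta x" by blast
  have "theta z : S' - I" if "z : S" "z ~: I" for z using that tail by blast
  then show "y : S'" using drag_maps[OF r S S' I(2,3,4) _ x(1)] x(2) by blast
 qed
 moreover have "S' \<subseteq> drag theta ` S"
 proof
  fix y assume y: "y : S'"
  have 1: "inv theta z : S - I" if z: "z : S'" "z ~: I" for z
  proof -
   obtain x where "x : S - I" "z = theta x" using z tail by blast
   then show ?thesis using inv_f_f[OF bij_is_inj[OF b]] by simp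
  qed
  have 2: "inv theta x = x" if "x : I" "x ~: e ` {p:ring. 3 < n1 p & n1 p <= 14}" for x
   using I(4)[OF that] inv_f_f[OF bij_is_inj[OF b], of x] by simp
  show "y : drag theta ` S" using drag_maps[OF rigid_inv[OF r] S' S I(1,3) 2 1 y] drag_inverse[OF rigid_inv[OF r], of y] rigid_inv_inv[OF r] by force
 qed
 ultimately show ?thesis using drag_aut[OF r] by blast
qed

end

section \<open>Splicing two rays\<close>

lemma corner_map:
 assumes A: "(A::real^2) ~= 0" "~ (A$2 = 0 & A$1 < 0)"
 obtains k l where "inj k" "!!p. plat k p" "0 < l" "!!u. u <= 0 ==> k (v2 u 0) = v2 u 0" "!!u. 0 <= u ==> k (v2 u 0) = (l * u) *\<^sub>R A"
proof (cases "A$2 = 0")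
 case True
 then have "0 < A$1" using A by (metis linorder_neqE_linordered_idom vec2_eq_iff zero_index)
 then show thesis using True by (intro that[of "%p. p" "1 / A$1"] plat_id) (auto simp: vec2_eq_iff)
next
 case False
 \<comment> \<open>The function \<open>w\<close> bends the right half-plane so that the positive
   axis reaches the height of \<open>A\<close>; the shear by \<open>d\<close> then corrects the
   first coordinate and leaves the negative axis alone.\<close>
 define d where "d = (A$1 - 1) / A$2"
 define w where "w p = p$2 + A$2 * max (p$1) 0" for p :: "real^2"
 define k where "k p = v2 (p$1 + d * w p) (w p)" for p
 have dA: "d * A$2 = A$1 - 1" using False by (simp add: d_def)
 show thesis
 proof (rule that[of k 1])
  show "plat k p" for p unfolding k_def[abs_def] w_def by (intro plat_intros)
  show "inj k"
  proof (rule injI)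
   fix p q assume "k p = k q"
   then show "p = q" by (auto simp: w_def vec2_eq_iff k_def)
  qed
  show "k (v2 u 0) = v2 u 0" if "u <= 0" for u using that by (simp add: k_def w_def)
  show "k (v2 u 0) = (1 * u) *\<^sub>R A" if "0 <= u" for u
  proof -
   have "u + d * (A$2 * u) = u + (d * A$2) * u" by auto
   also have "... = u * A$1" unfolding dA by (simp add: algebra_simps)
   finally show ?thesis using that by (simp add: k_def w_def vec2_eq_iff mult.commute)
  qed
 qed simp
qed

context compact_boundary_surface
begin

lemma pe_shrink:
 assumes e: "pe (D 1) e" and W: "openin M W" "e 0 : W"
 obtains c where "0 < c" "c <= 1" "pe (D 1) (%p. e (c *\<^sub>R p))" "(%p. e (c *\<^sub>R p)) ` D 1 \<subseteq> W"
proof -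
 have o: "open {p:D 1. e p : W}" by (rule pe_vimage_open[OF e W(1)])
 have "0 : {p:D 1. e p : W}" using W(2) by simp
 then obtain r where r: "0 < r" "!!p. n1 (p - 0) < r ==> p : {p:D 1. e p : W}" using open_n1_ball[OF o] by blast
 define c where "c = min r 1"
 have c: "0 < c" "c <= 1" "c <= r" using r(1) by (auto simp: c_def)
 have cp: "c *\<^sub>R p : D 1 & e (c *\<^sub>R p) : W" if "p : D 1" for p
 proof -
  have "c * n1 p < c * 1" using that c(1) by auto
  moreover have "n1 (c *\<^sub>R p - 0) = c * n1 p" using c(1) by simp
  ultimately have "n1 (c *\<^sub>R p - 0) < r" using c(3) by linarith
  then show ?thesis using r(2) by blast
 qed
 have "pe (D 1) (%p. e (c *\<^sub>R p))"
 proof (rule pe_comp[OF e, of "D 1" "%p. c *\<^sub>R p"])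
  show "inj_on (%p. c *\<^sub>R p) (D 1)" using c(1) by (auto simp: inj_on_def)
  show "plat (%p. c *\<^sub>R p) p" for p by (intro plat_scaleR plat_id)
 qed (use cp in auto)
 then show thesis using that c cp by blast
qed

lemma adapted_flip:
 assumes "adapted axis Z e" "is_sign sig" "is_sign tau" shows "adapted axis Z (%p. e (flip sig tau p))"
proof -
 have nz: "sig ~= 0" "tau ~= 0" using assms(2,3) by (auto simp: is_sign_def)
 have pe: "pe (D 1) e" using assms(1) by (simp add: adapted_def)
 have "pe (D 1) (%p. e (flip sig tau p))"
 proof (rule pe_comp[OF pe, of "D 1" "flip sig tau"])
  show "inj_on (flip sig tau) (D 1)" using nz by (auto simp: inj_on_def flip_def vec2_eq_iff)
  show "plat (flip sig tau) p" for p unfolding flip_def[abs_def] by (intro plat_intros)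
 qed (use assms(2,3) in auto)
 then show ?thesis using assms nz by (simp add: adapted_def axis_def)
qed

text \<open>Orders the axis of the chart like the parameter of the ray.\<close>
lemma fray_oriented_chart:
 assumes s: "fray s" and t: "0 < t" and W: "openin M W" "s t : W"
 obtains e where "adapted axis (s ` {0..}) e" "e ` D 1 \<subseteq> W" "e 0 = s t"
  "!!p. p : D 1 ==> e p : s ` {0..t} \<longleftrightarrow> p$2 = 0 & p$1 <= 0" "!!p. p : D 1 ==> e p : s ` {t..} \<longleftrightarrow> p$2 = 0 & 0 <= p$1"
proof -
 obtain e where e: "adapted axis (s ` {0..}) e" "e ` D 1 \<subseteq> W" "e 0 = s t" using fray_adapted_in[OF s t W] by blast
 have pe: "pe (D 1) e" using e by (simp add: adapted_def)
 have "e (v2 u 0) : s ` {0..}" if "u : {-1<..<1}" for u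
  using e(1) that by (auto simp: adapted_def axis_def abs_less_iff)
 then have "(%u. e (v2 u 0)) ` {-1<..<1} \<subseteq> s ` {0..}" by blast
 then obtain gamma where m: "strict_mono_on {-1<..<1} gamma | strict_antimono_on {-1<..<1} gamma" and gamma: "!!u. u : {-1<..<1} ==> 0 <= gamma u & e (v2 u 0) = s (gamma u)" using fray_arc[OF s _ pe_axis[OF pe]] by auto
 have v20: "v2 0 0 = 0" by (simp add: vec2_eq_iff)
 have gamma0: "gamma 0 = t" using gamma[of 0] e(3) fray_inj[OF s, of "gamma 0" t] t by (simp add: v20)
 have "EX sig. is_sign sig & (ALL u:{-1<..<1}. (gamma u <= t \<longleftrightarrow> sig * u <= 0) & (t <= gamma u \<longleftrightarrow> 0 <= sig * u))"
  using m
 proof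
  assume m: "strict_mono_on {-1<..<1} gamma"
  have "(gamma u <= gamma 0 \<longleftrightarrow> u <= 0) & (gamma 0 <= gamma u \<longleftrightarrow> 0 <= u)" if u: "u : {-1<..<1}" for u
   using strict_mono_on_less_eq[OF m, of u 0] strict_mono_on_less_eq[OF m, of 0 u] u by simp
  then show ?thesis unfolding gamma0 by (intro exI[of _ 1]) (auto simp: is_sign_def)
 next
  assume "strict_antimono_on {-1<..<1} gamma"
  then have m: "strict_mono_on {-1<..<1} (%u. - gamma u)" by (auto simp: monotone_on_def)
  have "(gamma u <= gamma 0 \<longleftrightarrow> 0 <= u) & (gamma 0 <= gamma u \<longleftrightarrow> u <= 0)" if u: "u : {-1<..<1}" for u
   using strict_mono_on_less_eq[OF m, of u 0] strict_mono_on_less_eq[OF m, of 0 u] u by simp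
  then show ?thesis unfolding gamma0 by (intro exI[of _ "-1"]) (auto simp: is_sign_def)
 qed
 then obtain sig where sig: "is_sign sig" "!!u. u : {-1<..<1} ==> (gamma u <= t \<longleftrightarrow> sig * u <= 0) & (t <= gamma u \<longleftrightarrow> 0 <= sig * u)" by blast
 define e' where "e' p = e (flip sig 1 p)" for p
 have s1: "is_sign 1" by (simp add: is_sign_def)
 have ad: "adapted axis (s ` {0..}) e'" unfolding e'_def[abs_def] by (rule adapted_flip[OF e(1) sig(1) s1])
 have img: "e' ` D 1 \<subseteq> W" using e(2) sig(1) s1 by (auto simp: e'_def)
 have "flip sig 1 0 = 0" by (simp add: vec2_eq_iff)
 then have cen: "e' 0 = s t" using e(3) by (simp add: e'_def)
 have key: "e' p = s (gamma (sig * p$1)) & 0 <= gamma (sig * p$1) & (gamma (sig * p$1) <= t \<longleftrightarrow> p$1 <= 0) & (t <= gamma (sig * p$1) \<longleftrightarrow> 0 <= p$1)"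
  if p: "p : D 1" "p$2 = 0" for p
 proof -
  have u: "sig * p$1 : {-1<..<1}" using p sig(1) by (auto simp: is_sign_def n1_def)
  have "e' p = s (gamma (sig * p$1))" using p(2) gamma[OF u] by (auto simp: e'_def flip_def)
  moreover have sq: "sig * (sig * p$1) = p$1" using is_sign_square[OF sig(1)] by auto
  ultimately show ?thesis using gamma[OF u] sig(2)[OF u, unfolded sq] by blast
 qed
 have off: "e' p ~: s ` {0..}" if "p : D 1" "p$2 ~= 0" for p using ad that by (simp add: adapted_def axis_def)
 show thesis
 proof (rule that[OF ad img cen])
  fix p assume p: "p : D 1"
  show "e' p : s ` {0..t} \<longleftrightarrow> p$2 = 0 & p$1 <= 0"
  proof (cases "p$2 = 0")
   case True
   then show ?thesis using key[OF p True] fray_mem[OF s, of "{0..t}" "gamma (sig * p$1)"] by auto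
  qed (use off[OF p] in auto)
  show "e' p : s ` {t..} \<longleftrightarrow> p$2 = 0 & 0 <= p$1"
  proof (cases "p$2 = 0")
   case True
   then show ?thesis using key[OF p True] fray_mem[OF s, of "{t..}" "gamma (sig * p$1)"] t by auto
  qed (use off[OF p] t in auto)
 qed
qed

lemma fray_aut:
 assumes s: "fray s" and g: "aut W g" shows "fray (%t. g (s t))"
proof -
 have hm: "homeomorphic_map M M g" by (rule aut_homeomorphic[OF g])
 have b: "bij g" by (rule aut_bij[OF g])
 have inj: "g x = g y \<longleftrightarrow> x = y" for x y using b by (simp add: bij_def inj_eq)
 have img: "(%t. g (s t)) ` I = g ` s ` I" for I by auto
 have mem: "g x : g ` s ` I \<longleftrightarrow> x : s ` I" for x I using inj by auto
 have 1: "continuous_map (top_of_set {0..}) M (%t. g (s t))"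
  using continuous_map_compose[OF _ homeomorphic_imp_continuous_map[OF hm], of "top_of_set {0..}" s] s
  by (simp add: fray_def o_def)
 have 2: "inj_on (%t. g (s t)) {0..}" using s inj by (simp add: fray_def inj_on_def)
 have 3: "(%t. g (s t)) ` {0..} \<subseteq> Int_M" using fray_Int[OF s] aut_Int_M[OF g] by auto
 have 5: "EX T>=0. ALL t>=T. g (s t) ~: K" if K: "compactin M K" for K
 proof -
  obtain C where C: "compactin M C" "!!x. x ~: C ==> g x = x" using aut_supp[OF g] by metis
  obtain T where "T >= 0" "ALL t>=T. s t ~: C Un K" using s compactin_Un[OF C(1) K] unfolding fray_def by blast
  then show ?thesis using C(2) by auto
 qed
 have 6: "EX e. adapted axis ((%t. g (s t)) ` {0..}) e & e 0 = g (s t)" if "t > 0" for t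
 proof -
  obtain e where e: "adapted axis (s ` {0..}) e" "e 0 = s t" using s \<open>t > 0\<close> unfolding fray_def by blast
  then have "adapted axis ((%t. g (s t)) ` {0..}) (%p. g (e p))"
   using aut_pe[OF g] unfolding adapted_def img mem by blast
  then show ?thesis using e(2) by auto
 qed
 have 7: "EX e. pe (D 1) e & e 0 = g (s 0) & (ALL p:D 1. e p : (%t. g (s t)) ` {0..} \<longleftrightarrow> p$2 = 0 & 0 <= p$1)"
 proof -
  obtain e where e: "pe (D 1) e" "e 0 = s 0" "ALL p:D 1. e p : s ` {0..} \<longleftrightarrow> p$2 = 0 & 0 <= p$1" using s unfolding fray_def by blast
  then show ?thesis using aut_pe[OF g e(1)] mem unfolding img by metis
 qed
 show ?thesis using 1 2 3 fray_closed[OF s] homeomorphic_imp_closed_map[OF hm] 5 6 7 unfolding img closed_map_def fray_def by blast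
qed

text \<open>In an oriented chart of \<open>a\<close>, where \<open>a\<close> arrives along the
  negative axis, the ray \<open>b\<close> leaves in a straight direction \<open>A\<close> because it
  is PL. It does not run back along \<open>a\<close>, as the two pieces meet only in the corner; so
  \<open>corner_map\<close> straightens their union.\<close>

lemma fray_corner:
 assumes a: "fray a" "0 < y" and b: "fray b" "0 < T" and ab: "a y = b T" "a ` {0..<y} Int b ` {T..} = {}"
 obtains e where "pe (D 1) e" "e 0 = a y" "!!p. p : D 1 ==> e p : a ` {0..y} Un b ` {T..} \<longleftrightarrow> p$2 = 0"
proof -
 have top: "a y : topspace M" using fray_Int[OF a(1), of y] a(2) Int_M_subset by auto
 obtain ea where ea: "adapted axis (a ` {0..}) ea" "ea 0 = a y" "!!p. p : D 1 ==> ea p : a ` {0..y} \<longleftrightarrow> p$2 = 0 & p$1 <= 0"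
  by (rule fray_oriented_chart[OF a openin_topspace top]) blast
 have pa: "pe (D 1) ea" using ea(1) by (simp add: adapted_def)
 have "b T : ea ` D 1" using ea(2) ab(1) by (auto intro!: image_eqI[of _ ea 0])
 then obtain eb where eb: "adapted axis (b ` {0..}) eb" "eb ` D 1 \<subseteq> ea ` D 1" "eb 0 = b T" "!!p. p : D 1 ==> eb p : b ` {T..} \<longleftrightarrow> p$2 = 0 & 0 <= p$1"
  by (rule fray_oriented_chart[OF b pe_open[OF pa]]) blast
 have pb: "pe (D 1) eb" using eb(1) by (simp add: adapted_def)
 have inja: "inj_on ea (D 1)" and injb: "inj_on eb (D 1)" using pa pb by (auto simp: pe_def)
 define f where "f q = inv_into (D 1) ea (eb q)" for q
 have f: "f q : D 1 & ea (f q) = eb q" if "q : D 1" for q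
  using that eb(2) inv_into_into[of "eb q" ea "D 1"] f_inv_into_f[of "eb q" ea "D 1"] unfolding f_def by blast
 have plb: "plm eb 0" using pb by (simp add: pe_def)
 have "eb 0 = ea 0" using eb(3) ea(2) ab(1) by simp
 then have "plat f 0" unfolding f_def[abs_def] by (intro pe_inv[OF plb pa]) auto
 then obtain rho0 A where rho0: "0 < rho0" "!!u. 0 <= u ==> u < rho0 ==> f (0 + u *\<^sub>R v2 1 0) = f 0 + u *\<^sub>R A"
  using plat_germ_direction[of f 0 "v2 1 0"] by blast
 define rho where "rho = min rho0 1"
 have rho: "0 < rho" "rho <= 1" using rho0(1) by (auto simp: rho_def)
 have fA: "f (v2 u 0) = u *\<^sub>R A" if "0 <= u" "u < rho" for u
 proof -
  have "0 + u *\<^sub>R v2 1 0 = v2 u 0" by (simp add: vec2_eq_iff)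
  then show ?thesis using rho0(2)[of u] that f[of 0] eb(3) ea(2) ab(1) inj_onD[OF inja, of "f 0" 0] by (simp add: rho_def)
 qed
 have uD: "v2 u 0 : D 1" if "0 <= u" "u < rho" for u using that rho(2) by simp
 have eA: "ea (u *\<^sub>R A) = eb (v2 u 0) & u *\<^sub>R A : D 1" if "0 <= u" "u < rho" for u
  using f[OF uD[OF that]] fA[OF that] by simp
 have h: "0 <= rho/2" "rho/2 < rho" using rho(1) by auto
 have ne: "eb (v2 (rho/2) 0) ~= b T"
 proof
  assume "eb (v2 (rho/2) 0) = b T"
  then show False using inj_onD[OF injb, of "v2 (rho/2) 0" 0] eb(3) uD[OF h] rho(1) by (simp add: vec2_eq_iff)
 qed
 have A0: "A ~= 0" using ne eA[OF h] ea(2) ab(1) by auto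
 have Aneg: "~ (A$2 = 0 & A$1 < 0)"
 proof
  assume neg: "A$2 = 0 & A$1 < 0"
  then have "ea ((rho/2) *\<^sub>R A) : a ` {0..y}" using ea(3)[of "(rho/2) *\<^sub>R A"] eA[OF h] rho(1) by (simp add: mult_le_0_iff)
  moreover have "ea ((rho/2) *\<^sub>R A) ~= a y" using ne eA[OF h] ab(1) by simp
  ultimately have "ea ((rho/2) *\<^sub>R A) : a ` {0..<y}" by (auto simp: le_less)
  moreover have "ea ((rho/2) *\<^sub>R A) : b ` {T..}" using eb(4)[OF uD[OF h]] eA[OF h] rho(1) by simp
  ultimately show False using ab(2) by blast
 qed
 obtain k l where k: "inj k" "!!p. plat k p" "0 < l" "!!u. u <= 0 ==> k (v2 u 0) = v2 u 0" "!!u. 0 <= u ==> k (v2 u 0) = (l * u) *\<^sub>R A"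
  using corner_map[OF A0 Aneg] by metis
 have v20: "v2 0 0 = 0" by (simp add: vec2_eq_iff)
 have k0: "k 0 = 0" using k(4)[of 0] by (simp add: v20)
 have "D rho \<subseteq> D 1" using rho(2) by auto
 then have o1: "openin M (eb ` D rho)" by (intro pe_open pe_subset[OF pb open_D(2)])
 have "open {p:D 1. ea p : eb ` D rho}" by (rule pe_vimage_open[OF pa o1])
 moreover have "k 0 : {p:D 1. ea p : eb ` D rho}" using k0 ea(2) eb(3) ab(1) rho(1) by (auto intro!: image_eqI[of _ eb 0])
 ultimately have "\<forall>\<^sub>F p in nhds 0. k p : {p:D 1. ea p : eb ` D rho}" by (rule isCont_eventually_open[OF plat_isCont[OF k(2)]])
 then obtain delta0 where delta0: "0 < delta0" "!!p. n1 (p - 0) < delta0 ==> k p : {p:D 1. ea p : eb ` D rho}" unfolding eventually_n1 by blast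
 define delta where "delta = min (min delta0 1) (rho / l)"
 have delta: "0 < delta" "delta <= delta0" "delta <= 1" "l * delta <= rho"
 proof -
  show "0 < delta" "delta <= delta0" "delta <= 1" using delta0(1) rho(1) k(3) by (auto simp: delta_def)
  have "delta <= rho / l" by (simp add: delta_def)
  then show "l * delta <= rho" using k(3) by (simp add: field_simps)
 qed
 have kk: "k p : D 1 & ea (k p) : eb ` D rho" if "n1 p < delta" for p using delta0(2)[of p] that delta(2) by simp
 have char: "ea (k p) : a ` {0..y} Un b ` {T..} \<longleftrightarrow> p$2 = 0" if p: "n1 p < delta" for p
 proof
  assume "p$2 = 0"
  then have pv: "p = v2 (p$1) 0" by (simp add: vec2_eq_iff)
  show "ea (k p) : a ` {0..y} Un b ` {T..}"
  proof (cases "p$1 <= 0")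
   case True
   then show ?thesis using k(4)[of "p$1"] pv ea(3)[of p] True \<open>p$2 = 0\<close> kk[OF p] by simp
  next
   case False
   then have kp: "k p = (l * p$1) *\<^sub>R A" using k(5)[of "p$1"] pv by simp
   have "p$1 < delta" using p by (auto simp: n1_def)
   then have "l * p$1 < l * delta" by (rule mult_strict_left_mono) (rule k(3))
   then have u: "0 <= l * p$1" "l * p$1 < rho" using False k(3) delta(4) by (simp, linarith)
   then show ?thesis using eA[OF u] eb(4)[OF uD[OF u]] kp by simp
  qed
 next
  assume asm: "ea (k p) : a ` {0..y} Un b ` {T..}"
  then consider "ea (k p) : a ` {0..y}" | "ea (k p) : b ` {T..}" by blast
  then show "p$2 = 0"
  proof cases
   case 1
   then have "k p $ 2 = 0 & k p $ 1 <= 0" using ea(3)[of "k p"] kk[OF p] by blast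
   then have "k p = k (v2 (k p $ 1) 0)" using k(4)[of "k p $ 1"] by (simp_all add: vec2_eq_iff)
   then have "p = v2 (k p $ 1) 0" using k(1) by (simp add: inj_eq)
   then show ?thesis by (metis v2_nth(2))
  next
   case 2
   obtain q where q: "n1 q < rho" "ea (k p) = eb q" using kk[OF p] by auto
   then have qD: "q : D 1" using rho(2) by simp
   then have q2: "q$2 = 0" "0 <= q$1" using eb(4)[of q] 2 q(2) by auto
   then have qv: "q = v2 (q$1) 0" by (simp add: vec2_eq_iff)
   have u: "0 <= q$1" "q$1 < rho" using q2 q(1) by (auto simp: n1_def)
   have "k p = q$1 *\<^sub>R A" using eA[OF u] q(2) qv inj_onD[OF inja] kk[OF p] by simp
   also have "... = k (v2 (q$1 / l) 0)" using k(5)[of "q$1 / l"] u(1) k(3) by simp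
   finally have "p = v2 (q$1 / l) 0" using k(1) by (simp add: inj_eq)
   then show ?thesis by simp
  qed
 qed
 have sc: "n1 (delta *\<^sub>R p) < delta" if "p : D 1" for p using delta(1) that by auto
 show thesis
 proof (rule that[of "%p. ea (k (delta *\<^sub>R p))"])
  show "pe (D 1) (%p. ea (k (delta *\<^sub>R p)))"
  proof (rule pe_comp[OF pa, of "D 1" "%p. k (delta *\<^sub>R p)"])
   show "inj_on (%p. k (delta *\<^sub>R p)) (D 1)"
   proof (rule inj_onI)
    fix p q assume "k (delta *\<^sub>R p) = k (delta *\<^sub>R q)"
    then have "delta *\<^sub>R p = delta *\<^sub>R q" using k(1) by (rule injD[rotated])
    then show "p = q" using delta(1) by simp
   qed
   show "plat (%p. k (delta *\<^sub>R p)) p" for p by (rule plat_comp[OF _ k(2)]) (intro plat_scaleR plat_id)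
   show "(%p. k (delta *\<^sub>R p)) ` D 1 \<subseteq> D 1" using kk sc by blast
  qed simp
  show "ea (k (delta *\<^sub>R 0)) = a y" using k0 ea(2) by simp
  show "ea (k (delta *\<^sub>R p)) : a ` {0..y} Un b ` {T..} \<longleftrightarrow> p$2 = 0" if "p : D 1" for p
   using char[OF sc[OF that]] delta(1) by simp
 qed
qed

lemma fray_splice:
 assumes a: "fray a" "0 < y" and b: "fray b" "0 < T" and ab: "a y = b T" "a ` {0..<y} Int b ` {T..} = {}"
 shows "fray (%t. if t <= y then a t else b (T + t - y))"
proof -
 define s where "s t = (if t <= y then a t else b (T + t - y))" for t
 have tail: "s ` {t..} = b ` {T + t - y..}" if "y <= t" for t
 proof -
  have eq: "s u = b (T + u - y)" if "t <= u" for u using that \<open>y <= t\<close> ab(1) by (cases "u = y") (auto simp: s_def)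
  have "{T + t - y..} = (%u. T + u - y) ` {t..}"
  proof (intro equalityI subsetI)
   fix v assume "v : {T + t - y..}"
   then show "v : (%u. T + u - y) ` {t..}" by (intro image_eqI[of _ _ "v - T + y"]) auto
  qed auto
  then show ?thesis using eq by (simp add: image_image)
 qed
 have head: "s ` {t..y} = a ` {t..y}" for t by (auto simp: s_def)
 have tl: "s ` {t..} = a ` {t..y} Un b ` {T..}" if "t <= y" for t
 proof -
  have "{t..} = {t..y} Un {y..}" using that by auto
  then show ?thesis using head[of t] tail[of y] by auto
 qed
 have all: "s ` {0..} = a ` {0..y} Un b ` {T..}" using tl a(2) by simp
 have 1: "continuous_map (top_of_set {0..}) M s"
 proof -
  have "continuous_map (top_of_set {0..}) M a" using a(1) by (simp add: fray_def)
  then have c1: "continuous_map (top_of_set {0..y}) M a" by (rule continuous_map_from_subtopology_mono) auto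
  have "continuous_map (top_of_set {y..}) (top_of_set {0..}) (%t. T + t - y)" using b(2) by (auto intro!: continuous_intros)
  then have c2: "continuous_map (top_of_set {y..}) M (%t. b (T + t - y))"
   using continuous_map_compose[of "top_of_set {y..}" "top_of_set {0..}" "%t. T + t - y" M b] b(1) by (simp add: fray_def o_def)
  have "continuous_map (top_of_set {0..}) M (%t. if t <= y then a t else b (T + t - y))"
  proof (rule continuous_map_cases_le)
   show "continuous_map (subtopology (top_of_set {0..}) {x : topspace (top_of_set {0..}). x <= y}) M a"
   proof -
    have "{0..} Int {x. 0 <= x & x <= y} = {0..y}" by auto
    then show ?thesis using c1 by (simp add: subtopology_subtopology)
   qed
   show "continuous_map (subtopology (top_of_set {0..}) {x : topspace (top_of_set {0..}). y <= x}) M (%t. b (T + t - y))"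
   proof -
    have "{0..} Int {x. 0 <= x & y <= x} = {y..}" using a(2) by auto
    then show ?thesis using c2 by (simp add: subtopology_subtopology)
   qed
  qed (use ab(1) in \<open>auto simp: continuous_map_in_subtopology\<close>)
  then show ?thesis by (simp add: s_def[abs_def])
 qed
 have 2: "inj_on s {0..}"
 proof -
  have no: "a t ~= b (T + u - y)" if "0 <= t" "t <= y" "y < u" for t u
  proof
   assume eq: "a t = b (T + u - y)"
   show False
   proof (cases "t = y")
    case True
    then show False using eq ab(1) fray_inj[OF b(1), of T "T + u - y"] b(2) that by simp
   next
    case False
    then have "a t : a ` {0..<y}" using that by auto
    moreover have "a t : b ` {T..}" using that unfolding eq by auto
    ultimately
    show False using ab(2) by blast
   qed
  qed
  show ?thesis
  proof (rule inj_onI)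
   fix t u assume tu: "t : {0..}" "u : {0..}" "s t = s u"
   consider "t <= y" "u <= y" | "t <= y" "y < u" | "y < t" "u <= y" | "y < t" "y < u" by linarith
   then show "t = u"
   proof cases
    case 1 then show ?thesis using tu fray_inj[OF a(1)] by (simp add: s_def)
   next
    case 2 then show ?thesis using tu no[of t u] by (simp add: s_def)
   next
    case 3 then show ?thesis using tu no[of u t] by (simp add: s_def)
   next
    case 4 then show ?thesis using tu fray_inj[OF b(1), of "T + t - y" "T + u - y"] b(2) by (simp add: s_def)
   qed
  qed
 qed
 have 3: "s ` {0..} \<subseteq> Int_M" unfolding all using fray_Int[OF a(1)] fray_Int[OF b(1)] b(2) by auto
 have 4: "closedin M (s ` {t..})" if "0 <= t" for t
 proof (cases "t <= y")
  case True
  then show ?thesis using fray_closed_segment[OF a(1) that] fray_closed[OF b(1)] b(2) unfolding tl[OF True] by auto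
 next
  case False
  then show ?thesis using tail[of t] fray_closed[OF b(1), of "T + t - y"] b(2) by simp
 qed
 have 5: "EX U>=0. ALL t>=U. s t ~: K" if K: "compactin M K" for K
 proof -
  obtain U where U: "U >= 0" "ALL t>=U. b t ~: K" using b(1) K unfolding fray_def by blast
  have "s t ~: K" if "y + U + 1 <= t" for t using that U b(2) by (simp add: s_def)
  then show ?thesis using U(1) a(2) by (intro exI[of _ "y + U + 1"]) auto
 qed
 have cl: "closedin M (b ` {T..})" "closedin M (a ` {y..})" "closedin M (a ` {0..y})" "closedin M (b ` {0..T})"
  using fray_closed[OF b(1)] fray_closed[OF a(1)] fray_closed_segment[OF a(1)] fray_closed_segment[OF b(1)] a(2) b(2) by auto
 \<comment> \<open>Open sets in which the spliced ray has the same points as \<open>a\<close>,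
   respectively \<open>b\<close>. They contain all of it except the corner, which
   \<open>fray_corner\<close> handles.\<close>
 define Wa where "Wa = topspace M - (b ` {T..} Un a ` {y..})"
 define Wb where "Wb = topspace M - (a ` {0..y} Un b ` {0..T})"
 have W: "openin M Wa" "openin M Wb" using cl unfolding Wa_def Wb_def by auto
 have Sa: "x : s ` {0..} \<longleftrightarrow> x : a ` {0..}" if "x : Wa" for x using a(2) that by (force simp: all Wa_def)
 have Sb: "x : s ` {0..} \<longleftrightarrow> x : b ` {0..}" if "x : Wb" for x using b(2) that by (force simp: all Wb_def)
 have a_in: "a t : Wa" if "0 <= t" "t < y" for t
 proof -
  have "a t ~: b ` {T..}" using that ab(2) by force
  moreover have "a t ~: a ` {y..}" using fray_mem[OF a(1), of "{y..}" t] a(2) that by simp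
  moreover have "a t : topspace M" using fray_Int[OF a(1) that(1)] Int_M_subset by blast
  ultimately show ?thesis unfolding Wa_def by blast
 qed
 have 6: "EX e. adapted axis (s ` {0..}) e & e 0 = s t" if t: "t > 0" for t
 proof -
  consider "t < y" | "t = y" | "y < t" by linarith
  then show ?thesis
  proof cases
   case 1
   obtain e where e: "adapted axis (a ` {0..}) e" "e ` D 1 \<subseteq> Wa" "e 0 = a t"
    using fray_adapted_in[OF a(1) t W(1) a_in] 1 t by auto
   then have "adapted axis (s ` {0..}) e" using Sa unfolding adapted_def by blast
   then show ?thesis using e(3) 1 by (intro exI[of _ e]) (simp add: s_def)
  next
   case 2
   obtain e where "pe (D 1) e" "e 0 = a y" "!!p. p : D 1 ==> e p : a ` {0..y} Un b ` {T..} \<longleftrightarrow> p$2 = 0"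
    using fray_corner[OF a b ab] by blast
   then show ?thesis using 2 unfolding adapted_def axis_def all by (auto simp: s_def)
  next
   case 3
   have st: "s t = b (T + t - y)" using 3 by (simp add: s_def)
   have "s t : Wb"
   proof -
    have "s t ~: a ` {0..y}"
    proof
     assume "s t : a ` {0..y}"
     then obtain u where "0 <= u" "u <= y" "s t = s u" by (auto simp: s_def)
     then show False using inj_onD[OF 2, of t u] 3 t by auto
    qed
    moreover have "s t ~: b ` {0..T}" using fray_mem[OF b(1), of "{0..T}" "T + t - y"] 3 b(2) st by auto
    moreover have "s t : topspace M" using fray_Int[OF b(1), of "T + t - y"] 3 b(2) st Int_M_subset by auto
    ultimately show ?thesis unfolding Wb_def by blast
   qed
   then obtain e where e: "adapted axis (b ` {0..}) e" "e ` D 1 \<subseteq> Wb" "e 0 = s t"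
    using fray_adapted_in[OF b(1) _ W(2), of "T + t - y"] 3 b(2) st by auto
   then have "adapted axis (s ` {0..}) e" using Sb unfolding adapted_def by blast
   then show ?thesis using e(3) by blast
  qed
 qed
 have 7: "EX e. pe (D 1) e & e 0 = s 0 & (ALL p:D 1. e p : s ` {0..} \<longleftrightarrow> p$2 = 0 & 0 <= p$1)"
 proof -
  obtain e where e: "pe (D 1) e" "e 0 = a 0" "!!p. p : D 1 ==> e p : a ` {0..} \<longleftrightarrow> p$2 = 0 & 0 <= p$1" using a(1) by (auto simp: fray_def)
  obtain c where c: "0 < c" "c <= 1" "pe (D 1) (%p. e (c *\<^sub>R p))" "(%p. e (c *\<^sub>R p)) ` D 1 \<subseteq> Wa" using a_in[of 0] a(2) e(2) pe_shrink[OF e(1) W(1)] by auto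
  have "e (c *\<^sub>R p) : s ` {0..} \<longleftrightarrow> p$2 = 0 & 0 <= p$1" if p: "p : D 1" for p
  proof -
   have "c * n1 p <= 1 * n1 p" using c(2) by (intro mult_right_mono) auto
   then have "c *\<^sub>R p : D 1" using p c(1) by simp
   then show ?thesis using e(3)[of "c *\<^sub>R p"] c(1) Sa[of "e (c *\<^sub>R p)"] c(4) p by (auto simp: zero_le_mult_iff)
  qed
  then show ?thesis using c(3) e(2) a(2) by (intro exI[of _ "%p. e (c *\<^sub>R p)"]) (simp add: s_def)
 qed
 show ?thesis using 1 2 3 4 5 6 7 unfolding fray_def by (simp add: s_def[abs_def])
qed

text \<open>The form in which a common end is used: far out, the two rays can be joined within the
  interior while avoiding a given compact set. This is the hypothesis of
  \<open>point_transport\<close>.\<close>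

definition same_end :: "(real => 'a) => (real => 'a) => bool" where
 "same_end r r' \<longleftrightarrow> (ALL K. compactin M K & surface_boundary A \<subseteq> K -->
   (EX S. connectedin M S & S \<subseteq> Int_M & S Int K = {} & (EX T>=0. ALL t>=T. r t : S & r' t : S)))"

text \<open>An automorphism \<open>H\<close> fixing \<open>K\<close> pulls the tail of
  \<open>r\<close> over until it meets \<open>r'\<close>. The two are spliced at their first
  meeting, and \<open>inv H\<close> then restores the tail of \<open>r\<close> without touching the
  beginning of \<open>r'\<close>.\<close>

lemma hybrid_ray:
 assumes r: "fray r" and r': "fray r'" and ends: "same_end r r'"
  and L: "compactin M L" "surface_boundary A \<subseteq> L" and y: "0 <= y" "!!t. y < t ==> r' t ~: L"
 obtains s T y' where "fray s" "0 < T" "y < y'" "!!t. 0 <= t ==> t <= y ==> s t = r' t" "!!t. y < t ==> s t ~: L"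
  "!!t. y' <= t ==> s t = r (T + t - y')"
proof -
 define K where "K = L Un r' ` {0..y}"
 have K: "compactin M K" "surface_boundary A \<subseteq> K" unfolding K_def using L fray_compact[OF r' order_refl] by (auto intro: compactin_Un)
 obtain S T1 where S: "connectedin M S" "S \<subseteq> Int_M" "S Int K = {}" "0 <= T1" "!!t. T1 <= t ==> r t : S & r' t : S"
  using ends K unfolding same_end_def by blast
 obtain T2 where T2: "0 <= T2" "!!t. T2 <= t ==> r t ~: K" using r K(1) unfolding fray_def by blast
 define T0 where "T0 = T1 + T2 + 1"
 have T0: "0 < T0" "T1 <= T0" "T2 <= T0" using S(4) T2(1) by (auto simp: T0_def)
 define W where "W = Int_M - K"
 have W: "openin M W" unfolding W_def using compactin_imp_closedin[OF Hausdorff K(1)] by (intro openin_diff openin_Int_M)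
 have r'K: "r' t ~: K" if "y < t" for t
  using y that fray_mem[OF r', of "{0..y}" t] by (auto simp: K_def)
 define y1 where "y1 = y + 1 + T1"
 have y1: "y < y1" "T1 <= y1" using y(1) S(4) by (auto simp: y1_def)
 obtain H where H: "aut W H" "H (r T0) = r' y1" using S(2,3) point_transport[OF W S(1) _ S(2), of "r T0" "r' y1"] S(5)[of T0] S(5)[of y1] T0 y1 by (force simp: W_def)
 have Hfix: "H x = x" if "x : K" for x using aut_outside[OF H(1)] that by (simp add: W_def)
 have bH: "bij H" by (rule aut_bij[OF H(1)])
 have HK: "H x : K \<longleftrightarrow> x : K" for x
  using aut_mem[OF H(1) order_refl, of x] Hfix[of x] aut_Int_M[OF H(1), of x] Hfix[of "H x"] bH
  by (metis Hfix bij_def inj_eq)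
 let ?b = "%t. H (r t)"
 have fb: "fray ?b" by (rule fray_aut[OF r H(1)])
 define V where "V = {u:{0..y1}. r' u : ?b ` {T0..}}"
 have "closed {u:{0..}. r' u : ?b ` {T0..}}" using closedin_continuous_map_preimage[of "top_of_set {0..}" M r' "?b ` {T0..}"] r' fray_closed[OF fb] T0(1) closedin_closed_trans[OF _ closed_atLeast] by (auto simp: fray_def)
 then have "closed ({u:{0..}. r' u : ?b ` {T0..}} Int {..y1})" by auto
 moreover have "V = {u:{0..}. r' u : ?b ` {T0..}} Int {..y1}" by (auto simp: V_def)
 ultimately have "closed V" by simp
 moreover have "V \<subseteq> {0..y1}" by (auto simp: V_def)
 ultimately have cV: "compact V" using compact_Icc by (metis compact_Int_closed inf.absorb_iff2)
 have "y1 : V" using H(2) y1(1) y(1) by (force simp: V_def)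
 \<comment> \<open>The first parameter at which \<open>r'\<close> meets the displaced tail; this
   choice makes the two spliced pieces disjoint.\<close>
 then obtain y' where y': "y' : V" "!!u. u : V ==> y' <= u" using compact_attains_inf[OF cV] by blast
 obtain T where T: "T0 <= T" "?b T = r' y'" using y'(1) by (force simp: V_def)
 have bK: "?b t ~: K" if "T0 <= t" for t using HK T2(2)[of t] that T0(3) by simp
 have yy': "y < y'" using y'(1) bK[OF T(1)] T(2) by (auto simp: K_def V_def)
 have disj: "r' ` {0..<y'} Int ?b ` {T..} = {}"
 proof (rule ccontr)
  assume "r' ` {0..<y'} Int ?b ` {T..} ~= {}"
  then obtain x where x: "x : r' ` {0..<y'}" "x : ?b ` {T..}" by blast
  from x(1) obtain u where u1: "u : {0..<y'}" "x = r' u" by blast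
  from x(2) obtain t where t: "t : {T..}" "x = ?b t" by blast
  have u: "0 <= u" "u < y'" "T <= t" "r' u = ?b t" using u1 t by auto
  then show False using T(1) y'(1) y'(2) u(2) by (force simp: V_def)
 qed
 define s' where "s' t = (if t <= y' then r' t else ?b (T + t - y'))" for t
 have pos: "0 < y'" "0 < T" using yy' y(1) T(1) T0(1) by auto
 have fs': "fray s'" unfolding s'_def[abs_def]
  by (rule fray_splice[OF r' pos(1) fb pos(2) _ disj]) (use T(2) in simp)
 have aH: "aut W (inv H)" by (rule aut_inv[OF H(1)])
 have iH: "inv H (H x) = x" for x using bH by (simp add: bij_def inv_f_f)
 have iHfix: "inv H x = x" if "x : K" for x using iH[of x] Hfix[OF that] by simp
 show thesis
 proof (rule that[of "%t. inv H (s' t)" T y'])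
  show "fray (%t. inv H (s' t))" by (rule fray_aut[OF fs' aH])
  show "0 < T" "y < y'" by (fact pos yy')+
  show "inv H (s' t) = r' t" if "0 <= t" "t <= y" for t
   using iHfix[of "r' t"] that yy' by (auto simp: s'_def K_def)
  show "inv H (s' t) ~: L" if t: "y < t" for t
  proof
   assume "inv H (s' t) : L"
   then have k: "inv H (s' t) : K" by (simp add: K_def)
   then show False using HK[of "inv H (s' t)"] surj_f_inv_f[OF bij_is_surj[OF bH]] r'K[OF t] bK[of "T + t - y'"] T(1) by (auto simp: s'_def split: if_splits)
  qed
  show "inv H (s' t) = r (T + t - y')" if "y' <= t" for t
   using that T(2) iH[of "r T"] iH[of "r (T + t - y')"] by (cases "t = y'") (auto simp: s'_def)
 qed
qed

end

subsection \<open>Sides of a ray\<close>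

lemma n1_near: "\<bar>n1 (x + y) - n1 x\<bar> <= n1 y"
 using n1_triangle[of x y] n1_triangle[of "x + y" "- y"] by (simp add: abs_le_iff)

lemma germ_flip_0 [simp]: "v2 0 0 = 0" "flip s t 0 = 0" by (simp_all add: vec2_eq_iff)

lemma flip_scaleR: "c *\<^sub>R flip s t p = flip s t (c *\<^sub>R p)" by (simp add: vec2_eq_iff)

lemma is_sign_1 [simp]: "is_sign 1" by (simp add: is_sign_def)

lemma flip_sign_cancel: "is_sign omega ==> flip 1 omega (flip 1 omega p) = p"
 using is_sign_square[of omega] by (simp add: flip_flip)

context compact_boundary_surface
begin

text \<open>The first coordinate points forward along the ray, so two such frames at the same point
  can differ essentially only in the sign of the second coordinate.\<close>

definition oframe :: "(real => 'a) => real => (real^2 => 'a) => bool" where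
 "oframe s t e \<longleftrightarrow> adapted axis (s ` {0..}) e & e 0 = s t & 0 < t & (ALL p:D 1. e p : s ` {t..} \<longleftrightarrow> p$2 = 0 & 0 <= p$1)"

lemma oframe_exists:
 assumes "fray s" "0 < t" "openin M W" "s t : W" shows "EX e. oframe s t e & e ` D 1 \<subseteq> W"
 by (rule fray_oriented_chart[OF assms]) (use assms(2) in \<open>auto simp: oframe_def\<close>)

lemma oframe_scale:
 assumes "oframe s t e" "0 < c" "c <= 1" shows "oframe s t (%p. e (c *\<^sub>R p))"
proof -
 have "adapted axis (s ` {0..}) (%p. e (c *\<^sub>R p))"
  using adapted_recentre[of axis "s ` {0..}" e c 0] assms by (simp add: oframe_def)
 moreover have "c *\<^sub>R p : D 1" if "p : D 1" for p
 proof -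
  have "c * n1 p <= 1 * n1 p" using assms(3) by (intro mult_right_mono) auto
  then show ?thesis using that assms(2) by simp
 qed
 ultimately show ?thesis using assms by (simp add: oframe_def zero_le_mult_iff)
qed

lemma oframe_shrink:
 assumes e: "oframe s t e" and W: "openin M W" "s t : W"
 obtains c0 where "0 < c0" "c0 <= 1" "!!c. 0 < c ==> c <= c0 ==> (%p. e (c *\<^sub>R p)) ` D 1 \<subseteq> W"
proof -
 have pe: "pe (D 1) e" "e 0 : W" using e W(2) by (auto simp: oframe_def adapted_def)
 obtain c0 where c0: "0 < c0" "c0 <= 1" "(%p. e (c0 *\<^sub>R p)) ` D 1 \<subseteq> W" using pe_shrink[OF pe(1) W(1) pe(2)] by metis
 show thesis
 proof (rule that[OF c0(1,2)])
  fix c :: real assume c: "0 < c" "c <= c0"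
  show "(%p. e (c *\<^sub>R p)) ` D 1 \<subseteq> W"
  proof clarify
   fix p :: "real^2" assume p: "n1 p < 1"
   have "(c / c0) * n1 p <= 1 * n1 p" using c c0(1) by (intro mult_right_mono) auto
   moreover have "n1 ((c / c0) *\<^sub>R p) = (c / c0) * n1 p" using c c0(1) by simp
   ultimately have "n1 ((c / c0) *\<^sub>R p) < 1" using p by linarith
   then show "e (c *\<^sub>R p) : W" using c0(3) c0(1) by fastforce
  qed
 qed
qed

lemma oframe_flip: assumes "oframe s t e" "is_sign omega" shows "oframe s t (%p. e (flip 1 omega p))"
proof -
 show ?thesis using assms(2) assms adapted_flip[of "s ` {0..}" e 1 omega] by (auto simp: oframe_def is_sign_def)
qed

lemma oframe_transfer:
 assumes e: "oframe s t e" "e ` D 1 \<subseteq> W" and u: "0 < u" "s' u = s t" and W: "W Int s ` {0..} = W Int s' ` {0..}" "W Int s ` {t..} = W Int s' ` {u..}"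
 shows "oframe s' u e"
proof -
 have "e p : s ` {0..} \<longleftrightarrow> e p : s' ` {0..}" "e p : s ` {t..} \<longleftrightarrow> e p : s' ` {u..}" if "p : D 1" for p
  using e(2) W that by blast+
 then show ?thesis using e(1) u by (simp add: oframe_def adapted_def)
qed

text \<open>Transport of sides along the ray: \<open>omega\<close> records whether the upper side of
  \<open>e\<close> arrives at the upper side of \<open>e'\<close>. That a transport exists is
  \<open>side_exists\<close>, that the sign does not depend on it is
  \<open>side_unique\<close>.\<close>

definition side :: "(real => 'a) => (real^2 => 'a) => (real^2 => 'a) => real => bool" where
 "side s e e' omega \<longleftrightarrow> is_sign omega & (EX g rho. aut Int_M g & preserves (s ` {0..}) g & 0 < rho & (ALL p. n1 p < rho --> g (e p) = e' (flip 1 omega p)))"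

lemma side_sign: "side s e e' omega ==> is_sign omega" by (simp add: side_def)

lemma side_trans:
 assumes "side s e e' omega" "side s e' e'' omega'" shows "side s e e'' (omega * omega')"
proof -
 obtain g rho where g: "aut Int_M g" "preserves (s ` {0..}) g" "0 < rho" "!!p. n1 p < rho ==> g (e p) = e' (flip 1 omega p)" "is_sign omega"
  using assms(1) unfolding side_def by blast
 obtain g' rho' where g': "aut Int_M g'" "preserves (s ` {0..}) g'" "0 < rho'" "!!p. n1 p < rho' ==> g' (e' p) = e'' (flip 1 omega' p)" "is_sign omega'"
  using assms(2) unfolding side_def by blast
 have "g' (g (e p)) = e'' (flip 1 (omega * omega') p)" if "n1 p < min rho rho'" for p
  using g(4)[of p] g'(4)[of "flip 1 omega p"] that g(5) by (simp add: flip_flip mult.commute)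
 moreover have "aut Int_M (%x. g' (g x))" by (rule aut_comp[OF g'(1) g(1)])
 moreover have "preserves (s ` {0..}) (%x. g' (g x))" using g(2) g'(2) by (simp add: preserves_def)
 moreover have "0 < min rho rho'" using g(3) g'(3) by simp
 ultimately show ?thesis unfolding side_def using is_sign_mult[OF g(5) g'(5)] by blast
qed

lemma side_sym: assumes "side s e e' omega" shows "side s e' e omega"
proof -
 obtain g rho where g: "aut Int_M g" "preserves (s ` {0..}) g" "0 < rho" "!!p. n1 p < rho ==> g (e p) = e' (flip 1 omega p)" "is_sign omega"
  using assms(1) unfolding side_def by blast
 have b: "bij g" by (rule aut_bij[OF g(1)])
 have i: "inv g (g x) = x" "g (inv g x) = x" for x using b by (auto simp: bij_def inv_f_f surj_f_inv_f)
 have "inv g (e' p) = e (flip 1 omega p)" if "n1 p < rho" for p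
  using g(4)[of "flip 1 omega p"] i(1)[of "e (flip 1 omega p)"] that g(5) flip_sign_cancel[OF g(5)] by simp
 moreover have "preserves (s ` {0..}) (inv g)" using g(2) i(2) unfolding preserves_def by metis
 ultimately show ?thesis unfolding side_def using aut_inv[OF g(1)] g(3,5) by blast
qed

text \<open>A slide along the ray carries tails to tails, so it cannot reverse the first coordinate.
  Only the sign of the second one remains.\<close>

lemma oriented_slide:
 assumes s: "fray s" and e: "oframe s t e" and e': "oframe s t' e'" and t: "t <= t'" and W: "openin M W" "s ` {t..t'} \<subseteq> W"
 obtains g omega rho where "aut W g" "preserves (s ` {0..}) g" "is_sign omega" "0 < rho" "!!p. n1 p < rho ==> g (e p) = e' (flip 1 omega p)"
  "g (s t) = s t'"
proof -
 have t0: "0 < t" "0 < t'" using e e' by (auto simp: oframe_def)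
 have st: "s t : W" "s t' : W" using W(2) t by auto
 obtain c1 where c1: "0 < c1" "c1 <= 1" "!!c. 0 < c ==> c <= c1 ==> (%p. e (c *\<^sub>R p)) ` D 1 \<subseteq> W" using oframe_shrink[OF e W(1) st(1)] by metis
 obtain c2 where c2: "0 < c2" "c2 <= 1" "!!c. 0 < c ==> c <= c2 ==> (%p. e' (c *\<^sub>R p)) ` D 1 \<subseteq> W" using oframe_shrink[OF e' W(1) st(2)] by metis
 define c where "c = min c1 c2"
 have c: "0 < c" "c <= 1" "c <= c1" "c <= c2" using c1(1,2) c2(1) by (auto simp: c_def)
 define f where "f p = e (c *\<^sub>R p)" for p
 define f' where "f' p = e' (c *\<^sub>R p)" for p
 have f: "oframe s t f" "f ` D 1 \<subseteq> W" and f': "oframe s t' f'" "f' ` D 1 \<subseteq> W"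
  using oframe_scale[OF e c(1,2)] oframe_scale[OF e' c(1,2)] c1(3)[OF c(1,3)] c2(3)[OF c(1,4)] by (auto simp: f_def[abs_def] f'_def[abs_def])
 have "germ_equiv W (s ` {0..}) f 0 f' 0"
  using f f' by (intro fray_slide[OF s t0(1) t W]) (auto simp: oframe_def)
 then obtain g sig omega rho where g: "aut W g" "preserves (s ` {0..}) g" "is_sign sig" "is_sign omega" "0 < rho" "!!p. n1 p < rho ==> g (f p) = f' (flip sig omega p)"
  unfolding germ_equiv_def germ_flip_0 add_0 by blast
 have gs: "g (s t) = s t'" using g(6)[of 0] g(5) f(1) f'(1) by (simp add: oframe_def)
 have "g ` s ` {0..} \<subseteq> s ` {0..}" using preserves_image[OF aut_bij[OF g(1)] g(2)] by simp
 then have tl: "g ` (s ` {t..}) = s ` {t'..}" by (rule fray_reparam_tail[OF s g(1) _ _ _ gs]) (use t0 in auto)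
 have "sig = 1"
 proof (rule ccontr)
  assume "sig ~= 1"
  then have sig: "sig = -1" using g(3) by (auto simp: is_sign_def)
  let ?p = "v2 (min rho 1 / 2) 0"
  have p: "n1 ?p < rho" "?p : D 1" using g(5) by auto
  have "f ?p : s ` {t..}" using f(1) p(2) g(5) by (simp add: oframe_def)
  then have "f' (flip sig omega ?p) : s ` {t'..}" using g(6)[OF p(1)] tl by force
  then show False using f'(1) p(2) g(3,4) sig g(5) by (simp add: oframe_def)
 qed
 then have "!!p. n1 p < c * rho ==> g (e p) = e' (flip 1 omega p)"
 proof -
  fix p assume "n1 p < c * rho"
  then show "g (e p) = e' (flip 1 omega p)" using c(1) g(6)[of "(1/c) *\<^sub>R p"] \<open>sig = 1\<close> by (auto simp: f_def f'_def flip_scaleR field_simps)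
 qed
 then show thesis using that g c(1) gs by (metis mult_pos_pos)
qed

lemma side_exists:
 assumes s: "fray s" and e: "oframe s t e" and e': "oframe s t' e'" shows "EX omega. side s e e' omega"
proof -
 have W: "s ` {u..v} \<subseteq> Int_M" if "0 < u" for u v using fray_Int[OF s] that by auto
 have pos: "0 < t" "0 < t'" using e e' by (auto simp: oframe_def)
 show ?thesis
 proof (cases "t <= t'")
  case True
  show ?thesis by (rule oriented_slide[OF s e e' True openin_Int_M W[OF pos(1)]]) (auto simp: side_def)
 next
  case False
  then have le: "t' <= t" by simp
  have "EX omega. side s e' e omega" by (rule oriented_slide[OF s e' e le openin_Int_M W[OF pos(2)]]) (auto simp: side_def)
  then show ?thesis using side_sym by blast
 qed
qed

text \<open>
 An automorphism preserving the ray does not exchange its two sides: it is the identity far out, and in a chart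
 containing a long initial segment of the ray the side to which it sends the upper half is locally constant along the ray.
\<close>
text \<open>
 In a chart \<open>E\<close> straightening a long piece of the ray, the second coordinate of the image of a segment
 parallel to the axis does not vanish, and it is known at both ends of the segment.
\<close>
lemma side_unique_self:
 assumes s: "fray s" and e: "oframe s t e" and sd: "side s e e omega" shows "omega = 1"
proof (rule ccontr)
 assume "omega ~= 1"
 obtain g rho where g: "aut Int_M g" "preserves (s ` {0..}) g" "0 < rho" "!!p. n1 p < rho ==> g (e p) = e (flip 1 omega p)"
  using sd unfolding side_def by blast
 have omega: "is_sign omega" "omega = -1" using sd \<open>omega ~= 1\<close> by (auto simp: side_def is_sign_def)
 have t0: "0 < t" using e by (simp add: oframe_def)
 obtain K where K: "compactin M K" "!!x. x ~: K ==> g x = x" using aut_supp[OF g(1)] by metis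
 obtain T1 where T1: "0 <= T1" "!!u. T1 <= u ==> s u ~: K" using s K(1) unfolding fray_def by blast
 define T where "T = T1 + t + 1"
 have T: "0 < T" "t < T" "s T ~: K" using T1 t0 by (auto simp: T_def)
 obtain E gamma where E: "pe (D 1) E" "!!p. p : D 1 ==> E p : s ` {0..} \<longleftrightarrow> p$2 = 0 & 0 <= p$1" and ET: "s ` {0..T} \<subseteq> E ` D 1"
  and gamma: "strict_mono_on {0..<1} gamma" "gamma 0 = 0" "!!u. 0 <= u ==> u < 1 ==> 0 <= gamma u & E (v2 u 0) = s (gamma u)"
  and on_s: "!!p t. p : D 1 ==> 0 <= t ==> E p = s t ==> EX u. 0 <= u & u < 1 & p = v2 u 0 & t = gamma u"
  by (rule fray_start_chart[OF s less_imp_le[OF T(1)]]) blast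
 have on: "EX x. 0 < x & x < 1 & gamma x = u" if u: "0 < u" "u <= T" for u
 proof -
  have "s u : E ` D 1" by (rule subsetD[OF ET]) (use u in simp)
  then obtain p where p: "p : D 1" "E p = s u" by auto
  then show ?thesis using on_s[OF p(1) _ p(2)] gamma(2) u(1) by (metis less_eq_real_def less_irrefl)
 qed
 obtain a where a: "0 < a" "a < 1" "gamma a = t" using on[of t] t0 T(2) by auto
 obtain b where b: "0 < b" "b < 1" "gamma b = T" using on[of T] T(1) by auto
 have mono: "gamma x <= gamma y \<longleftrightarrow> x <= y" if "0 <= x" "x < 1" "0 <= y" "y < 1" for x y
  using strict_mono_on_less_eq[OF gamma(1), of x y] that by simp
 define c where "c = min a (1 - a)"
 have c: "0 < c" "c <= a" "c <= 1 - a" using a by (auto simp: c_def)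
 define k where "k p = v2 (a + c * p$1) (c * p$2)" for p :: "real^2"
 have kD: "0 <= k p $ 1" "k p : D 1" if p: "p : D 1" for p
 proof -
  have "c * \<bar>p$1\<bar> + c * \<bar>p$2\<bar> < c * 1" using p c(1) unfolding n1_def distrib_left[symmetric] by auto
  then have q: "\<bar>c * p$1\<bar> + \<bar>c * p$2\<bar> < c" using c(1) by (simp add: abs_mult)
  then show "0 <= k p $ 1" using c(2) by (auto simp: k_def)
  show "k p : D 1" using q c(2,3) by (auto simp: k_def)
 qed
 define f where "f p = E (k p)" for p
 have "oframe s t f"
  unfolding oframe_def adapted_def
 proof (intro conjI ballI)
  show "pe (D 1) f" unfolding f_def
  proof (rule pe_comp[OF E(1)])
   show "inj_on k (D 1)" using c(1) by (auto simp: inj_on_def k_def vec2_eq_iff)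
   show "plat k p" for p unfolding k_def[abs_def] by (intro plat_intros)
  qed (use kD in auto)
  show "f 0 = s t" using gamma(3)[of a] a by (simp add: f_def k_def)
  fix p assume p: "p : D 1"
  show ax: "f p : s ` {0..} \<longleftrightarrow> p : axis" using E(2)[OF kD(2)[OF p]] kD(1)[OF p] c(1) by (simp add: f_def axis_def k_def)
  show "f p : s ` {t..} \<longleftrightarrow> p$2 = 0 & 0 <= p$1"
  proof (cases "p$2 = 0")
   case True
   show ?thesis using kD[OF p] True gamma(3)[of "a + c * p$1"] fray_mem[OF s, of "{t..}"] mono[of a "a + c * p$1"] a t0 c(1) by (auto simp: f_def zero_le_mult_iff k_def)
  qed (use ax t0 in \<open>auto simp: axis_def\<close>)
 qed (rule t0)
 define W where "W = Int_M - s ` {T..}"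
 have W: "openin M W" "s ` {t..t} \<subseteq> W"
  unfolding W_def using fray_closed[OF s] fray_mem[OF s, of "{T..}" t] fray_Int[OF s, of t] T t0 by (auto intro: openin_diff[OF openin_Int_M])
 obtain u omega' rho' where u: "aut W u" "preserves (s ` {0..}) u" "is_sign omega'" "0 < rho'" "!!p. n1 p < rho' ==> u (e p) = f (flip 1 omega' p)" "u (s t) = s t"
  by (rule oriented_slide[OF s e \<open>oframe s t f\<close> order_refl W]) blast
 \<comment> \<open>The slide \<open>u\<close> transports \<open>g\<close> from the frame
   \<open>e\<close> to the frame \<open>f\<close>, which is cut out of the long chart
   \<open>E\<close>.\<close>
 define h where "h x = u (g (inv u x))" for x
 have uI: "aut Int_M u" by (rule aut_mono[OF u(1)]) (auto simp: W_def)
 have ub: "inv u (u x) = x" "u (inv u x) = x" for x using aut_bij[OF u(1)] by (auto simp: bij_def inv_f_f surj_f_inv_f)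
 have h: "aut Int_M h" unfolding h_def[abs_def] by (rule aut_comp[OF uI aut_comp[OF g(1) aut_inv[OF uI]]])
 have hS: "h x : s ` {0..} \<longleftrightarrow> x : s ` {0..}" for x
  using g(2) u(2) ub(2)[of x] unfolding h_def preserves_def by metis
 have hf: "h (f q) = f (flip 1 omega q)" if q: "n1 q < min rho rho'" for q
 proof -
  have "h (f q) = u (e (flip 1 omega (flip 1 omega' q)))" using u(5)[of "flip 1 omega' q"] ub(1)[of "e (flip 1 omega' q)"] q u(3) g(4)[of "flip 1 omega' q"] by (auto simp: h_def flip_sign_cancel)
  also have "... = f (flip 1 omega' (flip 1 omega (flip 1 omega' q)))" using u(3) omega q by (intro u(5)) simp
  also have "flip 1 omega' (flip 1 omega (flip 1 omega' q)) = flip 1 omega q"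
   using is_sign_square[OF u(3)] by (simp add: vec2_eq_iff algebra_simps)
  finally show ?thesis .
 qed
 obtain K' where K': "compactin M K'" "K' \<subseteq> W" "!!x. x ~: K' ==> u x = x" "!!x. x ~: K' ==> inv u x = x" using aut_supp[OF u(1)] by metis
 have hN: "h x = x" if "x : topspace M - (K Un K')" for x using that K(2) K'(3,4) by (simp add: h_def)
 have sTN: "s T : topspace M - (K Un K')" using T K'(2) fray_Int[OF s, of T] Int_M_subset unfolding W_def by auto
 have "open {q:D 1. E q : topspace M - (K Un K')}"
  by (rule pe_vimage_open[OF E(1)]) (use compactin_imp_closedin[OF Hausdorff] K(1) K'(1) in blast)
 then obtain r where r: "0 < r" "!!q. n1 (q - v2 b 0) < r ==> q : {q:D 1. E q : topspace M - (K Un K')}" using open_n1_ball[of _ "v2 b 0"] sTN gamma(3)[of b] b by force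
 have im: "h ` s ` {0..} = s ` {0..}" "preserves (s ` {0..}) h"
  using preserves_image[OF aut_bij[OF h]] hS by (auto simp: preserves_def)
 have h0: "h ` (s ` {0..T}) = s ` {0..T}" "h (s 0) = s 0"
  using fray_reparam_initial[OF s h im(2) _ _ hN[OF sTN]] T(1) by auto
 \<comment> \<open>For \<open>0 < p$1\<close> a vanishing second coordinate is equivalent to lying
   on the ray. The ray without its starting point is mapped to itself, so it stays in this
   region.\<close>
 define R where "R = E ` {p:D 1. 0 < p$1}"
 define O' where "O' = {q:D 1. h (E q) : R}"
 have "open (D 1 Int {p. 0 < p$1})" by (intro open_Int open_D open_Collect_less continuous_intros)
 then have oR: "openin M R" unfolding R_def by (intro pe_open pe_subset[OF E(1)]) (auto simp: Collect_conj_eq)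
 have peh: "pe (D 1) (%q. h (E q))" by (rule aut_pe[OF h E(1)])
 have oO: "open O'" unfolding O'_def by (rule pe_vimage_open[OF peh oR])
 have seg: "(%x. v2 x 0) ` {a..b} \<subseteq> O'"
 proof (intro image_subsetI)
  fix x assume x: "x : {a..b}"
  have x1: "0 < x" "x < 1" "v2 x 0 : D 1" "E (v2 x 0) = s (gamma x)" "0 <= gamma x" "gamma x <= T" using x a b gamma(3)[of x] mono[of x b] by auto
  have "h (s (gamma x)) : s ` {0..T}" using h0(1) x1 by auto
  then obtain v where v: "0 <= v" "v <= T" "h (s (gamma x)) = s v" by auto
  have "v ~= 0"
  proof
   assume "v = 0"
   then have "s (gamma x) = s 0" using v(3) h0(2) aut_bij[OF h] by (metis bij_def inj_eq)
   then show False using fray_inj[OF s, of "gamma x" 0] x1 mono[of x "x/2"] gamma(3)[of "x/2"] by auto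
  qed
  then obtain x' where "0 < x'" "x' < 1" "gamma x' = v" using on[of v] v by auto
  then have "h (E (v2 x 0)) : R" unfolding R_def using v(3) x1(4) gamma(3)[of x'] by (intro image_eqI[of _ _ "v2 x' 0"]) auto
  then show "v2 x 0 : O'" using x1(3) by (simp add: O'_def)
 qed
 have "continuous_on {a..b} (%x. v2 x 0)" by (intro plat_continuous_on ballI plat_v2 plat_id plat_const)
 then have "compact ((%x. v2 x 0) ` {a..b})" by (rule compact_continuous_image) simp
 then obtain d where d: "0 < d" "!!p q. p : (%x. v2 x 0) ` {a..b} ==> q ~: O' ==> d <= dist p q" using separate_compact_closed[of "(%x. v2 x 0) ` {a..b}" "- O'"] seg oO by blast
 \<comment> \<open>Small enough for three purposes: the segment at height \<open>y\<close> stays in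
   \<open>O'\<close>, its right end is where \<open>h\<close> is the identity, and its left end is
   where \<open>h\<close> is the reflected germ.\<close>
 define y where "y = min (min d r) (c * min (min rho rho') 1) / 2"
 have y: "0 < y" "y < d" "y < r" "y / c < min rho rho'" "y / c < 1"
  using d(1) r(1) c(1) g(3) u(4) by (auto simp: y_def min_less_iff_disj field_simps)
 have inO: "v2 x y : O'" if "x : {a..b}" for x
 proof (rule ccontr)
  assume "v2 x y ~: O'"
  then have "d <= dist (v2 x 0) (v2 x y)" using d(2) that by blast
  also have "... <= n1 (v2 x 0 - v2 x y)" unfolding dist_norm by (rule norm_le_n1)
  also have "... = y" using y(1) by (simp add: n1_def)
  finally show False using y(2) by simp
 qed
 define F where "F q = inv_into (D 1) E (h (E q))" for q
 have F: "F q = p" if "p : D 1" "h (E q) = E p" for p q using E(1) that by (auto simp: F_def pe_def)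
 have "plat F q" if "q : O'" for q
 proof -
  have "h (E q) : R" using that by (simp add: O'_def)
  then obtain p where p: "p : D 1" "h (E q) = E p" unfolding R_def by blast
  have "plm (%q. h (E q)) q" using peh that by (simp add: pe_def O'_def)
  then show ?thesis unfolding F_def[abs_def] by (rule pe_inv[of "%q. h (E q)", OF _ E(1) p])
 qed
 then have "plat (%x. F (v2 x y) $ 2) x" if "x : {a..b}" for x
  using plat_comp[of "%x. v2 x y" x F] inO[OF that] by (intro plat_nth) (simp add: plat_v2 plat_id plat_const)
 then have cont: "continuous_on {a..b} (%x. F (v2 x y) $ 2)" by (intro plat_continuous_on) blast
 have nz: "F (v2 x y) $ 2 ~= 0" if x: "x : {a..b}" for x
 proof -
  obtain p where p: "p : D 1" "0 < p$1" "h (E (v2 x y)) = E p" using inO[OF x] by (auto simp: O'_def R_def)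
  have "E p ~: s ` {0..}" using E(2)[of "v2 x y"] inO[OF x] y(1) hS p(3) by (force simp: O'_def)
  then show ?thesis using E(2)[OF p(1)] p F[OF p(1,3)] by simp
 qed
 have Fb: "F (v2 b y) $ 2 = y" using r(2)[of "v2 b y"] hN[of "E (v2 b y)"] y(1,3) F[of "v2 b y" "v2 b y"] by (simp add: n1_def)
 have p: "k (v2 0 (y / c)) = v2 a y" "k (v2 0 (- (y / c))) = v2 a (- y)" "v2 0 (- (y / c)) : D 1" "n1 (v2 0 (y / c)) < min rho rho'"
  using c(1) y by (auto simp: k_def)
 have Fa: "F (v2 a y) $ 2 = - y" using hf[OF p(4)] p(1,2) F[of "v2 a (- y)"] kD(2)[OF p(3)] p(2) by (simp add: f_def flip_def omega(2))
 obtain x where "x : {a..b}" "F (v2 x y) $ 2 = 0" using IVT'[of "%x. F (v2 x y) $ 2" a 0 b] cont mono[of a b] a b T(2) Fa Fb y(1) by auto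
 then show False using nz by blast
qed

lemma side_unique:
 assumes s: "fray s" and e: "oframe s t e" and "side s e e' omega" "side s e e' omega'" shows "omega = omega'"
proof -
 show ?thesis using side_unique_self[OF s e side_trans[OF assms(3) side_sym[OF assms(4)]]] side_sign[OF assms(3)] side_sign[OF assms(4)] by (auto simp: is_sign_def)
qed

text \<open>The slide has its support in \<open>W\<close>, where the two rays have the same points,
  so it preserves both. Uniqueness along \<open>s\<close> identifies its sign.\<close>

lemma side_local:
 assumes s: "fray s" "oframe s t e" "oframe s t' e'" and s': "fray s'" "oframe s' u e"
  and t: "t <= t'" and W: "openin M W" "s ` {t..t'} \<subseteq> W" "W \<subseteq> Int_M" "W Int s ` {0..} = W Int s' ` {0..}" and sd: "side s e e' omega"
 shows "side s' e e' omega"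
proof -
 obtain g omega' rho where g: "aut W g" "preserves (s ` {0..}) g" "is_sign omega'" "0 < rho" "!!p. n1 p < rho ==> g (e p) = e' (flip 1 omega' p)"
  by (rule oriented_slide[OF s(1,2,3) t W(1,2)]) blast
 have aI: "aut Int_M g" by (rule aut_mono[OF g(1) W(3)])
 have "g x : s' ` {0..} \<longleftrightarrow> x : s' ` {0..}" for x
 proof (cases "x : W")
  case True
  then have "g x : W" using aut_mem[OF g(1) order_refl] by blast
  then show ?thesis using True W(4) g(2) unfolding preserves_def by blast
 qed (use aut_outside[OF g(1)] in simp)
 then have "side s' e e' omega'" unfolding side_def preserves_def using g aI by blast
 moreover have "omega' = omega" using g aI side_unique[OF s(1,2) _ sd] unfolding side_def by blast
 ultimately show ?thesis by simp
qed

section \<open>Signs of rays with a common tail\<close>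

definition agree :: "(real => 'a) => real => (real => 'a) => real => bool" where
 "agree rho t a u \<longleftrightarrow> 0 < t & 0 < u & (ALL v>=0. rho (t + v) = a (u + v))"

text \<open>An arbitrary choice of a side for every ray, against which signs are measured.\<close>

definition base :: "(real => 'a) => real^2 => 'a" where "base a = (SOME e. oframe a 1 e)"

definition positive :: "(real => 'a) => real => (real^2 => 'a) => bool" where
 "positive a u e \<longleftrightarrow> oframe a u e & side a (base a) e 1"

text \<open>The frame \<open>e\<close> is moved along \<open>rho\<close> into the tail shared with
  \<open>a\<close> and compared there with the chosen side of \<open>a\<close>. This is a relation
  because the comparison involves choices; their independence is \<open>sgn_unique\<close>.\<close>

definition sgn_rel :: "(real => 'a) => (real => 'a) => (real^2 => 'a) => real => bool" where
 "sgn_rel a rho e omega \<longleftrightarrow> (EX t u f. agree rho t a u & oframe rho t f & positive a u f & side rho e f omega)"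

lemma base: assumes "fray a" shows "oframe a 1 (base a)"
proof -
 have "EX e. oframe a 1 e" using fray_Int[OF assms, of 1] oframe_exists[OF assms _ openin_Int_M, of 1] by auto
 then show ?thesis unfolding base_def by (rule someI_ex)
qed

lemma positive_exists:
 assumes a: "fray a" and u: "0 < u" and W: "openin M W" "a u : W" shows "EX e. positive a u e & e ` D 1 \<subseteq> W"
proof -
 obtain e where e: "oframe a u e" "e ` D 1 \<subseteq> W" using oframe_exists[OF a u W] by blast
 obtain omega where omega: "side a (base a) e omega" using side_exists[OF a base[OF a] e(1)] by blast
 note sg = side_sign[OF omega]
 let ?e = "%p. e (flip 1 omega p)"
 have "side a e ?e omega"
  unfolding side_def using sg flip_sign_cancel[OF sg]
  by (intro conjI exI[of _ "%x. x"] exI[of _ 1]) (auto simp: aut_id preserves_def)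
 then show ?thesis using side_trans[OF omega] is_sign_square[OF sg] e(2) sg oframe_flip[OF e(1) sg] unfolding positive_def by force
qed

lemma agree_shift: "agree rho t a u ==> 0 <= x ==> agree rho (t + x) a (u + x)"
 unfolding agree_def by (metis add.assoc add_nonneg_nonneg add_pos_nonneg)

lemma agree_image: assumes "agree rho t a u" shows "rho ` {t..} = a ` {u..}"
proof -
 have sh: "{y..} = (%v. y + v) ` {0..}" for y :: real by auto
 have "rho ` {t..} = (%v. rho (t + v)) ` {0..}" unfolding sh[of t] image_image ..
 also have "... = (%v. a (u + v)) ` {0..}" using assms by (intro image_cong) (auto simp: agree_def)
 also have "... = a ` {u..}" unfolding sh[of u] image_image ..
 finally show ?thesis .
qed

lemma agree_trans: assumes "agree rho t a u" "agree a u' b w" shows "EX x>=0. EX y>=0. agree rho (t + x) b (w + y)"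
proof (cases "u <= u'")
 case True
 have "rho (t + (u' - u) + v) = b (w + v)" if "0 <= v" for v
 proof -
  have "rho (t + (u' - u + v)) = a (u + (u' - u + v))" using assms(1) that True by (simp add: agree_def)
  also have "... = a (u' + v)" by (simp add: algebra_simps)
  also have "... = b (w + v)" using assms(2) that by (simp add: agree_def)
  finally show ?thesis by (simp add: algebra_simps)
 qed
 then have "agree rho (t + (u' - u)) b (w + 0)" using assms True unfolding agree_def by simp
 then show ?thesis using True by (intro exI[of _ "u' - u"] conjI exI[of _ 0]) auto
next
 case False
 have "rho (t + v) = b (w + (u - u') + v)" if "0 <= v" for v
 proof -
  have "rho (t + v) = a (u' + (u - u' + v))" using assms(1) that by (simp add: agree_def)
  also have "... = b (w + (u - u' + v))" using assms(2) that False unfolding agree_def by (metis add_nonneg_nonneg diff_ge_0_iff_ge linear)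
  finally show ?thesis by (simp add: algebra_simps)
 qed
 then have "agree rho (t + 0) b (w + (u - u'))" using assms False by (auto simp: agree_def)
 then show ?thesis using False by (intro exI[of _ 0] conjI exI[of _ "u - u'"]) auto
qed

text \<open>An open set in which both rays have the same points, as \<open>side_local\<close> asks
  for.\<close>

definition region :: "(real => 'a) => real => (real => 'a) => real => 'a set" where
 "region rho t a u = Int_M - (rho ` {0..t} Un a ` {0..u})"

lemma region:
 assumes rho: "fray rho" and a: "fray a" and ag: "agree rho t a u"
 shows "openin M (region rho t a u)" "region rho t a u Int rho ` {0..} = region rho t a u Int a ` {0..}"
  "!!x. t < x ==> rho x : region rho t a u" "!!x. u < x ==> a x : region rho t a u"
proof -
 have tu: "0 < t" "0 < u" using ag by (auto simp: agree_def)
 show "openin M (region rho t a u)" unfolding region_def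
  by (intro openin_diff openin_Int_M closedin_Un fray_closed_segment rho a order_refl)
 show "region rho t a u Int rho ` {0..} = region rho t a u Int a ` {0..}" using tu agree_image[OF ag] unfolding region_def by fastforce
 have key: "rho (t + x) : region rho t a u & rho (t + x) = a (u + x)" if "0 < x" for x
 proof -
  have eq: "rho (t + x) = a (u + x)" using ag that by (simp add: agree_def)
  have "rho (t + x) ~: rho ` {0..t}" using fray_mem[OF rho, of "{0..t}" "t + x"] tu that by auto
  moreover have "a (u + x) ~: a ` {0..u}" using fray_mem[OF a, of "{0..u}" "u + x"] tu that by auto
  moreover have "rho (t + x) : Int_M" using fray_Int[OF rho] tu that by simp
  ultimately show ?thesis using eq by (simp add: region_def)
 qed
 show "rho x : region rho t a u" if "t < x" for x using conjunct1[OF key[of "x - t"]] that by simp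
 show "a x : region rho t a u" if "u < x" for x using key[of "x - u"] that by auto
qed

lemma agree_oframe:
 assumes rho: "fray rho" and a: "fray a" and ag: "agree rho t a u" and x: "0 < x"
  and f: "oframe a (u + x) f" "f ` D 1 \<subseteq> region rho t a u"
 shows "oframe rho (t + x) f"
proof (rule oframe_transfer[OF f])
 have sh: "agree rho (t + x) a (u + x)" using agree_shift[OF ag] x by simp
 show "0 < t + x" using ag x by (simp add: agree_def)
 show "rho (t + x) = a (u + x)" using ag x by (simp add: agree_def)
 show "region rho t a u Int a ` {0..} = region rho t a u Int rho ` {0..}" using region(2)[OF rho a ag] by simp
 show "region rho t a u Int a ` {u + x..} = region rho t a u Int rho ` {t + x..}" using agree_image[OF sh] by simp
qed

lemma sgn_sign: "sgn_rel a rho e omega ==> is_sign omega" using side_sign by (auto simp: sgn_rel_def)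

text \<open>The chosen side of \<open>a\<close> is carried along \<open>a\<close> itself, and beyond
  \<open>t\<close> and \<open>u\<close> the two rays share their points. So the comparison can be
  made at any later frame in \<open>region\<close>.\<close>

lemma sgn_far:
 assumes rho: "fray rho" and a: "fray a" and sg: "sgn_rel a rho e omega"
 obtains t u where "agree rho t a u"
  "!!x f. 0 < x ==> positive a (u + x) f ==> f ` D 1 \<subseteq> region rho t a u ==> oframe rho (t + x) f & side rho e f omega"
proof -
 obtain t u f0 where f0: "agree rho t a u" "oframe rho t f0" "positive a u f0" "side rho e f0 omega" using sg unfolding sgn_rel_def by blast
 show thesis
 proof (rule that[OF f0(1)])
  fix x f assume x: "0 < x" and f: "positive a (u + x) f" "f ` D 1 \<subseteq> region rho t a u"
  have "side a f0 f 1" using side_trans[OF side_sym[of a "base a" f0 1], of f 1] f0(3) f(1) by (simp add: positive_def)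
  \<comment> \<open>The starting point \<open>a u\<close> of the slide is not in
    \<open>region\<close>; the chart \<open>f0\<close> around it is added.\<close>
  define W where "W = region rho t a u Un f0 ` D 1"
  have pe0: "pe (D 1) f0" using f0(2) by (simp add: oframe_def adapted_def)
  have W: "openin M W" unfolding W_def by (intro openin_Un region(1)[OF rho a f0(1)] pe_open[OF pe0])
  have "f0 ` D 1 Int rho ` {0..} = f0 ` D 1 Int a ` {0..}"
   using f0(2,3) unfolding positive_def oframe_def adapted_def by blast
  then have eq: "W Int a ` {0..} = W Int rho ` {0..}" using region(2)[OF rho a f0(1)] unfolding W_def by blast
  have "a u : f0 ` D 1" using f0(3) by (auto simp: positive_def oframe_def intro!: image_eqI[of _ f0 0])
  moreover have "a y : region rho t a u" if "u < y" for y by (rule region(4)[OF rho a f0(1) that])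
  ultimately have sub: "a ` {u..u + x} \<subseteq> W" unfolding W_def by force
  have WI: "W \<subseteq> Int_M" using pe0 unfolding W_def region_def pe_def by blast
  have "side rho f0 f 1"
   by (rule side_local[OF a _ _ rho f0(2) _ W sub WI eq \<open>side a f0 f 1\<close>]) (use f0(3) f(1) x in \<open>auto simp: positive_def\<close>)
  then show "oframe rho (t + x) f & side rho e f omega" using agree_oframe[OF rho a f0(1) x _ f(2)] f(1) side_trans[OF f0(4), of f 1] by (simp add: positive_def)
 qed
qed

text \<open>Both signs are evaluated at one frame, beyond the starting points of both agreements,
  where \<open>side_unique\<close> compares them.\<close>

lemma sgn_unique:
 assumes rho: "fray rho" and a: "fray a" and e: "oframe rho t0 e" and sg: "sgn_rel a rho e omega" "sgn_rel a rho e omega'" shows "omega = omega'"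
proof -
 obtain t u where tu: "agree rho t a u"
  "!!x f. 0 < x ==> positive a (u + x) f ==> f ` D 1 \<subseteq> region rho t a u ==> oframe rho (t + x) f & side rho e f omega"
  by (rule sgn_far[OF rho a sg(1)]) blast
 obtain t' u' where tu': "agree rho t' a u'"
  "!!x f. 0 < x ==> positive a (u' + x) f ==> f ` D 1 \<subseteq> region rho t' a u' ==> oframe rho (t' + x) f & side rho e f omega'"
  by (rule sgn_far[OF rho a sg(2)]) blast
 have pos: "0 < u" "0 < u'" using tu(1) tu'(1) by (auto simp: agree_def)
 have "openin M (region rho t a u Int region rho t' a u')" using region(1)[OF rho a] tu(1) tu'(1) by blast
 moreover have "a (u + u') : region rho t a u Int region rho t' a u'" using region(4)[OF rho a] tu(1) tu'(1) pos by simp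
 ultimately obtain f where f: "positive a (u + u') f" "f ` D 1 \<subseteq> region rho t a u Int region rho t' a u'" using positive_exists[OF a, of "u + u'"] pos by force
 have "side rho e f omega" using tu(2)[OF pos(2) f(1)] f(2) by blast
 moreover have "side rho e f omega'" using tu'(2)[OF pos(1)] f by (auto simp: add.commute)
 ultimately show ?thesis by (rule side_unique[OF rho e])
qed

lemma sgn_exists:
 assumes rho: "fray rho" and a: "fray a" and ag: "agree rho t a u" and e: "oframe rho t0 e" shows "EX omega. sgn_rel a rho e omega"
proof -
 have u1: "0 < u + 1" using ag by (simp add: agree_def)
 obtain f where f: "positive a (u + 1) f" "f ` D 1 \<subseteq> region rho t a u"
  using positive_exists[OF a u1 region(1)[OF rho a ag] region(4)[OF rho a ag]] by auto
 have o: "oframe rho (t + 1) f" using agree_oframe[OF rho a ag _ _ f(2), of 1] f(1) by (simp add: positive_def)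
 obtain omega where "side rho e f omega" using side_exists[OF rho e o] by blast
 then show ?thesis unfolding sgn_rel_def using agree_shift[OF ag, of 1] o f(1) by auto
qed

lemma sgn_mult: "side rho e e' x ==> sgn_rel a rho e' omega ==> sgn_rel a rho e (x * omega)"
 unfolding sgn_rel_def using side_trans by blast

text \<open>The frame lies on the common tail of \<open>rho\<close> and \<open>sig\<close>, and its
  slide to a later frame takes place in their \<open>region\<close>. The different initial pieces of
  the rays therefore have no influence on the sign.\<close>

lemma sgn_shift:
 assumes rho: "fray rho" and sig: "fray sig" and d: "fray d" and ag: "agree rho z sig w" and x: "0 < x"
  and e: "oframe rho (z + x) e" "oframe sig (w + x) e" and sg: "sgn_rel d sig e omega"
 shows "sgn_rel d rho e omega"
proof -
 obtain t u where tu: "agree sig t d u"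
  "!!x f. 0 < x ==> positive d (u + x) f ==> f ` D 1 \<subseteq> region sig t d u ==> oframe sig (t + x) f & side sig e f omega"
  by (rule sgn_far[OF sig d sg]) blast
 have pos: "0 < t" "0 < u" "0 < z" "0 < w" using tu(1) ag by (auto simp: agree_def)
 define y where "y = w + x"
 have y: "0 < y" "w < t + y" using pos x by (auto simp: y_def)
 have mem: "d (u + y) : region rho z sig w Int region sig t d u" using tu(1) y region(4)[OF rho sig ag y(2)] region(4)[OF sig d tu(1)] by (simp add: agree_def)
 have uy: "0 < u + y" using pos y by simp
 obtain f where f: "positive d (u + y) f" "f ` D 1 \<subseteq> region rho z sig w Int region sig t d u"
  using positive_exists[OF d uy openin_Int[OF region(1)[OF rho sig ag] region(1)[OF sig d tu(1)]] mem] by blast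
 have fs: "oframe sig (t + y) f" "side sig e f omega" using tu(2)[OF y(1) f(1)] f(2) by auto
 have ty: "t + y = w + (t + x)" by (simp add: y_def)
 have tx: "0 < t + x" using pos x by simp
 have fr: "oframe rho (z + (t + x)) f"
  by (rule agree_oframe[OF rho sig ag tx]) (use fs(1) f(2) ty in auto)
 have "side rho e f omega"
 proof (rule side_local[OF sig e(2) fs(1) rho e(1) _ region(1)[OF rho sig ag] _ _ _ fs(2)])
  show "w + x <= t + y" using pos by (simp add: y_def)
  show "sig ` {w + x..t + y} \<subseteq> region rho z sig w" using region(4)[OF rho sig ag] x by auto
  show "region rho z sig w \<subseteq> Int_M" by (auto simp: region_def)
  show "region rho z sig w Int sig ` {0..} = region rho z sig w Int rho ` {0..}" using region(2)[OF rho sig ag] by simp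
 qed
 moreover have "agree rho (z + (t + x)) d (u + y)"
 proof -
  have "rho (z + (t + x) + v) = d (u + y + v)" if "0 <= v" for v
  proof -
   have "rho (z + (t + x + v)) = sig (w + (t + x + v))" using ag that tx by (simp add: agree_def)
   also have "... = sig (t + (y + v))" by (simp add: y_def algebra_simps)
   also have "... = d (u + (y + v))" using tu(1) that y by (simp add: agree_def)
   finally show ?thesis by (simp add: algebra_simps)
  qed
  then show ?thesis using pos tx y unfolding agree_def by simp
 qed
 ultimately show ?thesis unfolding sgn_rel_def using fr f(1) by blast
qed

subsection \<open>Back and forth\<close>

definition annulus :: "(real^2 => 'a) => 'a set" where "annulus e = e ` {p. 2 <= n1 p & n1 p <= 15}"

text \<open>The setting of a single step: two rays run together through the annulus and may part
  only behind it, without coming back to the annulus or to \<open>P\<close>.\<close>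

definition gate :: "'a set => (real^2 => 'a) => (real => real) => (real => 'a) => (real => 'a) => bool" where
 "gate P e tau rho s \<longleftrightarrow> pe wide_ring e & e ` wide_ring Int P = {} & strict_mono_on {2..15} tau & continuous_on {2..15} tau &
   (ALL t. 2 <= t --> t <= 15 --> 0 <= tau t & rho (tau t) = e (v2 0 t)) & (ALL t. 0 <= t --> t <= tau 15 --> rho t = s t) &
   (ALL t>=0. rho t : annulus e | s t : annulus e --> t : tau ` {2..15}) & (ALL t. tau 2 <= t --> rho t ~: P & s t ~: P)"

text \<open>The frame at \<open>(0, 5)\<close>, about which \<open>drag\<close> asks for a fixed
  disc. Exchanging the coordinates makes the first one run along the ray, and the factor 1/2 keeps
  the frame inside \<open>ring\<close>.\<close>

definition gframe :: "(real^2 => 'a) => real^2 => 'a" where "gframe e p = e (v2 0 5 + (1/2) *\<^sub>R swp p)"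

lemma gate_tau:
 assumes "gate P e tau rho s" "2 <= t" "t <= 15"
 shows "0 <= tau t" "rho (tau t) = e (v2 0 t)" "s (tau t) = e (v2 0 t)" "tau 2 <= tau t" "tau t <= tau 15"
proof -
 show "tau 2 <= tau t" "tau t <= tau 15"
  using assms by (cases "t = 2"; cases "t = 15"; force simp: gate_def strict_mono_on_def less_imp_le)+
 then show "0 <= tau t" "rho (tau t) = e (v2 0 t)" "s (tau t) = e (v2 0 t)" using assms unfolding gate_def by metis+
qed

lemma gate_less: "gate P e tau rho s ==> 2 <= t ==> t < t' ==> t' <= 15 ==> tau t < tau t'"
 by (auto simp: gate_def strict_mono_on_def)

lemma gate_sym: assumes "gate P e tau rho s" shows "gate P e tau s rho"
proof -
 have "s (tau t) = e (v2 0 t)" if "2 <= t" "t <= 15" for t using gate_tau(3)[OF assms that] .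
 then show ?thesis using assms unfolding gate_def by metis
qed

lemma gate_annulus:
 assumes "gate P e tau rho s" "0 <= t" "rho t : annulus e"
 obtains u where "2 <= u" "u <= 15" "t = tau u" "rho t = e (v2 0 u)"
proof -
 have "t : tau ` {2..15}" using assms by (simp add: gate_def)
 then obtain u where u: "2 <= u" "u <= 15" "t = tau u" by auto
 then show thesis using that gate_tau(2)[OF assms(1) u(1,2)] by simp
qed

lemma gate_inj: "gate P e tau rho s ==> p : wide_ring ==> q : wide_ring ==> e p = e q \<longleftrightarrow> p = q"
 by (auto simp: gate_def pe_def inj_on_def)

lemma gate_ring:
 assumes g: "gate P e tau rho s" and p: "p : ring" shows "e p : rho ` {0..} \<longleftrightarrow> p$1 = 0 & 0 < p$2"
proof
 have pw: "p : wide_ring" using p by (auto simp: ring_def wide_ring_def)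
 assume "e p : rho ` {0..}"
 then obtain t where t: "0 <= t" "e p = rho t" by auto
 have "rho t : annulus e" using p t(2)[symmetric] by (auto simp: annulus_def ring_def)
 then obtain u where u: "2 <= u" "u <= 15" "rho t = e (v2 0 u)" using gate_annulus[OF g t(1)] by metis
 show "p$1 = 0 & 0 < p$2" using gate_inj[OF g pw, of "v2 0 u"] t(2) u u(1) by (simp add: wide_ring_def)
next
 assume ax: "p$1 = 0 & 0 < p$2"
 then have pv: "p = v2 0 (p$2)" "n1 p = p$2" by (simp_all add: vec2_eq_iff n1_def)
 then have "2 <= p$2" "p$2 <= 15" using p by (auto simp: ring_def)
 then show "e p : rho ` {0..}" using gate_tau[OF g] pv by force
qed

lemma gate_point:
 assumes "n1 p < 1" shows "v2 0 5 + (1/2) *\<^sub>R swp p : ring"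
proof -
 show "v2 0 5 + (1/2) *\<^sub>R swp p : ring" using n1_near[of "v2 0 5" "(1/2) *\<^sub>R swp p"] assms unfolding ring_def abs_le_iff mem_Collect_eq by simp
qed

lemma gate_oframe: assumes rho: "fray rho" and g: "gate P e tau rho s" shows "oframe rho (tau 5) (gframe e)"
proof -
 have pe: "pe (D 1) (%p. e (v2 0 5 + (1/2) *\<^sub>R swp p))"
 proof (rule pe_comp[OF wide_ring_pe, of e "D 1" "%p. v2 0 5 + (1/2) *\<^sub>R swp p"])
  show "pe wide_ring e" using g by (simp add: gate_def)
  show "inj_on (%p. v2 0 5 + (1/2) *\<^sub>R swp p) (D 1)" by (auto simp: inj_on_def swp_def vec2_eq_iff)
  show "plat (%p. v2 0 5 + (1/2) *\<^sub>R swp p) p" for p by (intro plat_add plat_const plat_scaleR plat_swp)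
  show "(%p. v2 0 5 + (1/2) *\<^sub>R swp p) ` D 1 \<subseteq> ring" using gate_point by auto
 qed simp
 have mem: "gframe e p : rho ` {0..} \<longleftrightarrow> p$2 = 0" if p: "p : D 1" for p
 proof -
  show ?thesis using p gate_ring[OF g gate_point[of p]] by (auto simp: gframe_def n1_def)
 qed
 have tail: "gframe e p : rho ` {tau 5..} \<longleftrightarrow> p$2 = 0 & 0 <= p$1" if p: "p : D 1" for p
 proof (cases "p$2 = 0")
  case True
  define u where "u = 5 + p$1 / 2"
  have u: "2 <= u" "u <= 15" using p by (auto simp: u_def n1_def)
  have "gframe e p = e (v2 0 u)" using True by (simp add: gframe_def u_def swp_def vec2_eq_iff arg_cong[of _ _ e])
  then have "gframe e p : rho ` {tau 5..} \<longleftrightarrow> tau 5 <= tau u" using gate_tau(2)[OF g u] fray_mem[OF rho, of "{tau 5..}" "tau u"] gate_tau(1)[OF g u] gate_tau(1)[OF g, of 5] by auto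
  also have "... \<longleftrightarrow> 5 <= u" using gate_less[OF g, of 5 u] gate_less[OF g, of u 5] u by (cases u "5::real" rule: linorder_cases) auto
  finally show ?thesis using True by (simp add: u_def)
 next
  case False
  show ?thesis using gate_tau(1)[OF g, of 5] mem[OF p] False by auto
 qed
 have "0 < tau 5" using gate_less[OF g, of 2 5] gate_tau(1)[OF g, of 2] by simp
 moreover have "gframe e 0 = rho (tau 5)" using gate_tau(2)[OF g, of 5] by (simp add: gframe_def swp_def)
 ultimately show ?thesis using pe mem tail by (simp add: oframe_def adapted_def axis_def gframe_def[abs_def])
qed

text \<open>
 The sign \<open>c\<close> compares the sides of \<open>a\<close> and \<open>b\<close>, transported along \<open>rho\<close> and \<open>s\<close> from the annulus, where the two
 rays agree.
\<close>

definition linked where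
 "linked a b P e tau rho s c \<longleftrightarrow> fray rho & fray s & (EX t u. agree rho t a u) & (EX t u. agree s t b u) & gate P e tau rho s &
   is_sign c & (EX omega. sgn_rel a rho (gframe e) omega & sgn_rel b s (gframe e) (c * omega))"

text \<open>The frame at \<open>(0, 5)\<close> is slid along \<open>rho\<close> to a frame
  \<open>f\<close> on the common tail, and back along \<open>s\<close>. Since the sign is 1, both
  slides induce the same germ, and the composite \<open>theta\<close> fixes a disc about
  \<open>(0, 5)\<close>. It maps the tail of \<open>rho\<close> to that of \<open>s\<close>, so
  \<open>drag_exists\<close> applies.\<close>

lemma linked_drag:
 assumes a: "fray a" and P: "compactin M P" and lk: "linked a a P e tau rho s 1"
 shows "EX phi. aut (Int_M - P) phi & phi ` (rho ` {0..}) = s ` {0..}"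
proof -
 have g: "gate P e tau rho s" and rho: "fray rho" and s: "fray s" using lk by (auto simp: linked_def)
 have pew: "pe wide_ring e" and eP: "e ` wide_ring Int P = {}" using g by (auto simp: gate_def)
 obtain omega where sg: "sgn_rel a rho (gframe e) omega" "sgn_rel a s (gframe e) omega" using lk by (auto simp: linked_def)
 have orho: "oframe rho (tau 5) (gframe e)" by (rule gate_oframe[OF rho g])
 have os: "oframe s (tau 5) (gframe e)" by (rule gate_oframe[OF s gate_sym[OF g]])
 \<comment> \<open>The slides fix \<open>P\<close>, the inner part of the annulus and the ray up to
   \<open>tau (9/2)\<close>. The stretch from there to \<open>tau 5\<close> is left free, since
   moving the point at \<open>tau 5\<close> outwards has to stretch some arc behind it.\<close>
 define W where "W = Int_M - (P Un rho ` {0..tau (9/2)} Un e ` {p. 2 <= n1 p & n1 p <= 4})"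
 have W: "openin M W"
 proof -
  have "compactin M (P Un rho ` {0..tau (9/2)} Un e ` {p. 2 <= n1 p & n1 p <= 4})"
   by (intro compactin_Un P fray_compact[OF rho order_refl] wide_ring_compact[OF pew]) auto
  then show ?thesis unfolding W_def by (intro openin_diff openin_Int_M compactin_imp_closedin[OF Hausdorff])
 qed
 have head: "rho ` {0..tau (9/2)} = s ` {0..tau (9/2)}"
  using g gate_tau(5)[OF g, of "9/2"] by (intro image_cong) (auto simp: gate_def)
 have inW: "r t : W" if r: "fray r" "gate P e tau r r'" "r ` {0..tau (9/2)} = rho ` {0..tau (9/2)}" and t: "tau 5 <= t" for r r' t
 proof -
  note gr = r(2)
  have t0: "0 <= t" using t gate_tau(1)[OF gr, of 5] by simp
  have t5: "tau 2 < tau 5" "tau (9/2) < tau 5" using gate_less[OF gr] by auto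
  have "r t ~: P" using gr t t5 by (auto simp: gate_def)
  moreover have "r t ~: rho ` {0..tau (9/2)}" unfolding r(3)[symmetric]
   using fray_mem[OF r(1), of "{0..tau (9/2)}" t] t0 t t5 by auto
  moreover have "r t ~: e ` {p. 2 <= n1 p & n1 p <= 4}"
  proof
   assume "r t : e ` {p. 2 <= n1 p & n1 p <= 4}"
   then obtain p where p: "2 <= n1 p" "n1 p <= 4" "r t = e p" by auto
   then obtain u where u: "2 <= u" "u <= 15" "t = tau u" "r t = e (v2 0 u)" using gate_annulus[OF gr t0] by (auto simp: annulus_def)
   show False using gate_inj[OF gr, of p "v2 0 u"] p u p(2) u(1) gate_less[OF gr u(1), of 5] u(3) t by (simp add: wide_ring_def)
  qed
  moreover have "r t : Int_M" by (rule fray_Int[OF r(1) t0])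
  ultimately show ?thesis by (simp add: W_def)
 qed
 note inrho = inW[OF rho g refl] and ins = inW[OF s gate_sym[OF g] head[symmetric]]
 obtain t u where tu: "agree rho t a u"
  "!!x f. 0 < x ==> positive a (u + x) f ==> f ` D 1 \<subseteq> region rho t a u ==> oframe rho (t + x) f & side rho (gframe e) f omega"
  by (rule sgn_far[OF rho a sg(1)]) blast
 obtain t' u' where tu': "agree s t' a u'"
  "!!x f. 0 < x ==> positive a (u' + x) f ==> f ` D 1 \<subseteq> region s t' a u' ==> oframe s (t' + x) f & side s (gframe e) f omega"
  by (rule sgn_far[OF s a sg(2)]) blast
 have pos: "0 < t" "0 < u" "0 < t'" "0 < u'" using tu(1) tu'(1) by (auto simp: agree_def)
 have tau5: "0 <= tau 5" using gate_tau(1)[OF g] by simp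
 \<comment> \<open>The choice gives \<open>u + x = u' + x'\<close>: both signs are compared at the
   same point of \<open>a\<close>, and this point comes after \<open>tau 5\<close> on both
   rays.\<close>
 define x where "x = u' + tau 5"
 define x' where "x' = u + tau 5"
 have x: "0 < x" "0 < x'" "u + x = u' + x'" "tau 5 <= t + x" "tau 5 <= t' + x'" using pos tau5 by (auto simp: x_def x'_def)
 have ux: "0 < u + x" using pos x by simp
 have "openin M (region rho t a u Int region s t' a u')" using region(1)[OF rho a tu(1)] region(1)[OF s a tu'(1)] by blast
 moreover have "a (u + x) : region rho t a u Int region s t' a u'"
  using region(4)[OF rho a tu(1), of "u + x"] region(4)[OF s a tu'(1), of "u' + x'"] x by simp
 ultimately obtain f where f: "positive a (u + x) f" "f ` D 1 \<subseteq> region rho t a u Int region s t' a u'"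
  using positive_exists[OF a ux] by metis
 have frho: "oframe rho (t + x) f" "side rho (gframe e) f omega" using tu(2)[OF x(1) f(1)] f(2) by auto
 have fs: "oframe s (t' + x') f" "side s (gframe e) f omega" using tu'(2)[OF x(2)] f x(3) by auto
 have slide: "EX h d. aut W h & 0 < d & (ALL p. n1 p < d --> h (gframe e p) = f (flip 1 omega p)) & h ` (r ` {tau 5..}) = r ` {y..}"
  if r: "fray r" "oframe r (tau 5) (gframe e)" "oframe r y f" "tau 5 <= y" "side r (gframe e) f omega" "!!t. tau 5 <= t ==> r t : W" for r y
 proof -
  have "r ` {tau 5..y} \<subseteq> W" using r(6) by auto
  then obtain h omega' d where h: "aut W h" "preserves (r ` {0..}) h" "is_sign omega'" "0 < d" "!!p. n1 p < d ==> h (gframe e p) = f (flip 1 omega' p)" "h (r (tau 5)) = r y"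
   by (rule oriented_slide[OF r(1,2,3,4) W]) blast
  have "omega' = omega" using h aut_mono[OF h(1)   ] side_unique[OF r(1,2) _ r(5)] unfolding side_def by (force simp: W_def)
  moreover have "h ` r ` {0..} \<subseteq> r ` {0..}" using preserves_image[OF aut_bij[OF h(1)] h(2)] by simp
  then have "h ` (r ` {tau 5..}) = r ` {y..}" using tau5 r(4) by (intro fray_reparam_tail[OF r(1) h(1) _ _ _ h(6)]) auto
  ultimately show ?thesis using h by blast
 qed
 obtain h d where h: "aut W h" "0 < d" "!!p. n1 p < d ==> h (gframe e p) = f (flip 1 omega p)" "h ` (rho ` {tau 5..}) = rho ` {t + x..}"
  using slide[OF rho orho frho(1) x(4) frho(2) inrho] by blast
 obtain h' d' where h': "aut W h'" "0 < d'" "!!p. n1 p < d' ==> h' (gframe e p) = f (flip 1 omega p)" "h' ` (s ` {tau 5..}) = s ` {t' + x'..}"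
  using slide[OF s os fs(1) x(5) fs(2) ins] by blast
 have same: "rho ` {t + x..} = s ` {t' + x'..}"
  using agree_image[OF agree_shift[OF tu(1), of x]] agree_image[OF agree_shift[OF tu'(1), of x']] x by simp
 have ih': "inv h' (h' z) = z" for z using aut_bij[OF h'(1)] by (simp add: bij_def inv_f_f)
 define theta where "theta z = inv h' (h z)" for z
 have atheta: "aut W theta" unfolding theta_def[abs_def] by (rule aut_comp[OF aut_inv[OF h'(1)] h(1)])
 have germ: "theta (gframe e p) = gframe e p" if "n1 p < min d d'" for p
  using h(3)[of p] h'(3)[of p] ih'[of "gframe e p"] that by (simp add: theta_def)
 have fix_out: "theta z = z" if "z ~: W" for z by (rule aut_outside[OF atheta that])
 let ?I = "rho ` {0..<tau 5}"
 have head5: "rho ` {0..<tau 5} = s ` {0..<tau 5}"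
  using g gate_tau(5)[OF g, of 5] by (intro image_cong) (auto simp: gate_def)
 have minus: "r ` {0..} - r ` {0..<tau 5} = r ` {tau 5..}" if "fray r" for r
 proof (intro equalityI subsetI)
  fix z assume "z : r ` {0..} - r ` {0..<tau 5}"
  then obtain v where v: "0 <= v" "z = r v" "z ~: r ` {0..<tau 5}" by auto
  then show "z : r ` {tau 5..}" using v(2) by force
 next
  fix z assume "z : r ` {tau 5..}"
  then obtain v where v: "tau 5 <= v" "z = r v" by auto
  have "z ~: r ` {0..<tau 5}" unfolding v(2) by (subst fray_mem[OF that]) (use v tau5 in auto)
  then show "z : r ` {0..} - r ` {0..<tau 5}" using v tau5 by auto
 qed
 have tail: "theta ` (rho ` {0..} - ?I) = s ` {0..} - ?I"
 proof -
  have "theta ` (rho ` {tau 5..}) = inv h' ` h ` (rho ` {tau 5..})" by (simp add: theta_def[abs_def] image_image)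
  also have "... = inv h' ` h' ` (s ` {tau 5..})" unfolding h(4) h'(4) same ..
  also have "... = s ` {tau 5..}" by (simp add: image_image ih')
  finally show ?thesis using minus[OF rho] minus[OF s] head5 by simp
 qed
 have "EX phi. aut (W Un e ` ring) phi & phi ` (rho ` {0..}) = s ` {0..}"
 proof (rule drag_exists[of e W theta "min d d' / 2" "rho ` {0..}" "s ` {0..}" ?I])
  show "pe ring e" by (rule wide_ring_pe[OF pew])
  show "aut W theta" "theta ` (rho ` {0..} - ?I) = s ` {0..} - ?I" by (fact atheta tail)+
  show "theta (e p) = e p" if "p : ring" "n1 p <= 4" for p
   using that by (intro fix_out) (auto simp: W_def ring_def)
  show "0 < min d d' / 2" using h(2) h'(2) by simp
  show "theta (e (v2 0 5 + p)) = e (v2 0 5 + p)" if "n1 p < min d d' / 2" for p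
  proof -
   have "(1/2) *\<^sub>R swp (2 *\<^sub>R swp p) = p" by (simp add: swp_def vec2_eq_iff)
   then show ?thesis using germ[of "2 *\<^sub>R swp p"] that by (simp add: gframe_def)
  qed
  show "e p : rho ` {0..} \<longleftrightarrow> p$1 = 0 & 0 < p$2" if "p : ring" for p using gate_ring[OF g that] .
  show "e p : s ` {0..} \<longleftrightarrow> p$1 = 0 & 0 < p$2" if "p : ring" for p using gate_ring[OF gate_sym[OF g] that] .
  show "?I \<subseteq> rho ` {0..}" by auto
  show "?I \<subseteq> s ` {0..}" unfolding head5 by auto
  show "e (v2 0 v) : ?I \<longleftrightarrow> v < 5" if v: "2 < v" "v < 15" for v
  proof -
   have v': "0 <= tau v" "e (v2 0 v) = rho (tau v)" using gate_tau[OF g, of v] v by auto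
   then have "e (v2 0 v) : ?I \<longleftrightarrow> tau v < tau 5" unfolding v'(2) by (subst fray_mem[OF rho]) auto
   also have "... \<longleftrightarrow> v < 5" using gate_less[OF g, of v 5] gate_less[OF g, of 5 v] v by (cases v "5::real" rule: linorder_cases) auto
   finally show ?thesis .
  qed
  show "theta z = z" if z: "z : ?I" "z ~: e ` {p:ring. 3 < n1 p & n1 p <= 14}" for z
  proof (rule fix_out)
   obtain v where v: "0 <= v" "v < tau 5" "z = rho v" using z(1) by auto
   \<comment> \<open>By continuity of \<open>tau\<close> the ray between \<open>tau (9/2)\<close>
     and \<open>tau 5\<close> lies on the axis of the ring, in the part excluded by the hypothesis
     on \<open>z\<close>.\<close>
   have "v <= tau (9/2)"
   proof (rule ccontr)
    assume neg: "~ ?thesis"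
    have "continuous_on {9/2..5} tau" using g by (auto simp: gate_def intro: continuous_on_subset)
    then obtain w where w: "9/2 <= w" "w <= 5" "tau w = v" using IVT'[of tau "9/2" v 5] neg v by auto
    then show False using gate_tau(2)[OF g, of w] v(3) w z(2) by (simp add: ring_def)
   qed
   then show "z ~: W" using v by (auto simp: W_def)
  qed
 qed
 moreover have "W Un e ` ring \<subseteq> Int_M - P"
 proof -
  have "ring \<subseteq> wide_ring" by (auto simp: ring_def wide_ring_def)
  then show ?thesis using eP wide_ring_pe[OF pew] unfolding W_def pe_def by blast
 qed
 ultimately show ?thesis using aut_mono by blast
qed

text \<open>As \<open>P'\<close> contains the first annulus and the ray up to its exit, the second
  switch takes place behind the first gate, which therefore also serves \<open>rho\<close> and
  \<open>sig\<close>. The sign found at the second gate is carried back along \<open>s\<close>, and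
  equally along \<open>sig\<close>, which agrees with \<open>s\<close> that far.\<close>

lemma linked_compose:
 assumes lk: "linked a b P e tau rho s c" and lk': "linked b d P' e' tau' s sig c'" and frays: "fray b" "fray d"
  and sub: "P Un annulus e Un s ` {0..tau 15} \<subseteq> P'"
 shows "linked a d P e tau rho sig (c * c')"
proof -
 have g: "gate P e tau rho s" and rho: "fray rho" and s: "fray s" and g': "gate P' e' tau' s sig" and sig: "fray sig"
  using lk lk' by (auto simp: linked_def)
 have late: "tau 15 < tau' 2"
 proof (rule ccontr)
  assume "~ ?thesis"
  then have "s (tau 15) ~: P'" using g' by (auto simp: gate_def)
  moreover have "s (tau 15) : s ` {0..tau 15}" using gate_tau(1)[OF g, of 15] by auto
  ultimately show False using sub by blast
 qed
 have tau': "tau' 2 < tau' 15" "tau' 2 < tau' 5" "tau' 5 < tau' 15" using gate_less[OF g'] by auto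
 have eq: "s t = sig t" if "0 <= t" "t <= tau' 15" for t using g' that by (simp add: gate_def)
 have far: "sig t ~: P'" if "tau' 2 <= t" for t using g' that by (simp add: gate_def)
 have gg: "gate P e tau rho sig"
 proof -
  have 1: "rho t = sig t" if "0 <= t" "t <= tau 15" for t
   using g eq[of t] that late tau' by (simp add: gate_def)
  have 2: "t : tau ` {2..15}" if t: "0 <= t" "sig t : annulus e" for t
  proof -
   have "s t : annulus e" using far[of t] t(2) sub eq[of t] t tau' by force
   then show ?thesis using g t(1) by (simp add: gate_def)
  qed
  have 3: "sig t ~: P" if t: "tau 2 <= t" for t
  proof (cases "t < tau' 2")
   case True
   have "0 <= t" using t gate_tau(1)[OF g, of 2] by simp
   then show ?thesis using eq True tau' g t by (force simp: gate_def)
  next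
   case False
   then show ?thesis using far[of t] sub by auto
  qed
  show ?thesis using g 1 2 3 unfolding gate_def by blast
 qed
 have os: "oframe s (tau 5) (gframe e)" by (rule gate_oframe[OF s gate_sym[OF g]])
 have osig: "oframe sig (tau 5) (gframe e)" by (rule gate_oframe[OF sig gate_sym[OF gg]])
 have os': "oframe s (tau' 5) (gframe e')" by (rule gate_oframe[OF s g'])
 have osig': "oframe sig (tau' 5) (gframe e')" by (rule gate_oframe[OF sig gate_sym[OF g']])
 obtain omega where omega: "sgn_rel a rho (gframe e) omega" "sgn_rel b s (gframe e) (c * omega)" using lk by (auto simp: linked_def)
 obtain omega' where omega': "sgn_rel b s (gframe e') omega'" "sgn_rel d sig (gframe e') (c' * omega')" using lk' by (auto simp: linked_def)
 obtain x where x: "side s (gframe e) (gframe e') x" using side_exists[OF s os os'] by blast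
 have "x * omega' = c * omega" by (rule sgn_unique[OF s frays(1) os sgn_mult[OF x omega'(1)] omega(2)])
 define W where "W = Int_M - (s ` {tau' 15..} Un sig ` {tau' 15..})"
 have p15: "0 <= tau' 15" "0 <= tau 5" using gate_tau(1)[OF g'] gate_tau(1)[OF g] by auto
 have W: "openin M W" unfolding W_def by (intro openin_diff openin_Int_M closedin_Un fray_closed s sig p15)
 have "{0..} = {0..<tau' 15} Un {tau' 15..}" using p15 by auto
 then have "s ` {0..} = s ` {0..<tau' 15} Un s ` {tau' 15..}" "sig ` {0..} = sig ` {0..<tau' 15} Un sig ` {tau' 15..}" by auto
 moreover have hd: "s ` {0..<tau' 15} = sig ` {0..<tau' 15}" using eq by auto
 ultimately have WW: "W Int s ` {0..} = W Int sig ` {0..}" using hd unfolding W_def by auto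
 have le: "tau 5 <= tau' 5" using gate_tau(5)[OF g, of 5] late tau' by simp
 have "s ` {tau 5..tau' 5} \<subseteq> W"
 proof
  fix z assume "z : s ` {tau 5..tau' 5}"
  then obtain t where t: "tau 5 <= t" "t <= tau' 5" "z = s t" by auto
  have t0: "0 <= t" "t <= tau' 15" using t(1,2) p15 tau' by auto
  show "z : W" using fray_mem[OF s, of "{tau' 15..}" t] t tau' p15 t0 fray_mem[OF sig, of "{tau' 15..}" t] eq[OF t0] fray_Int[OF s t0(1)] t(3) by (simp add: W_def)
 qed
 then have "side sig (gframe e) (gframe e') x"
  by (intro side_local[OF s os os' sig osig le W _ _ WW x]) (auto simp: W_def)
 then have "sgn_rel d sig (gframe e) (x * (c' * omega'))" using sgn_mult omega'(2) by blast
 moreover have "x * (c' * omega') = (c * c') * omega" using \<open>x * omega' = c * omega\<close> by auto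
 ultimately show ?thesis using lk lk' gg omega(1) is_sign_mult unfolding linked_def by auto
qed

text \<open>The gate of \<open>b\<close> lies on the tail shared with \<open>s\<close>, because
  \<open>P'\<close> contains the initial pieces of both. After a shift of the parameter it is a gate
  of \<open>s\<close>, and \<open>rho\<close> follows \<open>s\<close> first and then
  \<open>t\<close>.\<close>

lemma linked_transfer:
 assumes s: "fray s" and b: "fray b" and d: "fray d" and ag: "agree s z b w"
  and lk: "linked b d P' e tau b t c" and sub: "P Un s ` {0..z} Un b ` {0..w} \<subseteq> P'"
 shows "EX tau' rho. linked b d P e tau' s rho c"
proof -
 have g: "gate P' e tau b t" and t: "fray t" using lk by (auto simp: linked_def)
 have zw: "0 < z" "0 < w" using ag by (auto simp: agree_def)
 have late: "w < tau 2"
 proof (rule ccontr)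
  assume "~ ?thesis"
  then have "b w ~: P'" using g by (auto simp: gate_def)
  moreover have "b w : b ` {0..w}" using zw by auto
  ultimately show False using sub by blast
 qed
 have eq: "b x = t x" if "0 <= x" "x <= tau 15" for x using g that by (simp add: gate_def)
 have tau2: "tau 2 < tau 15" using gate_less[OF g] by auto
 define rho where "rho x = (if x <= z then s x else t (w + x - z))" for x
 have sb: "s (z + v) = b (w + v)" if "0 <= v" for v using ag that by (simp add: agree_def)
 have "fray rho" unfolding rho_def[abs_def]
 proof (rule fray_splice[OF s zw(1) t zw(2)])
  show "s z = t w" using sb[of 0] eq[of w] late tau2 zw by simp
  show "s ` {0..<z} Int t ` {w..} = {}"
  proof (rule ccontr)
   assume "s ` {0..<z} Int t ` {w..} ~= {}"
   then obtain y where y: "y : s ` {0..<z}" "y : t ` {w..}" by blast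
   from y(1) obtain u where u: "0 <= u" "u < z" "y = s u" by auto
   from y(2) obtain v where v: "w <= v" "y = t v" by auto
   show False
   proof (cases "v <= tau 15")
    case True
    then show False using eq[of v] sb[of "v - w"] u v zw fray_inj[OF s u(1), of "z + (v - w)"] by simp
   next
    case False
    then have "t v ~: P'" using g tau2 by (simp add: gate_def)
    moreover have "s u : P'" using u sub by auto
    ultimately show False using u(3) v(2) by simp
   qed
  qed
 qed
 have rhot: "agree rho z t w" using sb[of 0] eq[of w] late tau2 zw by (auto simp: rho_def agree_def)
 define tau' where "tau' u = z + (tau u - w)" for u
 have tau'z: "z < tau' u" if "2 <= u" "u <= 15" for u using gate_tau(4)[OF g that] late by (simp add: tau'_def)
 have sb': "s x = b (w + (x - z))" "rho x = t (w + (x - z))" if "z <= x" for x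
  using sb[of "x - z"] rhot that unfolding agree_def by (metis add.commute diff_add_cancel diff_ge_0_iff_ge)+
 have lowC: "s x ~: annulus e" "rho x ~: annulus e" if x: "0 <= x" "x <= z" for x
 proof -
  have "s x : P'" using x sub by auto
  moreover have "annulus e \<subseteq> e ` wide_ring" unfolding annulus_def by (rule image_mono) (auto simp: wide_ring_def)
  moreover have "e ` wide_ring Int P' = {}" using g by (simp add: gate_def)
  ultimately show "s x ~: annulus e" by blast
  then show "rho x ~: annulus e" using x by (simp add: rho_def)
 qed
 have gg: "gate P e tau' s rho"
  unfolding gate_def
 proof (intro conjI allI impI)
  show "pe wide_ring e" using g by (simp add: gate_def)
  show "e ` wide_ring Int P = {}" using g sub by (auto simp: gate_def)
  show "strict_mono_on {2..15} tau'" using g by (simp add: gate_def strict_mono_on_def tau'_def)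
  show "continuous_on {2..15} tau'" unfolding tau'_def using g by (auto simp: gate_def intro!: continuous_intros)
  fix u :: real assume u: "2 <= u" "u <= 15"
  show "0 <= tau' u" using tau'z[OF u] zw by simp
  show "s (tau' u) = e (v2 0 u)" using sb'(1) tau'z[OF u] gate_tau(2)[OF g u] by (simp add: tau'_def)
 next
  fix x assume x: "0 <= x" "x <= tau' 15"
  show "s x = rho x"
  proof (cases "x <= z")
   case False
   then show ?thesis using sb'[of x] eq[of "w + (x - z)"] x zw by (simp add: tau'_def)
  qed (simp add: rho_def)
 next
  fix x :: real assume x: "0 <= x" "s x : annulus e | rho x : annulus e"
  then have zx: "z < x" using lowC by force
  then have "w + (x - z) : tau ` {2..15}" using x sb'[of x] zw g unfolding gate_def by auto
  then obtain u where "u : {2..15}" "w + (x - z) = tau u" by blast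
  then show "x : tau' ` {2..15}" by (intro image_eqI[of _ _ u]) (auto simp: tau'_def)
 next
  fix x assume x: "tau' 2 <= x"
  then have "s x ~: P'" "rho x ~: P'" using tau'z[of 2] sb'[of x] g by (auto simp: gate_def tau'_def)
  then show "s x ~: P" "rho x ~: P" using sub by auto
 qed
 have os: "oframe s (tau' 5) (gframe e)" by (rule gate_oframe[OF s gg])
 have orho: "oframe rho (tau' 5) (gframe e)" by (rule gate_oframe[OF \<open>fray rho\<close> gate_sym[OF gg]])
 have ob: "oframe b (tau 5) (gframe e)" by (rule gate_oframe[OF b g])
 have ot: "oframe t (tau 5) (gframe e)" by (rule gate_oframe[OF t gate_sym[OF g]])
 obtain omega where omega: "sgn_rel b b (gframe e) omega" "sgn_rel d t (gframe e) (c * omega)" using lk by (auto simp: linked_def)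
 have x: "0 < tau 5 - w" using gate_less[OF g, of 2 5] late by simp
 have "sgn_rel b s (gframe e) omega" by (rule sgn_shift[OF s b b ag x _ _ omega(1)]) (use os ob in \<open>auto simp: tau'_def\<close>)
 moreover have "sgn_rel d rho (gframe e) (c * omega)" by (rule sgn_shift[OF \<open>fray rho\<close> t d rhot x _ _ omega(2)]) (use orho ot in \<open>auto simp: tau'_def\<close>)
 moreover have "EX x u. agree rho x d u" using lk agree_trans[OF rhot] by (force simp: linked_def)
 moreover have "is_sign c" using lk by (simp add: linked_def)
 ultimately show ?thesis using \<open>fray rho\<close> s ag gg unfolding linked_def by blast
qed

text \<open>The sign comes before the compact set, so that all steps of the back-and-forth can use
  the same one.\<close>

definition avail :: "(real => 'a) => (real => 'a) => real => bool" where
 "avail a b c \<longleftrightarrow> (ALL P. compactin M P & surface_boundary A \<subseteq> P --> (EX e tau s. linked a b P e tau a s c))"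

text \<open>The annulus is put around \<open>r'\<close> outside \<open>P\<close> and outside the
  initial piece of \<open>r'\<close> that may visit \<open>P\<close>. Behind it,
  \<open>hybrid_ray\<close> switches to the tail of \<open>r\<close> while avoiding both
  \<open>P\<close> and the annulus.\<close>

lemma linked_exists:
 assumes r: "fray r" and r': "fray r'" and ends: "same_end r r'" and P: "compactin M P" "surface_boundary A \<subseteq> P"
 shows "EX e tau s c. linked r' r P e tau r' s c"
proof -
 obtain U where U: "0 <= U" "!!t. U <= t ==> r' t ~: P" using r' P(1) unfolding fray_def by blast
 define L where "L = P Un r' ` {0..U}"
 have L: "compactin M L" "surface_boundary A \<subseteq> L" unfolding L_def using P fray_compact[OF r' order_refl] by (auto intro: compactin_Un)
 obtain e tau where e: "pe wide_ring e" "e ` wide_ring Int L = {}"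
  "!!p. p : wide_ring ==> e p : r' ` {0..} \<longleftrightarrow> p$1 = 0 & 0 < p$2"
  "strict_mono_on {2..15} tau" "continuous_on {2..15} tau" "!!t. 2 <= t ==> t <= 15 ==> 0 <= tau t & r' (tau t) = e (v2 0 t)"
  by (rule ring_exists[OF r' L]) blast
 let ?C = "annulus e"
 have C: "compactin M ?C" unfolding annulus_def by (rule wide_ring_compact[OF e(1)]) auto
 have U2: "U < tau 2" using e(6)[of 2] e(2) by (force simp: L_def wide_ring_def)
 have rC: "t : tau ` {2..15}" if t: "0 <= t" "r' t : ?C" for t
 proof -
  obtain p where p: "2 <= n1 p" "n1 p <= 15" "r' t = e p" using t(2) by (auto simp: annulus_def)
  have "p : wide_ring" using p by (auto simp: wide_ring_def)
  then have "p$1 = 0" "0 < p$2" using e(3)[of p] p(3) t(1) by (metis atLeast_iff imageI)+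
  then have pv: "p = v2 0 (p$2)" "n1 p = p$2" by (simp_all add: vec2_eq_iff n1_def)
  then have "t = tau (p$2)" using e(6)[of "p$2"] p fray_inj[OF r' t(1)] by force
  then show ?thesis using p pv by auto
 qed
 have taule: "tau u <= tau 15" if "u : {2..15}" for u
  using e(4) that by (cases "u = 15") (auto simp: strict_mono_on_def less_imp_le)
 have away: "r' t ~: P Un ?C" if t: "tau 15 < t" for t using e(6)[of 15] t rC[of t] taule U(2)[of t] U2 e(4) by force
 have PC: "compactin M (P Un ?C)" "surface_boundary A \<subseteq> P Un ?C" using P C by (auto intro: compactin_Un)
 obtain s T y where s: "fray s" "0 < T" "tau 15 < y" "!!t. 0 <= t ==> t <= tau 15 ==> s t = r' t" "!!t. tau 15 < t ==> s t ~: P Un ?C"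
  "!!t. y <= t ==> s t = r (T + t - y)"
 proof (rule hybrid_ray[OF r r' ends PC, of "tau 15"])
  show "0 <= tau 15" using e(6)[of 15] by simp
  show "r' t ~: P Un ?C" if "tau 15 < t" for t using away that .
 qed (rule that)
 have g: "gate P e tau r' s"
  unfolding gate_def
 proof (intro conjI allI impI)
  show "e ` wide_ring Int P = {}" using e(2) by (auto simp: L_def)
  show "0 <= tau t" "r' (tau t) = e (v2 0 t)" if "2 <= t" "t <= 15" for t using e(6)[OF that] by auto
  show "r' t = s t" if "0 <= t" "t <= tau 15" for t using s(4)[OF that] by simp
  show "t : tau ` {2..15}" if t: "0 <= t" "r' t : ?C | s t : ?C" for t using rC[OF t(1)] s(4)[OF t(1)] s(5)[of t] t(2) by force
  show "r' t ~: P" if "tau 2 <= t" for t using U(2)[of t] U2 that by simp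
  show "s t ~: P" if t: "tau 2 <= t" for t using s(4)[of t] s(5)[of t] U U2 t by force
 qed (fact e)+
 have ags: "agree s y r T" using s(2,3,6) e(6)[of 15] unfolding agree_def by auto
 have agr: "agree r' 1 r' 1" by (simp add: agree_def)
 obtain omega where omega: "sgn_rel r' r' (gframe e) omega" using sgn_exists[OF r' r' agr gate_oframe[OF r' g]] by blast
 obtain omega' where omega': "sgn_rel r s (gframe e) omega'" using sgn_exists[OF s(1) r ags gate_oframe[OF s(1) gate_sym[OF g]]] by blast
 have sg: "is_sign omega" "is_sign omega'" using sgn_sign omega omega' by auto
 have eq: "omega' * omega * omega = omega'" using is_sign_square[OF sg(1)] by auto
 have "sgn_rel r s (gframe e) (omega' * omega * omega)" unfolding eq by (rule omega')
 then show ?thesis using r' s(1) agr ags g omega is_sign_mult[OF sg(2,1)] unfolding linked_def by blast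
qed

lemma gate_mono: assumes "gate P' e tau rho s" "P \<subseteq> P'" shows "gate P e tau rho s"
proof -
 have "rho t ~: P & s t ~: P" if "tau 2 <= t" for t using assms that unfolding gate_def by blast
 moreover have "e ` wide_ring Int P = {}" using assms unfolding gate_def by blast
 ultimately show ?thesis using assms(1) unfolding gate_def by blast
qed

lemma linked_mono: "linked a b P' e tau rho s c ==> P \<subseteq> P' ==> linked a b P e tau rho s c"
 unfolding linked_def using gate_mono by blast

text \<open>If neither sign were available, each would fail for some compact set; but a link outside
  the union of the two sets has one of the signs.\<close>

lemma avail_exists:
 assumes r: "fray r" and r': "fray r'" and ends: "same_end r r'" shows "EX c. is_sign c & avail r' r c"
proof (rule ccontr)
 assume neg: "~ ?thesis"
 have "EX P. compactin M P & surface_boundary A \<subseteq> P & (ALL e tau s. ~ linked r' r P e tau r' s c)" if "is_sign c" for c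
  using neg that unfolding avail_def by blast
 then obtain P1 P2 where P: "compactin M P1" "surface_boundary A \<subseteq> P1" "!!e tau s. ~ linked r' r P1 e tau r' s 1"
  "compactin M P2" "!!e tau s. ~ linked r' r P2 e tau r' s (-1)"
  by (metis is_sign_def)
 have "compactin M (P1 Un P2)" "surface_boundary A \<subseteq> P1 Un P2" using P by (auto intro: compactin_Un)
 then obtain e tau s c where lk: "linked r' r (P1 Un P2) e tau r' s c" using linked_exists[OF r r' ends] by blast
 then have "c = 1 | c = -1" by (auto simp: linked_def is_sign_def)
 then show False using linked_mono[OF lk, of P1] linked_mono[OF lk, of P2] P by auto
qed

lemma avail_lead:
 assumes av: "avail b d c" and s: "fray s" and b: "fray b" and d: "fray d" and ag: "agree s z b w" and P: "compactin M P" "surface_boundary A \<subseteq> P"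
 shows "EX e tau rho. linked b d P e tau s rho c"
proof -
 let ?P = "P Un s ` {0..z} Un b ` {0..w}"
 have "compactin M ?P" by (intro compactin_Un P fray_compact s b order_refl)
 moreover have "surface_boundary A \<subseteq> ?P" using P(2) by blast
 ultimately obtain e tau t where "linked b d ?P e tau b t c" using av unfolding avail_def by blast
 then show ?thesis using linked_transfer[OF s b d ag _ order_refl] by blast
qed

text \<open>Going from \<open>b\<close> to \<open>a\<close>, back to \<open>b\<close> and again to \<open>a\<close> multiplies the sign \<open>c\<close> by the square of \<open>c'\<close>.\<close>
lemma avail_swap:
 assumes a: "fray a" and b: "fray b" and av: "avail a b c" "avail b a c'" and c: "is_sign c'" shows "avail b a c"
 unfolding avail_def
proof (intro allI impI)
 fix P assume P: "compactin M P & surface_boundary A \<subseteq> P"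
 have big: "compactin M (Q Un annulus e Un rho ` {0..tau 15})" if "compactin M Q" "gate Q e tau sig rho" "fray rho" for Q e tau rho and sig :: "real => 'a"
  using that unfolding annulus_def by (intro compactin_Un fray_compact wide_ring_compact) (auto simp: gate_def)
 obtain e1 tau1 rho1 where l1: "linked b a P e1 tau1 b rho1 c'" using av(2) P unfolding avail_def by blast
 define P2 where "P2 = P Un annulus e1 Un rho1 ` {0..tau1 15}"
 have P2: "compactin M P2" "surface_boundary A \<subseteq> P2" using big[of P e1 tau1 b rho1] l1 P by (auto simp: P2_def linked_def)
 obtain z1 w1 where "fray rho1" "agree rho1 z1 a w1" using l1 by (auto simp: linked_def)
 then obtain e2 tau2 rho2 where l2: "linked a b P2 e2 tau2 rho1 rho2 c" using avail_lead[OF av(1) _ a b _ P2] by blast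
 define P3 where "P3 = P2 Un annulus e2 Un rho2 ` {0..tau2 15}"
 have P3: "compactin M P3" "surface_boundary A \<subseteq> P3" using big[of P2 e2 tau2 rho1 rho2] l2 P2 by (auto simp: P3_def linked_def)
 obtain z2 w2 where "fray rho2" "agree rho2 z2 b w2" using l2 by (auto simp: linked_def)
 then obtain e3 tau3 rho3 where l3: "linked b a P3 e3 tau3 rho2 rho3 c'" using avail_lead[OF av(2) _ b a _ P3] by blast
 have "linked a a P2 e2 tau2 rho1 rho3 (c * c')" by (rule linked_compose[OF l2 l3 b a]) (simp add: P3_def)
 then have "linked b a P e1 tau1 b rho3 (c' * (c * c'))" by (rule linked_compose[OF l1 _ a a]) (simp add: P2_def)
 moreover have "c' * (c * c') = c" using is_sign_square[OF c] by auto
 ultimately show "EX e tau s. linked b a P e tau b s c" by auto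
qed

lemma same_end_sym: "same_end r r' ==> same_end r' r" by (simp add: same_end_def conj_commute)

text \<open>With one sign for both directions, two consecutive switches have the sign
  \<open>c * c = 1\<close> that \<open>linked_drag\<close> requires.\<close>

lemma avail_both:
 assumes r: "fray r" and r': "fray r'" and ends: "same_end r r'" shows "EX c. is_sign c & avail r r' c & avail r' r c"
proof -
 obtain c where c: "is_sign c" "avail r' r c" using avail_exists[OF r r' ends] by blast
 obtain c' where c': "is_sign c'" "avail r r' c'" using avail_exists[OF r' r same_end_sym[OF ends]] by blast
 have "avail r r' c" by (rule avail_swap[OF r' r c(2) c'(2) c'(1)])
 then show ?thesis using c by blast
qed

section \<open>Exhaustion by compact sets and passage to the limit\<close>

lemma compact_meets_finitely_many:
 assumes V: "locally_finite_in M \<V>" and K: "compactin M K" shows "finite {V:\<V>. V Int K ~= {}}"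
proof -
 have KM: "K \<subseteq> topspace M" using K by (rule compactin_subset_topspace)
 have "EX N. openin M N & x : N & finite {V:\<V>. V Int N ~= {}}" if "x : K" for x
  using V that KM unfolding locally_finite_in_def by blast
 then obtain N where N: "!!x. x : K ==> openin M (N x) & x : N x & finite {V:\<V>. V Int N x ~= {}}"
  using bchoice[of K "%x N. openin M N & x : N & finite {V:\<V>. V Int N ~= {}}"] by blast
 have "openin M U" if "U : N ` K" for U using that N by blast
 moreover have "K \<subseteq> \<Union>(N ` K)" using N by blast
 ultimately obtain \<F> where \<F>: "finite \<F>" "\<F> \<subseteq> N ` K" "K \<subseteq> \<Union>\<F>" using compactinD[OF K, of "N ` K"] by metis
 obtain F where F: "finite F" "F \<subseteq> K" "\<F> = N ` F" using \<F>(1,2) by (meson finite_subset_image)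
 have "{V:\<V>. V Int K ~= {}} \<subseteq> (\<Union>x\<in>F. {V:\<V>. V Int N x ~= {}})" using \<F>(3) F(3) by blast
 moreover have "finite (\<Union>x\<in>F. {V:\<V>. V Int N x ~= {}})" using F N by blast
 ultimately show ?thesis by (rule finite_subset)
qed

text \<open>Each stage is the union of the closures of those members of a locally finite cover that
  meet the previous stage; they are finitely many and compact. The union of all stages may miss some
  components of \<open>M\<close>, but being closed and open it contains the component of
  \<open>x0\<close>.\<close>

lemma exhaustion:
 assumes x0: "x0 : topspace M"
 obtains E :: "nat => 'a set" where "!!n. compactin M (E n)" "!!n. E n \<subseteq> M interior_of (E (Suc n))" "x0 : E 0" "closedin M (\<Union>n. E n)"
proof -
 define \<U> where "\<U> = {U. openin M U & (EX K. compactin M K & U \<subseteq> K)}"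
 have "EX U:\<U>. x : U" if x: "x : topspace M" for x
 proof -
  obtain b U where b: "plf b" "openin M U" "x : U" "ALL y:U. 1 <= b y" using bump_exists[OF x] by blast
  have "U \<subseteq> {y:topspace M. 1 <= b y}" using b openin_subset by blast
  then show ?thesis using plf_superlevel_compact[OF b(1), of 1] b(2,3) unfolding \<U>_def by auto
 qed
 then have "\<Union>\<U> = topspace M" unfolding \<U>_def using openin_subset by fastforce
 moreover have "ALL U:\<U>. openin M U" by (auto simp: \<U>_def)
 ultimately obtain \<V> where \<V>: "!!V. V : \<V> ==> openin M V & (EX U:\<U>. V \<subseteq> U)" "\<Union>\<V> = topspace M" "locally_finite_in M \<V>"
  using surface unfolding pl_surface_def paracompact_space_def by metis
 have clV: "compactin M (M closure_of V)" if V: "V : \<V>" for V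
 proof -
  obtain K where K: "compactin M K" "V \<subseteq> K" using \<V>(1)[OF V] unfolding \<U>_def by blast
  have "M closure_of V \<subseteq> K" by (rule closure_of_minimal[OF K(2) compactin_imp_closedin[OF Hausdorff K(1)]])
  then show ?thesis using closed_compactin[OF K(1)] closedin_closure_of by blast
 qed
 define nxt where "nxt K = \<Union>((%V. M closure_of V) ` {V:\<V>. V Int K ~= {}})" for K
 define E where "E = rec_nat {x0} (%_. nxt)"
 have E0: "E 0 = {x0}" and ES: "E (Suc n) = nxt (E n)" for n by (simp_all add: E_def)
 have nxt: "compactin M (nxt K)" if "compactin M K" for K
  unfolding nxt_def
 proof (rule compactin_Union)
  show "finite ((%V. M closure_of V) ` {V:\<V>. V Int K ~= {}})" using compact_meets_finitely_many[OF \<V>(3) that] by blast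
 qed (use clV in auto)
 have cE: "compactin M (E n)" for n by (induction n) (use x0 nxt in \<open>auto simp: E0 ES\<close>)
 have sub: "V \<subseteq> nxt K" if "V : \<V>" "V Int K ~= {}" for V K
 proof -
  have "V \<subseteq> M closure_of V" using openin_subset \<V>(1)[OF that(1)] by (intro closure_of_subset) blast
  then show ?thesis using that unfolding nxt_def by blast
 qed
 have intE: "E n \<subseteq> M interior_of (E (Suc n))" for n
 proof
  fix x assume x: "x : E n"
  then obtain V where V: "V : \<V>" "x : V" using compactin_subset_topspace[OF cE] \<V>(2) by blast
  then have "V \<subseteq> E (Suc n)" using sub[OF V(1)] x unfolding ES by blast
  then have "V \<subseteq> M interior_of (E (Suc n))" using \<V>(1)[OF V(1)] by (intro interior_of_maximal) auto
  then show "x : M interior_of (E (Suc n))" using V(2) by blast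
 qed
 have "openin M (topspace M - (\<Union>n. E n))"
 proof (subst openin_subopen, intro ballI)
  fix x assume x: "x : topspace M - (\<Union>n. E n)"
  then obtain V where V: "V : \<V>" "x : V" using \<V>(2) by blast
  have "V Int E n = {}" for n
  proof (rule ccontr)
   assume "V Int E n ~= {}"
   then have "x : E (Suc n)" using sub[OF V(1)] V(2) unfolding ES by blast
   then show False using x by blast
  qed
  then have "V \<subseteq> topspace M - (\<Union>n. E n)" using \<V>(1)[OF V(1)] openin_subset by blast
  then show "EX T. openin M T & x : T & T \<subseteq> topspace M - (\<Union>n. E n)" using \<V>(1)[OF V(1)] V(2) by blast
 qed
 moreover have "(\<Union>n. E n) \<subseteq> topspace M" using compactin_subset_topspace[OF cE] by blast
 ultimately show thesis using that[of E] cE intE E0 by (simp add: closedin_def)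
qed

lemma connected_nbhd:
 assumes x: "x : topspace M" shows "EX N. openin M N & x : N & connectedin M N"
proof -
 obtain U phi where c: "(U, phi) : A" "x : U" using chart_cover[OF x] by blast
 have hm: "homeomorphic_map (subtopology M U) (top_of_set (phi ` U)) phi" by (rule chart_homeo(2)[OF c(1)])
 have UM: "U \<subseteq> topspace M" using chart_open[OF c(1)] openin_subset by blast
 obtain T where T: "open T" "phi ` U = half_plane Int T" using chart_homeo(1)[OF c(1)] by (auto simp: openin_open)
 obtain r where r: "r > 0" "ball (phi x) r \<subseteq> T" using T(2) c(2) T(1) open_contains_ball by blast
 define B where "B = half_plane Int ball (phi x) r"
 define N where "N = {y:U. phi y : B}"
 have "openin (top_of_set half_plane) B" unfolding B_def by auto
 then have oN: "openin M N" unfolding N_def by (rule chart_preimage_open[OF c(1)])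
 have "phi ` N = B"
 proof
  show "B \<subseteq> phi ` N"
  proof
   fix q assume q: "q : B"
   then have "q : phi ` U" using T(2) r(2) by (auto simp: B_def)
   then show "q : phi ` N" using q by (auto simp: N_def)
  qed
 qed (auto simp: N_def)
 moreover have "convex half_plane" unfolding half_plane_def by (auto simp: convex_def)
 then have "connected B" unfolding B_def by (intro convex_connected convex_Int convex_ball)
 ultimately have "connectedin (subtopology M U) N" using homeomorphic_map_connectedness[OF hm, of N] UM unfolding connectedin_subtopology by (auto simp: N_def)
 then show ?thesis using c(2) r(1) T(2) oN by (force simp: connectedin_subtopology N_def B_def)
qed

lemma component_open: assumes C: "C : connected_components_of M" shows "openin M C"
proof (subst openin_subopen, intro ballI)
 fix x assume x: "x : C"
 then obtain N where N: "openin M N" "x : N" "connectedin M N" using connected_components_of_subset[OF C] connected_nbhd by blast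
 then show "EX T. openin M T & x : T & T \<subseteq> C" using connected_components_of_maximal[OF C N(3)] x N unfolding disjnt_def by blast
qed

text \<open>The image of a component is connected, and far out on the ray \<open>h\<close> is the
  identity, so the image meets the component again.\<close>

lemma aut_component:
 assumes h: "aut W h" and C: "C : connected_components_of M" and s: "fray s" "s ` {0..} \<subseteq> C" shows "h x : C \<longleftrightarrow> x : C"
proof -
 have sub: "g ` C \<subseteq> C" if g: "aut W g" for g
 proof -
  obtain K where K: "compactin M K" "!!x. x ~: K ==> g x = x" using aut_supp[OF g] by metis
  obtain T where T: "0 <= T" "!!t. T <= t ==> s t ~: K" using s(1) K(1) unfolding fray_def by blast
  have "connectedin M (g ` C)"
   by (rule connectedin_continuous_map_image[OF homeomorphic_imp_continuous_map[OF aut_homeomorphic[OF g]] connectedin_connected_components_of[OF C]])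
  moreover have "g (s T) = s T" using K(2) T by blast
  moreover have "s T : C" using s(2) T(1) by auto
  ultimately show ?thesis using connected_components_of_maximal[OF C \<open>connectedin M (g ` C)\<close>] unfolding disjnt_def by (metis IntI empty_iff imageI)
 qed
 show ?thesis using aut_bij[OF h] sub[OF h] sub[OF aut_inv[OF h]] by (auto simp: bij_def inv_f_f)
qed

text \<open>Local agreement with compactly supported automorphisms survives the passage to the
  limit, whereas compact support does not. It is demanded of the inverse too, which makes the notion
  symmetric.\<close>

definition laut :: "('a => 'a) => bool" where
 "laut h \<longleftrightarrow> bij h & (ALL x:topspace M. EX W g. openin M W & x : W & aut Int_M g & (ALL y:W. h y = g y)) &
   (ALL x:topspace M. EX W g. openin M W & x : W & aut Int_M g & (ALL y:W. inv h y = g y))"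

lemma laut_inv: "laut h ==> laut (inv h)"
 unfolding laut_def by (simp add: bij_imp_bij_inv inv_inv_eq)

lemma laut_comp: assumes h: "laut h" and k: "laut k" shows "laut (%x. k (h x))"
proof -
 have comp: "EX W g. openin M W & x : W & aut Int_M g & (ALL y:W. k (h y) = g y)"
  if h: "ALL x:topspace M. EX W g. openin M W & x : W & aut Int_M g & (ALL y:W. h y = g y)"
   and k: "ALL x:topspace M. EX W g. openin M W & x : W & aut Int_M g & (ALL y:W. k y = g y)"
   and x: "x : topspace M" for x and h k :: "'a => 'a"
 proof -
  obtain W g where W: "openin M W" "x : W" "aut Int_M g" "ALL y:W. h y = g y" using bspec[OF h x] by auto
  have "g x : topspace M" using aut_topspace[OF W(3)] x by blast
  then obtain W' g' where W': "openin M W'" "g x : W'" "aut Int_M g'" "ALL y:W'. k y = g' y" using bspec[OF k \<open>g x : topspace M\<close>] by auto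
  have "openin M (W Int {y. g y : W'})" using W(1) aut_vimage_open[OF W(3) W'(1)] by blast
  moreover have "k (h y) = g' (g y)" if "y : W Int {y. g y : W'}" for y using that W(4) W'(4) by simp
  ultimately show ?thesis using aut_comp[OF W'(3) W(3)] W(2) W'(2) by auto
 qed
 have b: "bij h" "bij k" using h k by (auto simp: laut_def)
 have "inv (k \<circ> h) = inv h \<circ> inv k" by (rule o_inv_distrib[OF b(2,1)])
 then have i: "inv (%x. k (h x)) = (%x. inv h (inv k x))" by (simp add: o_def)
 show ?thesis using bij_comp[OF b] comp h k unfolding laut_def i by (simp add: o_def)
qed

text \<open>On each \<open>E n\<close> both the maps and their inverses are eventually constant.
  Stability of the maps alone would not make the limit surjective; with the inverses included, the
  two limits are inverse to each other.\<close>

lemma limit_laut: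
 assumes C: "openin M C" "closedin M C" and E: "!!n. E n \<subseteq> M interior_of (E (Suc n))" "C \<subseteq> (\<Union>n::nat. E n)"
  and Phi: "!!n. aut Int_M (Phi n)" "!!n x. Phi n x : C \<longleftrightarrow> x : C"
  and stab: "!!n x. x : E n ==> x : C ==> Phi (Suc n) x = Phi n x"  "!!n x. x : E n ==> x : C ==> inv (Phi (Suc n)) x = inv (Phi n) x"
 obtains h where "laut h" "!!n x. x : E n ==> x : C ==> h x = Phi n x" "!!n x. x : E n ==> x : C ==> inv h x = inv (Phi n) x" "!!x. h x : C \<longleftrightarrow> x : C"
proof -
 have "E n \<subseteq> E (Suc n)" for n using E(1)[of n] interior_of_subset[of M "E (Suc n)"] by blast
 then have mono: "E m \<subseteq> E n" if "m <= n" for m n using that by (rule lift_Suc_mono_le)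
 \<comment> \<open>The value is taken at the first stage that contains the point. Outside
   \<open>C\<close>, where the exhaustion may never arrive, the limit is the identity.\<close>
 define lim where "lim F x = (if x : C then F (LEAST n. x : E n) x else x)" for F :: "nat => 'a => 'a" and x
 have lim: "lim F x = F n x" if st: "ALL n x. x : E n --> x : C --> F (Suc n) x = F n x" and x: "x : E n" "x : C" for F n x
 proof -
  let ?m = "LEAST n. x : E n"
  have m: "x : E ?m" "?m <= n" using x(1) by (auto intro: LeastI Least_le)
  have "F n x = F ?m x" using m(2)
  proof (induction n rule: dec_induct)
   case (step k)
   then show ?case using st[rule_format, of x k] mono[of ?m k] m(1) x(2) by auto
  qed simp
  then show ?thesis using x(2) by (simp add: lim_def)
 qed
 let ?h = "lim Phi" and ?k = "lim (%n. inv (Phi n))"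
 have h: "lim Phi x = Phi n x" if "x : E n" "x : C" for x n using lim[OF _ that, of Phi] stab(1) by blast
 have k: "lim (%n. inv (Phi n)) x = inv (Phi n) x" if "x : E n" "x : C" for x n using lim[OF _ that, of "%n. inv (Phi n)"] stab(2) by blast
 have b: "bij (Phi n)" for n by (rule aut_bij[OF Phi(1)])
 have inv1: "inv (Phi n) (Phi n x) = x" "Phi n (inv (Phi n) x) = x" for n x using b[of n] by (auto simp: bij_def inv_f_f surj_f_inv_f)
 have iC: "inv (Phi n) x : C \<longleftrightarrow> x : C" for n x using Phi(2)[of n "inv (Phi n) x"] inv1 by simp
 have kh: "?k (?h x) = x" for x
 proof (cases "x : C")
  case True
  then obtain n where n: "x : E n" using E(2) by blast
  have "?h x : C" using h[OF n True] Phi(2) True by simp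
  then obtain m where m: "?h x : E m" using E(2) by blast
  let ?l = "max m n"
  show ?thesis using m n mono[of n ?l] mono[of m ?l] h[of x ?l] k[of "?h x" ?l] True \<open>?h x : C\<close> inv1 by fastforce
 qed (simp add: lim_def)
 have hk: "?h (?k x) = x" for x
 proof (cases "x : C")
  case True
  then obtain n where n: "x : E n" using E(2) by blast
  have "?k x : C" using k[OF n True] iC True by simp
  then obtain m where m: "?k x : E m" using E(2) by blast
  let ?l = "max m n"
  show ?thesis using m n mono[of n ?l] mono[of m ?l] k[of x ?l] h[of "?k x" ?l] True \<open>?k x : C\<close> inv1 by fastforce
 qed (simp add: lim_def)
 have bij: "bij ?h" by (rule bijI') (metis kh hk)+
 have inv: "inv ?h = ?k" by (rule inv_equality) (use kh hk in auto)
 have loc: "EX W g. openin M W & x : W & aut Int_M g & (ALL y:W. lim F y = g y)"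
  if F: "!!n x. x : E n ==> x : C ==> lim F x = F n x" "!!n. aut Int_M (F n)" and x: "x : topspace M" for F x
 proof (cases "x : C")
  case True
  then obtain n where "x : E n" using E(2) by blast
  then have "x : C Int M interior_of (E (Suc n))" using E(1) True by blast
  moreover have "openin M (C Int M interior_of (E (Suc n)))" using C(1) by auto
  moreover have "lim F y = F (Suc n) y" if "y : C Int M interior_of (E (Suc n))" for y
   using F(1)[of y "Suc n"] that interior_of_subset[of M "E (Suc n)"] by blast
  ultimately show ?thesis using F(2) by blast
 next
  case False
  moreover have "openin M (topspace M - C)" using C(2) by blast
  ultimately show ?thesis using x aut_id[of Int_M] by (intro exI[of _ "topspace M - C"] exI[of _ "%x. x"]) (simp add: lim_def)
 qed
 have "laut ?h" unfolding laut_def inv using bij loc[OF h Phi(1)] loc[OF k aut_inv[OF Phi(1)]] by blast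
 moreover have "?h x : C \<longleftrightarrow> x : C" for x
  using h Phi(2) E(2) by (cases "x : C") (auto simp: lim_def)
 ultimately show thesis using that[of ?h] h k inv by simp
qed

lemma linked_same: assumes "linked a b P e tau rho s c" shows "rho ` {0..} Int P = s ` {0..} Int P"
proof -
 have g: "gate P e tau rho s" using assms by (simp add: linked_def)
 have tau: "tau 2 < tau 15" using gate_less[OF g] by auto
 have eq: "rho t = s t" if "0 <= t" "t < tau 2" for t using g that tau by (simp add: gate_def)
 have out: "rho t ~: P" "s t ~: P" if "tau 2 <= t" for t using g that by (auto simp: gate_def)
 show ?thesis
 proof (intro equalityI subsetI)
  fix x assume "x : rho ` {0..} Int P"
  then obtain t where t: "0 <= t" "x = rho t" "x : P" by auto
  then show "x : s ` {0..} Int P" using out[of t] eq[of t] t by force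
 next
  fix x assume "x : s ` {0..} Int P"
  then obtain t where t: "0 <= t" "x = s t" "x : P" by auto
  then show "x : rho ` {0..} Int P" using out[of t] eq[of t] t by force
 qed
qed

text \<open>
 Back and forth: \<open>rho n\<close> has the tail of \<open>r\<close> for even \<open>n\<close> and that of \<open>r'\<close> for odd \<open>n\<close>, and it agrees with its
 successor up to a gate beyond \<open>P n\<close>. As \<open>P n\<close> is chosen after \<open>Phi n\<close>, it can be made to contain \<open>Phi n ` E n\<close>.
\<close>
lemma back_and_forth:
 assumes r: "fray r" and r': "fray r'" and ends: "same_end r r'" and E: "!!n. compactin M (E n)"
 shows "EX P (rho :: nat => real => 'a) Phi. ALL n. (rho n ` {0..} Int P n = rho (Suc n) ` {0..} Int P n & E n Un Phi n ` E n \<subseteq> P n) & aut Int_M (Phi n) &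
  (EX g. aut (Int_M - P n) g & Phi (Suc (Suc n)) = (%x. g (Phi n x))) & Phi n ` ((if even n then r else r') ` {0..}) = rho n ` {0..}"
proof -
 obtain c where c: "is_sign c" "avail r r' c" "avail r' r c" using avail_both[OF r r' ends] by blast
 define R where "R n = (if even n then r else r')" for n :: nat
 have R: "fray (R n)" "avail (R n) (R (Suc n)) c" "R (Suc (Suc n)) = R n" for n using r r' c by (auto simp: R_def)
 \<comment> \<open>The state consists of a compact set, two consecutive rays linked outside it, and
   automorphisms carrying \<open>r\<close> and \<open>r'\<close>, in alternating order, to these
   rays.\<close>
 define I where "I n = (%(P, rho, rho', Phi, Phi'). compactin M P & surface_boundary A \<subseteq> P & E n Un Phi ` E n \<subseteq> P &
   (EX e tau. linked (R n) (R (Suc n)) P e tau rho rho' c) & aut Int_M Phi & Phi ` (R n ` {0..}) = rho ` {0..} &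
   aut Int_M Phi' & Phi' ` (R (Suc n) ` {0..}) = rho' ` {0..})" for n
 define Q where "Q = (%(P :: 'a set, rho :: real => 'a, rho' :: real => 'a, Phi :: 'a => 'a, Phi' :: 'a => 'a) (Pn :: 'a set, rhon :: real => 'a, rhon' :: real => 'a, Phin :: 'a => 'a, Phin' :: 'a => 'a).
   P \<subseteq> Pn & rhon = rho' & Phin = Phi' & (EX g. aut (Int_M - P) g & Phin' = (%x. g (Phi x))))"
 have "EX F. ALL n. I n (F n) & Q (F n) (F (Suc n))"
 proof (rule dependent_nat_choice[of I "%_. Q"])
  let ?P = "surface_boundary A Un E 0"
  have P: "compactin M ?P" by (intro compactin_Un boundary E)
  then obtain e tau rho where lk: "linked r r' ?P e tau r rho c" using c(2) unfolding avail_def by blast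
  then have rho: "fray rho" by (simp add: linked_def)
  obtain z w where ag: "agree rho z r' w" using lk by (auto simp: linked_def)
  then have zw: "0 < z" "0 < w" by (auto simp: agree_def)
  \<comment> \<open>The rays \<open>r'\<close> and \<open>rho\<close> share a tail. Sliding each of
    them onto this tail gives the first map of odd index.\<close>
  obtain g1 where g1: "aut Int_M g1" "g1 ` (r' ` {0..}) = r' ` {w..}" using fray_tail_slide[OF r' zw(2)] by blast
  obtain g2 where g2: "aut Int_M g2" "g2 ` (rho ` {0..}) = rho ` {z..}" using fray_tail_slide[OF rho zw(1)] by blast
  have i: "inv g2 (g2 x) = x" for x using aut_bij[OF g2(1)] by (simp add: bij_def inv_f_f)
  have "(%x. inv g2 (g1 x)) ` (r' ` {0..}) = inv g2 ` g1 ` (r' ` {0..})" by auto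
  also have "... = inv g2 ` g2 ` (rho ` {0..})" unfolding g1(2) g2(2) agree_image[OF ag] ..
  also have "... = rho ` {0..}" by (simp add: image_image i)
  finally have "(%x. inv g2 (g1 x)) ` (r' ` {0..}) = rho ` {0..}" .
  moreover have "aut Int_M (%x. inv g2 (g1 x))" by (rule aut_comp[OF aut_inv[OF g2(1)] g1(1)])
  ultimately have "I 0 (?P, r, rho, (%x. x), (%x. inv g2 (g1 x)))"
   using P lk by (auto simp: I_def R_def aut_id)
  then show "EX x. I 0 x" by blast
 next
  fix st n assume st: "I n st"
  obtain P rho rho' Phi Phi' where eq: "st = (P, rho, rho', Phi, Phi')" by (metis prod_cases5)
  have I: "compactin M P" "surface_boundary A \<subseteq> P" "aut Int_M Phi" "Phi ` (R n ` {0..}) = rho ` {0..}" "aut Int_M Phi'" "Phi' ` (R (Suc n) ` {0..}) = rho' ` {0..}"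
   using st by (auto simp: I_def eq)
  obtain e tau where lk: "linked (R n) (R (Suc n)) P e tau rho rho' c" using st by (auto simp: I_def eq)
  \<comment> \<open>The annulus and the ray up to \<open>tau 15\<close> are included for
    \<open>linked_compose\<close>, the set \<open>E (Suc n)\<close> and its image for the
    convergence of the inverses and of the maps.\<close>
  define Pn where "Pn = P Un annulus e Un rho' ` {0..tau 15} Un E (Suc n) Un Phi' ` E (Suc n)"
  have "fray rho'" "pe wide_ring e" using lk by (auto simp: linked_def gate_def)
  then have Pn: "compactin M Pn" "surface_boundary A \<subseteq> Pn"
   using I(2) unfolding Pn_def annulus_def
   by (auto intro!: compactin_Un I(1) fray_compact wide_ring_compact E aut_compactin[OF I(5)])
  obtain z w where "agree rho' z (R (Suc n)) w" using lk by (auto simp: linked_def)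
  then obtain e' tau' rho'' where lk': "linked (R (Suc n)) (R (Suc (Suc n))) Pn e' tau' rho' rho'' c"
   using avail_lead[OF R(2) \<open>fray rho'\<close> R(1) R(1) _ Pn] by blast
  have "linked (R n) (R (Suc (Suc n))) P e tau rho rho'' (c * c)" by (rule linked_compose[OF lk lk' R(1) R(1)]) (auto simp: Pn_def)
  then obtain g where g: "aut (Int_M - P) g" "g ` (rho ` {0..}) = rho'' ` {0..}" using R(3) is_sign_square[OF c(1)] linked_drag[OF R(1) I(1)] by metis
  have "aut Int_M (%x. g (Phi x))" by (rule aut_comp[OF aut_mono[OF g(1)] I(3)]) auto
  moreover have "(%x. g (Phi x)) ` (R (Suc (Suc n)) ` {0..}) = rho'' ` {0..}"
  proof -
   have "(%x. g (Phi x)) ` (R n ` {0..}) = g ` Phi ` (R n ` {0..})" by auto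
   then show ?thesis unfolding R(3) I(4) g(2) .
  qed
  ultimately have "I (Suc n) (Pn, rho', rho'', Phi', (%x. g (Phi x)))"
   using Pn lk' I by (auto simp: I_def Pn_def)
  moreover have "Q st (Pn, rho', rho'', Phi', (%x. g (Phi x)))" using g(1) by (auto simp: Q_def eq Pn_def)
  ultimately show "EX y. I (Suc n) y & Q st y" by blast
 qed
 then obtain F where F: "!!n. I n (F n)" "!!n. Q (F n) (F (Suc n))" by blast
 define P where "P n = fst (F n)" for n
 define rho where "rho n = fst (snd (F n))" for n
 define rho' where "rho' n = fst (snd (snd (F n)))" for n
 define Phi where "Phi n = fst (snd (snd (snd (F n))))" for n
 define Phi' where "Phi' n = snd (snd (snd (snd (F n))))" for n
 have Fn: "F n = (P n, rho n, rho' n, Phi n, Phi' n)" for n by (simp add: P_def rho_def rho'_def Phi_def Phi'_def)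
 have In: "E n Un Phi n ` E n \<subseteq> P n" "EX e tau. linked (R n) (R (Suc n)) (P n) e tau (rho n) (rho' n) c" "aut Int_M (Phi n)" "Phi n ` (R n ` {0..}) = rho n ` {0..}" for n
  using F(1)[of n] unfolding I_def Fn by auto
 have Qn: "P n \<subseteq> P (Suc n)" "rho (Suc n) = rho' n" "Phi (Suc n) = Phi' n" "EX g. aut (Int_M - P n) g & Phi' (Suc n) = (%x. g (Phi n x))" for n
  using F(2)[of n] unfolding Q_def Fn by auto
 have "EX g. aut (Int_M - P n) g & Phi (Suc (Suc n)) = (%x. g (Phi n x))" for n using Qn(4)[of n] Qn(3)[of "Suc n"] by simp
 moreover have "Phi n ` ((if even n then r else r') ` {0..}) = rho n ` {0..}" for n using In(4)[of n] by (simp add: R_def)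
 moreover have "rho n ` {0..} Int P n = rho (Suc n) ` {0..} Int P n" for n using In(2)[of n] linked_same unfolding Qn(2) by blast
 ultimately show ?thesis using In(1,3) by metis
qed

text \<open>The limits \<open>h\<close> of the even and \<open>k\<close> of the odd maps send
  \<open>r\<close> and \<open>r'\<close> to the same set: membership of a point of
  \<open>E n\<close> is decided at the stages \<open>2 * n\<close> and \<open>2 * n + 1\<close>,
  whose rays agree within \<open>P (2 * n)\<close>. So \<open>h\<close> followed by
  \<open>inv k\<close> is the map sought.\<close>

theorem ray_laut:
 assumes r: "fray r" and r': "fray r'" and ends: "same_end r r'"
  and C: "C : connected_components_of M" "r ` {0..} \<subseteq> C" "r' ` {0..} \<subseteq> C"
 shows "EX psi. laut psi & psi ` (r ` {0..}) = r' ` {0..}"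
proof -
 have r0: "r 0 : C" using C(2) by auto
 then obtain E where E: "!!n. compactin M (E n)" "!!n. E n \<subseteq> M interior_of (E (Suc n))" "r 0 : E 0" "closedin M (\<Union>n. E n)" using connected_components_of_subset[OF C(1)] exhaustion by blast
 have oC: "openin M C" by (rule component_open[OF C(1)])
 have cC: "closedin M C" by (rule closedin_connected_components_of[OF C(1)])
 have EM: "E n \<subseteq> E (Suc n)" for n using E(2)[of n] interior_of_subset[of M "E (Suc n)"] by blast
 have Emono: "E m \<subseteq> E n" if "m <= n" for m n using EM that by (rule lift_Suc_mono_le)
 have CE: "C \<subseteq> (\<Union>n. E n)"
 proof -
  have "(\<Union>n. E n) = (\<Union>n. M interior_of (E n))" using E(2) interior_of_subset[of M] by blast
  then have o: "openin M (\<Union>n. E n)" by auto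
  have "C \<subseteq> (\<Union>n. E n) | disjnt C (\<Union>n. E n)"
   by (rule connectedin_clopen_cases[OF connectedin_connected_components_of[OF C(1)] E(4) o])
  then show ?thesis using r0 E(3) unfolding disjnt_def by blast
 qed
 obtain P Phi and rho :: "nat => real => 'a" where all: "ALL n. (rho n ` {0..} Int P n = rho (Suc n) ` {0..} Int P n & E n Un Phi n ` E n \<subseteq> P n) & aut Int_M (Phi n) &
  (EX g. aut (Int_M - P n) g & Phi (Suc (Suc n)) = (%x. g (Phi n x))) & Phi n ` ((if even n then r else r') ` {0..}) = rho n ` {0..}" using back_and_forth[of r r' E, OF r r' ends E(1)] by auto
 have B: "rho n ` {0..} Int P n = rho (Suc n) ` {0..} Int P n" "E n Un Phi n ` E n \<subseteq> P n" "aut Int_M (Phi n)"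
  "EX g. aut (Int_M - P n) g & Phi (Suc (Suc n)) = (%x. g (Phi n x))"
  "Phi n ` ((if even n then r else r') ` {0..}) = rho n ` {0..}" for n using spec[OF all, of n] by auto
 have step: "Phi (Suc (Suc n)) x = Phi n x & inv (Phi (Suc (Suc n))) x = inv (Phi n) x" if x: "x : E n" for n x
 proof -
  obtain g where g: "aut (Int_M - P n) g" "Phi (Suc (Suc n)) = (%x. g (Phi n x))" using B(4) by blast
  have bg: "bij g" and bPhi: "bij (Phi n)" using aut_bij[OF g(1)] aut_bij[OF B(3)] by auto
  have fix_P: "g y = y" "inv g y = y" if "y : P n" for y
   using aut_outside[OF g(1)] aut_outside[OF aut_inv[OF g(1)]] that by auto
  have "Phi n x : P n" "x : P n" using B(2)[of n] x by auto
  moreover have "inv (g \<circ> Phi n) = inv (Phi n) \<circ> inv g" by (rule o_inv_distrib[OF bg bPhi])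
  ultimately show ?thesis unfolding g(2) using fix_P by (simp add: o_def)
 qed
 have ex: "EX h. laut h & (ALL n x. x : E n & x : C --> inv h x = inv (Phi (2 * n + i)) x) & (ALL x. h x : C \<longleftrightarrow> x : C)" for i
 proof -
  have m: "x : E (2 * n + i)" if "x : E n" for n x using Emono[of n "2 * n + i"] that by auto
  show ?thesis
  proof (rule limit_laut[OF oC cC E(2) CE, of "%n. Phi (2 * n + i)"])
   show "aut Int_M (Phi (2 * n + i))" for n by (rule B(3))
   show "Phi (2 * n + i) x : C \<longleftrightarrow> x : C" for n x by (rule aut_component[OF B(3) C(1) r C(2)])
   show "Phi (2 * Suc n + i) x = Phi (2 * n + i) x" if "x : E n" "x : C" for n x using step[OF m[OF that(1)]] by simp
   show "inv (Phi (2 * Suc n + i)) x = inv (Phi (2 * n + i)) x" if "x : E n" "x : C" for n x using step[OF m[OF that(1)]] by simp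
  qed blast
 qed
 obtain h where h: "laut h" "!!n x. x : E n ==> x : C ==> inv h x = inv (Phi (2 * n)) x" "!!x. h x : C \<longleftrightarrow> x : C" using ex[of 0] by auto
 obtain k where k: "laut k" "!!n x. x : E n ==> x : C ==> inv k x = inv (Phi (2 * n + 1)) x" "!!x. k x : C \<longleftrightarrow> x : C" using ex[of 1] by auto
 have mem: "y : g ` S \<longleftrightarrow> inv g y : S" if "bij g" for g :: "'a => 'a" and y S
  using that by (metis bij_inv_eq_iff image_iff)
 have bhk: "bij h" "bij k" using h(1) k(1) by (auto simp: laut_def)
 have "y : h ` (r ` {0..}) \<longleftrightarrow> y : k ` (r' ` {0..})" for y
 proof (cases "y : C")
  case True
  then obtain n where n: "y : E n" using CE by blast
  have yP: "y : P (2 * n)" using B(2)[of "2 * n"] Emono[of n "2 * n"] n by auto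
  have "y : h ` (r ` {0..}) \<longleftrightarrow> y : Phi (2 * n) ` (r ` {0..})"
   using mem[OF bhk(1)] mem[OF aut_bij[OF B(3)]] h(2)[OF n True] by simp
  also have "... \<longleftrightarrow> y : rho (2 * n) ` {0..}" using B(5)[of "2 * n"] by simp
  also have "... \<longleftrightarrow> y : rho (2 * n + 1) ` {0..}" using B(1)[of "2 * n"] yP by auto
  also have "... \<longleftrightarrow> y : Phi (2 * n + 1) ` (r' ` {0..})" using B(5)[of "2 * n + 1"] by simp
  also have "... \<longleftrightarrow> y : k ` (r' ` {0..})"
   using mem[OF bhk(2)] mem[OF aut_bij[OF B(3)]] k(2)[OF n True] by simp
  finally show ?thesis .
 next
  case False
  then show ?thesis using h(3) k(3) C(2,3) by blast
 qed
 then have eq: "h ` (r ` {0..}) = k ` (r' ` {0..})" by blast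
 have ik: "inv k (k x) = x" for x using bhk(2) by (simp add: bij_def inv_f_f)
 have "(%x. inv k (h x)) ` (r ` {0..}) = inv k ` h ` (r ` {0..})" by auto
 also have "... = r' ` {0..}" unfolding eq by (simp add: image_image ik)
 finally show ?thesis using laut_comp[OF h(1) laut_inv[OF k(1)]] by blast
qed

end

section \<open>Transfer to the notions used in the theorem\<close>

lemma affine_on_cong: "affine_on P f ==> (!!y. y : P ==> f y = g y) ==> affine_on P g"
 by (simp add: affine_on_def)

context compact_boundary_surface
begin

lemma chart_inverse_plm:
 assumes c: "(U, phi) : A" and x: "x : U" "x : Int_M"
 shows "plm (inv_into U phi) (phi x)"
proof (rule plmI[OF c])
 let ?i = "inv_into U phi"
 have i: "?i (phi x) = x" using chart_inj[OF c] x(1) by simp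
 show "?i (phi x) : U" "?i (phi x) : Int_M" using x i by auto
 have "phi x : interior (phi ` U)" using chart_open[OF c] x by (intro chart_interior[OF c]) auto
 then have ev: "\<forall>\<^sub>F q in nhds (phi x). q : phi ` U" using interior_subset unfolding eventually_nhds by auto
 then show "\<forall>\<^sub>F q in nhds (phi x). ?i q : U" by (rule eventually_mono) (rule inv_into_into)
 show "plat (%q. phi (?i q)) (phi x)"
 proof (rule plat_cong_ev[OF plat_id])
  show "\<forall>\<^sub>F q in nhds (phi x). q = phi (?i q)" using ev by (rule eventually_mono) (simp add: f_inv_into_f)
 qed
qed

text \<open>The inverse of \<open>psi\<close> on a small square about \<open>psi x\<close> is a
  parametrisation; the factor \<open>c\<close> is chosen so that its image stays in the
  interior.\<close>

lemma flat_chart: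
 assumes U: "openin M U" "x : U" "x : Int_M"
  and iso: "pl_isomorphism (subtopology M U) (restrict_atlas U A) (euclidean :: (real^2) topology) (standard_atlas UNIV) psi"
 obtains e c where "0 < c" "pe (D 1) e" "e 0 = x" "!!p. p : D 1 ==> e p : U & psi (e p) = psi x + c *\<^sub>R p" "inj_on psi U"
proof -
 obtain g where hm: "homeomorphic_maps (subtopology M U) (euclidean :: (real^2) topology) psi g"
  and pl: "pl_map (euclidean :: (real^2) topology) (standard_atlas UNIV) (subtopology M U) (restrict_atlas U A) g"
  using iso unfolding pl_isomorphism_def by blast
 have UM: "U \<subseteq> topspace M" using U(1) openin_subset by blast
 then have t: "topspace (subtopology M U) = U" by auto
 have cg: "continuous_map euclidean (subtopology M U) g" and inv: "!!y. y : U ==> g (psi y) = y" "!!p. psi (g p) = p"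
  using hm unfolding homeomorphic_maps_def t by auto
 have gU: "g p : U" for p using continuous_map_image_subset_topspace[OF cg] unfolding t by auto
 have cM: "continuous_map euclidean M g" using cg by (simp add: continuous_map_in_subtopology)
 have op: "open {p. g p : V}" if V: "openin M V" for V
  using openin_continuous_map_preimage[OF cM V] by simp
 have plm: "plm g p" if p: "g p : Int_M" for p
 proof -
  obtain V phi where V: "(V, phi) : A" "g p : V" using chart_cover Int_M_subset p by blast
  have o: "open {q. g q : V}" by (rule op[OF chart_open[OF V(1)]])
  have id: "inv_into UNIV (%x::real^2. x) = (%x. x)" unfolding inv_into_def by simp
  have "pl_on {q. g q : V} (phi \<circ> g)" using pl V(1) gU unfolding restrict_atlas_def pl_map_def standard_atlas_def id by (auto simp: o_def)
  then show ?thesis using pl_on_iff_plat[OF o] V(2) o plmI[OF V(1), of g p] p unfolding eventually_nhds by (auto simp: o_def)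
 qed
 have "open {p. g p : Int_M}" by (rule op[OF openin_Int_M])
 moreover have "psi x : {p. g p : Int_M}" using inv(1) U by simp
 ultimately obtain c where c: "0 < c" "!!p. n1 (p - psi x) < c ==> g p : Int_M" using open_n1_ball[of "{p. g p : Int_M}" "psi x"] by auto
 define k where "k p = psi x + c *\<^sub>R p" for p
 have k: "g (k p) : Int_M" if "p : D 1" for p using that c by (intro c(2)) (simp add: k_def)
 have plk: "plat k p" for p unfolding k_def[abs_def] by (intro plat_intros)
 have "pe (D 1) (%p. g (k p))"
  unfolding pe_def
 proof (intro conjI ballI)
  show "inj_on (%p. g (k p)) (D 1)"
  proof (rule inj_onI)
   fix p q assume "g (k p) = g (k q)"
   then have "k p = k q" using inv(2) by metis
   then show "p = q" using c(1) by (simp add: k_def)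
  qed
  show "plm (%p. g (k p)) p" if "p : D 1" for p by (rule plm_comp[OF plm[OF k[OF that]] plk])
 qed (use k in auto)
 moreover have "g (k 0) = x" using inv(1) U(2) by (simp add: k_def)
 moreover have "inj_on psi U" using inv(1) by (metis inj_onI)
 ultimately show thesis using that[of c "%p. g (k p)"] c(1) gU inv(2) by (simp add: k_def)
qed

lemma ray_fray:
 assumes r: "ray M A r" shows "fray r"
proof -
 have emb: "homeomorphic_map (top_of_set {0..}) (subtopology M (r ` {0..})) r"
  and pr: "proper_map (top_of_set {0..}) M r" and flat: "locally_flat_ray M A r" and int: "r ` {0..} \<subseteq> Int_M"
  using r unfolding ray_def embedding_map_def by auto
 have "continuous_map (top_of_set {0..}) M r"
  using homeomorphic_imp_continuous_map[OF emb] by (simp add: continuous_map_in_subtopology)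
 moreover have "inj_on r {0..}" using homeomorphic_imp_injective_map[OF emb] by simp
 moreover have "closedin M (r ` {a..})" if "0 <= a" for a
 proof -
  have "closedin (top_of_set {0..}) {a..}" using that by (intro closed_subset) auto
  then show ?thesis using proper_imp_closed_map[OF pr] unfolding closed_map_def by blast
 qed
 moreover have "EX T>=0. ALL t>=T. r t ~: K" if K: "compactin M K" for K
 proof -
  have "compactin (top_of_set {0..}) {t : topspace (top_of_set {0..}). r t : K}"
   by (rule compactin_proper_map_preimage[OF pr K])
  then obtain B where B: "!!t. 0 <= t ==> r t : K ==> \<bar>t\<bar> <= B" using compact_imp_bounded[of "{t. 0 <= t & r t : K}"] by (auto simp: bounded_real compactin_subtopology)
  then show ?thesis by (intro exI[of _ "max 0 (B + 1)"]) force
 qed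
 moreover have chart: "EX e c U psi. 0 < c & pe (D 1) e & e 0 = r t &
   (ALL p:D 1. e p : r ` {0..} \<longleftrightarrow> psi (r t) + c *\<^sub>R p : psi ` (U Int r ` {0..})) & r t : U &
   (if t = 0 then psi (r t) = 0 & psi ` (U Int r ` {0..}) = {v. v $ 2 = 0 & 0 <= v $ 1} else psi ` (U Int r ` {0..}) = {v. v $ 2 = 0})"
  if t: "0 <= t" for t
 proof -
  obtain U psi where U: "openin M U" "r t : U"
   "pl_isomorphism (subtopology M U) (restrict_atlas U A) (euclidean :: (real^2) topology) (standard_atlas UNIV) psi"
   "if t = 0 then psi (r t) = 0 & psi ` (U Int r ` {0..}) = {v. v $ 2 = 0 & 0 <= v $ 1} else psi ` (U Int r ` {0..}) = {v. v $ 2 = 0}"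
   using flat t unfolding locally_flat_ray_def by blast
  have "r t : Int_M" using int t by auto
  then obtain e c where e: "0 < c" "pe (D 1) e" "e 0 = r t" "!!p. p : D 1 ==> e p : U & psi (e p) = psi (r t) + c *\<^sub>R p" "inj_on psi U"
   by (rule flat_chart[OF U(1,2) _ U(3)]) blast
  have "e p : r ` {0..} \<longleftrightarrow> psi (r t) + c *\<^sub>R p : psi ` (U Int r ` {0..})" if p: "p : D 1" for p
  proof -
   have ep: "e p : U" "psi (r t) + c *\<^sub>R p = psi (e p)" using e(4)[OF p] by auto
   show ?thesis unfolding ep(2) using ep(1) e(5) inj_on_image_mem_iff[OF e(5) ep(1), of "U Int r ` {0..}"] by blast
  qed
  then show ?thesis using e(1-3) U(2,4) by blast
 qed
 moreover have "EX e. adapted axis (r ` {0..}) e & e 0 = r t" if t: "0 < t" for t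
 proof -
  obtain e c U psi where e: "0 < c" "pe (D 1) e" "e 0 = r t"
   "ALL p:D 1. e p : r ` {0..} \<longleftrightarrow> psi (r t) + c *\<^sub>R p : psi ` (U Int r ` {0..})" "r t : U"
   "psi ` (U Int r ` {0..}) = {v::real^2. v $ 2 = 0}"
   using chart[of t] t by force
  have "psi (r t) : psi ` (U Int r ` {0..})" using e(5) t by auto
  then show ?thesis using e(1-4) unfolding e(6) adapted_def axis_def by auto
 qed
 moreover have "EX e. pe (D 1) e & e 0 = r 0 & (ALL p:D 1. e p : r ` {0..} \<longleftrightarrow> p$2 = 0 & 0 <= p$1)" using chart[of 0] by (auto simp: zero_le_mult_iff)
 ultimately show ?thesis using int unfolding fray_def by auto
qed

lemma end_component:
 assumes C: "C : connected_components_of M" and eta: "end_of_connected (subtopology M C) eta" shows "eta {} = C"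
proof -
 let ?X = "subtopology M C"
 have "eta {} : connected_components_of (subtopology ?X (topspace ?X - {}))"
  using eta unfolding end_of_connected_def by blast
 then have "eta {} : connected_components_of ?X" by (simp only: Diff_empty subtopology_topspace)
 moreover have "connected_components_of ?X = {C}" using connectedin_connected_components_of[OF C] nonempty_connected_components_of[OF C] unfolding connected_components_of_eq_singleton connectedin_def by (metis inf.absorb_iff2 topspace_subtopology topspace_discrete_topology)
 ultimately show ?thesis by simp
qed

lemma points_to_component:
 assumes C: "C : connected_components_of M" "end_of_connected (subtopology M C) eta" and r: "points_to M r eta"
  and K: "compactin M K"
 shows "EX a>=0. r ` {a<..} \<subseteq> eta (C Int K)"
proof -
 obtain C' where C': "C' : connected_components_of M" "end_of_connected (subtopology M C') eta"
  "!!K. compactin (subtopology M C') K ==> EX a>=0. r ` {a<..} \<subseteq> eta K"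
  using r unfolding points_to_def by blast
 have "C' = C" using end_component[OF C] end_component[OF C'(1,2)] by simp
 moreover have "compactin M (C Int K)" by (rule closed_Int_compactin[OF closedin_connected_components_of[OF C(1)] K])
 ultimately show ?thesis using C'(3)[of "C Int K"] by (simp add: compactin_subtopology)
qed

lemma points_to_image:
 assumes C: "C : connected_components_of M" "end_of_connected (subtopology M C) eta" and r: "points_to M r eta" "fray r"
 shows "r ` {0..} \<subseteq> C"
proof -
 obtain a where a: "a >= 0" "r ` {a<..} \<subseteq> eta (C Int {})" using points_to_component[OF C r(1), of "{}"] by auto
 then have "r (a + 1) : C" using end_component[OF C] by auto
 moreover have "connectedin M (r ` {0..})"
  using connectedin_continuous_map_image[of "top_of_set {0..}" M r "{0..}"] r(2)
  by (simp add: fray_def connectedin_subtopology)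
 moreover have "r (a + 1) : r ` {0..}" using a(1) by auto
 ultimately show ?thesis using connected_components_of_maximal[OF C(1), of "r ` {0..}"] unfolding disjnt_def by blast
qed

text \<open>The connected set asked for is the component that the end assigns to
  \<open>C Int K\<close>; it lies in the interior because \<open>K\<close> contains the
  boundary.\<close>

lemma points_to_same_end:
 assumes C: "C : connected_components_of M" "end_of_connected (subtopology M C) eta" and r: "points_to M r eta" and r': "points_to M r' eta"
 shows "same_end r r'"
 unfolding same_end_def
proof (intro allI impI)
 fix K assume K: "compactin M K & surface_boundary A \<subseteq> K"
 let ?X = "subtopology M C" and ?S = "eta (C Int K)"
 have CM: "C \<subseteq> topspace M" by (rule connected_components_of_subset[OF C(1)])
 then have t: "topspace ?X = C" by auto
 have "?S : connected_components_of (subtopology ?X (topspace ?X - C Int K))" using closed_Int_compactin[OF closedin_connected_components_of[OF C(1)]] K C(2) unfolding end_of_connected_def by (simp add: compactin_subtopology)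
 then have S: "connectedin (subtopology ?X (topspace ?X - C Int K)) ?S" by (rule connectedin_connected_components_of)
 then have con: "connectedin M ?S" and sub: "?S \<subseteq> C - C Int K" unfolding t by (auto simp: connectedin_subtopology)
 obtain a a' where a: "a >= 0" "r ` {a<..} \<subseteq> ?S" "a' >= 0" "r' ` {a'<..} \<subseteq> ?S"
  using points_to_component[OF C r] points_to_component[OF C r'] K by blast
 have "ALL t>=max a a' + 1. r t : ?S & r' t : ?S" using a(2,4) by auto
 moreover have "0 <= max a a' + 1" using a(1) by simp
 moreover have "?S \<subseteq> Int_M" using sub CM K unfolding surface_interior_def by blast
 moreover have "?S Int K = {}" using sub by blast
 ultimately show "EX S. connectedin M S & S \<subseteq> Int_M & S Int K = {} & (EX T>=0. ALL t>=T. r t : S & r' t : S)"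
  using con by blast
qed

lemma laut_continuous: assumes "laut h" shows "continuous_map M M h"
proof -
 have loc: "EX W g. openin M W & x : W & aut Int_M g & (ALL y:W. h y = g y)" if "x : topspace M" for x
  using assms that unfolding laut_def by blast
 have "h x : topspace M" if x: "x : topspace M" for x using loc[OF x] aut_topspace x by metis
 moreover have "openin M {x:topspace M. h x : V}" if V: "openin M V" for V
 proof (subst openin_subopen, intro ballI)
  fix x assume x: "x : {x:topspace M. h x : V}"
  then obtain W g where W: "openin M W" "x : W" "aut Int_M g" "ALL y:W. h y = g y" using loc by blast
  have "openin M (W Int {y. g y : V})" using W(1) aut_vimage_open[OF W(3) V] by blast
  moreover have "x : W Int {y. g y : V}" using W x by simp
  moreover have "W Int {y. g y : V} \<subseteq> {x:topspace M. h x : V}" using W(4) openin_subset[OF W(1)] by auto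
  ultimately show "EX T. openin M T & x : T & T \<subseteq> {x:topspace M. h x : V}" by blast
 qed
 ultimately show ?thesis by (auto simp: continuous_map_def)
qed

text \<open>At interior points \<open>lpl\<close> gives the pieces. A boundary point is off the
  support of the local automorphism, so there \<open>h\<close> is the identity nearby and its chart
  expression is a transition map; intersecting with a small polytope \<open>B\<close> keeps the
  pieces where this holds.\<close>

lemma laut_pl_map: assumes "laut h" shows "pl_map M A M A h"
 unfolding pl_map_def
proof (intro conjI laut_continuous[OF assms] ballI, clarify)
 fix U phi V kappa assume c: "(U, phi) : A" "(V, kappa) : A"
 let ?N = "{x:U. h x : V}" and ?f = "kappa \<circ> h \<circ> inv_into U phi"
 have UM: "U \<subseteq> topspace M" using chart_open[OF c(1)] openin_subset by blast
 have "openin M {x:topspace M. h x : V}"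
  by (rule openin_continuous_map_preimage[OF laut_continuous[OF assms] chart_open[OF c(2)]])
 then have "openin M (U Int {x:topspace M. h x : V})" using chart_open[OF c(1)] by blast
 moreover have "U Int {x:topspace M. h x : V} = ?N" using UM by blast
 ultimately have oN: "openin M ?N" by simp
 have inv: "inv_into U phi (phi y) = y" if "y : U" for y using chart_inj[OF c(1)] that by simp
 show "pl_on (phi ` ?N) ?f"
  unfolding pl_on_def affine_on_def[symmetric]
 proof
  fix q assume "q : phi ` ?N"
  then obtain x where x: "q = phi x" "x : U" "h x : V" by blast
  then have xM: "x : topspace M" using UM by blast
  obtain W g where W: "openin M W" "x : W" "aut Int_M g" "ALL y:W. h y = g y"
   using assms xM unfolding laut_def by blast
  show "EX \<P>. finite \<P> & (ALL P:\<P>. polytope P & P \<subseteq> phi ` ?N & affine_on P ?f) &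
   (EX T. openin (top_of_set (phi ` ?N)) T & q : T & T \<subseteq> \<Union>\<P>)"
  proof (cases "x : Int_M")
   case True
   have qi: "q : interior (phi ` ?N)" unfolding x(1) using x True by (intro chart_interior[OF c(1) oN]) auto
   have "lpl h x" by (rule lpl_cong[OF aut_lpl[OF W(3) True] W(1,2)]) (use W(4) in simp)
   then have "plm (%q. h (inv_into U phi q)) q"
    using chart_inverse_plm[OF c(1) x(2) True] inv[OF x(2)] unfolding lpl_def x(1) by blast
   then have "plat ?f q" using c(2) x(3) inv[OF x(2)] unfolding plm_def x(1) by (simp add: o_def)
   from plat_pieces[OF this open_interior qi] obtain \<P> where P: "finite \<P>"
    "ALL P:\<P>. polytope P & affine_on P ?f & q : P & P \<subseteq> interior (phi ` ?N)" "q : interior (\<Union>\<P>)"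
    by blast
   have "interior (\<Union>\<P>) \<subseteq> phi ` ?N" using P(2) interior_subset[of "\<Union>\<P>"] interior_subset[of "phi ` ?N"] by blast
   then have "openin (top_of_set (phi ` ?N)) (interior (\<Union>\<P>))" by (simp add: open_subset)
   moreover have "ALL P:\<P>. polytope P & P \<subseteq> phi ` ?N & affine_on P ?f"
    using P(2) interior_subset[of "phi ` ?N"] by blast
   ultimately show ?thesis using P(1,3) interior_subset[of "\<Union>\<P>"] by blast
  next
   case False
   obtain K where K: "compactin M K" "K \<subseteq> Int_M" "!!x. x ~: K ==> g x = x" using aut_supp[OF W(3)] by metis
   let ?W = "?N Int V Int (W - K)"
   have oW: "openin M ?W" using openin_diff[OF W(1) compactin_imp_closedin[OF Hausdorff K(1)]] oN chart_open[OF c(2)] by blast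
   have xW: "x : ?W" using x K(2,3) False W W(2) K(2) by force
   obtain G where G: "open G" "phi ` ?W = half_plane Int G"
    using chart_image_open[OF c(1) oW] by (auto simp: openin_open)
   have qG: "q : G" using G(2) xW x(1) by blast
   obtain B where B: "polytope B" "q : interior B" "B \<subseteq> G" using small_polytope[OF G(1) qG] by blast
   have "pl_on (phi ` (U Int V)) (kappa \<circ> inv_into U phi)"
    using surface c unfolding pl_surface_def pl_surface_atlas_def by fast
   moreover have "q : phi ` (U Int V)" using xW x(1) by blast
   ultimately obtain \<P> T where P: "finite \<P>"
    "ALL P:\<P>. polytope P & P \<subseteq> phi ` (U Int V) & affine_on P (kappa \<circ> inv_into U phi)"
    "openin (top_of_set (phi ` (U Int V))) T" "q : T" "T \<subseteq> \<Union>\<P>"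
    unfolding pl_on_def affine_on_def[symmetric] by meson
   obtain G' where G': "open G'" "T = phi ` (U Int V) Int G'" using P(3) by (auto simp: openin_open)
   let ?Q = "(%P. P Int B) ` \<P>" and ?T = "phi ` ?N Int (G' Int interior B)"
   have sub: "p : phi ` ?W" if "p : phi ` U" "p : B" for p using that chart_half_plane[OF c(1)] G(2) B(3) by (auto simp: half_plane_def)
   have eq: "(kappa \<circ> inv_into U phi) p = ?f p" if p: "p : phi ` ?W" for p
   proof -
    obtain y where y: "y : U" "y : W" "y ~: K" "p = phi y" using p by blast
    then show ?thesis using W(4) K(3) inv[OF y(1)] y(4) by simp
   qed
   have "polytope P' & P' \<subseteq> phi ` ?N & affine_on P' ?f" if P': "P' : ?Q" for P'
   proof -
    obtain P where Q: "P : \<P>" "P' = P Int B" using P' by blast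
    have *: "polytope P" "P \<subseteq> phi ` (U Int V)" "affine_on P (kappa \<circ> inv_into U phi)" using P(2) Q(1) by auto
    have PW: "P' \<subseteq> phi ` ?W" using sub *(2) Q(2) by blast
    have "affine_on P' (kappa \<circ> inv_into U phi)" by (rule affine_on_subset[OF *(3)]) (use Q in blast)
    then have "affine_on P' ?f" by (rule affine_on_cong) (use eq PW in blast)
    moreover have "polytope P'" unfolding Q(2) by (rule polytope_Int[OF *(1) B(1)])
    ultimately show ?thesis using PW by blast
   qed
   moreover have "?T \<subseteq> \<Union>?Q"
   proof
    fix p assume p: "p : ?T"
    then have pB: "p : B" using interior_subset by blast
    then have "p : phi ` ?W" using p by (intro sub) auto
    then show "p : \<Union>?Q" using G'(2) p P(5) pB by blast
   qed
   moreover have "openin (top_of_set (phi ` ?N)) ?T" using G'(1) by auto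
   moreover have "q : ?T" using P(4) G'(2) B(2) xW x(1) by blast
   moreover have "finite ?Q" using P(1) by blast
   ultimately show ?thesis by blast
  qed
 qed
qed

lemma laut_pl_automorphism: assumes h: "laut h" shows "pl_automorphism M A h"
proof -
 show ?thesis using h laut_continuous[OF h] laut_continuous[OF laut_inv[OF h]] laut_pl_map[OF h] laut_pl_map[OF laut_inv[OF h]] unfolding homeomorphic_maps_def pl_automorphism_def pl_isomorphism_def by (auto simp: bij_def inv_f_f surj_f_inv_f laut_def)
qed

end

theorem theorem6p10:
  fixes M :: "'a topology"
    and \<A> :: "('a, real^2) atlas"
    and \<eta> :: "'a set \<Rightarrow> 'a set"
    and r r' :: "real \<Rightarrow> 'a"
  assumes "pl_surface M \<A>"
    and "compactin M (surface_boundary \<A>)"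
    and "end_of M \<eta>"
    and "ray M \<A> r" and "points_to M r \<eta>"
    and "ray M \<A> r'" and "points_to M r' \<eta>"
  shows "\<exists>\<psi>. pl_automorphism M \<A> \<psi> \<and> \<psi> ` (r ` {0..}) = r' ` {0..}"
proof -
 interpret compact_boundary_surface M \<A> by unfold_locales fact+
 obtain C where C: "C : connected_components_of M" "end_of_connected (subtopology M C) \<eta>"
  using \<open>end_of M \<eta>\<close> unfolding end_of_def by blast
 have f: "fray r" "fray r'" using ray_fray assms by blast+
 obtain \<psi> where "laut \<psi>" "\<psi> ` (r ` {0..}) = r' ` {0..}"
  using ray_laut[OF f points_to_same_end[OF C assms(5,7)] C(1) points_to_image[OF C assms(5) f(1)] points_to_image[OF C assms(7) f(2)]]
  by blast
 then show ?thesis using laut_pl_automorphism by blast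
qed

end
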